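(* Let $N\geq 2$, let $\Omega\subset\mathbb{R}^N$ be a bounded radially symmetric domain, and let $p>1$. If $\lambda_2(p;\Omega)=\tau_1(p;\Omega)$, then the second eigenvalue $\lambda_2(p;\Omega)$ has multiplicity at least $N$.
   Context: Let $p>1$. For a bounded open set $U\subset\mathbb{R}^N$, the first eigenvalue of the Dirichlet $p$-Laplacian is $$\lambda_1(p;U)=\min\Big\{\int_U|\nabla u|^p\,dx : u\in W^{1,p}_0(U),\ \|u\|_{L^p(U)}=1\Big\}.$$ Variational eigenvalues. Let $\mathcal{S}_p=\{u\in W^{1,p}_0(\Omega): \|u\|_{L^p(\Omega)}=1\}$. A set $\mathcal{A}\subset W^{1,p}_0(\Omega)$ is symmetric if $u\in\mathcal{A}$ implies $-u\in\mathcal{A}$. Its Krasnosel'skii genus is $\gamma(\mathcal{A})=\inf\{k\in\mathbb{N} : \text{there exists a continuous odd map } f:\mathcal{A}\to S^{k-1}\}$, with $\gamma(\mathcal{A})=+\infty$ if no such $k$ exists; here $S^{k-1}$ is the $(k-1)$-dimensional sphere and $\mathbb{N}=\{1,2,\dots\}$. Let $\Gamma_k(p)$ be the collection of all $\mathcal{A}\subset\mathcal{S}_p$ that are symmetric, compact (in $W_0^{1,p}(\Omega)$) and satisfy $\gamma(\mathcal{A})\geq k$. Define $\lambda_k(p;\Omega)=\inf_{\mathcal{A}\in\Gamma_k(p)}\max_{u\in\mathcal{A}}\int_\Omega|\nabla u|^p\,dx$ for $k\in\mathbb{N}$. It is known that $0<\lambda_1(p;\Omega)<\lambda_2(p;\Omega)\leq\dots\leq\lambda_k(p;\Omega)\to+\infty$.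 Multiplicity. The variational eigenvalue $\lambda_k(p;\Omega)$ has multiplicity $m$ if there exist $m$ variational eigenvalues $\lambda_l(p;\Omega),\dots,\lambda_{l+m-1}(p;\Omega)$ with $l\leq k\leq l+m-1$ such that $$\lambda_{l-1}(p;\Omega)<\lambda_l(p;\Omega)=\dots=\lambda_k(p;\Omega)=\dots=\lambda_{l+m-1}(p;\Omega)<\lambda_{l+m}(p;\Omega).$$ The eigenvalue $\tau_1$. Use spherical coordinates $x_1=r\cos\theta_1$, $x_2=r\sin\theta_1\cos\theta_2$, ..., $x_{N-1}=r\sin\theta_1\cdots\sin\theta_{N-2}\cos\theta_{N-1}$, $x_N=r\sin\theta_1\cdots\sin\theta_{N-2}\sin\theta_{N-1}$, with $r\geq0$, $(\theta_1,\dots,\theta_{N-2})\in[0,\pi]^{N-2}$, $\theta_{N-1}\in[0,2\pi)$. Then $\tau_1(p;\Omega)=\lambda_1(p;\mathcal{W}_1(1))$, where $\mathcal{W}_1(1)=\{x\in\Omega : 0<\theta_{N-1}<\pi\}$. *)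

theory Defs
  imports "HOL-Analysis.Analysis"
begin

section \<open>Smooth functions with compact support\<close>

definition gradient :: "(real^'n \<Rightarrow> real) \<Rightarrow> real^'n \<Rightarrow> real^'n" where
  "gradient f x = (\<chi> i. frechet_derivative f (at x) (axis i 1))"

primrec k_times_differentiable :: "nat \<Rightarrow> (real^'n \<Rightarrow> real) \<Rightarrow> bool" where
  "k_times_differentiable 0 f \<longleftrightarrow> True"
| "k_times_differentiable (Suc k) f \<longleftrightarrow>
     (\<forall>x. f differentiable at x) \<and> (\<forall>i. k_times_differentiable k (\<lambda>x. gradient f x $ i))"

definition smooth :: "(real^'n \<Rightarrow> real) \<Rightarrow> bool" where
  "smooth f \<longleftrightarrow> (\<forall>k. k_times_differentiable k f)"

text \<open>The space \<open>C\<^sub>c\<^sup>\<infinity>(U)\<close>, its elements being extended by zero to the whole space.\<close>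

definition test_functions :: "(real^'n) set \<Rightarrow> (real^'n \<Rightarrow> real) set" where
  "test_functions U =
     {\<phi>. smooth \<phi> \<and> (\<exists>K. compact K \<and> K \<subseteq> U \<and> (\<forall>x. x \<notin> K \<longrightarrow> \<phi> x = 0))}"


section \<open>Sobolev spaces\<close>

text \<open>
  Elements of Lebesgue and Sobolev spaces are represented by functions on the whole space of which
  only the restriction to \<open>U\<close>, up to null sets, matters. All norms, integrals and topologies below
  ignore changes outside \<open>U\<close> and on null sets.
\<close>

definition Lp :: "real \<Rightarrow> (real^'n) set \<Rightarrow> (real^'n \<Rightarrow> 'b::euclidean_space) set" where
  "Lp p U = {f \<in> borel_measurable (lebesgue_on U).
               integrable (lebesgue_on U) (\<lambda>x. norm (f x) powr p)}"

definition Lp_norm :: "real \<Rightarrow> (real^'n) set \<Rightarrow> (real^'n \<Rightarrow> 'b::euclidean_space) \<Rightarrow> real" where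
  "Lp_norm p U f = (LINT x|lebesgue_on U. norm (f x) powr p) powr (1 / p)"

definition is_weak_gradient ::
    "(real^'n) set \<Rightarrow> (real^'n \<Rightarrow> real) \<Rightarrow> (real^'n \<Rightarrow> real^'n) \<Rightarrow> bool" where
  "is_weak_gradient U u g \<longleftrightarrow>
     (\<forall>K. compact K \<and> K \<subseteq> U \<longrightarrow> u absolutely_integrable_on K \<and> g absolutely_integrable_on K) \<and>
     (\<forall>\<phi>\<in>test_functions U.
        (LINT x|lebesgue_on U. \<phi> x *\<^sub>R g x) = - (LINT x|lebesgue_on U. u x *\<^sub>R gradient \<phi> x))"

text \<open>The weak gradient is unique up to null sets of \<open>U\<close>; here some representative is chosen.\<close>

definition weak_gradient ::
    "(real^'n) set \<Rightarrow> (real^'n \<Rightarrow> real) \<Rightarrow> real^'n \<Rightarrow> real^'n" where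
  "weak_gradient U u = (SOME g. is_weak_gradient U u g)"

definition W1p :: "real \<Rightarrow> (real^'n) set \<Rightarrow> (real^'n \<Rightarrow> real) set" where
  "W1p p U = {u \<in> Lp p U. \<exists>g \<in> Lp p U. is_weak_gradient U u g}"

definition p_energy :: "real \<Rightarrow> (real^'n) set \<Rightarrow> (real^'n \<Rightarrow> real) \<Rightarrow> real" where
  "p_energy p U u = (LINT x|lebesgue_on U. norm (weak_gradient U u x) powr p)"

definition W1p_norm :: "real \<Rightarrow> (real^'n) set \<Rightarrow> (real^'n \<Rightarrow> real) \<Rightarrow> real" where
  "W1p_norm p U u = (Lp_norm p U u powr p + p_energy p U u) powr (1 / p)"

text \<open>The closure of \<open>C\<^sub>c\<^sup>\<infinity>(U)\<close> in \<open>W\<^sup>1\<^sup>,\<^sup>p(U)\<close>.\<close>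

definition W01p :: "real \<Rightarrow> (real^'n) set \<Rightarrow> (real^'n \<Rightarrow> real) set" where
  "W01p p U =
     {u \<in> W1p p U. \<forall>\<epsilon>>0. \<exists>\<phi>\<in>test_functions U. W1p_norm p U (\<lambda>x. u x - \<phi> x) < \<epsilon>}"

text \<open>
  The norm topology of \<open>W\<^sub>0\<^sup>1\<^sup>,\<^sup>p(U)\<close>. It does not separate functions that agree almost everywhere
  on \<open>U\<close>, so its compact sets and its continuous maps into Hausdorff spaces are those of the
  space of equivalence classes.
\<close>

definition W01p_topology :: "real \<Rightarrow> (real^'n) set \<Rightarrow> (real^'n \<Rightarrow> real) topology" where
  "W01p_topology p U = topology (\<lambda>S. S \<subseteq> W01p p U \<and>
     (\<forall>u\<in>S. \<exists>\<epsilon>>0. \<forall>v\<in>W01p p U. W1p_norm p U (\<lambda>x. v x - u x) < \<epsilon> \<longrightarrow> v \<in> S))"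

lemma openin_W01p_topology:
  "openin (W01p_topology p U) S \<longleftrightarrow> S \<subseteq> W01p p U \<and>
     (\<forall>u\<in>S. \<exists>\<epsilon>>0. \<forall>v\<in>W01p p U. W1p_norm p U (\<lambda>x. v x - u x) < \<epsilon> \<longrightarrow> v \<in> S)"
proof -
  have "istopology (\<lambda>S. S \<subseteq> W01p p U \<and>
     (\<forall>u\<in>S. \<exists>\<epsilon>>0. \<forall>v\<in>W01p p U. W1p_norm p U (\<lambda>x. v x - u x) < \<epsilon> \<longrightarrow> v \<in> S))"
    (is "istopology ?P")
    unfolding istopology_def
  proof (intro conjI allI impI)
    fix S T assume S: "?P S" and T: "?P T"
    show "S \<inter> T \<subseteq> W01p p U" using S by blast
    show "\<forall>u\<in>S \<inter> T. \<exists>\<epsilon>>0. \<forall>v\<in>W01p p U. W1p_norm p U (\<lambda>x. v x - u x) < \<epsilon> \<longrightarrow> v \<in> S \<inter> T"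
    proof
      fix u assume "u \<in> S \<inter> T"
      then obtain d e where "d > 0" "e > 0"
        "\<forall>v\<in>W01p p U. W1p_norm p U (\<lambda>x. v x - u x) < d \<longrightarrow> v \<in> S"
        "\<forall>v\<in>W01p p U. W1p_norm p U (\<lambda>x. v x - u x) < e \<longrightarrow> v \<in> T"
        using S T by blast
      then show "\<exists>\<epsilon>>0. \<forall>v\<in>W01p p U. W1p_norm p U (\<lambda>x. v x - u x) < \<epsilon> \<longrightarrow> v \<in> S \<inter> T"
        by (intro exI[of _ "min d e"]) auto
    qed
  next
    fix \<K> assume K: "\<forall>K\<in>\<K>. ?P K"
    then show "\<Union>\<K> \<subseteq> W01p p U" by blast
    show "\<forall>u\<in>\<Union>\<K>. \<exists>\<epsilon>>0. \<forall>v\<in>W01p p U. W1p_norm p U (\<lambda>x. v x - u x) < \<epsilon> \<longrightarrow> v \<in> \<Union>\<K>"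
    proof
      fix u assume "u \<in> \<Union>\<K>"
      then obtain S where S: "S \<in> \<K>" "u \<in> S" by blast
      with K obtain e where e: "e > 0"
        "\<forall>v\<in>W01p p U. W1p_norm p U (\<lambda>x. v x - u x) < e \<longrightarrow> v \<in> S" by meson
      with S show "\<exists>\<epsilon>>0. \<forall>v\<in>W01p p U. W1p_norm p U (\<lambda>x. v x - u x) < \<epsilon> \<longrightarrow> v \<in> \<Union>\<K>"
        by (intro exI[of _ e]) auto
    qed
  qed
  then show ?thesis
    by (simp add: W01p_topology_def)
qed

lemma topspace_W01p_topology: "topspace (W01p_topology p U) = W01p p U"
proof -
  have "openin (W01p_topology p U) (W01p p U)"
    unfolding openin_W01p_topology using zero_less_one by blast
  then show ?thesis
    by (meson openin_W01p_topology openin_subset openin_topspace subset_antisym)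
qed


section \<open>Eigenvalues\<close>

definition Lp_sphere :: "real \<Rightarrow> (real^'n) set \<Rightarrow> (real^'n \<Rightarrow> real) set" where
  "Lp_sphere p U = {u \<in> W01p p U. Lp_norm p U u = 1}"

text \<open>The infimum is attained if \<open>U\<close> is nonempty, bounded and open.\<close>

definition first_eigenvalue :: "real \<Rightarrow> (real^'n) set \<Rightarrow> real" where
  "first_eigenvalue p U = (INF u\<in>Lp_sphere p U. p_energy p U u)"

definition symmetric :: "(real^'n \<Rightarrow> real) set \<Rightarrow> bool" where
  "symmetric A \<longleftrightarrow> (\<forall>u\<in>A. (\<lambda>x. - u x) \<in> A)"

text \<open>The infimum in \<^typ>\<open>enat\<close> of the empty set is \<open>\<infinity>\<close>.\<close>

definition genus :: "real \<Rightarrow> (real^'n) set \<Rightarrow> (real^'n \<Rightarrow> real) set \<Rightarrow> enat" where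
  "genus p U A = Inf {enat k |k. k \<ge> 1 \<and>
     (\<exists>f. continuous_map (subtopology (W01p_topology p U) A) (nsphere (k - 1)) f \<and>
          (\<forall>u\<in>A. \<forall>i. f (\<lambda>x. - u x) i = - f u i))}"

text \<open>
  The genus as defined above gives the empty set the value 1, so the empty set, over which there is
  no maximum, has to be excluded explicitly.
\<close>

definition genus_family :: "real \<Rightarrow> (real^'n) set \<Rightarrow> nat \<Rightarrow> (real^'n \<Rightarrow> real) set set" where
  "genus_family p U k = {A. A \<noteq> {} \<and> A \<subseteq> Lp_sphere p U \<and> symmetric A \<and>
     compactin (W01p_topology p U) A \<and> genus p U A \<ge> enat k}"

text \<open>The supremum over \<open>A\<close> is a maximum, since \<open>A\<close> is compact and the energy is continuous.\<close>

definition variational_eigenvalue :: "real \<Rightarrow> (real^'n) set \<Rightarrow> nat \<Rightarrow> real" where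
  "variational_eigenvalue p U k = (INF A\<in>genus_family p U k. SUP u\<in>A. p_energy p U u)"

text \<open>
  Multiplicity of the \<open>k\<close>-th member of a sequence \<open>\<mu>\<close> indexed from 1. For \<open>l = 1\<close> there is no
  preceding member, and the condition on it is void.
\<close>

definition has_multiplicity :: "(nat \<Rightarrow> real) \<Rightarrow> nat \<Rightarrow> nat \<Rightarrow> bool" where
  "has_multiplicity \<mu> k m \<longleftrightarrow>
     (\<exists>l\<ge>1. l \<le> k \<and> k < l + m \<and> (\<forall>j\<in>{l..<l + m}. \<mu> j = \<mu> k) \<and>
        (l > 1 \<longrightarrow> \<mu> (l - 1) < \<mu> l) \<and> \<mu> k < \<mu> (l + m))"


section \<open>Radially symmetric domains and the eigenvalue \<open>\<tau>\<^sub>1\<close>\<close>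

definition radially_symmetric :: "(real^'n) set \<Rightarrow> bool" where
  "radially_symmetric U \<longleftrightarrow> (\<forall>f. orthogonal_transformation f \<longrightarrow> f ` U = U)"

text \<open>
  Here \<open>\<iota>\<close> is an enumeration of the index type by \<open>1, \<dots>, N\<close>, so that \<open>x $ \<iota> k\<close> is the coordinate
  usually written \<open>x\<^sub>k\<close>.
\<close>

definition spherical_coordinates ::
    "(nat \<Rightarrow> 'n::finite) \<Rightarrow> real^'n \<Rightarrow> real \<Rightarrow> (nat \<Rightarrow> real) \<Rightarrow> bool" where
  "spherical_coordinates \<iota> x r \<theta> \<longleftrightarrow> (let N = CARD('n) in
     r \<ge> 0 \<and> (\<forall>j\<in>{1..N - 2}. 0 \<le> \<theta> j \<and> \<theta> j \<le> pi) \<and> 0 \<le> \<theta> (N - 1) \<and> \<theta> (N - 1) < 2 * pi \<and>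
     (\<forall>k\<in>{1..N - 1}. x $ \<iota> k = r * (\<Prod>j=1..k - 1. sin (\<theta> j)) * cos (\<theta> k)) \<and>
     x $ \<iota> N = r * (\<Prod>j=1..N - 1. sin (\<theta> j)))"

text \<open>
  The set \<open>W\<^sub>1(1)\<close>. Points with \<open>x\<^sub>N\<^sub>-\<^sub>1 = x\<^sub>N = 0\<close> admit every value of \<open>\<theta>\<^sub>N\<^sub>-\<^sub>1\<close>. Requiring the
  condition for all choices of the coordinates leaves them out; the set is then the open half
  \<open>{x \<in> U. x\<^sub>N > 0}\<close>.
\<close>

definition half_domain :: "(nat \<Rightarrow> 'n::finite) \<Rightarrow> (real^'n) set \<Rightarrow> (real^'n) set" where
  "half_domain \<iota> U =
     {x \<in> U. \<forall>r \<theta>. spherical_coordinates \<iota> x r \<theta> \<longrightarrow> 0 < \<theta> (CARD('n) - 1) \<and> \<theta> (CARD('n) - 1) < pi}"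

lemma spherical_coordinates_exist_aux:
  fixes c :: "nat \<Rightarrow> real"
  assumes "n \<ge> 2"
  shows "\<exists>r \<theta>. r \<ge> 0 \<and> (\<forall>j\<in>{1..n - 2}. 0 \<le> \<theta> j \<and> \<theta> j \<le> pi) \<and> 0 \<le> \<theta> (n - 1) \<and> \<theta> (n - 1) < 2 * pi \<and>
     (\<forall>k\<in>{1..n - 1}. c k = r * (\<Prod>j=1..k - 1. sin (\<theta> j)) * cos (\<theta> k)) \<and>
     c n = r * (\<Prod>j=1..n - 1. sin (\<theta> j))"
  using assms
proof (induction n arbitrary: c rule: dec_induct)
  case base
  define z where "z = Complex (c 1) (c 2)"
  obtain t where t: "0 \<le> t" "t < 2 * pi" "z = of_real (cmod z) * exp (\<i> * of_real t)"
    using that[of "Arg2pi z"] Arg2pi[of z] unfolding is_Arg_def by blast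
  have "c 1 = cmod z * cos t" "c 2 = cmod z * sin t"
    using arg_cong[OF t(3), of Re] arg_cong[OF t(3), of Im] by (simp_all add: z_def Re_exp Im_exp)
  then show ?case
    using t by (intro exI[of _ "cmod z"] exI[of _ "\<lambda>_. t"]) (auto simp: numeral_2_eq_2)
next
  case (step n)
  obtain r' \<theta>' where *: "r' \<ge> 0" "\<forall>j\<in>{1..n - 2}. 0 \<le> \<theta>' j \<and> \<theta>' j \<le> pi"
    "0 \<le> \<theta>' (n - 1)" "\<theta>' (n - 1) < 2 * pi"
    "\<forall>k\<in>{1..n - 1}. c (Suc k) = r' * (\<Prod>j=1..k - 1. sin (\<theta>' j)) * cos (\<theta>' k)"
    "c (Suc n) = r' * (\<Prod>j=1..n - 1. sin (\<theta>' j))"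
    using step.IH[of "\<lambda>k. c (Suc k)"] by blast
  define r where "r = sqrt ((c 1)\<^sup>2 + r'\<^sup>2)"
  have "\<exists>t. 0 \<le> t \<and> t \<le> pi \<and> c 1 = r * cos t \<and> r' = r * sin t"
  proof (cases "r = 0")
    case True
    then have "c 1 = 0" "r' = 0" by (simp_all add: r_def sum_power2_eq_zero_iff)
    then show ?thesis using True by (intro exI[of _ 0]) auto
  next
    case False
    have "(c 1 / r)\<^sup>2 + (r' / r)\<^sup>2 = ((c 1)\<^sup>2 + r'\<^sup>2) / r\<^sup>2"
      by (simp add: power_divide add_divide_distrib)
    also have "r\<^sup>2 = (c 1)\<^sup>2 + r'\<^sup>2" by (simp add: r_def)
    finally have "(c 1 / r)\<^sup>2 + (r' / r)\<^sup>2 = 1"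
      using False by (simp add: r_def)
    moreover have "0 \<le> r' / r" using *(1) by (simp add: r_def)
    ultimately obtain t where "0 \<le> t" "t \<le> pi" "c 1 / r = cos t" "r' / r = sin t"
      using sincos_total_pi by metis
    then show ?thesis using False by (intro exI[of _ t]) (auto simp: field_simps)
  qed
  then obtain t where t: "0 \<le> t" "t \<le> pi" "c 1 = r * cos t" "r' = r * sin t" by blast
  define \<theta> where "\<theta> j = (if j = 1 then t else \<theta>' (j - 1))" for j
  have prod: "(\<Prod>j=1..Suc k. sin (\<theta> j)) = sin t * (\<Prod>j=1..k. sin (\<theta>' j))" for k
  proof -
    have "(\<Prod>j=1..Suc k. sin (\<theta> j)) = sin (\<theta> 1) * (\<Prod>j=Suc 1..Suc k. sin (\<theta> j))"
      by (subst prod.atLeast_Suc_atMost) auto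
    also have "(\<Prod>j=Suc 1..Suc k. sin (\<theta> j)) = (\<Prod>j=1..k. sin (\<theta> (Suc j)))"
      by (rule prod.shift_bounds_cl_Suc_ivl)
    also have "\<dots> = (\<Prod>j=1..k. sin (\<theta>' j))"
      by (intro prod.cong) (auto simp: \<theta>_def)
    finally show ?thesis by (simp add: \<theta>_def)
  qed
  have "r \<ge> 0" by (simp add: r_def)
  moreover have "\<forall>j\<in>{1..Suc n - 2}. 0 \<le> \<theta> j \<and> \<theta> j \<le> pi"
  proof
    fix j assume j: "j \<in> {1..Suc n - 2}"
    then have "j \<noteq> 1 \<Longrightarrow> j - 1 \<in> {1..n - 2}" by auto
    then show "0 \<le> \<theta> j \<and> \<theta> j \<le> pi"
      using *(2) t(1,2) unfolding \<theta>_def by presburger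
  qed
  moreover have "0 \<le> \<theta> (Suc n - 1)" "\<theta> (Suc n - 1) < 2 * pi"
    using *(3,4) step.hyps by (auto simp: \<theta>_def)
  moreover have "c k = r * (\<Prod>j=1..k - 1. sin (\<theta> j)) * cos (\<theta> k)" if k: "k \<in> {1..Suc n - 1}" for k
  proof (cases "k = 1")
    case True
    then show ?thesis using t by (simp add: \<theta>_def)
  next
    case False
    then obtain k' where k': "k = Suc (Suc k')" "Suc k' \<in> {1..n - 1}"
      using k by (cases k; cases "k - 1") auto
    have "c k = r' * (\<Prod>j=1..k'. sin (\<theta>' j)) * cos (\<theta>' (Suc k'))"
      using *(5) k' by fastforce
    also have "\<dots> = r * (sin t * (\<Prod>j=1..k'. sin (\<theta>' j))) * cos (\<theta> k)"
      using t k' by (simp add: \<theta>_def)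
    finally show ?thesis using k' prod[of k'] by simp
  qed
  moreover have "c (Suc n) = r * (\<Prod>j=1..Suc n - 1. sin (\<theta> j))"
    using *(6) t(4) prod[of "n - 1"] step.hyps by simp
  ultimately show ?case by blast
qed

lemma half_domain_eq:
  fixes \<iota> :: "nat \<Rightarrow> 'n::finite"
  assumes "CARD('n) \<ge> 2"
  shows "half_domain \<iota> U = {x \<in> U. x $ \<iota> CARD('n) > 0}"
proof -
  define N where "N = CARD('n)"
  have N: "N \<ge> 2" using assms by (simp add: N_def)
  have prod: "(\<Prod>j=1..N - 1. f j) = (\<Prod>j=1..N - 2. f j) * f (N - 1)" for f :: "nat \<Rightarrow> real"
  proof -
    have "N - 1 = Suc (N - 2)" using N by simp
    then show ?thesis by simp
  qed
  have pos: "x $ \<iota> N > 0"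
    if *: "\<And>r \<theta>. spherical_coordinates \<iota> x r \<theta> \<Longrightarrow> 0 < \<theta> (N - 1) \<and> \<theta> (N - 1) < pi" for x
  proof (rule ccontr)
    assume neg: "\<not> x $ \<iota> N > 0"
    obtain r \<theta> where s: "spherical_coordinates \<iota> x r \<theta>"
      using spherical_coordinates_exist_aux[OF N, of "\<lambda>k. x $ \<iota> k"]
      unfolding spherical_coordinates_def Let_def N_def by metis
    define P where "P = (\<Prod>j=1..N - 2. sin (\<theta> j))"
    have "P \<ge> 0" unfolding P_def
      using s by (intro prod_nonneg) (auto simp: spherical_coordinates_def Let_def N_def intro!: sin_ge_zero)
    moreover have "r \<ge> 0" "x $ \<iota> N = r * P * sin (\<theta> (N - 1))"
      using s prod by (auto simp: spherical_coordinates_def Let_def N_def P_def)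
    moreover have "sin (\<theta> (N - 1)) > 0" using *[OF s] by (simp add: sin_gt_zero)
    ultimately have "r * P = 0"
      using neg by (metis mult_nonneg_nonneg mult_pos_pos order_le_less)
    have rP: "r * (\<Prod>j=1..N - 2. sin (\<theta> j)) = 0" using \<open>r * P = 0\<close> by (simp add: P_def)
    define \<theta>' where "\<theta>' = \<theta>(N - 1 := 0)"
    have eq: "(\<Prod>j=1..k. sin (\<theta>' j)) = (\<Prod>j=1..k. sin (\<theta> j))" if "k \<le> N - 2" for k
      using that N by (intro prod.cong) (auto simp: \<theta>'_def)
    have "x $ \<iota> k = r * (\<Prod>j=1..k - 1. sin (\<theta>' j)) * cos (\<theta>' k)" if k: "k \<in> {1..N - 1}" for k
    proof -
      have "x $ \<iota> k = r * (\<Prod>j=1..k - 1. sin (\<theta> j)) * cos (\<theta> k)"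
        using s k by (auto simp: spherical_coordinates_def Let_def N_def)
      moreover have "(\<Prod>j=1..k - 1. sin (\<theta>' j)) = (\<Prod>j=1..k - 1. sin (\<theta> j))"
        using k by (intro eq) auto
      ultimately show ?thesis
        using rP by (cases "k = N - 1") (auto simp: \<theta>'_def numeral_2_eq_2)
    qed
    moreover have "x $ \<iota> N = r * (\<Prod>j=1..N - 1. sin (\<theta>' j))"
      using \<open>r * P = 0\<close> \<open>x $ \<iota> N = _\<close> unfolding prod by (simp add: \<theta>'_def)
    moreover have "r \<ge> 0" "\<forall>j\<in>{1..N - 2}. 0 \<le> \<theta>' j \<and> \<theta>' j \<le> pi"
      using s N by (auto simp: spherical_coordinates_def Let_def N_def \<theta>'_def)
    moreover have "\<theta>' (N - 1) = 0" by (simp add: \<theta>'_def)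
    ultimately have "spherical_coordinates \<iota> x r \<theta>'"
      by (simp add: spherical_coordinates_def Let_def N_def)
    from *[OF this] \<open>\<theta>' (N - 1) = 0\<close> show False by simp
  qed
  have ang: "0 < \<theta> (N - 1) \<and> \<theta> (N - 1) < pi"
    if x: "x $ \<iota> N > 0" and s: "spherical_coordinates \<iota> x r \<theta>" for x r \<theta>
  proof -
    define P where "P = (\<Prod>j=1..N - 2. sin (\<theta> j))"
    have "P \<ge> 0" unfolding P_def
      using s by (intro prod_nonneg) (auto simp: spherical_coordinates_def Let_def N_def intro!: sin_ge_zero)
    moreover have "r \<ge> 0" "x $ \<iota> N = r * P * sin (\<theta> (N - 1))"
      "0 \<le> \<theta> (N - 1)" "\<theta> (N - 1) < 2 * pi"
      using s prod by (auto simp: spherical_coordinates_def Let_def N_def P_def)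
    ultimately have "sin (\<theta> (N - 1)) > 0"
      using x by (metis mult_nonneg_nonneg not_less zero_less_mult_pos mult_nonneg_nonpos)
    then have "\<theta> (N - 1) \<noteq> 0" "\<not> pi \<le> \<theta> (N - 1)"
      using sin_le_zero[of "\<theta> (N - 1)"] \<open>\<theta> (N - 1) < 2 * pi\<close> by auto
    then show ?thesis using \<open>0 \<le> \<theta> (N - 1)\<close> by simp
  qed
  show ?thesis
    using pos ang unfolding half_domain_def N_def by blast
qed

definition tau1 :: "(nat \<Rightarrow> 'n::finite) \<Rightarrow> real \<Rightarrow> (real^'n) set \<Rightarrow> real" where
  "tau1 \<iota> p U = first_eigenvalue p (half_domain \<iota> U)"

end

theory Submission
  imports Defs "HOL-Homology.Brouwer_Degree"
begin

text \<open>
  Let \<open>v\<close> be a test function on the upper half of the domain whose Rayleigh quotient is close to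
  \<open>\<tau>\<^sub>1\<close>. Restricted to a suitable half plane through the axis \<open>e\<^sub>N\<close> and rotated about that axis, it
  becomes an axially symmetric function with an almost as small quotient. By the symmetry of the
  domain the axis can be moved to any unit vector \<open>e\<close>, which gives normalised functions \<open>V\<^sub>e\<close>
  living on \<open>x \<bullet> e > 0\<close>. The combinations \<open>\<alpha> V\<^sub>e + \<beta> V\<^sub>-\<^sub>e\<close> with \<open>\<bar>\<alpha>\<bar>\<^sup>p + \<bar>\<beta>\<bar>\<^sup>p = 1\<close> form a
  compact symmetric set on which the energy is close to \<open>\<tau>\<^sub>1\<close>. An odd map from it to the sphere of
  dimension \<open>N - 1\<close> would, along a path from \<open>(\<alpha>, \<beta>) = (c, c)\<close> to \<open>(-c, c)\<close>, be a homotopy from an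
  even to an odd self-map of that sphere. This is impossible by homology, so the genus is at least
  \<open>N + 1\<close> and \<open>\<lambda>\<^sub>N\<^sub>+\<^sub>1 \<le> \<tau>\<^sub>1 = \<lambda>\<^sub>2\<close>. Finally \<open>\<lambda>\<^sub>k\<close> is unbounded: functions of small energy are nearly
  determined by their integrals over the cells of a fine grid, which bounds the genus.
\<close>

section \<open>Even and odd self-maps of the sphere\<close>

text \<open>In general no rotation carrying a fixed axis to \<open>e\<close> can be chosen
  continuously in \<open>e\<close>. Axial symmetry removes the choice: V_e(x) depends only on |x|
  and the height of x along \<open>e\<close>, hence continuously on \<open>e\<close>. A half plane
  suffices because Lebesgue measure is the product of a measure in (distance from the axis, height)
  and a measure in the direction: averaged over directions, the integrals of |v|^p and |grad v|^p
  are unchanged up to a common factor. Rotating the restriction discards the derivative across the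
  half plane, so gradients do not grow. Distance is not smooth on the axis, so it is replaced by the
  root of distance^2 + d^2; the compact support of \<open>v\<close> leaves room for the shift. With
  test functions and a level c strictly above tau_1, Sobolev continuity of the families follows from
  uniform convergence. V_e and V_-e have disjoint supports, so p-th powers of norms add: the weights
  give norm 1 and energy at most c. Exchanging e with -e amounts to exchanging the weights, so equal
  weights give an even function of e and opposite weights an odd one. The multiplicity requires a
  strictly larger eigenvalue to end the run, which unboundedness supplies.\<close>

definition antipode :: "(nat \<Rightarrow> real) \<Rightarrow> nat \<Rightarrow> real" where
  "antipode x = (\<lambda>i. - x i)"

lemma antipode_apply [simp]: "antipode x i = - x i"
  by (simp add: antipode_def)

lemma antipode_antipode [simp]: "antipode (antipode x) = x"
  by (simp add: antipode_def)

lemma topspace_nsphere: "topspace (nsphere n) = {x. (\<Sum>i\<le>n. (x i)\<^sup>2) = 1 \<and> (\<forall>i>n. x i = 0)}"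
  by (auto simp: nsphere)

lemma antipode_in_topspace_nsphere [simp]:
  "antipode x \<in> topspace (nsphere n) \<longleftrightarrow> x \<in> topspace (nsphere n)"
  by (simp add: topspace_nsphere)

lemma continuous_map_antipode: "continuous_map (nsphere n) (nsphere n) antipode"
proof -
  have "continuous_map (powertop_real UNIV) euclideanreal (\<lambda>x. - x k)" for k
    by (metis UNIV_I continuous_map_product_projection continuous_map_minus)
  then show ?thesis
    by (auto simp: nsphere antipode_def continuous_map_in_subtopology continuous_map_componentwise_UNIV
        intro!: continuous_map_from_subtopology continuous_map_product_projection)
qed

text \<open>In dimension 0 a reduced cycle must also have augmentation 0. The push-forward to a
  point expresses this as \<open>reduced_homology_group\<close> does, as membership in a kernel, so
  the constructions below can start at dimension 0.\<close>

definition reduced_cycle :: "nat \<Rightarrow> 'a topology \<Rightarrow> 'a chain \<Rightarrow> bool" where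
  "reduced_cycle p X c \<longleftrightarrow> singular_relcycle p X {} c \<and> (p = 0 \<longrightarrow> chain_map 0 (\<lambda>x. ()) c = 0)"

text \<open>The class of a reduced cycle lies in the reduced homology group, so it is the zero class
  when that group is trivial. This turns vanishing of groups into explicit bounding chains, which
  the inductions on dimension need.\<close>

lemma reduced_cycle_is_boundary:
  assumes triv: "trivial_group (reduced_homology_group (int p) X)" and c: "reduced_cycle p X c"
  shows "\<exists>d. singular_chain (Suc p) X d \<and> chain_boundary (Suc p) d = c"
proof -
  have cyc: "singular_relcycle p X {} c" using c by (simp add: reduced_cycle_def)
  have "homologous_rel_set p X {} c \<in> carrier (reduced_homology_group (int p) X)"
  proof (cases "p = 0")
    case True
    have "hom_induced (int p) X {} (discrete_topology {()}) {} (\<lambda>x. ()) (homologous_rel_set p X {} c)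
       = homologous_rel_set p (discrete_topology {()}) {} (chain_map p (\<lambda>x. ()) c)"
      by (rule hom_induced_chain_map) (use cyc in auto)
    also have "chain_map p (\<lambda>x. ()) c = 0"
      using c True by (simp add: reduced_cycle_def)
    also have "homologous_rel_set p (discrete_topology {()}) {} 0
        = \<one>\<^bsub>homology_group (int p) (discrete_topology {()})\<^esub>"
      unfolding one_relative_homology_group by (simp add: homologous_rel_set_eq_relboundary)
    finally show ?thesis
      unfolding carrier_reduced_homology_group kernel_def
      using cyc by (auto simp: carrier_relative_homology_group)
  next
    case False
    then show ?thesis
      using cyc by (auto simp: un_reduced_homology_group carrier_relative_homology_group)
  qed
  then have "homologous_rel_set p X {} c = \<one>\<^bsub>reduced_homology_group (int p) X\<^esub>"
    using triv by (auto simp: trivial_group_def)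
  then have "homologous_rel_set p X {} c = singular_relboundary_set p X {}"
    by (simp add: one_reduced_homology_group)
  then show ?thesis
    by (simp add: homologous_rel_set_eq_relboundary singular_boundary)
qed

section \<open>Fundamental cycles of spheres built from hemispheres\<close>

definition vertex_chain :: "'a \<Rightarrow> 'a chain" where
  "vertex_chain a = frag_of (restrict (\<lambda>_. a) (standard_simplex 0))"

lemma chain_map_vertex_chain: "chain_map 0 f (vertex_chain a) = vertex_chain (f a)"
  by (auto simp: vertex_chain_def simplex_map_def fun_eq_iff restrict_def intro!: arg_cong[of _ _ frag_of])

lemma singular_chain_vertex_chain: "a \<in> topspace X \<Longrightarrow> singular_chain 0 X (vertex_chain a)"
  by (auto simp: vertex_chain_def singular_chain_of singular_simplex_def
      intro: continuous_map_eq[of _ _ "\<lambda>_. a"])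

lemma chain_boundary_dim0 [simp]: "chain_boundary 0 c = 0"
  by (simp add: chain_boundary_def)

definition upper_hemisphere :: "nat \<Rightarrow> (nat \<Rightarrow> real) topology" where
  "upper_hemisphere n = subtopology (nsphere n) {x. x n \<ge> 0}"

lemma chain_map_antipode_antipode:
  assumes "singular_chain p (nsphere n) c"
  shows "chain_map p antipode (chain_map p antipode c) = c"
proof -
  have "chain_map p antipode (chain_map p antipode c) = chain_map p (antipode \<circ> antipode) c"
    by (simp add: chain_map_compose)
  also have "\<dots> = c"
    by (rule chain_map_id_gen[OF assms]) simp
  finally show ?thesis .
qed

lemma singular_chain_upper_hemisphere_imp:
  "singular_chain p (upper_hemisphere n) c \<Longrightarrow> singular_chain p (nsphere n) c"
  by (simp add: upper_hemisphere_def singular_chain_subtopology)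

lemma nsphere_equator_upper:
  "subtopology (upper_hemisphere (Suc n)) {x. x (Suc n) = 0} = nsphere n"
proof -
  have "{x. 0 \<le> x (Suc n)} \<inter> {x. x (Suc n) = 0} = {x :: nat \<Rightarrow> real. x (Suc n) = 0}" by auto
  then show ?thesis
    by (simp add: upper_hemisphere_def subtopology_subtopology subtopology_nsphere_equator)
qed

lemma singular_chain_nsphere_Suc_upper:
  "singular_chain p (nsphere n) c \<Longrightarrow> singular_chain p (upper_hemisphere (Suc n)) c"
  using singular_chain_subtopology[of p "upper_hemisphere (Suc n)" "{x. x (Suc n) = 0}" c]
  by (simp add: nsphere_equator_upper)

lemma singular_chain_nsphere_mono:
  "m \<le> n \<Longrightarrow> singular_chain p (nsphere m) c \<Longrightarrow> singular_chain p (nsphere n) c"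
  by (induction n rule: dec_induct)
     (auto dest: singular_chain_nsphere_Suc_upper singular_chain_upper_hemisphere_imp)

text \<open>\<open>sphere_chain n h\<close> is the fundamental cycle of the \<open>n\<close>-sphere when \<open>h\<close> triangulates its upper
  hemisphere.\<close>

definition sphere_chain :: "nat \<Rightarrow> (nat \<Rightarrow> real) chain \<Rightarrow> (nat \<Rightarrow> real) chain" where
  "sphere_chain n h = h + frag_cmul ((-1) ^ Suc n) (chain_map n antipode h)"

text \<open>A chain version of the antipodally symmetric cell structure of the sphere with two cells
  in each dimension. The alternating sign in \<open>sphere_chain\<close> is forced: with a the
  antipodal push-forward and s the sign, the boundary of a sphere chain involves (1 + s a)(1 - s a)
  = 1 - a a = 0.\<close>

definition hemisphere_chains :: "(nat \<Rightarrow> (nat \<Rightarrow> real) chain) \<Rightarrow> bool" where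
  "hemisphere_chains h \<longleftrightarrow>
     h 0 = vertex_chain (\<lambda>i. if i = 0 then 1 else 0) \<and>
     (\<forall>n. singular_chain n (upper_hemisphere n) (h n) \<and> 
       chain_boundary (Suc n) (h (Suc n)) = sphere_chain n (h n))"

text \<open>The upper hemisphere is contractible, so the cycle \<open>sphere_chain n c\<close> on
  its equator bounds a chain in it; that chain is the next member. The invariant \<open>P\<close>
  carries along that the sphere chain is again a reduced cycle.\<close>

lemma hemisphere_chains_exist: "\<exists>h. hemisphere_chains h"
proof -
  let ?e = "\<lambda>i::nat. if i = 0 then 1 else (0::real)"
  define P where "P n c \<longleftrightarrow> singular_chain n (upper_hemisphere n) c \<and>
      reduced_cycle n (nsphere n) (sphere_chain n c) \<and> (n = 0 \<longrightarrow> c = vertex_chain ?e)" for n c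
  have "\<exists>h. \<forall>n. P n (h n) \<and> chain_boundary (Suc n) (h (Suc n)) = sphere_chain n (h n)"
  proof (rule dependent_nat_choice)
    have e: "?e \<in> topspace (upper_hemisphere 0)"
      by (auto simp: upper_hemisphere_def topspace_nsphere)
    have "singular_chain 0 (upper_hemisphere 0) (vertex_chain ?e)"
      by (rule singular_chain_vertex_chain[OF e])
    moreover from this have "singular_chain 0 (nsphere 0) (vertex_chain ?e)"
      by (rule singular_chain_upper_hemisphere_imp)
    then have "singular_chain 0 (nsphere 0) (sphere_chain 0 (vertex_chain ?e))"
      unfolding sphere_chain_def
      by (intro singular_chain_add singular_chain_cmul singular_chain_chain_map[OF _ continuous_map_antipode])
    then have "reduced_cycle 0 (nsphere 0) (sphere_chain 0 (vertex_chain ?e))"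
      by (simp add: reduced_cycle_def singular_cycle sphere_chain_def chain_map_add chain_map_diff
          chain_map_minus chain_map_vertex_chain)
    ultimately show "\<exists>c. P 0 c" unfolding P_def by blast
  next
    fix c n assume P: "P n c"
    let ?z = "sphere_chain n c"
    have z: "singular_chain n (nsphere n) ?z" "chain_boundary n ?z = 0"
      using P by (auto simp: P_def reduced_cycle_def singular_cycle)
    have c: "singular_chain n (nsphere n) c"
      using P by (auto simp: P_def intro: singular_chain_upper_hemisphere_imp)
    have "reduced_cycle n (upper_hemisphere (Suc n)) ?z"
      using P z by (auto simp: P_def reduced_cycle_def singular_cycle singular_chain_nsphere_Suc_upper)
    then obtain d where d: "singular_chain (Suc n) (upper_hemisphere (Suc n)) d"
      "chain_boundary (Suc n) d = ?z"
      using reduced_cycle_is_boundary[of n "upper_hemisphere (Suc n)" ?z]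
        trivial_reduced_homology_group_contractible_space contractible_space_upper_hemisphere[of "Suc n" "Suc n"]
      unfolding upper_hemisphere_def by blast
    have d': "singular_chain (Suc n) (nsphere (Suc n)) d"
      using d by (auto intro: singular_chain_upper_hemisphere_imp)
    have "singular_chain (Suc n) (nsphere (Suc n)) (sphere_chain (Suc n) d)"
      unfolding sphere_chain_def using d'
      by (intro singular_chain_add singular_chain_cmul singular_chain_chain_map[OF _ continuous_map_antipode])
    moreover have "chain_boundary (Suc n) (sphere_chain (Suc n) d) = 0"
    proof -
      have "chain_boundary (Suc n) (chain_map (Suc n) antipode d) = chain_map n antipode ?z"
        using chain_boundary_chain_map[OF d', of antipode] d by simp
      also have "\<dots> = chain_map n antipode c + frag_cmul ((-1) ^ Suc n) c"
        by (simp only: sphere_chain_def chain_map_add chain_map_cmul chain_map_antipode_antipode[OF c])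
      finally have "chain_boundary (Suc n) (sphere_chain (Suc n) d) =
        ?z + frag_cmul ((-1) ^ n) (chain_map n antipode c + frag_cmul ((-1) ^ Suc n) c)"
        using d by (simp add: sphere_chain_def chain_boundary_add chain_boundary_cmul)
      also have "\<dots> = 0"
        by (cases "even n") (auto simp: sphere_chain_def frag_cmul_distrib2)
      finally show ?thesis .
    qed
    ultimately show "\<exists>d. P (Suc n) d \<and> chain_boundary (Suc n) d = ?z"
      using d by (auto simp: P_def reduced_cycle_def singular_cycle)
  qed
  then obtain h where "\<forall>n. P n (h n) \<and> chain_boundary (Suc n) (h (Suc n)) = sphere_chain n (h n)" ..
  then show ?thesis
    unfolding hemisphere_chains_def P_def by blast
qed

lemma sphere_chain_singular_chain:
  assumes "hemisphere_chains h"
  shows "singular_chain n (nsphere n) (h n)" "singular_chain n (nsphere n) (sphere_chain n (h n))"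
    "chain_boundary n (sphere_chain n (h n)) = 0"
proof -
  show h: "singular_chain n (nsphere n) (h n)" for n
    using assms by (auto simp: hemisphere_chains_def intro: singular_chain_upper_hemisphere_imp)
  show "singular_chain n (nsphere n) (sphere_chain n (h n))"
    unfolding sphere_chain_def using h
    by (intro singular_chain_add singular_chain_cmul singular_chain_chain_map[OF _ continuous_map_antipode])
  have "sphere_chain n (h n) = chain_boundary (Suc n) (h (Suc n))"
    using assms by (simp add: hemisphere_chains_def)
  then show "chain_boundary n (sphere_chain n (h n)) = 0"
    using h[of "Suc n"] chain_boundary_boundary_alt by metis
qed

text \<open>The 0-sphere is two points and the 1-simplex is connected, so every singular 1-simplex
  is constant and its two faces cancel.\<close>

lemma chain_boundary_nsphere_0:
  assumes "singular_chain 1 (nsphere 0) b"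
  shows "chain_boundary 1 b = 0"
  using assms unfolding singular_chain_def
proof (induction b rule: frag_induction)
  case (one f)
  then have f: "continuous_map (subtopology (powertop_real UNIV) (standard_simplex 1)) (nsphere 0) f"
    by (simp add: singular_simplex_def)
  have sq: "f x \<in> topspace (nsphere 0)" if "x \<in> standard_simplex 1" for x
    using f that by (auto simp: continuous_map_def Pi_iff)
  have "continuous_map (subtopology (powertop_real UNIV) (standard_simplex 1)) euclideanreal (\<lambda>x. f x 0)"
    using continuous_map_compose[OF f continuous_map_nsphere_projection[of 0 0]] by (simp add: o_def)
  moreover have "connectedin (subtopology (powertop_real UNIV) (standard_simplex 1)) (standard_simplex 1)"
    by (simp add: connectedin_subtopology connectedin_standard_simplex)
  ultimately have "connectedin euclideanreal ((\<lambda>x. f x 0) ` standard_simplex 1)"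
    using connectedin_continuous_map_image by blast
  then have conn: "connected ((\<lambda>x. f x 0) ` standard_simplex 1)" by simp
  have pm: "f x 0 = 1 \<or> f x 0 = -1" if "x \<in> standard_simplex 1" for x
    using sq[OF that] by (simp add: topspace_nsphere power2_eq_1_iff)
  have const0: "f x 0 = f y 0" if xy: "x \<in> standard_simplex 1" "y \<in> standard_simplex 1" for x y
  proof (rule ccontr)
    assume "f x 0 \<noteq> f y 0"
    then have "(0::real) \<in> (\<lambda>x. f x 0) ` standard_simplex 1"
      using pm[OF xy(1)] pm[OF xy(2)]
        connectedD_interval[OF conn imageI[OF xy(1)] imageI[OF xy(2)], of 0]
        connectedD_interval[OF conn imageI[OF xy(2)] imageI[OF xy(1)], of 0]
      by force
    then show False using pm by fastforce
  qed
  have const: "f x = f y" if "x \<in> standard_simplex 1" "y \<in> standard_simplex 1" for x y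
  proof
    fix i show "f x i = f y i"
      using const0[OF that] sq[OF that(1)] sq[OF that(2)] by (cases "i = 0") (auto simp: topspace_nsphere)
  qed
  have "singular_face 1 0 f = singular_face 1 (Suc 0) f"
    unfolding singular_face_def
    by (auto simp: restrict_def fun_eq_iff intro!: fun_cong[OF const] simplical_face_in_standard_simplex)
  then show ?case
    by (simp add: chain_boundary_of)
next
  case (diff a b)
  then show ?case by (simp add: chain_boundary_diff)
qed simp

text \<open>The fundamental class is not divisible by 2. Modulo the lower hemisphere only the upper
  half of the sphere chain remains; excision carries the situation to the upper hemisphere relative
  to its equator, and the boundary operator then lands on the sphere one dimension lower, where
  induction applies.\<close>

lemma sphere_chain_not_even:
  assumes h: "hemisphere_chains h"
    and "singular_relcycle n (nsphere n) {} c" "singular_chain (Suc n) (nsphere n) b"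
  shows "sphere_chain n (h n) \<noteq> frag_cmul 2 c + chain_boundary (Suc n) b"
  using assms(2,3)
proof (induction n arbitrary: c b)
  case 0
  let ?e = "\<lambda>i::nat. if i = 0 then 1 else (0::real)"
  define \<sigma> where "\<sigma> = restrict (\<lambda>_. ?e) (standard_simplex 0)"
  define \<tau> where "\<tau> = restrict (\<lambda>_. antipode ?e) (standard_simplex 0)"
  obtain s :: "nat \<Rightarrow> real" where s: "s \<in> standard_simplex 0" using nonempty_standard_simplex by blast
  have "\<sigma> s 0 \<noteq> \<tau> s 0" using s by (simp add: \<sigma>_def \<tau>_def)
  then have "\<sigma> \<noteq> \<tau>" by auto
  have "sphere_chain 0 (h 0) = vertex_chain ?e - vertex_chain (antipode ?e)"
    using h by (simp add: hemisphere_chains_def sphere_chain_def chain_map_vertex_chain)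
  also have "\<dots> = frag_of \<sigma> - frag_of \<tau>" by (simp add: vertex_chain_def \<sigma>_def \<tau>_def)
  \<comment> \<open>The north pole has coefficient 1, whereas all coefficients of a doubled chain
    are even and 1-boundaries vanish on the 0-sphere.\<close>
  finally have "Poly_Mapping.lookup (sphere_chain 0 (h 0)) \<sigma> = 1"
    using \<open>\<sigma> \<noteq> \<tau>\<close> by (simp add: lookup_minus lookup_frag_of)
  moreover have "chain_boundary (Suc 0) b = 0"
    using chain_boundary_nsphere_0 0 by simp
  moreover have "Poly_Mapping.lookup (frag_cmul 2 c) \<sigma> = 2 * Poly_Mapping.lookup c \<sigma>" by simp
  ultimately show ?case
    by (metis add.right_neutral even_mult_iff odd_one even_numeral)
next
  case (Suc n)
  show ?case
  proof
    let ?S = "nsphere (Suc n)" and ?U = "upper_hemisphere (Suc n)" and ?m = "Suc n"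
    let ?L = "{x :: nat \<Rightarrow> real. x (Suc n) \<le> 0}" and ?E = "{x :: nat \<Rightarrow> real. x (Suc n) = 0}"
    let ?\<phi> = "hom_induced (int ?m) ?U ?E ?S ?L id"
    assume eq: "sphere_chain ?m (h ?m) = frag_cmul 2 c + chain_boundary (Suc ?m) b"
    have iso: "?\<phi> \<in> iso (relative_homology_group (int ?m) ?U ?E) (relative_homology_group (int ?m) ?S ?L)"
      using iso_relative_homology_group_upper_hemisphere[of "int ?m" ?m ?m]
      by (simp add: upper_hemisphere_def)
    have cm: "continuous_map ?U ?S id"
      by (simp add: upper_hemisphere_def)
    have ind: "?\<phi> (homologous_rel_set ?m ?U ?E a) = homologous_rel_set ?m ?S ?L a"
      if "singular_relcycle ?m ?U ?E a" for a
    proof -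
      have "?\<phi> (homologous_rel_set ?m ?U ?E a) = homologous_rel_set ?m ?S ?L (chain_map ?m id a)"
        by (rule hom_induced_chain_map[OF cm _ that]) auto
      then show ?thesis
        using that by (simp add: singular_relcycle chain_map_ident[of _ ?U])
    qed
    have c: "singular_relcycle ?m ?S ?L c"
      using Suc.prems(1) by (simp add: singular_cycle) (simp add: singular_relcycle)
    then have "homologous_rel_set ?m ?S ?L c \<in> carrier (relative_homology_group (int ?m) ?S ?L)"
      unfolding carrier_relative_homology_group by blast
    then have "homologous_rel_set ?m ?S ?L c \<in> ?\<phi> ` carrier (relative_homology_group (int ?m) ?U ?E)"
      using iso by (simp add: iso_iff del: of_nat_Suc)
    \<comment> \<open>Excision replaces \<open>c\<close> by a relative cycle \<open>c'\<close> of
      the upper hemisphere modulo its equator.\<close>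
    then obtain c' where c': "singular_relcycle ?m ?U ?E c'"
      "homologous_rel_set ?m ?S ?L c = ?\<phi> (homologous_rel_set ?m ?U ?E c')"
      unfolding carrier_relative_homology_group by auto
    from c'(2) have hcc': "singular_relboundary ?m ?S ?L (c - c')"
      unfolding ind[OF c'(1)] homologous_rel_set_eq unfolding homologous_rel_def by blast
    have bh: "chain_boundary ?m (h ?m) = sphere_chain n (h n)"
      and hU: "singular_chain ?m ?U (h ?m)"
      using h by (auto simp: hemisphere_chains_def)
    have hrel: "singular_relcycle ?m ?U ?E (h ?m)"
      using hU sphere_chain_singular_chain(2)[OF h, of n]
      by (simp add: singular_relcycle bh nsphere_equator_upper)
    define a where "a = h ?m - frag_cmul 2 c'"
    have arel: "singular_relcycle ?m ?U ?E a"
      unfolding a_def by (intro singular_relcycle_diff singular_relcycle_cmul hrel c')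
    \<comment> \<open>The antipodal half of the sphere chain lies in the lower hemisphere, so it is
      a relative boundary, as are the boundary of \<open>b\<close> and c - c'.\<close>
    have "singular_relboundary ?m ?S ?L a"
    proof -
      let ?s = "(-1) ^ Suc ?m :: int"
      have "continuous_map ?U (subtopology ?S ?L) antipode"
        using continuous_map_antipode[of ?m]
        by (auto simp: upper_hemisphere_def continuous_map_in_subtopology continuous_map_from_subtopology)
      then have "singular_chain ?m (subtopology ?S ?L) (chain_map ?m antipode (h ?m))"
        using singular_chain_chain_map[OF hU] by blast
      then have r1: "singular_relboundary ?m ?S ?L (frag_cmul ?s (chain_map ?m antipode (h ?m)))"
        by (intro singular_relboundary_cmul singular_chain_imp_relboundary)
      have r2: "singular_relboundary ?m ?S ?L (chain_boundary (Suc ?m) b)"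
        unfolding singular_relboundary using Suc.prems(2)
        by (intro exI[of _ b] exI[of _ 0]) auto
      have "a = frag_cmul 2 (c - c') + chain_boundary (Suc ?m) b
             - frag_cmul ?s (chain_map ?m antipode (h ?m))"
        using eq frag_cmul_distrib2[of 2 "c - c'" c'] unfolding a_def sphere_chain_def
        by (simp add: algebra_simps)
      then show ?thesis
        using r1 r2 hcc' by (simp only: singular_relboundary_add singular_relboundary_diff singular_relboundary_cmul)
    qed
    then have "?\<phi> (homologous_rel_set ?m ?U ?E a) = \<one>\<^bsub>relative_homology_group (int ?m) ?S ?L\<^esub>"
      using ind[OF arel] by (simp add: homologous_rel_set_eq_relboundary del: of_nat_Suc)
    moreover interpret \<phi>: group_hom "relative_homology_group (int ?m) ?U ?E" "relative_homology_group (int ?m) ?S ?L" ?\<phi>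
      by (simp add: group_hom_axioms_def group_hom_def hom_induced_hom)
    have "homologous_rel_set ?m ?U ?E a \<in> carrier (relative_homology_group (int ?m) ?U ?E)"
      unfolding carrier_relative_homology_group using arel by blast
    ultimately have "homologous_rel_set ?m ?U ?E a = \<one>\<^bsub>relative_homology_group (int ?m) ?U ?E\<^esub>"
      using iso unfolding \<phi>.iso_iff by (metis (no_types, lifting) iso \<phi>.iso_iff \<phi>.inj_iff_trivial_ker \<phi>.hom_one inj_onD \<phi>.one_closed)
    then have "singular_relboundary ?m ?U ?E a"
      by (simp add: homologous_rel_set_eq_relboundary del: of_nat_Suc)
    then obtain d e where de: "singular_chain (Suc ?m) ?U d" "singular_chain ?m (nsphere n) e"
      "chain_boundary (Suc ?m) d + e = a"
      unfolding singular_relboundary nsphere_equator_upper by blast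
    \<comment> \<open>The boundary of h is the sphere chain of the equator, so taking boundaries of
      h - 2 c' writes that chain in the form excluded by the induction hypothesis.\<close>
    have "chain_boundary ?m a = chain_boundary ?m e"
      using chain_boundary_boundary_alt[OF de(1)] by (simp add: de(3)[symmetric] chain_boundary_add)
    then have "sphere_chain n (h n) = frag_cmul 2 (chain_boundary ?m c') + chain_boundary ?m e"
      unfolding a_def by (simp add: chain_boundary_diff chain_boundary_cmul bh algebra_simps)
    moreover have "singular_relcycle n (nsphere n) {} (chain_boundary ?m c')"
      using c' chain_boundary_boundary_alt[of n ?U c']
      by (simp add: singular_relcycle nsphere_equator_upper singular_cycle)
    ultimately show False
      using Suc.IH de(2) by blast
  qed
qed

text \<open>For a cycle \<open>x\<close> this says that its homology class is divisible by 2, that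
  is, zero after tensoring with Z/2. Parity is thus tracked inside integral homology.\<close>

definition even_class :: "nat \<Rightarrow> 'a topology \<Rightarrow> 'a chain \<Rightarrow> bool" where
  "even_class p X x \<longleftrightarrow> (\<exists>c b. singular_relcycle p X {} c \<and> singular_chain (Suc p) X b \<and>
     x = frag_cmul 2 c + chain_boundary (Suc p) b)"

lemma even_class_add: "even_class p X x \<Longrightarrow> even_class p X y \<Longrightarrow> even_class p X (x + y)"
proof -
  assume "even_class p X x" "even_class p X y"
  then obtain c b c' b' where "singular_relcycle p X {} c" "singular_chain (Suc p) X b"
    "x = frag_cmul 2 c + chain_boundary (Suc p) b"
    "singular_relcycle p X {} c'" "singular_chain (Suc p) X b'"
    "y = frag_cmul 2 c' + chain_boundary (Suc p) b'"
    unfolding even_class_def by blast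
  then show ?thesis
    unfolding even_class_def
    by (rule_tac exI[of _ "c + c'"], rule_tac exI[of _ "b + b'"])
       (auto simp: singular_relcycle_add singular_chain_add chain_boundary_add frag_cmul_distrib2)
qed

lemma frag_cmul_minus_right: "frag_cmul k (- c) = frag_cmul (- k) c"
  by (rule poly_mapping_eqI) simp

lemma even_class_minus: "even_class p X x \<Longrightarrow> even_class p X (- x)"
proof -
  assume "even_class p X x"
  then obtain c b where "singular_relcycle p X {} c" "singular_chain (Suc p) X b"
    "x = frag_cmul 2 c + chain_boundary (Suc p) b"
    unfolding even_class_def by blast
  then show ?thesis
    unfolding even_class_def
    by (rule_tac exI[of _ "- c"], rule_tac exI[of _ "- b"])
       (auto simp: singular_relcycle_minus singular_chain_minus chain_boundary_minus frag_cmul_minus_right)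
qed

lemma even_class_diff: "even_class p X x \<Longrightarrow> even_class p X y \<Longrightarrow> even_class p X (x - y)"
  using even_class_add[of p X x "- y"] even_class_minus[of p X y] by simp

lemma even_class_boundary: "singular_relboundary p X {} x \<Longrightarrow> even_class p X x"
  unfolding even_class_def singular_boundary by (metis add_0 frag_cmul_zero2 singular_relcycle_0)

lemma even_class_double: "singular_relcycle p X {} c \<Longrightarrow> even_class p X (frag_cmul 2 c)"
  unfolding even_class_def by (metis add.right_neutral chain_boundary_0 singular_chain_0)

text \<open>The antipodal map is a homeomorphism, so its degree is 1 or -1 and the image of
  \<open>e\<close> is homologous to e or -e. Either way e plus or minus its image is homologous to 0
  or to a multiple of e by 2.\<close>

lemma even_class_antipode:
  assumes n: "n \<ge> 1" and e: "singular_relcycle n (nsphere n) {} e" and s: "s = 1 \<or> s = -1"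
  shows "even_class n (nsphere n) (e + frag_cmul s (chain_map n antipode e))"
proof -
  let ?X = "nsphere n"
  let ?v = "homologous_rel_set n ?X {} e"
  let ?\<nu> = "chain_map n antipode e"
  define d where "d = Brouwer_degree2 n antipode"
  have v: "?v \<in> carrier (reduced_homology_group (int n) ?X)"
    using e n by (auto simp: un_reduced_homology_group carrier_relative_homology_group)
  have red: "reduced_homology_group (int n) ?X = homology_group (int n) ?X"
    using n by (simp add: un_reduced_homology_group)
  have \<nu>: "homologous_rel_set n ?X {} ?\<nu> = ?v [^]\<^bsub>homology_group (int n) ?X\<^esub> d"
    using Brouwer_degree2[OF v, of antipode] hom_induced_chain_map[OF continuous_map_antipode _ e]
    by (simp add: d_def red)
  have "homeomorphic_map ?X ?X antipode"
    unfolding homeomorphic_map_maps homeomorphic_maps_def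
    by (intro exI[of _ antipode]) (auto simp: continuous_map_antipode)
  then have "\<bar>d\<bar> = 1" unfolding d_def by (rule Brouwer_degree2_homeomorphic_map)
  then consider "d = 1" | "d = -1" by linarith
  then have "singular_relboundary n ?X {} (?\<nu> - e) \<or> singular_relboundary n ?X {} (?\<nu> + e)"
  proof cases
    case 1
    have "homologous_rel_set n ?X {} ?\<nu> = ?v"
      using \<nu> v by (simp add: 1 red group.int_pow_1)
    then show ?thesis unfolding homologous_rel_set_eq unfolding homologous_rel_def by blast
  next
    case 2
    have "?v [^]\<^bsub>homology_group (int n) ?X\<^esub> d = inv\<^bsub>homology_group (int n) ?X\<^esub> ?v"
      using v unfolding red 2 by (simp add: group.int_pow_neg group.int_pow_1)
    then have "homologous_rel_set n ?X {} ?\<nu> = uminus ` ?v"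
      using \<nu> v unfolding red by (simp add: inv_relative_homology_group)
    moreover have "?\<nu> \<in> homologous_rel_set n ?X {} ?\<nu>" by simp
    ultimately obtain y where "homologous_rel n ?X {} e y" "?\<nu> = - y" by auto
    then have "singular_relboundary n ?X {} (e + ?\<nu>)" by (simp add: homologous_rel_def)
    then show ?thesis by (simp add: add.commute)
  qed
  moreover have "e + frag_cmul 1 ?\<nu> = frag_cmul 2 e + (?\<nu> - e)" "e + frag_cmul (-1) ?\<nu> = - (?\<nu> - e)"
    "e + frag_cmul 1 ?\<nu> = ?\<nu> + e" "e + frag_cmul (-1) ?\<nu> = frag_cmul 2 e - (?\<nu> + e)"
    using frag_cmul_distrib[of 1 1 e] by (simp_all add: algebra_simps)
  ultimately show ?thesis
    using s even_class_double[OF e]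
    by (metis even_class_add even_class_diff even_class_minus even_class_boundary)
qed

text \<open>An antipodally equivariant chain homotopy from the identity to \<open>g\<close> is built
  on the hemispheres one dimension at a time. Below dimension \<open>n\<close> the reduced homology
  of the sphere vanishes and the next value exists; in dimension \<open>n\<close> the remaining
  defect enters symmetrised, and is even by \<open>even_class_antipode\<close>.\<close>

lemma odd_map_sphere_chain:
  assumes h: "hemisphere_chains h" and n: "n \<ge> 1"
    and g: "continuous_map (nsphere n) (nsphere n) g"
    and odd: "\<And>x. x \<in> topspace (nsphere n) \<Longrightarrow> g (antipode x) = antipode (g x)"
  shows "even_class n (nsphere n) (chain_map n g (sphere_chain n (h n)) - sphere_chain n (h n))"
proof -
  let ?X = "nsphere n"
  let ?s = "\<lambda>k. (-1) ^ k :: int"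
  \<comment> \<open>With \<open>c\<close> the value of the homotopy on the hemisphere chain of
    dimension k - 1, the bracket is its value on the boundary of \<open>h k\<close>; so
    \<open>E k c\<close> is the cycle that the value on \<open>h k\<close> has to bound. For k = 0
    the start is c = 0.\<close>
  define E where "E k c = chain_map k g (h k) - h k - (c + frag_cmul (?s k) (chain_map k antipode c))" for k c
  have hX: "singular_chain k ?X (h k)" if "k \<le> n" for k
    using singular_chain_nsphere_mono[OF that] sphere_chain_singular_chain(1)[OF h] by blast
  have comm: "chain_map k g (chain_map k antipode c) = chain_map k antipode (chain_map k g c)"
    if "singular_chain k ?X c" for k c
  proof -
    have "chain_map k (g \<circ> antipode) c = chain_map k (antipode \<circ> g) c"
      by (rule chain_map_eq[OF that]) (simp add: odd)
    then show ?thesis by (simp add: chain_map_compose)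
  qed
  have gX: "singular_chain k ?X (chain_map k g c)" and aX: "singular_chain k ?X (chain_map k antipode c)"
    if "singular_chain k ?X c" for k c
    using that by (auto intro: singular_chain_chain_map g continuous_map_antipode)
  have EX: "singular_chain k ?X (E k c)" if "k \<le> n" "singular_chain k ?X c" for k c
    unfolding E_def using that hX gX aX
    by (intro singular_chain_add singular_chain_diff singular_chain_cmul) auto
  have main: "\<exists>c. singular_chain k ?X c \<and> reduced_cycle k ?X (E k c)" if "k \<le> n" for k
    using that
  proof (induction k)
    case 0
    have "reduced_cycle 0 ?X (E 0 0)"
      using EX[of 0 0] h by (simp add: reduced_cycle_def singular_cycle E_def hemisphere_chains_def
          chain_map_vertex_chain chain_map_diff)
    then show ?case by (intro exI[of _ 0]) simp
  next
    case (Suc k)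
    then obtain c where c: "singular_chain k ?X c" "reduced_cycle k ?X (E k c)" by auto
    have "trivial_group (reduced_homology_group (int k) ?X)"
      using Suc.prems by (simp add: trivial_reduced_homology_group_nsphere)
    then obtain d where d: "singular_chain (Suc k) ?X d" "chain_boundary (Suc k) d = E k c"
      using reduced_cycle_is_boundary c(2) by blast
    let ?a = "chain_map k antipode"
    have hk: "singular_chain k ?X (h k)" using hX Suc.prems by simp
    have bh: "chain_boundary (Suc k) (h (Suc k)) = sphere_chain k (h k)"
      using h by (simp add: hemisphere_chains_def)
    have bgh: "chain_boundary (Suc k) (chain_map (Suc k) g (h (Suc k))) = chain_map k g (sphere_chain k (h k))"
      using chain_boundary_chain_map[OF hX[OF Suc.prems], of g] bh by simp
    have bad: "chain_boundary (Suc k) (chain_map (Suc k) antipode d) = ?a (E k c)"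
      using chain_boundary_chain_map[OF d(1), of antipode] d(2) by simp
    have "chain_boundary (Suc k) (E (Suc k) d) =
      chain_map k g (sphere_chain k (h k)) - sphere_chain k (h k) - (E k c + frag_cmul (?s (Suc k)) (?a (E k c)))"
      unfolding E_def[of "Suc k"]
      by (simp only: chain_boundary_diff chain_boundary_add chain_boundary_cmul bh bgh bad d(2))
    also have "\<dots> = 0"
    proof -
      have aa: "?a (?a c) = c" "chain_map k g (?a (h k)) = ?a (chain_map k g (h k))"
        using chain_map_antipode_antipode c(1) comm hk by auto
      show ?thesis
        unfolding E_def sphere_chain_def
        by (cases "even k") (simp_all add: chain_map_add chain_map_diff chain_map_minus aa)
    qed
    finally have "reduced_cycle (Suc k) ?X (E (Suc k) d)"
      using EX[OF Suc.prems d(1)] by (simp add: reduced_cycle_def singular_cycle)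
    then show ?case using d(1) by blast
  qed
  obtain c where c: "singular_chain n ?X c" "reduced_cycle n ?X (E n c)"
    using main[of n] by auto
  let ?a = "chain_map n antipode"
  have aa: "?a (?a c) = c" "chain_map n g (?a (h n)) = ?a (chain_map n g (h n))"
    using chain_map_antipode_antipode c(1) comm hX by auto
  \<comment> \<open>The terms in \<open>c\<close> cancel: with s = (-1)^n they form (1 - s a)(1 + s
    a) c = c - a a c = 0, where a is the antipodal push-forward.\<close>
  have "chain_map n g (sphere_chain n (h n)) - sphere_chain n (h n) = E n c + frag_cmul (?s (Suc n)) (?a (E n c))"
    unfolding E_def sphere_chain_def
    by (cases "even n") (simp_all add: chain_map_add chain_map_diff chain_map_minus aa)
  moreover have "even_class n ?X (E n c + frag_cmul (?s (Suc n)) (?a (E n c)))"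
    using c(2) by (intro even_class_antipode[OF n]) (auto simp: reduced_cycle_def minus_one_power_iff)
  ultimately show ?thesis by simp
qed

text \<open>Since \<open>f\<close> does not distinguish antipodes, it sends the sphere chain to h +
  (-1)^(n+1) h, pushed forward by \<open>f\<close>. For even \<open>n\<close> this is 0. For odd
  \<open>n\<close> it is twice the image of h, and that image is a cycle because the same
  computation in dimension n - 1 gives boundary 0.\<close>

lemma even_map_sphere_chain:
  assumes h: "hemisphere_chains h" and n: "n \<ge> 1"
    and f: "continuous_map (nsphere n) (nsphere n) f"
    and even: "\<And>x. x \<in> topspace (nsphere n) \<Longrightarrow> f (antipode x) = f x"
  shows "even_class n (nsphere n) (chain_map n f (sphere_chain n (h n)))"
proof -
  let ?X = "nsphere n"
  obtain m where m: "n = Suc m" using n by (cases n) auto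
  have hX: "singular_chain k ?X (h k)" if "k \<le> n" for k
    using singular_chain_nsphere_mono[OF that] sphere_chain_singular_chain(1)[OF h] by blast
  have fa: "chain_map k f (chain_map k antipode c) = chain_map k f c" if "singular_chain k ?X c" for k c
  proof -
    have "chain_map k (f \<circ> antipode) c = chain_map k f c"
      by (rule chain_map_eq[OF that]) (simp add: even)
    then show ?thesis by (simp add: chain_map_compose)
  qed
  show ?thesis
  proof (cases "even n")
    case True
    then have "chain_map n f (sphere_chain n (h n)) = 0"
      using fa[OF hX] by (simp add: sphere_chain_def chain_map_diff chain_map_add chain_map_minus)
    then show ?thesis by (simp add: even_class_boundary)
  next
    case False
    have "chain_boundary n (chain_map n f (h n)) = chain_map m f (sphere_chain m (h m))"
      using chain_boundary_chain_map[OF hX[of n], of f] h by (simp add: m hemisphere_chains_def)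
    also have "\<dots> = 0"
      using fa[OF hX[of m]] False by (simp add: m sphere_chain_def chain_map_diff chain_map_add chain_map_minus)
    finally have "singular_relcycle n ?X {} (chain_map n f (h n))"
      using hX[of n] by (simp add: singular_cycle singular_chain_chain_map[OF _ f])
    moreover have "chain_map n f (sphere_chain n (h n)) = frag_cmul 2 (chain_map n f (h n))"
      using fa[OF hX[of n]] False frag_cmul_distrib[of 1 1 "chain_map n f (h n)"]
      by (simp add: sphere_chain_def chain_map_add)
    ultimately show ?thesis by (simp add: even_class_double)
  qed
qed

text \<open>Modulo even classes \<open>f\<close> kills the fundamental cycle and \<open>g\<close>
  fixes it, while homotopic maps agree on homology; so the fundamental cycle itself would be
  even.\<close>

theorem even_map_not_homotopic_odd_map:
  assumes hom: "homotopic_with (\<lambda>x. True) (nsphere n) (nsphere n) f g"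
    and even: "\<And>x. x \<in> topspace (nsphere n) \<Longrightarrow> f (antipode x) = f x"
    and odd: "\<And>x. x \<in> topspace (nsphere n) \<Longrightarrow> g (antipode x) = antipode (g x)"
  shows False
proof -
  have f: "continuous_map (nsphere n) (nsphere n) f" and g: "continuous_map (nsphere n) (nsphere n) g"
    using homotopic_with_imp_continuous_maps[OF hom] by auto
  show False
  proof (cases "n \<ge> 1")
    case True
    obtain h where h: "hemisphere_chains h" using hemisphere_chains_exist by blast
    let ?z = "sphere_chain n (h n)" and ?X = "nsphere n"
    have z: "singular_relcycle n ?X {} ?z"
      using sphere_chain_singular_chain[OF h] by (simp add: singular_cycle)
    have "hom_induced (int n) ?X {} ?X {} f = hom_induced (int n) ?X {} ?X {} g"
      by (rule homology_homotopy_empty[OF hom])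
    then have "homologous_rel_set n ?X {} (chain_map n f ?z) = homologous_rel_set n ?X {} (chain_map n g ?z)"
      using hom_induced_chain_map[OF f _ z, of "{}"] hom_induced_chain_map[OF g _ z, of "{}"] by simp
    then have "even_class n ?X (chain_map n f ?z - chain_map n g ?z)"
      unfolding homologous_rel_set_eq unfolding homologous_rel_def by (rule even_class_boundary)
    moreover have "even_class n ?X (chain_map n f ?z)"
      by (rule even_map_sphere_chain[OF h True f even])
    moreover have "even_class n ?X (chain_map n g ?z - ?z)"
      by (rule odd_map_sphere_chain[OF h True g odd])
    ultimately have "even_class n ?X ?z"
      using even_class_diff[of n ?X "chain_map n f ?z" "chain_map n f ?z - chain_map n g ?z"]
        even_class_diff[of n ?X "chain_map n g ?z" "chain_map n g ?z - ?z"] by simp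
    then show False
      using sphere_chain_not_even[OF h] unfolding even_class_def by blast
  next
    case False
    \<comment> \<open>On two points an even map is constant, of degree 0, and an odd map is an
      involution, whose degree has square 1.\<close>
    then have n: "n = 0" by simp
    define e where "e = (\<lambda>i::nat. if i = 0 then 1 else (0::real))"
    have top: "x = e \<or> x = antipode e" if "x \<in> topspace (nsphere 0)" for x
      using that by (auto simp: topspace_nsphere power2_eq_1_iff e_def fun_eq_iff)
    have e: "e \<in> topspace (nsphere 0)" by (simp add: topspace_nsphere e_def)
    have "homotopic_with (\<lambda>x. True) (nsphere 0) (nsphere 0) f (\<lambda>x. f e)"
      by (rule homotopic_with_equal) (use f top even e n in auto)
    then have 0: "Brouwer_degree2 0 g = 0"
      using Brouwer_degree2_nullhomotopic Brouwer_degree2_homotopic[OF hom] n by simp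
    have "g e \<in> topspace (nsphere 0)"
      using g e n by (auto simp: continuous_map_def)
    then have "g (g x) = x" if "x \<in> topspace (nsphere 0)" for x
      using top[OF that] top[of "g e"] odd e n by auto
    then have "homotopic_with (\<lambda>x. True) (nsphere 0) (nsphere 0) (g \<circ> g) id"
      using g n by (intro homotopic_with_equal) (auto intro: continuous_map_compose)
    then have "Brouwer_degree2 0 g * Brouwer_degree2 0 g = 1"
      using Brouwer_degree2_homotopic Brouwer_degree2_compose[of 0 g g] g n by fastforce
    then show False using 0 by simp
  qed
qed

section \<open>The Borsuk-Ulam theorem\<close>

lemma continuous_map_into_nsphere:
  assumes "\<And>i. continuous_map X euclideanreal (\<lambda>x. f x i)"
    and "\<And>x. x \<in> topspace X \<Longrightarrow> f x \<in> topspace (nsphere n)"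
  shows "continuous_map X (nsphere n) f"
  using assms unfolding nsphere continuous_map_in_subtopology continuous_map_componentwise_UNIV
  by (auto simp: image_subset_iff Pi_iff)

lemma topspace_nsphere_mono: "m \<le> n \<Longrightarrow> topspace (nsphere m) \<subseteq> topspace (nsphere n)"
proof (induction n rule: dec_induct)
  case (step n)
  have "topspace (nsphere n) \<subseteq> topspace (nsphere (Suc n))" by (auto simp: topspace_nsphere)
  then show ?case using step by blast
qed simp

lemma continuous_map_nsphere_inclusion: "m \<le> n \<Longrightarrow> continuous_map (nsphere m) (nsphere n) (\<lambda>x. x)"
  using topspace_nsphere_mono[of m n]
  by (intro continuous_map_into_nsphere) (auto simp: continuous_map_nsphere_projection)

text \<open>The (k+1)-sphere sits in the domain, and its upper hemisphere is swept out by
  \<open>\<Phi>\<close>, from the equator at t = 0 to the pole at t = 1. Composed with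
  \<open>f\<close> this is a homotopy from an odd self-map of the k-sphere to a constant one, which
  is even.\<close>

theorem Borsuk_Ulam_nsphere:
  assumes "k < m" and f: "continuous_map (nsphere m) (nsphere k) f"
    and odd: "\<And>x. x \<in> topspace (nsphere m) \<Longrightarrow> f (antipode x) = antipode (f x)"
  shows False
proof -
  define \<Phi> where "\<Phi> = (\<lambda>(t, x) i. if i = Suc k then t else sqrt (1 - t\<^sup>2) * (x i :: real))"
  let ?T = "prod_topology (top_of_set {0..1::real}) (nsphere k)"
  have top: "\<Phi> (t, x) \<in> topspace (nsphere (Suc k))" if "t \<in> {0..1}" "x \<in> topspace (nsphere k)" for t x
  proof -
    have t: "t\<^sup>2 \<le> 1" using that by (simp add: power_le_one)
    have "(\<Sum>i\<le>k. (\<Phi> (t, x) i)\<^sup>2) = (\<Sum>i\<le>k. (1 - t\<^sup>2) * (x i)\<^sup>2)"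
      using t by (intro sum.cong) (auto simp: \<Phi>_def power_mult_distrib)
    also have "\<dots> = 1 - t\<^sup>2"
      using that by (simp add: topspace_nsphere flip: sum_distrib_left)
    finally show ?thesis using that by (auto simp: topspace_nsphere \<Phi>_def)
  qed
  have fst: "continuous_map ?T euclideanreal (\<lambda>p. fst p)"
    using continuous_map_fst continuous_map_into_fulltopology by blast
  have "continuous_map (top_of_set {0..1::real}) euclideanreal (\<lambda>t. sqrt (1 - t\<^sup>2))"
    by (auto intro!: continuous_intros)
  from continuous_map_compose[OF continuous_map_fst this]
  have sqrt: "continuous_map ?T euclideanreal (\<lambda>p. sqrt (1 - (fst p)\<^sup>2))"
    by (simp add: o_def)
  have snd: "continuous_map ?T euclideanreal (\<lambda>p. snd p i)" for i
    using continuous_map_compose[OF continuous_map_snd continuous_map_nsphere_projection[of k i]]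
    by (simp add: o_def)
  have "continuous_map ?T (nsphere (Suc k)) \<Phi>"
  proof (rule continuous_map_into_nsphere)
    show "continuous_map ?T euclideanreal (\<lambda>p. \<Phi> p i)" for i
      using fst continuous_map_real_mult[OF sqrt snd[of i]]
      by (cases "i = Suc k") (auto simp: \<Phi>_def case_prod_unfold)
  qed (use top in auto)
  then have cont: "continuous_map ?T (nsphere k) (f \<circ> \<Phi>)"
    using continuous_map_compose[OF _ f] continuous_map_compose[OF _ continuous_map_nsphere_inclusion[of "Suc k" m]]
      \<open>k < m\<close> by (force simp: o_def)
  have "homotopic_with (\<lambda>_. True) (nsphere k) (nsphere k) (\<lambda>x. f (\<Phi> (0, x))) (\<lambda>x. f (\<Phi> (1, x)))"
    unfolding homotopic_with_def
    by (rule exI[of _ "f \<circ> \<Phi>"]) (use cont in auto)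
  then have "homotopic_with (\<lambda>_. True) (nsphere k) (nsphere k) (\<lambda>x. f (\<Phi> (1, x))) (\<lambda>x. f (\<Phi> (0, x)))"
    by (simp add: homotopic_with_sym)
  moreover have "\<Phi> (1, antipode x) = \<Phi> (1, x)" for x
    by (auto simp: \<Phi>_def)
  moreover have "f (\<Phi> (0, antipode x)) = antipode (f (\<Phi> (0, x)))" if "x \<in> topspace (nsphere k)" for x
  proof -
    have "\<Phi> (0, antipode x) = antipode (\<Phi> (0, x))"
      by (auto simp: \<Phi>_def fun_eq_iff)
    moreover have "\<Phi> (0, x) \<in> topspace (nsphere m)"
      using top[OF _ that, of 0] topspace_nsphere_mono[of "Suc k" m] \<open>k < m\<close> by auto
    ultimately show ?thesis using odd by simp
  qed
  ultimately show False
    using even_map_not_homotopic_odd_map[of k "\<lambda>x. f (\<Phi> (1, x))" "\<lambda>x. f (\<Phi> (0, x))"] by simp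
qed

section \<open>Calculus of smooth functions\<close>

lemma gradient_eqI: "GDERIV f x :> D \<Longrightarrow> gradient f x = D"
  by (simp add: gradient_def gderiv_def vec_eq_iff inner_axis' flip: frechet_derivative_at)

lemma GDERIV_gradient: "f differentiable at x \<Longrightarrow> GDERIV f x :> gradient f x"
proof -
  assume "f differentiable at x"
  then have f: "(f has_derivative frechet_derivative f (at x)) (at x)"
    by (simp add: frechet_derivative_works)
  then have lin: "linear (frechet_derivative f (at x))"
    by (rule has_derivative_linear)
  have "frechet_derivative f (at x) h = h \<bullet> gradient f x" for h
  proof -
    have "frechet_derivative f (at x) h = frechet_derivative f (at x) (\<Sum>i\<in>UNIV. h $ i *\<^sub>R axis i 1)"
      using basis_expansion[of h] by (simp add: scalar_mult_eq_scaleR)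
    also have "\<dots> = (\<Sum>i\<in>UNIV. h $ i * frechet_derivative f (at x) (axis i 1))"
      by (simp add: linear_sum[OF lin] linear_scale[OF lin])
    also have "\<dots> = h \<bullet> gradient f x" by (simp add: inner_vec_def gradient_def)
    finally show ?thesis .
  qed
  then have "frechet_derivative f (at x) = (\<lambda>h. h \<bullet> gradient f x)" by (rule ext)
  then show ?thesis using f by (simp add: gderiv_def)
qed

lemma GDERIV_differentiable: "GDERIV f x :> D \<Longrightarrow> f differentiable at x"
  unfolding gderiv_def differentiable_def by blast

lemma GDERIV_sum:
  assumes "\<And>i. i \<in> I \<Longrightarrow> GDERIV (f i) x :> D i"
  shows "GDERIV (\<lambda>x. \<Sum>i\<in>I. f i x) x :> (\<Sum>i\<in>I. D i)"
proof -
  have "((\<lambda>x. \<Sum>i\<in>I. f i x) has_derivative (\<lambda>h. \<Sum>i\<in>I. h \<bullet> D i)) (at x)"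
    using assms by (intro has_derivative_sum) (auto simp: gderiv_def)
  then show ?thesis by (simp add: gderiv_def inner_sum_right)
qed

lemma GDERIV_vec_compose:
  fixes f :: "real^'m \<Rightarrow> real" and g :: "'m \<Rightarrow> real^'n \<Rightarrow> real"
  assumes f: "GDERIV f (\<chi> j. g j x) :> F" and g: "\<And>j. GDERIV (g j) x :> G j"
  shows "GDERIV (\<lambda>x. f (\<chi> j. g j x)) x :> (\<Sum>j\<in>UNIV. F $ j *\<^sub>R G j)"
proof -
  have "((\<lambda>x. \<chi> j. g j x) has_derivative (\<lambda>h. \<chi> j. h \<bullet> G j)) (at x)"
  proof (subst has_derivative_componentwise_within, rule ballI)
    fix b :: "real^'m" assume "b \<in> Basis"
    then obtain j where "b = axis j 1" by (auto simp: Basis_vec_def)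
    then show "((\<lambda>x. (\<chi> j. g j x) \<bullet> b) has_derivative (\<lambda>h. (\<chi> j. h \<bullet> G j) \<bullet> b)) (at x)"
      using g[of j] by (simp add: inner_axis gderiv_def)
  qed
  from has_derivative_compose[OF this, of f "\<lambda>h. h \<bullet> F"] f
  have "((\<lambda>x. f (\<chi> j. g j x)) has_derivative (\<lambda>h. (\<chi> j. h \<bullet> G j) \<bullet> F)) (at x)"
    by (simp add: gderiv_def)
  moreover have "(\<chi> j. h \<bullet> G j) \<bullet> F = h \<bullet> (\<Sum>j\<in>UNIV. F $ j *\<^sub>R G j)" for h
    by (simp add: inner_sum_right inner_vec_def[of "\<chi> j. h \<bullet> G j"] mult.commute)
  ultimately show ?thesis by (simp add: gderiv_def)
qed

lemma k_times_differentiable_Suc_D: "k_times_differentiable (Suc k) f \<Longrightarrow> k_times_differentiable k f"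
  by (induction k arbitrary: f) auto

lemma k_times_differentiable_const: "k_times_differentiable k (\<lambda>x :: real^'n. c)"
proof (induction k arbitrary: c)
  case (Suc k)
  have "gradient (\<lambda>x. c) x = 0" for x :: "real^'n" by (rule gradient_eqI[OF GDERIV_const])
  then show ?case using Suc[of 0] differentiable_const by simp
qed simp

lemma k_times_differentiable_add:
  "k_times_differentiable k f \<Longrightarrow> k_times_differentiable k g \<Longrightarrow> k_times_differentiable k (\<lambda>x. f x + g x)"
proof (induction k arbitrary: f g)
  case (Suc k)
  have "gradient (\<lambda>x. f x + g x) x = gradient f x + gradient g x" for x
    using Suc.prems by (intro gradient_eqI GDERIV_add GDERIV_gradient) auto
  then show ?case using Suc by simp
qed simp

lemma k_times_differentiable_mult:
  "k_times_differentiable k f \<Longrightarrow> k_times_differentiable k g \<Longrightarrow> k_times_differentiable k (\<lambda>x. f x * g x)"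
proof (induction k arbitrary: f g)
  case (Suc k)
  have "gradient (\<lambda>x. f x * g x) x = f x *\<^sub>R gradient g x + g x *\<^sub>R gradient f x" for x
    using Suc.prems by (intro gradient_eqI GDERIV_mult GDERIV_gradient) auto
  then show ?case
    using Suc k_times_differentiable_Suc_D[OF Suc.prems(1)] k_times_differentiable_Suc_D[OF Suc.prems(2)]
    by (simp add: k_times_differentiable_add)
qed simp

lemma k_times_differentiable_sum:
  "(\<And>i. i \<in> I \<Longrightarrow> k_times_differentiable k (f i)) \<Longrightarrow> k_times_differentiable k (\<lambda>x. \<Sum>i\<in>I. f i x)"
  by (induction I rule: infinite_finite_induct)
     (auto simp: k_times_differentiable_const k_times_differentiable_add)

lemma k_times_differentiable_compose:
  fixes f :: "real^'m \<Rightarrow> real" and g :: "'m \<Rightarrow> real^'n \<Rightarrow> real"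
  shows "k_times_differentiable k f \<Longrightarrow> (\<And>j. k_times_differentiable k (g j)) \<Longrightarrow>
    k_times_differentiable k (\<lambda>x. f (\<chi> j. g j x))"
proof (induction k arbitrary: f)
  case (Suc k)
  have G: "GDERIV (\<lambda>x. f (\<chi> j. g j x)) x :> (\<Sum>j\<in>UNIV. gradient f (\<chi> j. g j x) $ j *\<^sub>R gradient (g j) x)" for x
    using Suc.prems by (intro GDERIV_vec_compose GDERIV_gradient) auto
  have "k_times_differentiable k (\<lambda>x. \<Sum>j\<in>UNIV. gradient f (\<chi> j. g j x) $ j * gradient (g j) x $ i)" for i
    using Suc.prems k_times_differentiable_Suc_D[OF Suc.prems(2)]
    by (intro k_times_differentiable_sum k_times_differentiable_mult Suc.IH) auto
  then show ?case
    using GDERIV_differentiable[OF G] by (simp add: gradient_eqI[OF G])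
qed simp

lemma smooth_differentiable: "smooth f \<Longrightarrow> f differentiable at x"
  unfolding smooth_def by (metis k_times_differentiable.simps(2))

lemma smooth_gradient: "smooth f \<Longrightarrow> smooth (\<lambda>x. gradient f x $ i)"
  unfolding smooth_def by (metis k_times_differentiable.simps(2))

lemma GDERIV_smooth: "smooth f \<Longrightarrow> GDERIV f x :> gradient f x"
  by (simp add: GDERIV_gradient smooth_differentiable)

lemma smooth_const: "smooth (\<lambda>x. c)"
  and smooth_add: "smooth f \<Longrightarrow> smooth g \<Longrightarrow> smooth (\<lambda>x. f x + g x)"
  and smooth_mult: "smooth f \<Longrightarrow> smooth g \<Longrightarrow> smooth (\<lambda>x. f x * g x)"
  by (simp_all add: smooth_def k_times_differentiable_const k_times_differentiable_add k_times_differentiable_mult)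

lemma smooth_sum: "(\<And>i. i \<in> I \<Longrightarrow> smooth (f i)) \<Longrightarrow> smooth (\<lambda>x. \<Sum>i\<in>I. f i x)"
  by (simp add: smooth_def k_times_differentiable_sum)

lemma smooth_prod: "(\<And>i. i \<in> I \<Longrightarrow> smooth (f i)) \<Longrightarrow> smooth (\<lambda>x. \<Prod>i\<in>I. f i x)"
  by (induction I rule: infinite_finite_induct) (auto simp: smooth_const smooth_mult)

lemma smooth_diff: "smooth f \<Longrightarrow> smooth g \<Longrightarrow> smooth (\<lambda>x. f x - g x)"
  using smooth_add[of f "\<lambda>x. -1 * g x"] smooth_mult[OF smooth_const[of "-1"], of g] by simp

lemma smooth_compose:
  fixes f :: "real^'m \<Rightarrow> real" and g :: "'m \<Rightarrow> real^'n \<Rightarrow> real"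
  shows "smooth f \<Longrightarrow> (\<And>j. smooth (g j)) \<Longrightarrow> smooth (\<lambda>x. f (\<chi> j. g j x))"
  by (simp add: smooth_def k_times_differentiable_compose)

lemma smooth_component: "smooth (\<lambda>x. x $ i)"
  unfolding smooth_def
proof
  fix k show "k_times_differentiable k (\<lambda>x :: real^'a. x $ i)"
  proof (cases k)
    case (Suc m)
    have G: "GDERIV (\<lambda>x :: real^'a. x $ i) x :> axis i 1" for x
      by (simp add: gderiv_def inner_axis bounded_linear.has_derivative[OF bounded_linear_vec_nth has_derivative_ident])
    then have "gradient (\<lambda>x :: real^'a. x $ i) x = axis i 1" for x by (rule gradient_eqI)
    then show ?thesis
      using GDERIV_differentiable[OF G] by (simp add: Suc k_times_differentiable_const)
  qed simp
qed

lemma smooth_inner_const: "smooth (\<lambda>x. x \<bullet> e)"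
  unfolding inner_vec_def by (auto intro!: smooth_sum smooth_mult smooth_const smooth_component)

lemma smooth_norm_sq: "smooth (\<lambda>x. x \<bullet> x)"
  unfolding inner_vec_def by (auto intro!: smooth_sum smooth_mult smooth_component)

lemma smooth_powr:
  assumes q: "smooth q" and pos: "\<And>x. q x > 0"
  shows "smooth (\<lambda>x. q x powr a)"
proof -
  have "k_times_differentiable k (\<lambda>x. q x powr a)" for k
  proof (induction k arbitrary: a)
    case (Suc k)
    have "DERIV (\<lambda>t. t powr a) (q x) :> a * q x powr (a - 1)" for x
      by (rule has_real_derivative_powr, rule pos)
    then have G: "GDERIV (\<lambda>x. q x powr a) x :> (a * q x powr (a - 1)) *\<^sub>R gradient q x" for x
      by (intro GDERIV_DERIV_compose GDERIV_smooth q)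
    have "k_times_differentiable k (\<lambda>x. a * q x powr (a - 1) * gradient q x $ i)" for i
      using smooth_gradient[OF q, of i] unfolding smooth_def
      by (intro k_times_differentiable_mult k_times_differentiable_const Suc) auto
    then show ?case
      using GDERIV_differentiable[OF G] by (simp add: gradient_eqI[OF G])
  qed simp
  then show ?thesis by (simp add: smooth_def)
qed

lemma smooth_continuous_on: "smooth f \<Longrightarrow> continuous_on S f"
  by (meson smooth_differentiable differentiable_imp_continuous_within continuous_at_imp_continuous_on)

lemma smooth_gradient_continuous_on: "smooth f \<Longrightarrow> continuous_on S (gradient f)"
proof -
  assume "smooth f"
  then have "continuous_on S (\<lambda>x. \<chi> i. gradient f x $ i)"
    by (intro continuous_on_vec_lambda smooth_continuous_on smooth_gradient)
  then show ?thesis by simp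
qed

subsection \<open>Bump functions\<close>

text \<open>For m = 0 this is the classical flat function exp(-1/t). The powers of 1/t make the
  family closed under differentiation up to linear combinations, so smoothness follows by induction
  over all \<open>m\<close> at once.\<close>

definition flat_exp :: "nat \<Rightarrow> real \<Rightarrow> real" where
  "flat_exp m t = (if t \<le> 0 then 0 else exp (- inverse t) * inverse t ^ m)"

text \<open>A single term of the exponential series, that of index m + 2, bounds exp(1/t) from
  below. Quadratic decay is what makes the difference quotients at 0 tend to 0.\<close>

lemma flat_exp_bound: "\<bar>flat_exp m t\<bar> \<le> fact (m + 2) * t\<^sup>2"
proof (cases "t \<le> 0")
  case False
  then have t: "t > 0" by simp
  have "inverse t ^ (m + 2) / fact (m + 2) \<le> exp (inverse t)"
  proof -
    have "(\<Sum>n\<in>{m + 2}. inverse t ^ n /\<^sub>R fact n) \<le> suminf (\<lambda>n. inverse t ^ n /\<^sub>R fact n)"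
      using t by (intro sum_le_suminf summable_exp_generic) auto
    then show ?thesis by (simp add: exp_def divide_real_def mult.commute)
  qed
  then have "inverse t ^ (m + 2) \<le> fact (m + 2) * exp (inverse t)"
    by (simp add: pos_divide_le_eq mult.commute)
  then have "exp (- inverse t) * (inverse t ^ (m + 2)) \<le> exp (- inverse t) * (fact (m + 2) * exp (inverse t))"
    by (intro mult_left_mono) auto
  also have "\<dots> = fact (m + 2)" by (simp add: exp_minus)
  finally have "exp (- inverse t) * inverse t ^ m * (inverse t)\<^sup>2 \<le> fact (m + 2)"
    by (simp only: power_add mult.assoc)
  then have "exp (- inverse t) * inverse t ^ m * (inverse t)\<^sup>2 * t\<^sup>2 \<le> fact (m + 2) * t\<^sup>2"
    by (rule mult_right_mono) simp
  also have "exp (- inverse t) * inverse t ^ m * (inverse t)\<^sup>2 * t\<^sup>2 = exp (- inverse t) * inverse t ^ m"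
    using t by (simp add: power2_eq_square field_simps)
  finally have "exp (- inverse t) * inverse t ^ m \<le> fact (m + 2) * t\<^sup>2" .
  then show ?thesis using t by (simp add: flat_exp_def)
qed (simp add: flat_exp_def)

lemma DERIV_flat_exp: "DERIV (flat_exp m) t :> flat_exp (m + 2) t - m * flat_exp (m + 1) t"
proof -
  consider "t < 0" | "t = 0" | "t > 0" by linarith
  then show ?thesis
  proof cases
    case 1
    have "DERIV (\<lambda>_. 0) t :> (0 :: real)" by simp
    then have "DERIV (flat_exp m) t :> 0"
    proof (rule DERIV_cong_ev[THEN iffD1, rotated -1])
      show "\<forall>\<^sub>F x in nhds t. 0 = flat_exp m x"
        using eventually_nhds_in_open[of "{..<0}" t] 1 by (auto elim!: eventually_mono simp: flat_exp_def)
    qed auto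
    then show ?thesis using 1 by (simp add: flat_exp_def)
  next
    case 2
    have "(\<lambda>h. flat_exp m h / h) \<midarrow>0\<rightarrow> 0"
    proof (rule Lim_null_comparison)
      show "\<forall>\<^sub>F h in at 0. norm (flat_exp m h / h) \<le> fact (m + 2) * \<bar>h\<bar>"
      proof (intro always_eventually allI)
        fix h :: real
        show "norm (flat_exp m h / h) \<le> fact (m + 2) * \<bar>h\<bar>"
        proof (cases "h = 0")
          case False
          have "norm (flat_exp m h / h) \<le> fact (m + 2) * h\<^sup>2 / \<bar>h\<bar>"
            unfolding real_norm_def abs_divide by (intro divide_right_mono flat_exp_bound) simp
          also have "h\<^sup>2 = \<bar>h\<bar> * \<bar>h\<bar>" by (simp add: power2_eq_square)
          finally show ?thesis using False by (simp only: mult.assoc[symmetric]) simp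
        qed simp
      qed
      show "((\<lambda>h. fact (m + 2) * \<bar>h\<bar>) \<longlongrightarrow> (0::real)) (at 0)"
        by (auto intro!: tendsto_eq_intros)
    qed
    then show ?thesis using 2 by (simp add: DERIV_def flat_exp_def)
  next
    case 3
    let ?D = "exp (- inverse t) * inverse t ^ (m + 2) - m * (exp (- inverse t) * inverse t ^ (m + 1))"
    have inv: "DERIV inverse t :> - (inverse t ^ 2)"
      using DERIV_inverse[of t] 3 by (simp add: numeral_2_eq_2)
    have "DERIV (\<lambda>t. exp (- inverse t)) t :> exp (- inverse t) * - (- (inverse t ^ 2))"
      by (intro DERIV_chain2[OF DERIV_exp] DERIV_minus inv)
    from DERIV_mult[OF this DERIV_power[OF inv, of m]]
    have "DERIV (\<lambda>t. exp (- inverse t) * inverse t ^ m) t :> ?D"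
      by (cases m) (auto elim!: DERIV_cong simp: power2_eq_square mult.assoc mult.left_commute)
    then have "DERIV (flat_exp m) t :> ?D"
    proof (rule DERIV_cong_ev[THEN iffD1, rotated -1])
      show "\<forall>\<^sub>F x in nhds t. exp (- inverse x) * inverse x ^ m = flat_exp m x"
        using eventually_nhds_in_open[of "{0<..}" t] 3 by (auto elim!: eventually_mono simp: flat_exp_def)
    qed auto
    then show ?thesis using 3 by (simp add: flat_exp_def)
  qed
qed

lemma smooth_flat_exp: 
  assumes q: "smooth q"
  shows "smooth (\<lambda>x. flat_exp m (q x))"
proof -
  have "k_times_differentiable k (\<lambda>x. flat_exp m (q x))" for k
  proof (induction k arbitrary: m)
    case (Suc k)
    have G: "GDERIV (\<lambda>x. flat_exp m (q x)) x :>
        (flat_exp (m + 2) (q x) - m * flat_exp (m + 1) (q x)) *\<^sub>R gradient q x" for x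
      by (intro GDERIV_DERIV_compose[OF _ DERIV_flat_exp] GDERIV_smooth q)
    have "k_times_differentiable k (\<lambda>x. (flat_exp (m + 2) (q x) + (- real m) * flat_exp (m + 1) (q x)) * gradient q x $ i)" for i
      using smooth_gradient[OF q, of i] unfolding smooth_def
      by (intro k_times_differentiable_mult k_times_differentiable_add k_times_differentiable_const Suc) auto
    then show ?case
      using GDERIV_differentiable[OF G] by (simp add: gradient_eqI[OF G])
  qed simp
  then show ?thesis by (simp add: smooth_def)
qed

text \<open>The scaling by \<open>Suc n\<close> lets the bumps converge to the indicator of the open
  box while staying below 1, so integrals over boxes are limits of integrals against test
  functions.\<close>

definition box_bump :: "real^'n \<Rightarrow> real^'n \<Rightarrow> nat \<Rightarrow> real^'n \<Rightarrow> real" where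
  "box_bump a b n x = (\<Prod>i\<in>UNIV. flat_exp 0 (Suc n * (x $ i - a $ i)) * flat_exp 0 (Suc n * (b $ i - x $ i)))"

lemma flat_exp_0_range: "0 \<le> flat_exp 0 t" "flat_exp 0 t \<le> 1"
  by (auto simp: flat_exp_def)

lemma smooth_box_bump: "smooth (box_bump a b n)"
proof -
  have "smooth (\<lambda>x. \<Prod>i\<in>UNIV. flat_exp 0 (Suc n * (x $ i - a $ i)) * flat_exp 0 (Suc n * (b $ i - x $ i)))"
    by (intro smooth_prod smooth_mult smooth_flat_exp smooth_diff smooth_const smooth_component)
  then show ?thesis by (simp add: box_bump_def[abs_def])
qed

lemma box_bump_range: "0 \<le> box_bump a b n x" "box_bump a b n x \<le> 1"
  unfolding box_bump_def
  by (auto intro!: prod_nonneg prod_le_1 mult_le_one mult_nonneg_nonneg simp: flat_exp_0_range)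

lemma box_bump_pos_iff: "box_bump a b n x > 0 \<longleftrightarrow> x \<in> box a b"
proof -
  have "flat_exp 0 t > 0 \<longleftrightarrow> t > 0" for t by (simp add: flat_exp_def)
  then have *: "flat_exp 0 s * flat_exp 0 t > 0 \<longleftrightarrow> s > 0 \<and> t > 0" for s t
    using flat_exp_0_range(1)[of s] flat_exp_0_range(1)[of t] by (auto simp: zero_less_mult_iff)
  let ?F = "\<lambda>i. flat_exp 0 (Suc n * (x $ i - a $ i)) * flat_exp 0 (Suc n * (b $ i - x $ i))"
  have "box_bump a b n x > 0 \<longleftrightarrow> (\<forall>i. ?F i > 0)"
  proof
    assume pos: "box_bump a b n x > 0"
    show "\<forall>i. ?F i > 0"
    proof
      fix i
      have "?F i \<noteq> 0"
      proof
        assume "?F i = 0"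
        then have "box_bump a b n x = 0"
          unfolding box_bump_def by (intro prod_zero bexI[of _ i]) simp_all
        then show False using pos by simp
      qed
      moreover have "?F i \<ge> 0" by (intro mult_nonneg_nonneg flat_exp_0_range)
      ultimately show "?F i > 0" by linarith
    qed
  qed (auto simp: box_bump_def intro!: prod_pos)
  also have "\<dots> \<longleftrightarrow> (\<forall>i. x $ i - a $ i > 0 \<and> b $ i - x $ i > 0)"
    unfolding * by (simp add: zero_less_mult_iff)
  finally show ?thesis by (auto simp: mem_box_cart)
qed

lemma box_bump_eq_0: "x \<notin> box a b \<Longrightarrow> box_bump a b n x = 0"
  using box_bump_pos_iff[of a b n x] box_bump_range(1)[of a b n x] by linarith

lemma box_bump_tendsto:
  assumes "x \<in> box a b"
  shows "(\<lambda>n. box_bump a b n x) \<longlonglongrightarrow> 1"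
proof -
  have *: "(\<lambda>n. flat_exp 0 (Suc n * t)) \<longlonglongrightarrow> 1" if t: "t > 0" for t :: real
  proof -
    have "filterlim (\<lambda>n. real (Suc n) * t) at_top sequentially"
      unfolding mult.commute[of _ t]
      by (rule filterlim_tendsto_pos_mult_at_top[of "\<lambda>_. t" t])
         (use t filterlim_compose[OF filterlim_real_sequentially filterlim_Suc] in auto)
    then have "(\<lambda>n. inverse (real (Suc n) * t)) \<longlonglongrightarrow> 0"
      by (intro tendsto_inverse_0_at_top)
    then have "(\<lambda>n. exp (- inverse (real (Suc n) * t))) \<longlonglongrightarrow> exp (- 0)"
      by (intro tendsto_exp tendsto_minus)
    moreover have "flat_exp 0 (Suc n * t) = exp (- inverse (real (Suc n) * t))" for n
    proof -
      have "real (Suc n) * t > 0" by (rule mult_pos_pos) (use t in auto)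
      then show ?thesis unfolding flat_exp_def by (auto simp del: of_nat_Suc)
    qed
    ultimately show ?thesis by simp
  qed
  have "(\<lambda>n. \<Prod>i\<in>UNIV. flat_exp 0 (Suc n * (x $ i - a $ i)) * flat_exp 0 (Suc n * (b $ i - x $ i)))
     \<longlonglongrightarrow> (\<Prod>i\<in>(UNIV :: 'a set). 1 * 1)"
    using assms by (intro tendsto_prod tendsto_mult *) (auto simp: mem_box_cart)
  then show ?thesis by (simp add: box_bump_def)
qed

lemma box_bump_test_function: "cbox a b \<subseteq> U \<Longrightarrow> box_bump a b n \<in> test_functions U"
  unfolding test_functions_def using smooth_box_bump[of a b n] box_subset_cbox[of a b]
  by (auto intro!: exI[of _ "cbox a b"] box_bump_eq_0)

section \<open>Lebesgue spaces\<close>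

text \<open>Convexity of the p-th power at (1-t)(a/(1-t)) + t(b/t). The weight \<open>t\<close>
  stays free; \<open>Minkowski\<close> chooses it from the two norms after integrating.\<close>

lemma powr_add_le_convex:
  fixes a b p t :: real
  assumes "p \<ge> 1" "0 < t" "t < 1" "a \<ge> 0" "b \<ge> 0"
  shows "(a + b) powr p \<le> (1 - t) powr (1 - p) * a powr p + t powr (1 - p) * b powr p"
proof -
  have ge1: "s powr (1 - p) \<ge> 1" if "0 < s" "s < 1" for s
    using that assms(1) ge_one_powr_ge_zero[of "1 / s" "p - 1"]
    by (simp add: powr_divide powr_diff powr_minus field_simps)
  consider "a = 0" | "b = 0" | "a > 0" "b > 0" using assms by linarith
  then show ?thesis
  proof cases
    case 1
    then show ?thesis using ge1[of t] assms mult_right_mono[of 1 "t powr (1 - p)" "b powr p"] by simp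
  next
    case 2
    then show ?thesis using ge1[of "1 - t"] assms mult_right_mono[of 1 "(1 - t) powr (1 - p)" "a powr p"] by simp
  next
    case 3
    have "((1 - t) *\<^sub>R (a / (1 - t)) + t *\<^sub>R (b / t)) powr p
        \<le> (1 - t) * (a / (1 - t)) powr p + t * (b / t) powr p"
      by (rule convex_onD[OF powr_convex[OF assms(1)]]) (use 3 assms in auto)
    moreover have "s * (c / s) powr p = s powr (1 - p) * c powr p" if "0 < s" "c > 0" for s c
      using that by (simp add: powr_divide powr_diff)
    ultimately show ?thesis using 3 assms by simp
  qed
qed

lemma Lp_norm_nonneg: "Lp_norm p U f \<ge> 0"
  by (simp add: Lp_norm_def)

lemma Lp_norm_powr:
  assumes "p > 0"
  shows "Lp_norm p U f powr p = (LINT x|lebesgue_on U. norm (f x) powr p)"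
proof -
  have "(LINT x|lebesgue_on U. norm (f x) powr p) \<ge> 0" by simp
  then show ?thesis using assms by (simp add: Lp_norm_def powr_powr)
qed

lemma Lp_norm_le_iff:
  assumes "p > 0" "c \<ge> 0"
  shows "Lp_norm p U f \<le> c \<longleftrightarrow> (LINT x|lebesgue_on U. norm (f x) powr p) \<le> c powr p"
  using assms Lp_norm_powr[of p U f] Lp_norm_nonneg[of p U f] 
  by (metis powr_mono2 powr_less_mono2 not_le order_less_imp_le)

lemma Lp_norm_cong: "(\<And>x. x \<in> U \<Longrightarrow> norm (f x) = norm (g x)) \<Longrightarrow> Lp_norm p U f = Lp_norm p U g"
  unfolding Lp_norm_def by (intro arg_cong[of _ _ "\<lambda>t. t powr (1 / p)"] Bochner_Integration.integral_cong) auto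

lemma Lp_norm_commute: "Lp_norm p U (\<lambda>x. f x - g x) = Lp_norm p U (\<lambda>x. g x - f x)"
  by (rule Lp_norm_cong) (simp add: norm_minus_commute)

lemma Lp_cmult:
  assumes "f \<in> Lp p U" "p > 0"
  shows "(\<lambda>x. c *\<^sub>R f x) \<in> Lp p U" "Lp_norm p U (\<lambda>x. c *\<^sub>R f x) = \<bar>c\<bar> * Lp_norm p U f"
proof -
  have eq: "norm (c *\<^sub>R f x) powr p = \<bar>c\<bar> powr p * norm (f x) powr p" for x
    by (simp add: powr_mult)
  show "(\<lambda>x. c *\<^sub>R f x) \<in> Lp p U" using assms unfolding Lp_def mem_Collect_eq eq by (auto intro: integrable_mult_right)
  show "Lp_norm p U (\<lambda>x. c *\<^sub>R f x) = \<bar>c\<bar> * Lp_norm p U f"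
    unfolding Lp_norm_def eq using assms by (simp add: powr_mult powr_powr)
qed

lemma Lp_minus: "f \<in> Lp p U \<Longrightarrow> (\<lambda>x. - f x) \<in> Lp p U"
  unfolding Lp_def by auto

lemma Lp_mono:
  fixes f :: "real^'n \<Rightarrow> 'b::euclidean_space" and g :: "real^'n \<Rightarrow> 'c::euclidean_space"
  assumes "g \<in> Lp p U" "f \<in> borel_measurable (lebesgue_on U)" "\<And>x. x \<in> U \<Longrightarrow> norm (f x) \<le> norm (g x)" "p > 0"
  shows "f \<in> Lp p U" "Lp_norm p U f \<le> Lp_norm p U g"
proof -
  have le: "norm (f x) powr p \<le> norm (g x) powr p" if "x \<in> U" for x
    using assms(3)[OF that] assms(4) by (intro powr_mono2) auto
  have g: "integrable (lebesgue_on U) (\<lambda>x. norm (g x) powr p)" using assms by (simp add: Lp_def)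
  have f: "integrable (lebesgue_on U) (\<lambda>x. norm (f x) powr p)"
    by (rule Bochner_Integration.integrable_bound[OF g]) (use assms(2) le in auto)
  then show "f \<in> Lp p U" using assms(2) by (simp add: Lp_def)
  have "(LINT x|lebesgue_on U. norm (f x) powr p) \<le> (LINT x|lebesgue_on U. norm (g x) powr p)"
    by (rule integral_mono[OF f g]) (use le in auto)
  then show "Lp_norm p U f \<le> Lp_norm p U g"
    using assms(4) Lp_norm_powr[of p U g] by (simp add: Lp_norm_le_iff Lp_norm_nonneg)
qed

lemma Minkowski:
  fixes f g :: "real^'n \<Rightarrow> 'b::euclidean_space"
  assumes p: "p \<ge> 1" and f: "f \<in> Lp p U" and g: "g \<in> Lp p U"
  shows "(\<lambda>x. f x + g x) \<in> Lp p U" "Lp_norm p U (\<lambda>x. f x + g x) \<le> Lp_norm p U f + Lp_norm p U g"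
proof -
  let ?M = "lebesgue_on U"
  have meas: "f \<in> borel_measurable ?M" "g \<in> borel_measurable ?M"
    and int: "integrable ?M (\<lambda>x. norm (f x) powr p)" "integrable ?M (\<lambda>x. norm (g x) powr p)"
    using f g by (auto simp: Lp_def)
  have le: "norm (f x + g x) powr p \<le> (1 - t) powr (1 - p) * norm (f x) powr p + t powr (1 - p) * norm (g x) powr p"
    if t: "0 < t" "t < 1" for t x
  proof -
    have "norm (f x + g x) powr p \<le> (norm (f x) + norm (g x)) powr p"
      using p by (intro powr_mono2 norm_triangle_ineq) auto
    also have "\<dots> \<le> (1 - t) powr (1 - p) * norm (f x) powr p + t powr (1 - p) * norm (g x) powr p"
      using t p by (intro powr_add_le_convex) auto
    finally show ?thesis .
  qed
  have sum_int: "integrable ?M (\<lambda>x. norm (f x + g x) powr p)"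
  proof (rule Bochner_Integration.integrable_bound)
    show "integrable ?M (\<lambda>x. (1 - 1 / 2) powr (1 - p) * norm (f x) powr p + (1 / 2) powr (1 - p) * norm (g x) powr p)"
      using int by auto
    show "(\<lambda>x. norm (f x + g x) powr p) \<in> borel_measurable ?M" using meas by measurable
    show "AE x in ?M. norm (norm (f x + g x) powr p)
        \<le> norm ((1 - 1 / 2) powr (1 - p) * norm (f x) powr p + (1 / 2) powr (1 - p) * norm (g x) powr p)"
      using le[of "1/2"] by (intro AE_I2) (auto intro: order_trans[OF _ abs_ge_self])
  qed
  then show "(\<lambda>x. f x + g x) \<in> Lp p U" using meas by (auto simp: Lp_def)
  show "Lp_norm p U (\<lambda>x. f x + g x) \<le> Lp_norm p U f + Lp_norm p U g"
  proof (rule field_le_epsilon)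
    fix e :: real assume e: "e > 0"
    \<comment> \<open>The summand e / 2 makes \<open>A\<close> and \<open>B\<close> positive. With t
      = B/(A+B) the two terms of the bound become A/(A+B) and B/(A+B) times (A+B)^p and add up to
      (A+B)^p.\<close>
    define A where "A = Lp_norm p U f + e / 2"
    define B where "B = Lp_norm p U g + e / 2"
    define t where "t = B / (A + B)"
    have AB: "A > 0" "B > 0" using e Lp_norm_nonneg[of p U f] Lp_norm_nonneg[of p U g] by (auto simp: A_def B_def)
    then have t: "0 < t" "t < 1" "1 - t = A / (A + B)" by (auto simp: t_def field_simps)
    have fA: "(LINT x|?M. norm (f x) powr p) \<le> A powr p" and gB: "(LINT x|?M. norm (g x) powr p) \<le> B powr p"
      using p e AB Lp_norm_le_iff[of p A U f] Lp_norm_le_iff[of p B U g] by (auto simp: A_def B_def)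
    have "(LINT x|?M. norm (f x + g x) powr p) \<le>
      (LINT x|?M. (1 - t) powr (1 - p) * norm (f x) powr p + t powr (1 - p) * norm (g x) powr p)"
      using int le[OF t(1,2)] by (intro integral_mono sum_int) auto
    also have "\<dots> = (1 - t) powr (1 - p) * (LINT x|?M. norm (f x) powr p) + t powr (1 - p) * (LINT x|?M. norm (g x) powr p)"
      using int by simp
    also have "\<dots> \<le> (1 - t) powr (1 - p) * A powr p + t powr (1 - p) * B powr p"
      by (intro add_mono mult_left_mono fA gB) auto
    also have "\<dots> = (A + B) powr p"
    proof -
      have *: "(C / (A + B)) powr (1 - p) * C powr p = (A + B) powr p / (A + B) * C" if "C > 0" for C
      proof -
        define S where "S = A + B"
        have S: "S > 0" using AB by (simp add: S_def)
        have 1: "C powr (1 - p) * C powr p = C" using that by (simp add: powr_add[symmetric])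
        have 2: "S powr (1 - p) * S powr p = S" using S by (simp add: powr_add[symmetric])
        have "(C / S) powr (1 - p) * C powr p = (C powr (1 - p) * C powr p) / S powr (1 - p)"
          using that S by (simp add: powr_divide)
        also have "\<dots> = C / S powr (1 - p)" by (simp only: 1)
        also have "\<dots> = S powr p / (S powr (1 - p) * S powr p) * C" using S by simp
        finally show ?thesis unfolding 2 unfolding S_def .
      qed
      show ?thesis
        unfolding t(3) unfolding t_def *[OF AB(1)] *[OF AB(2)] using AB
        by (simp flip: distrib_left add_divide_distrib)
    qed
    finally have "Lp_norm p U (\<lambda>x. f x + g x) \<le> A + B"
      using p AB by (simp add: Lp_norm_le_iff)
    then show "Lp_norm p U (\<lambda>x. f x + g x) \<le> Lp_norm p U f + Lp_norm p U g + e"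
      by (simp add: A_def B_def)
  qed
qed

lemma Lp_diff: "p \<ge> 1 \<Longrightarrow> f \<in> Lp p U \<Longrightarrow> g \<in> Lp p U \<Longrightarrow> (\<lambda>x. f x - g x) \<in> Lp p U"
  using Minkowski(1)[OF _ _ Lp_minus, of p f U g] by simp

lemma Lp_norm_triangle:
  assumes "p \<ge> 1" "f \<in> Lp p U" "g \<in> Lp p U"
  shows "Lp_norm p U f \<le> Lp_norm p U (\<lambda>x. f x - g x) + Lp_norm p U g"
  using Minkowski(2)[OF assms(1) Lp_diff[OF assms] assms(3)] by simp

lemma Lp_sum:
  assumes "p \<ge> 1" "finite I" "\<And>i. i \<in> I \<Longrightarrow> f i \<in> Lp p U"
  shows "(\<lambda>x. \<Sum>i\<in>I. f i x) \<in> Lp p U" "Lp_norm p U (\<lambda>x. \<Sum>i\<in>I. f i x) \<le> (\<Sum>i\<in>I. Lp_norm p U (f i))"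
proof -
  have "(\<lambda>x. \<Sum>i\<in>I. f i x) \<in> Lp p U \<and> Lp_norm p U (\<lambda>x. \<Sum>i\<in>I. f i x) \<le> (\<Sum>i\<in>I. Lp_norm p U (f i))"
    using assms(2,3)
  proof (induction I)
    case empty
    show ?case using assms by (simp add: Lp_def Lp_norm_def)
  next
    case (insert i I)
    then show ?case
      using Minkowski[OF assms(1), of "f i" U "\<lambda>x. \<Sum>i\<in>I. f i x"] by fastforce
  qed
  then show "(\<lambda>x. \<Sum>i\<in>I. f i x) \<in> Lp p U" "Lp_norm p U (\<lambda>x. \<Sum>i\<in>I. f i x) \<le> (\<Sum>i\<in>I. Lp_norm p U (f i))"
    by auto
qed

lemma finite_measure_lebesgue_on_bounded:
  assumes "bounded U" "U \<in> sets lebesgue"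
  shows "finite_measure (lebesgue_on U)"
proof (rule finite_measureI)
  have "U \<in> lmeasurable" using assms by (simp add: bounded_set_imp_lmeasurable)
  then show "emeasure (lebesgue_on U) (space (lebesgue_on U)) \<noteq> \<infinity>"
    using assms by (auto simp: emeasure_restrict_space fmeasurable_def)
qed

lemma Lp_bounded:
  fixes f :: "real^'n \<Rightarrow> 'b::euclidean_space"
  assumes U: "bounded U" "U \<in> sets lebesgue" and f: "f \<in> borel_measurable (lebesgue_on U)"
    and c: "\<And>x. x \<in> U \<Longrightarrow> norm (f x) \<le> c" "c \<ge> 0" and p: "p > 0"
  shows "f \<in> Lp p U" "Lp_norm p U f \<le> c * measure lebesgue U powr (1 / p)"
proof -
  interpret finite_measure "lebesgue_on U" by (rule finite_measure_lebesgue_on_bounded[OF U])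
  have one: "(\<lambda>x. c) \<in> Lp p U" by (simp add: Lp_def)
  have fc: "norm (f x) \<le> norm c" if "x \<in> U" for x using c that by auto
  show "f \<in> Lp p U" by (rule Lp_mono(1)[OF one f fc p])
  have "Lp_norm p U f \<le> Lp_norm p U (\<lambda>x. c)" by (rule Lp_mono(2)[OF one f fc p])
  also have "\<dots> = c * measure lebesgue U powr (1 / p)"
    using c p U by (simp add: Lp_norm_def measure_restrict_space powr_mult powr_powr mult.commute)
  finally show "Lp_norm p U f \<le> c * measure lebesgue U powr (1 / p)" .
qed

text \<open>Pointwise y <= eta + eta^(1-p) y^p, because either y <= eta or (y/eta)^(p-1) >= 1.
  Choosing eta small first and then the p-norm small makes the 1-norm small.\<close>

lemma Lp_integrable:
  fixes f :: "real^'n \<Rightarrow> 'b::euclidean_space"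
  assumes U: "bounded U" "U \<in> sets lebesgue" and f: "f \<in> Lp p U" and p: "p > 1"
  shows "integrable (lebesgue_on U) f"
    and "\<eta> > 0 \<Longrightarrow> (LINT x|lebesgue_on U. norm (f x)) \<le> \<eta> * measure lebesgue U + \<eta> powr (1 - p) * Lp_norm p U f powr p"
proof -
  interpret finite_measure "lebesgue_on U" by (rule finite_measure_lebesgue_on_bounded[OF U])
  have int: "integrable (lebesgue_on U) (\<lambda>x. norm (f x) powr p)" and m: "f \<in> borel_measurable (lebesgue_on U)"
    using f by (auto simp: Lp_def)
  have le: "y \<le> \<eta> + \<eta> powr (1 - p) * y powr p" if "\<eta> > 0" "y \<ge> 0" for \<eta> y :: real
  proof (cases "y \<le> \<eta>")
    case False
    then have "1 \<le> (y / \<eta>) powr (p - 1)"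
      using that p by (intro ge_one_powr_ge_zero) auto
    also have "\<dots> = \<eta> powr (1 - p) * y powr (p - 1)"
      using that False by (simp add: powr_divide powr_diff)
    finally have "1 * y \<le> \<eta> powr (1 - p) * y powr (p - 1) * y"
      using that by (intro mult_right_mono) auto
    also have "\<dots> = \<eta> powr (1 - p) * y powr p"
      using False that by (simp add: powr_diff)
    finally show ?thesis using that by simp
  qed (use that in \<open>simp add: add_increasing2\<close>)
  have fin: "integrable (lebesgue_on U) (\<lambda>x. \<eta> + \<eta> powr (1 - p) * norm (f x) powr p)" for \<eta>
    using int by auto
  show i: "integrable (lebesgue_on U) f"
    by (rule Bochner_Integration.integrable_bound[OF fin[of 1] m]) (use le[of 1] in auto)
  show "(LINT x|lebesgue_on U. norm (f x)) \<le> \<eta> * measure lebesgue U + \<eta> powr (1 - p) * Lp_norm p U f powr p"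
    if "\<eta> > 0"
  proof -
    have "(LINT x|lebesgue_on U. norm (f x)) \<le> (LINT x|lebesgue_on U. \<eta> + \<eta> powr (1 - p) * norm (f x) powr p)"
      by (rule integral_mono) (use i fin le[OF that] in auto)
    also have "\<dots> = \<eta> * measure lebesgue U + \<eta> powr (1 - p) * Lp_norm p U f powr p"
      using int p U by (simp add: Lp_norm_powr measure_restrict_space mult.commute)
    finally show ?thesis .
  qed
qed

text \<open>On bounded sets, convergence in the \<open>p\<close>-norm implies convergence in the 1-norm; the modulus
  of continuity is left implicit.\<close>

lemma Lp_norm_small_L1_small:
  fixes U :: "(real^'n) set"
  assumes U: "bounded U" "U \<in> sets lebesgue" and p: "p > 1" and \<epsilon>: "\<epsilon> > 0"
  obtains \<delta> where "\<delta> > 0"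
    "\<And>f :: real^'n \<Rightarrow> 'b::euclidean_space. f \<in> Lp p U \<Longrightarrow> Lp_norm p U f < \<delta> \<Longrightarrow> (LINT x|lebesgue_on U. norm (f x)) < \<epsilon>"
proof -
  define V where "V = measure lebesgue U"
  have V: "V \<ge> 0" by (simp add: V_def)
  define \<eta> where "\<eta> = \<epsilon> / (2 * (V + 1))"
  have \<eta>: "\<eta> > 0" "\<eta> * V < \<epsilon> / 2 + 0"
    using V \<epsilon> by (auto simp: \<eta>_def field_simps add_pos_nonneg)
  define \<delta> where "\<delta> = (\<epsilon> / (2 * \<eta> powr (1 - p))) powr (1 / p)"
  have \<delta>: "\<delta> > 0" using \<epsilon> \<eta> by (simp add: \<delta>_def)
  show thesis
  proof (rule that[OF \<delta>])
    fix f :: "real^'n \<Rightarrow> 'b" assume f: "f \<in> Lp p U" "Lp_norm p U f < \<delta>"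
    have "Lp_norm p U f powr p \<le> \<delta> powr p"
      using f p by (intro powr_mono2) (auto simp: Lp_norm_nonneg)
    also have "\<delta> powr p = \<epsilon> / (2 * \<eta> powr (1 - p))"
      using \<epsilon> \<eta> p by (simp add: \<delta>_def powr_powr)
    finally have "\<eta> powr (1 - p) * Lp_norm p U f powr p \<le> \<eta> powr (1 - p) * (\<epsilon> / (2 * \<eta> powr (1 - p)))"
      by (rule mult_left_mono) simp
    also have "\<dots> = \<epsilon> / 2" using \<eta> by simp
    finally show "(LINT x|lebesgue_on U. norm (f x)) < \<epsilon>"
      using Lp_integrable(2)[OF U f(1) p \<eta>(1)] \<eta>(2) by (simp add: V_def)
  qed
qed

section \<open>Integrals of compactly supported functions\<close>

lemma integrable_compact_support:
  fixes f :: "'a::euclidean_space \<Rightarrow> 'b::{banach, second_countable_topology}"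
  assumes "continuous_on UNIV f" "compact K" "\<And>x. x \<notin> K \<Longrightarrow> f x = 0"
  shows "integrable lborel f"
proof -
  have "integrable lborel (\<lambda>x. indicator K x *\<^sub>R f x)"
    using assms by (intro borel_integrable_compact) (auto intro: continuous_on_subset)
  moreover have "(\<lambda>x. indicator K x *\<^sub>R f x) = f"
    using assms by (auto simp: indicator_def)
  ultimately show ?thesis by simp
qed

lemma integrable_lebesgue_on_support:
  fixes f :: "real^'n \<Rightarrow> 'b::{banach, second_countable_topology}"
  assumes "U \<in> sets lebesgue" "\<And>x. x \<notin> U \<Longrightarrow> f x = 0"
  shows "integrable (lebesgue_on U) f \<longleftrightarrow> integrable lebesgue f"
    "(LINT x|lebesgue_on U. f x) = (LINT x|lebesgue. f x)"
proof -
  have *: "(\<lambda>x. indicator U x *\<^sub>R f x) = f"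
    using assms by (auto simp: indicator_def)
  show "integrable (lebesgue_on U) f \<longleftrightarrow> integrable lebesgue f"
    "(LINT x|lebesgue_on U. f x) = (LINT x|lebesgue. f x)"
    using assms(1) by (simp_all add: integrable_restrict_space integral_restrict_space *)
qed

lemma integral_translation:
  fixes f :: "'a::euclidean_space \<Rightarrow> 'b::{banach, second_countable_topology}"
  assumes [measurable]: "f \<in> borel_measurable borel"
  shows "integrable lborel (\<lambda>x. f (x + c)) \<longleftrightarrow> integrable lborel f"
    "(LINT x|lborel. f (x + c)) = (LINT x|lborel. f x)"
proof -
  have eq: "lborel = distr lborel borel ((+) c)" by (simp add: lborel_distr_plus)
  have "integrable (distr lborel borel ((+) c)) f \<longleftrightarrow> integrable lborel (\<lambda>x. f (c + x))"
    by (subst integrable_distr_eq) auto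
  then show "integrable lborel (\<lambda>x. f (x + c)) \<longleftrightarrow> integrable lborel f"
    by (simp add: lborel_distr_plus add.commute)
  have "integral\<^sup>L (distr lborel borel ((+) c)) f = (LINT x|lborel. f (c + x))"
    by (subst integral_distr) auto
  then show "(LINT x|lborel. f (x + c)) = (LINT x|lborel. f x)"
    by (simp add: lborel_distr_plus add.commute)
qed

section \<open>Difference quotients of test functions\<close>

lemma test_functionsE:
  assumes "\<phi> \<in> test_functions U"
  obtains K B where "compact K" "K \<subseteq> U" "\<And>x. x \<notin> K \<Longrightarrow> \<phi> x = 0" "\<And>x. x \<notin> K \<Longrightarrow> gradient \<phi> x = 0"
    "B \<ge> 0" "\<And>x. \<bar>\<phi> x\<bar> \<le> B" "\<And>x. norm (gradient \<phi> x) \<le> B"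
proof -
  obtain K where K: "compact K" "K \<subseteq> U" "\<And>x. x \<notin> K \<Longrightarrow> \<phi> x = 0" and sm: "smooth \<phi>"
    using assms unfolding test_functions_def by blast
  have grad0: "gradient \<phi> x = 0" if "x \<notin> K" for x
  proof -
    have "(\<phi> has_derivative (\<lambda>h. 0)) (at x)"
      by (rule has_derivative_transform_within_open[OF has_derivative_const, of "- K" x 0 \<phi>])
         (use K(1,3) that in \<open>auto simp: open_Compl compact_imp_closed\<close>)
    then show ?thesis by (intro gradient_eqI) (simp add: gderiv_def)
  qed
  have "bounded (\<phi> ` K)" "bounded (gradient \<phi> ` K)"
    using sm K(1) by (auto intro!: compact_imp_bounded compact_continuous_image smooth_continuous_on smooth_gradient_continuous_on)
  then obtain B1 B2 where B: "\<forall>x\<in>K. \<bar>\<phi> x\<bar> \<le> B1" "\<forall>x\<in>K. norm (gradient \<phi> x) \<le> B2"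
    unfolding bounded_iff by auto
  define B where "B = max 0 (max B1 B2)"
  show thesis
  proof (rule that[OF K grad0, of B])
    show "\<bar>\<phi> x\<bar> \<le> B" "norm (gradient \<phi> x) \<le> B" for x
      using B K(3) grad0 by (cases "x \<in> K"; force simp: B_def)+
  qed (auto simp: B_def)
qed

lemma test_functions_smooth: "\<phi> \<in> test_functions U \<Longrightarrow> smooth \<phi>"
  by (simp add: test_functions_def)

lemma test_functions_mono: "U \<subseteq> V \<Longrightarrow> \<phi> \<in> test_functions U \<Longrightarrow> \<phi> \<in> test_functions V"
  by (auto simp: test_functions_def)

lemma test_functions_mult: "\<phi> \<in> test_functions U \<Longrightarrow> smooth \<psi> \<Longrightarrow> (\<lambda>x. \<phi> x * \<psi> x) \<in> test_functions U"
  unfolding test_functions_def using smooth_mult by auto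

lemma test_functions_add:
  assumes "\<phi> \<in> test_functions U" "\<psi> \<in> test_functions U"
  shows "(\<lambda>x. \<phi> x + \<psi> x) \<in> test_functions U"
proof -
  obtain K L where "compact K" "K \<subseteq> U" "\<forall>x. x \<notin> K \<longrightarrow> \<phi> x = 0" "compact L" "L \<subseteq> U" "\<forall>x. x \<notin> L \<longrightarrow> \<psi> x = 0"
    using assms unfolding test_functions_def by auto
  then show ?thesis
    using assms unfolding test_functions_def
    by (auto intro!: smooth_add exI[of _ "K \<union> L"] compact_Un)
qed

lemma test_functions_cmult: "\<phi> \<in> test_functions U \<Longrightarrow> (\<lambda>x. c * \<phi> x) \<in> test_functions U"
  using test_functions_mult[OF _ smooth_const, of \<phi> U c] by (simp add: mult.commute)

lemma test_functions_diff:
  "\<phi> \<in> test_functions U \<Longrightarrow> \<psi> \<in> test_functions U \<Longrightarrow> (\<lambda>x. \<phi> x - \<psi> x) \<in> test_functions U"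
  using test_functions_add[of \<phi> U "\<lambda>x. -1 * \<psi> x"] test_functions_cmult[of \<psi> U "-1"] by simp

lemma test_functions_sum:
  "(\<And>i. i \<in> I \<Longrightarrow> \<phi> i \<in> test_functions U) \<Longrightarrow> (\<lambda>x. \<Sum>i\<in>I. \<phi> i x) \<in> test_functions U"
proof (induction I rule: infinite_finite_induct)
  case empty
  have "smooth (\<lambda>x. 0)" by (rule smooth_const)
  then show ?case by (auto simp: test_functions_def intro!: exI[of _ "{}"])
next
  case (infinite I)
  have "smooth (\<lambda>x. 0)" by (rule smooth_const)
  then show ?case using infinite by (auto simp: test_functions_def intro!: exI[of _ "{}"])
qed (simp add: test_functions_add)

text \<open>The second claim is the majorant for dominated convergence: the gradient bound is a
  Lipschitz constant, and since no shift is longer than \<open>z\<close>, all quotients live in one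
  ball.\<close>

lemma difference_quotient:
  fixes \<phi> :: "real^'n \<Rightarrow> real" and z :: "real^'n"
  assumes \<phi>: "\<phi> \<in> test_functions UNIV"
  defines "D \<equiv> \<lambda>n x. real (Suc n) * (\<phi> (x + (1 / real (Suc n)) *\<^sub>R z) - \<phi> x)"
  shows "(\<lambda>n. D n x) \<longlonglongrightarrow> z \<bullet> gradient \<phi> x"
    and "\<exists>R B. B \<ge> 0 \<and> (\<forall>n x. \<bar>D n x\<bar> \<le> B * indicator (cball 0 R) x)"
proof -
  have sm: "smooth \<phi>" using \<phi> by (rule test_functions_smooth)
  show "(\<lambda>n. D n x) \<longlonglongrightarrow> z \<bullet> gradient \<phi> x"
  proof -
    have "((\<lambda>t. \<phi> (x + t *\<^sub>R z)) has_derivative (\<lambda>t. (t *\<^sub>R z) \<bullet> gradient \<phi> x)) (at 0)"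
      using GDERIV_smooth[OF sm, of "x + 0 *\<^sub>R z"] unfolding gderiv_def
      by (intro has_derivative_compose[of "\<lambda>t. x + t *\<^sub>R z" "\<lambda>t. t *\<^sub>R z" _ _ \<phi>])
         (auto intro!: derivative_eq_intros)
    then have "DERIV (\<lambda>t. \<phi> (x + t *\<^sub>R z)) 0 :> z \<bullet> gradient \<phi> x"
      by (simp add: has_field_derivative_def mult_commute_abs)
    then have "(\<lambda>h. (\<phi> (x + h *\<^sub>R z) - \<phi> x) / h) \<midarrow>0\<rightarrow> z \<bullet> gradient \<phi> x"
      by (simp add: DERIV_def)
    moreover have "filterlim (\<lambda>n. 1 / real (Suc n)) (at 0) sequentially"
      using LIMSEQ_inverse_real_of_nat by (auto simp: filterlim_at inverse_eq_divide)
    ultimately have "(\<lambda>n. (\<phi> (x + (1 / real (Suc n)) *\<^sub>R z) - \<phi> x) / (1 / real (Suc n))) \<longlonglongrightarrow> z \<bullet> gradient \<phi> x"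
      by (rule filterlim_compose)
    then show ?thesis by (simp add: D_def mult.commute)
  qed
  obtain K B where K: "compact K" "\<And>x. x \<notin> K \<Longrightarrow> \<phi> x = 0" and B: "B \<ge> 0" "\<And>x. norm (gradient \<phi> x) \<le> B"
    using test_functionsE[OF \<phi>] by metis
  obtain R where R: "K \<subseteq> cball 0 R"
    using compact_imp_bounded[OF K(1)] unfolding bounded_iff by (auto simp: subset_iff)
  have lip: "\<bar>\<phi> y - \<phi> x\<bar> \<le> B * norm (y - x)" for x y
  proof -
    have "norm (\<phi> y - \<phi> x) \<le> B * norm (y - x)"
    proof (rule differentiable_bound[of UNIV \<phi> "\<lambda>x h. h \<bullet> gradient \<phi> x"])
      show "(\<phi> has_derivative (\<lambda>h. h \<bullet> gradient \<phi> x)) (at x within UNIV)" for x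
        using GDERIV_smooth[OF sm, of x] by (simp add: gderiv_def)
      show "onorm (\<lambda>h. h \<bullet> gradient \<phi> x) \<le> B" for x
      proof (rule onorm_bound)
        fix h
        have "norm (h \<bullet> gradient \<phi> x) \<le> norm h * norm (gradient \<phi> x)"
          using Cauchy_Schwarz_ineq2 by simp
        also have "\<dots> \<le> norm h * B" by (intro mult_left_mono B) simp
        finally show "norm (h \<bullet> gradient \<phi> x) \<le> B * norm h" by (simp only: mult.commute)
      qed (rule B)
    qed auto
    then show ?thesis by simp
  qed
  have "\<bar>D n x\<bar> \<le> B * norm z * indicator (cball 0 (R + norm z)) x" for n x
  proof (cases "x \<in> cball 0 (R + norm z)")
    case True
    have "\<bar>D n x\<bar> = real (Suc n) * \<bar>\<phi> (x + (1 / real (Suc n)) *\<^sub>R z) - \<phi> x\<bar>"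
      by (simp add: D_def abs_mult)
    also have "\<dots> \<le> real (Suc n) * (B * norm ((x + (1 / real (Suc n)) *\<^sub>R z) - x))"
      by (intro mult_left_mono lip) auto
    also have "\<dots> = B * norm z" by simp
    finally show ?thesis using True by simp
  next
    case False
    define y where "y = (1 / real (Suc n)) *\<^sub>R z"
    have "1 / real (Suc n) * norm z \<le> 1 * norm z"
      by (intro mult_right_mono) auto
    then have "norm y \<le> norm z" by (simp add: y_def)
    then have "norm (x + y) > R" "norm x > R"
      using False norm_diff_ineq[of x y] norm_ge_zero[of z] unfolding mem_cball dist_0_norm by linarith+
    then have "norm (x + (1 / real (Suc n)) *\<^sub>R z) > R" "norm x > R" by (auto simp only: y_def)
    then have "x \<notin> K" "x + (1 / real (Suc n)) *\<^sub>R z \<notin> K" using R by auto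
    then show ?thesis using K False by (simp add: D_def)
  qed
  then show "\<exists>R B. B \<ge> 0 \<and> (\<forall>n x. \<bar>D n x\<bar> \<le> B * indicator (cball 0 R) x)"
    using B(1) by (intro exI[of _ "R + norm z"] exI[of _ "B * norm z"]) auto
qed

lemma integrable_indicator_cball: "integrable lborel (\<lambda>x. B * indicator (cball 0 R) x :: real)"
  using emeasure_lborel_cball_finite[of 0 R] by (intro integrable_mult_right integrable_real_indicator) auto

text \<open>By translation invariance every difference quotient has integral 0; the directional
  derivative is their dominated limit.\<close>

lemma integral_gradient_eq_0:
  assumes \<phi>: "\<phi> \<in> test_functions UNIV"
  shows "(LINT x|lborel. z \<bullet> gradient \<phi> x) = 0"
proof -
  define D where "D = (\<lambda>n x. real (Suc n) * (\<phi> (x + (1 / real (Suc n)) *\<^sub>R z) - \<phi> x))"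
  have cont: "continuous_on UNIV \<phi>" using \<phi> by (intro smooth_continuous_on test_functions_smooth)
  then have meas: "\<phi> \<in> borel_measurable borel" by (rule borel_measurable_continuous_onI)
  obtain K where K: "compact K" "\<And>x. x \<notin> K \<Longrightarrow> \<phi> x = 0" using test_functionsE[OF \<phi>] by metis
  have int: "integrable lborel \<phi>" by (rule integrable_compact_support[OF cont K])
  obtain R B where B: "B \<ge> 0" "\<And>n x. \<bar>D n x\<bar> \<le> B * indicator (cball 0 R) x"
    using difference_quotient(2)[OF \<phi>, of z] unfolding D_def by blast
  have D0: "(LINT x|lborel. D n x) = 0" for n
  proof -
    have "(LINT x|lborel. \<phi> (x + (1 / real (Suc n)) *\<^sub>R z) - \<phi> x) = 0"
      using integral_translation[OF meas, of "(1 / real (Suc n)) *\<^sub>R z"] int by simp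
    then show ?thesis unfolding D_def by simp
  qed
  have "(\<lambda>n. LINT x|lborel. D n x) \<longlonglongrightarrow> (LINT x|lborel. z \<bullet> gradient \<phi> x)"
  proof (rule integral_dominated_convergence)
    show "integrable lborel (\<lambda>x. B * indicator (cball 0 R) x :: real)" by (rule integrable_indicator_cball)
    show "(\<lambda>x. z \<bullet> gradient \<phi> x) \<in> borel_measurable lborel"
      using borel_measurable_continuous_onI[OF continuous_on_inner[OF continuous_on_const
        smooth_gradient_continuous_on[OF test_functions_smooth[OF \<phi>]]], of z] by simp
    show "D n \<in> borel_measurable lborel" for n
      unfolding D_def using meas by measurable
    show "AE x in lborel. (\<lambda>n. D n x) \<longlonglongrightarrow> z \<bullet> gradient \<phi> x"
      unfolding D_def by (intro AE_I2 difference_quotient(1)[OF \<phi>])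
    show "AE x in lborel. norm (D n x) \<le> B * indicator (cball 0 R) x" for n
      using B by (intro AE_I2) auto
  qed
  then have "(\<lambda>n. 0 :: real) \<longlonglongrightarrow> (LINT x|lborel. z \<bullet> gradient \<phi> x)" by (simp add: D0)
  then show ?thesis by (simp add: LIMSEQ_const_iff)
qed

lemma Lp_UNIV_compact_support:
  fixes f :: "real^'n \<Rightarrow> 'b::euclidean_space"
  assumes "continuous_on UNIV f" "compact K" "\<And>x. x \<notin> K \<Longrightarrow> f x = 0" "p > 0"
  shows "f \<in> Lp p UNIV"
proof -
  have "continuous_on UNIV (\<lambda>x. norm (f x) powr p)"
    using assms by (intro continuous_on_powr' continuous_intros) auto
  then have i: "integrable lborel (\<lambda>x. norm (f x) powr p)"
    using assms by (intro integrable_compact_support[of _ K]) auto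
  then have "integrable lebesgue (\<lambda>x. norm (f x) powr p)"
    by (subst integrable_completion) auto
  moreover have "f \<in> borel_measurable lebesgue"
    using measurable_completion[of f lborel borel] borel_measurable_continuous_onI[OF assms(1)] by simp
  ultimately show ?thesis by (simp add: Lp_def lebesgue_on_UNIV_eq)
qed

lemma Lp_norm_UNIV_lborel:
  fixes f :: "real^'n \<Rightarrow> 'b::euclidean_space"
  assumes "f \<in> borel_measurable borel"
  shows "Lp_norm p UNIV f = (LINT x|lborel. norm (f x) powr p) powr (1 / p)"
  unfolding Lp_norm_def lebesgue_on_UNIV_eq using assms by (subst integral_completion) auto

lemma Lp_norm_translation:
  fixes f :: "real^'n \<Rightarrow> 'b::euclidean_space"
  assumes f: "f \<in> borel_measurable borel"
  shows "Lp_norm p UNIV (\<lambda>x. f (x + c)) = Lp_norm p UNIV f"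
proof -
  have "(\<lambda>x. norm (f x) powr p) \<in> borel_measurable borel" using f by measurable
  from integral_translation(2)[OF this, of c] show ?thesis
    using f by (simp add: Lp_norm_UNIV_lborel)
qed

text \<open>The shift by \<open>z\<close> telescopes into n + 1 equal small shifts whose differences
  all have the same norm. By the triangle inequality the total is at most the norm of the difference
  quotient \<open>D n\<close>, which tends to the norm of the derivative in direction
  \<open>z\<close>.\<close>

lemma Lp_norm_shift_difference:
  assumes \<phi>: "\<phi> \<in> test_functions UNIV" and p: "p \<ge> 1"
  shows "Lp_norm p UNIV (\<lambda>x. \<phi> (x + z) - \<phi> x) \<le> norm z * Lp_norm p UNIV (gradient \<phi>)"
proof -
  define T where "T n x = \<phi> (x + (1 / real (Suc n)) *\<^sub>R z) - \<phi> x" for n x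
  define D where "D = (\<lambda>n x. real (Suc n) * (\<phi> (x + (1 / real (Suc n)) *\<^sub>R z) - \<phi> x))"
  have sm: "smooth \<phi>" using \<phi> by (rule test_functions_smooth)
  have cont: "continuous_on UNIV \<phi>" by (rule smooth_continuous_on[OF sm])
  then have meas [measurable]: "\<phi> \<in> borel_measurable borel" by (rule borel_measurable_continuous_onI)
  obtain K where K: "compact K" "\<And>x. x \<notin> K \<Longrightarrow> \<phi> x = 0" "\<And>x. x \<notin> K \<Longrightarrow> gradient \<phi> x = 0"
    using test_functionsE[OF \<phi>] by metis
  have \<phi>p: "\<phi> \<in> Lp p UNIV" by (rule Lp_UNIV_compact_support[OF cont K(1,2)]) (use p in auto)
  have gp: "gradient \<phi> \<in> Lp p UNIV"
    by (rule Lp_UNIV_compact_support[OF smooth_gradient_continuous_on[OF sm] K(1,3)]) (use p in auto)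
  have shift: "(\<lambda>x. \<phi> (x + c)) \<in> Lp p UNIV" for c
  proof (rule Lp_UNIV_compact_support[where K = "(\<lambda>x. x - c) ` K"])
    show "continuous_on UNIV (\<lambda>x. \<phi> (x + c))" by (rule continuous_on_compose2[OF cont]) (auto intro!: continuous_intros)
    show "compact ((\<lambda>x. x - c) ` K)" using K(1) by (intro compact_continuous_image continuous_intros)
    show "\<phi> (x + c) = 0" if "x \<notin> (\<lambda>x. x - c) ` K" for x
      using that by (intro K(2)) (auto simp: image_iff)
  qed (use p in auto)
  have Tp: "(\<lambda>x. T n (x + c)) \<in> Lp p UNIV" for n c
    unfolding T_def using Lp_diff[OF p shift[of "c + (1 / real (Suc n)) *\<^sub>R z"] shift[of c]] by (simp add: add.assoc)
  have step: "Lp_norm p UNIV (\<lambda>x. \<phi> (x + z) - \<phi> x) \<le> Lp_norm p UNIV (D n)" for n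
  proof -
    let ?m = "Suc n"
    have "\<phi> (x + z) - \<phi> x = (\<Sum>j<?m. T n (x + (real j / real ?m) *\<^sub>R z))" for x
    proof -
      have "(\<Sum>j<?m. T n (x + (real j / real ?m) *\<^sub>R z))
        = (\<Sum>j<?m. \<phi> (x + (real (Suc j) / real ?m) *\<^sub>R z) - \<phi> (x + (real j / real ?m) *\<^sub>R z))"
        unfolding T_def
        by (intro sum.cong refl arg_cong2[of _ _ _ _ "(-)"] arg_cong[of _ _ \<phi>])
           (simp add: add.assoc add.commute flip: scaleR_left_distrib add_divide_distrib)
      also have "\<dots> = \<phi> (x + (real ?m / real ?m) *\<^sub>R z) - \<phi> (x + (real 0 / real ?m) *\<^sub>R z)"
        by (rule sum_lessThan_telescope)
      finally show ?thesis by simp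
    qed
    then have "Lp_norm p UNIV (\<lambda>x. \<phi> (x + z) - \<phi> x) = Lp_norm p UNIV (\<lambda>x. \<Sum>j<?m. T n (x + (real j / real ?m) *\<^sub>R z))"
      by simp
    also have "\<dots> \<le> (\<Sum>j<?m. Lp_norm p UNIV (\<lambda>x. T n (x + (real j / real ?m) *\<^sub>R z)))"
      by (rule Lp_sum(2)[OF p _ Tp]) auto
    also have "\<dots> = (\<Sum>j<?m. Lp_norm p UNIV (T n))"
      by (intro sum.cong refl Lp_norm_translation) (simp add: T_def[abs_def])
    also have "\<dots> = Lp_norm p UNIV (\<lambda>x. real ?m *\<^sub>R T n x)"
      using Lp_cmult(2)[OF Tp[of n 0, simplified]] p by simp
    finally show ?thesis by (simp add: D_def T_def)
  qed
  obtain R B where B: "B \<ge> 0" "\<And>n x. \<bar>D n x\<bar> \<le> B * indicator (cball 0 R) x"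
    using difference_quotient(2)[OF \<phi>, of z] unfolding D_def by blast
  have Dmeas [measurable]: "D n \<in> borel_measurable borel" for n
    unfolding D_def by measurable
  have gmeas [measurable]: "(\<lambda>x. z \<bullet> gradient \<phi> x) \<in> borel_measurable borel"
    by (rule borel_measurable_continuous_onI[OF continuous_on_inner[OF continuous_on_const
        smooth_gradient_continuous_on[OF sm]]])
  have "(\<lambda>n. LINT x|lborel. norm (D n x) powr p) \<longlonglongrightarrow> (LINT x|lborel. norm (z \<bullet> gradient \<phi> x) powr p)"
  proof (rule integral_dominated_convergence)
    show "integrable lborel (\<lambda>x. B powr p * indicator (cball 0 R) x :: real)" by (rule integrable_indicator_cball)
    show "AE x in lborel. (\<lambda>n. norm (D n x) powr p) \<longlonglongrightarrow> norm (z \<bullet> gradient \<phi> x) powr p"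
    proof (intro AE_I2)
      fix x
      have "(\<lambda>n. D n x) \<longlonglongrightarrow> z \<bullet> gradient \<phi> x"
        unfolding D_def by (rule difference_quotient(1)[OF \<phi>])
      then show "(\<lambda>n. norm (D n x) powr p) \<longlonglongrightarrow> norm (z \<bullet> gradient \<phi> x) powr p"
        using p by (intro tendsto_powr' tendsto_norm tendsto_const) auto
    qed
    show "AE x in lborel. norm (norm (D n x) powr p) \<le> B powr p * indicator (cball 0 R) x" for n
    proof (intro AE_I2)
      fix x
      have "\<bar>D n x\<bar> powr p \<le> (B * indicator (cball 0 R) x) powr p"
        using B p by (intro powr_mono2) auto
      then show "norm (norm (D n x) powr p) \<le> B powr p * indicator (cball 0 R) x"
        by (auto simp: indicator_def split: if_splits)
    qed
  qed auto
  then have "(\<lambda>n. Lp_norm p UNIV (D n)) \<longlonglongrightarrow> Lp_norm p UNIV (\<lambda>x. z \<bullet> gradient \<phi> x)"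
    unfolding Lp_norm_UNIV_lborel[OF Dmeas] Lp_norm_UNIV_lborel[OF gmeas]
    using p by (intro tendsto_powr' tendsto_const) auto
  then have "Lp_norm p UNIV (\<lambda>x. \<phi> (x + z) - \<phi> x) \<le> Lp_norm p UNIV (\<lambda>x. z \<bullet> gradient \<phi> x)"
    by (rule LIMSEQ_le_const) (use step in auto)
  also have "\<dots> \<le> Lp_norm p UNIV (\<lambda>x. norm z *\<^sub>R gradient \<phi> x)"
  proof (rule Lp_mono(2))
    show "(\<lambda>x. norm z *\<^sub>R gradient \<phi> x) \<in> Lp p UNIV" using Lp_cmult(1)[OF gp] p by simp
    show "(\<lambda>x. z \<bullet> gradient \<phi> x) \<in> borel_measurable (lebesgue_on UNIV)"
      using measurable_completion[of "\<lambda>x. z \<bullet> gradient \<phi> x" lborel borel] gmeas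
      by (simp add: lebesgue_on_UNIV_eq)
    show "norm (z \<bullet> gradient \<phi> x) \<le> norm (norm z *\<^sub>R gradient \<phi> x)" for x
      using Cauchy_Schwarz_ineq2[of z "gradient \<phi> x"] by simp
  qed (use p in auto)
  also have "\<dots> = norm z * Lp_norm p UNIV (gradient \<phi>)"
    using Lp_cmult(2)[OF gp, of "norm z"] p by simp
  finally show ?thesis .
qed

section \<open>Weak gradients\<close>

lemma absolutely_integrable_continuous_compact:
  fixes f :: "real^'n \<Rightarrow> 'b::euclidean_space"
  assumes "continuous_on UNIV f" "compact K"
  shows "f absolutely_integrable_on K"
proof -
  have "integrable lborel (\<lambda>x. indicator K x *\<^sub>R f x)"
    using assms by (intro borel_integrable_compact) (auto intro: continuous_on_subset)
  then have "integrable lebesgue (\<lambda>x. indicator K x *\<^sub>R f x)"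
    by (subst integrable_completion) auto
  then show ?thesis by (simp add: set_integrable_def)
qed

lemma integrable_bounded_mult:
  fixes f :: "real^'n \<Rightarrow> 'b::euclidean_space" and h :: "real^'n \<Rightarrow> 'c::euclidean_space"
  assumes "f absolutely_integrable_on K" "h \<in> borel_measurable lebesgue"
    "\<And>x. norm (h x) \<le> B * norm (indicator K x *\<^sub>R f x)" "B \<ge> 0"
  shows "integrable lebesgue h"
proof (rule Bochner_Integration.integrable_bound[of lebesgue "\<lambda>x. B * norm (indicator K x *\<^sub>R f x)"])
  show "integrable lebesgue (\<lambda>x. B * norm (indicator K x *\<^sub>R f x))"
    using assms(1) unfolding set_integrable_def by (intro integrable_mult_right integrable_norm)
  show "AE x in lebesgue. norm (h x) \<le> norm (B * norm (indicator K x *\<^sub>R f x))"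
    using assms(3,4) by (intro AE_I2) auto
qed (use assms in auto)

lemma borel_measurable_lebesgue_continuous:
  fixes f :: "real^'n \<Rightarrow> 'b::euclidean_space"
  assumes "continuous_on UNIV f"
  shows "f \<in> borel_measurable lebesgue"
  using measurable_completion[of f lborel borel] borel_measurable_continuous_onI[OF assms] by simp

lemma integrable_test_mult:
  fixes f :: "real^'n \<Rightarrow> real^'n" and u :: "real^'n \<Rightarrow> real"
  assumes U: "open U" and \<phi>: "\<phi> \<in> test_functions U"
  shows "(\<And>K. compact K \<Longrightarrow> K \<subseteq> U \<Longrightarrow> f absolutely_integrable_on K) \<Longrightarrow> integrable (lebesgue_on U) (\<lambda>x. \<phi> x *\<^sub>R f x)"
    and "(\<And>K. compact K \<Longrightarrow> K \<subseteq> U \<Longrightarrow> u absolutely_integrable_on K) \<Longrightarrow> integrable (lebesgue_on U) (\<lambda>x. u x *\<^sub>R gradient \<phi> x)"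
proof -
  obtain K B where K: "compact K" "K \<subseteq> U" "\<And>x. x \<notin> K \<Longrightarrow> \<phi> x = 0" "\<And>x. x \<notin> K \<Longrightarrow> gradient \<phi> x = 0"
    "B \<ge> 0" "\<And>x. \<bar>\<phi> x\<bar> \<le> B" "\<And>x. norm (gradient \<phi> x) \<le> B"
    using test_functionsE[OF \<phi>] by blast
  have UL: "U \<in> sets lebesgue" using U by auto
  have sm: "smooth \<phi>" by (rule test_functions_smooth[OF \<phi>])
  have m1: "\<phi> \<in> borel_measurable lebesgue" "gradient \<phi> \<in> borel_measurable lebesgue"
    by (intro borel_measurable_lebesgue_continuous smooth_continuous_on smooth_gradient_continuous_on sm)+
  show "integrable (lebesgue_on U) (\<lambda>x. \<phi> x *\<^sub>R f x)"
    if f: "\<And>K. compact K \<Longrightarrow> K \<subseteq> U \<Longrightarrow> f absolutely_integrable_on K"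
  proof -
    have fK: "f absolutely_integrable_on K" using f K by blast
    then have m: "(\<lambda>x. indicator K x *\<^sub>R f x) \<in> borel_measurable lebesgue"
      unfolding set_integrable_def by (rule borel_measurable_integrable)
    have eq: "\<phi> x *\<^sub>R f x = \<phi> x *\<^sub>R (indicator K x *\<^sub>R f x)" for x
      using K(3)[of x] by (auto simp: indicator_def)
    have "integrable lebesgue (\<lambda>x. \<phi> x *\<^sub>R (indicator K x *\<^sub>R f x))"
    proof (rule integrable_bounded_mult[OF fK _ _ K(5)])
      show "norm (\<phi> x *\<^sub>R (indicator K x *\<^sub>R f x)) \<le> B * norm (indicator K x *\<^sub>R f x)" for x
        unfolding norm_scaleR[of "\<phi> x"] by (intro mult_right_mono K(6)) simp
    qed (intro borel_measurable_scaleR m1 m)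
    then have "integrable lebesgue (\<lambda>x. \<phi> x *\<^sub>R f x)" by (simp only: eq[symmetric])
    then show ?thesis
      using K(2,3) by (subst integrable_lebesgue_on_support(1)[OF UL]) auto
  qed
  show "integrable (lebesgue_on U) (\<lambda>x. u x *\<^sub>R gradient \<phi> x)"
    if u: "\<And>K. compact K \<Longrightarrow> K \<subseteq> U \<Longrightarrow> u absolutely_integrable_on K"
  proof -
    have uK: "u absolutely_integrable_on K" using u K by blast
    then have m: "(\<lambda>x. indicator K x *\<^sub>R u x) \<in> borel_measurable lebesgue"
      unfolding set_integrable_def by (rule borel_measurable_integrable)
    have eq: "u x *\<^sub>R gradient \<phi> x = (indicator K x *\<^sub>R u x) *\<^sub>R gradient \<phi> x" for x
      using K(4)[of x] by (auto simp: indicator_def)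
    have "integrable lebesgue (\<lambda>x. (indicator K x *\<^sub>R u x) *\<^sub>R gradient \<phi> x)"
    proof (rule integrable_bounded_mult[OF uK _ _ K(5)])
      show "norm ((indicator K x *\<^sub>R u x) *\<^sub>R gradient \<phi> x) \<le> B * norm (indicator K x *\<^sub>R u x)" for x
        unfolding norm_scaleR[of "indicator K x *\<^sub>R u x"] real_norm_def mult.commute[of B]
        by (intro mult_left_mono K(7)) simp
    qed (intro borel_measurable_scaleR m1 m)
    then have "integrable lebesgue (\<lambda>x. u x *\<^sub>R gradient \<phi> x)" by (simp only: eq[symmetric])
    then show ?thesis
      using K(2,4) by (subst integrable_lebesgue_on_support(1)[OF UL]) auto
  qed
qed

lemma integration_by_parts:
  assumes \<phi>: "\<phi> \<in> test_functions UNIV" and \<psi>: "smooth \<psi>"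
  shows "(LINT x|lborel. \<phi> x *\<^sub>R gradient \<psi> x) = - (LINT x|lborel. \<psi> x *\<^sub>R gradient \<phi> x)"
proof -
  have sm: "smooth \<phi>" by (rule test_functions_smooth[OF \<phi>])
  obtain K where K: "compact K" "\<And>x. x \<notin> K \<Longrightarrow> \<phi> x = 0" "\<And>x. x \<notin> K \<Longrightarrow> gradient \<phi> x = 0"
    using test_functionsE[OF \<phi>] by metis
  have grad: "gradient (\<lambda>x. \<phi> x * \<psi> x) x = \<phi> x *\<^sub>R gradient \<psi> x + \<psi> x *\<^sub>R gradient \<phi> x" for x
    by (intro gradient_eqI GDERIV_mult GDERIV_smooth sm \<psi>)
  have i1: "integrable lborel (\<lambda>x. \<phi> x *\<^sub>R gradient \<psi> x)"
    by (rule integrable_compact_support[OF _ K(1)])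
       (use K(2) in \<open>auto intro!: continuous_on_scaleR smooth_continuous_on smooth_gradient_continuous_on sm \<psi>\<close>)
  have i2: "integrable lborel (\<lambda>x. \<psi> x *\<^sub>R gradient \<phi> x)"
    by (rule integrable_compact_support[OF _ K(1)])
       (use K(3) in \<open>auto intro!: continuous_on_scaleR smooth_continuous_on smooth_gradient_continuous_on sm \<psi>\<close>)
  let ?I = "LINT x|lborel. \<phi> x *\<^sub>R gradient \<psi> x + \<psi> x *\<^sub>R gradient \<phi> x"
  have "z \<bullet> ?I = 0" for z
  proof -
    have "z \<bullet> ?I = (LINT x|lborel. z \<bullet> (\<phi> x *\<^sub>R gradient \<psi> x + \<psi> x *\<^sub>R gradient \<phi> x))"
      using i1 i2 by (intro integral_inner_right[symmetric]) auto
    also have "\<dots> = (LINT x|lborel. z \<bullet> gradient (\<lambda>x. \<phi> x * \<psi> x) x)"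
      by (simp only: grad)
    also have "\<dots> = 0"
      by (rule integral_gradient_eq_0[OF test_functions_mult[OF \<phi> \<psi>]])
    finally show ?thesis .
  qed
  from this[of ?I] have "?I = 0" by simp
  then show ?thesis using i1 i2 by (simp add: eq_neg_iff_add_eq_0)
qed

lemma is_weak_gradient_test_function:
  assumes U: "open U" and \<psi>: "\<psi> \<in> test_functions U"
  shows "is_weak_gradient U \<psi> (gradient \<psi>)"
  unfolding is_weak_gradient_def
proof (intro conjI allI impI ballI)
  have sm: "smooth \<psi>" by (rule test_functions_smooth[OF \<psi>])
  fix K assume "compact K \<and> K \<subseteq> U"
  then show "\<psi> absolutely_integrable_on K" "gradient \<psi> absolutely_integrable_on K"
    by (auto intro!: absolutely_integrable_continuous_compact smooth_continuous_on smooth_gradient_continuous_on sm)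
next
  have sm: "smooth \<psi>" by (rule test_functions_smooth[OF \<psi>])
  have UL: "U \<in> sets lebesgue" using U by auto
  fix \<phi> assume \<phi>: "\<phi> \<in> test_functions U"
  then have \<phi>': "smooth \<phi>" "\<phi> \<in> test_functions UNIV"
    by (auto simp: test_functions_smooth intro: test_functions_mono)
  obtain K where K: "K \<subseteq> U" "\<And>x. x \<notin> K \<Longrightarrow> \<phi> x = 0" "\<And>x. x \<notin> K \<Longrightarrow> gradient \<phi> x = 0"
    using test_functionsE[OF \<phi>] by metis
  have borel: "(\<lambda>x. \<phi> x *\<^sub>R gradient \<psi> x) \<in> borel_measurable lborel" "(\<lambda>x. \<psi> x *\<^sub>R gradient \<phi> x) \<in> borel_measurable lborel"
    by (simp_all add: borel_measurable_continuous_onI[OF continuous_on_scaleR[OF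
        smooth_continuous_on[OF \<phi>'(1)] smooth_gradient_continuous_on[OF sm]]]
      borel_measurable_continuous_onI[OF continuous_on_scaleR[OF
        smooth_continuous_on[OF sm] smooth_gradient_continuous_on[OF \<phi>'(1)]]])
  have "(LINT x|lebesgue_on U. \<phi> x *\<^sub>R gradient \<psi> x) = (LINT x|lebesgue. \<phi> x *\<^sub>R gradient \<psi> x)"
    using K by (intro integrable_lebesgue_on_support(2)[OF UL]) auto
  also have "\<dots> = (LINT x|lborel. \<phi> x *\<^sub>R gradient \<psi> x)"
    by (rule integral_completion[OF borel(1)])
  also have "\<dots> = - (LINT x|lborel. \<psi> x *\<^sub>R gradient \<phi> x)"
    by (rule integration_by_parts[OF \<phi>'(2) sm])
  also have "(LINT x|lborel. \<psi> x *\<^sub>R gradient \<phi> x) = (LINT x|lebesgue. \<psi> x *\<^sub>R gradient \<phi> x)"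
    by (rule integral_completion[OF borel(2), symmetric])
  also have "\<dots> = (LINT x|lebesgue_on U. \<psi> x *\<^sub>R gradient \<phi> x)"
    using K by (intro integrable_lebesgue_on_support(2)[OF UL, symmetric]) auto
  finally show "(LINT x|lebesgue_on U. \<phi> x *\<^sub>R gradient \<psi> x) = - (LINT x|lebesgue_on U. \<psi> x *\<^sub>R gradient \<phi> x)" .
qed

lemma is_weak_gradient_diff:
  assumes U: "open U" and u: "is_weak_gradient U u g" and v: "is_weak_gradient U v h"
  shows "is_weak_gradient U (\<lambda>x. u x - v x) (\<lambda>x. g x - h x)"
  unfolding is_weak_gradient_def
proof (intro conjI allI impI ballI)
  fix K assume "compact K \<and> K \<subseteq> U"
  then show "(\<lambda>x. u x - v x) absolutely_integrable_on K" "(\<lambda>x. g x - h x) absolutely_integrable_on K"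
    using u v by (auto simp: is_weak_gradient_def)
next
  fix \<phi> assume \<phi>: "\<phi> \<in> test_functions U"
  have i: "integrable (lebesgue_on U) (\<lambda>x. \<phi> x *\<^sub>R g x)" "integrable (lebesgue_on U) (\<lambda>x. \<phi> x *\<^sub>R h x)"
    "integrable (lebesgue_on U) (\<lambda>x. u x *\<^sub>R gradient \<phi> x)" "integrable (lebesgue_on U) (\<lambda>x. v x *\<^sub>R gradient \<phi> x)"
    using u v by (auto intro!: integrable_test_mult[OF U \<phi>] simp: is_weak_gradient_def)
  have "(LINT x|lebesgue_on U. \<phi> x *\<^sub>R g x) = - (LINT x|lebesgue_on U. u x *\<^sub>R gradient \<phi> x)"
    "(LINT x|lebesgue_on U. \<phi> x *\<^sub>R h x) = - (LINT x|lebesgue_on U. v x *\<^sub>R gradient \<phi> x)"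
    using u v \<phi> by (auto simp: is_weak_gradient_def)
  then show "(LINT x|lebesgue_on U. \<phi> x *\<^sub>R (g x - h x)) = - (LINT x|lebesgue_on U. (u x - v x) *\<^sub>R gradient \<phi> x)"
    using i by (simp add: scaleR_diff_right scaleR_diff_left)
qed

text \<open>Testing with the box bumps and passing to the limit gives the integral over the open
  box; the boundary of a box is negligible.\<close>

lemma box_integral_eq_0:
  fixes f :: "real^'n \<Rightarrow> real^'n"
  assumes U: "open U" and f: "\<And>K. compact K \<Longrightarrow> K \<subseteq> U \<Longrightarrow> f absolutely_integrable_on K"
    and zero: "\<And>\<phi>. \<phi> \<in> test_functions U \<Longrightarrow> (LINT x|lebesgue_on U. \<phi> x *\<^sub>R f x) = 0"
    and ab: "cbox a b \<subseteq> U"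
  shows "integral (cbox a b) f = 0"
proof -
  have UL: "U \<in> sets lebesgue" using U by auto
  have fab: "f absolutely_integrable_on cbox a b" by (rule f[OF compact_cbox ab])
  then have m: "(\<lambda>x. indicator (cbox a b) x *\<^sub>R f x) \<in> borel_measurable lebesgue"
    unfolding set_integrable_def by (rule borel_measurable_integrable)
  have eq: "box_bump a b n x *\<^sub>R f x = box_bump a b n x *\<^sub>R (indicator (cbox a b) x *\<^sub>R f x)" for n x
    using box_bump_eq_0[of x a b n] box_subset_cbox[of a b] by (auto simp: indicator_def)
  have "(\<lambda>n. LINT x|lebesgue. box_bump a b n x *\<^sub>R f x) \<longlonglongrightarrow> (LINT x|lebesgue. indicator (box a b) x *\<^sub>R f x)"
  proof (rule integral_dominated_convergence)
    show "integrable lebesgue (\<lambda>x. norm (indicator (cbox a b) x *\<^sub>R f x))"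
      using fab unfolding set_integrable_def by (rule integrable_norm)
    show "(\<lambda>x. indicator (box a b) x *\<^sub>R f x) \<in> borel_measurable lebesgue"
    proof -
      have "(\<lambda>x. indicator (box a b) x *\<^sub>R (indicator (cbox a b) x *\<^sub>R f x)) \<in> borel_measurable lebesgue"
        by (rule borel_measurable_scaleR[OF borel_measurable_indicator m]) auto
      moreover have "indicator (box a b) x *\<^sub>R (indicator (cbox a b) x *\<^sub>R f x) = indicator (box a b) x *\<^sub>R f x" for x
        using box_subset_cbox[of a b] by (auto simp: indicator_def)
      ultimately show ?thesis by (simp only:)
    qed
    show "(\<lambda>x. box_bump a b n x *\<^sub>R f x) \<in> borel_measurable lebesgue" for n
    proof -
      have bm: "box_bump a b n \<in> borel_measurable lebesgue"
        by (rule borel_measurable_lebesgue_continuous[OF smooth_continuous_on[OF smooth_box_bump]])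
      have "(\<lambda>x. box_bump a b n x *\<^sub>R f x) = (\<lambda>x. box_bump a b n x *\<^sub>R (indicator (cbox a b) x *\<^sub>R f x))"
        by (rule ext, rule eq)
      then show ?thesis using borel_measurable_scaleR[OF bm m] by (simp only:)
    qed
    show "AE x in lebesgue. (\<lambda>n. box_bump a b n x *\<^sub>R f x) \<longlonglongrightarrow> indicator (box a b) x *\<^sub>R f x"
    proof (intro AE_I2)
      fix x
      show "(\<lambda>n. box_bump a b n x *\<^sub>R f x) \<longlonglongrightarrow> indicator (box a b) x *\<^sub>R f x"
      proof (cases "x \<in> box a b")
        case True
        then show ?thesis using tendsto_scaleR[OF box_bump_tendsto[OF True] tendsto_const[of "f x"]] by simp
      next
        case False
        then show ?thesis by (simp add: box_bump_eq_0)
      qed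
    qed
    show "AE x in lebesgue. norm (box_bump a b n x *\<^sub>R f x) \<le> norm (indicator (cbox a b) x *\<^sub>R f x)" for n
    proof (intro AE_I2)
      fix x
      have "norm (box_bump a b n x *\<^sub>R f x) = \<bar>box_bump a b n x\<bar> * norm (indicator (cbox a b) x *\<^sub>R f x)"
        unfolding eq[of n x] norm_scaleR[of "box_bump a b n x"] ..
      also have "\<dots> \<le> 1 * norm (indicator (cbox a b) x *\<^sub>R f x)"
        using box_bump_range[of a b n x] by (intro mult_right_mono) auto
      finally show "norm (box_bump a b n x *\<^sub>R f x) \<le> norm (indicator (cbox a b) x *\<^sub>R f x)" by simp
    qed
  qed
  moreover have "(LINT x|lebesgue. box_bump a b n x *\<^sub>R f x) = 0" for n
  proof -
    have "(LINT x|lebesgue_on U. box_bump a b n x *\<^sub>R f x) = (LINT x|lebesgue. box_bump a b n x *\<^sub>R f x)"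
    proof (rule integrable_lebesgue_on_support(2)[OF UL])
      fix x assume "x \<notin> U"
      then have "x \<notin> box a b" using ab box_subset_cbox[of a b] by blast
      then show "box_bump a b n x *\<^sub>R f x = 0" by (simp add: box_bump_eq_0)
    qed
    then show ?thesis using zero[OF box_bump_test_function[OF ab]] by simp
  qed
  ultimately have 0: "(LINT x|lebesgue. indicator (box a b) x *\<^sub>R f x) = 0"
    by (simp add: LIMSEQ_const_iff)
  have fbox: "f absolutely_integrable_on box a b"
    by (rule set_integrable_subset[OF fab]) (auto simp: box_subset_cbox)
  have "integral (box a b) f = 0"
    using set_lebesgue_integral_eq_integral(2)[OF fbox] 0 by (simp add: set_lebesgue_integral_def)
  then have "(f has_integral 0) (box a b)"
    using integrable_integral[OF set_lebesgue_integral_eq_integral(1)[OF fbox]] by simp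
  then have "(f has_integral 0) (cbox a b)" by (simp only: has_integral_open_interval)
  then show ?thesis by (rule integral_unique)
qed

text \<open>By Lebesgue differentiation \<open>f\<close> is almost everywhere the limit of its
  averages over shrinking cubes, and these vanish by \<open>box_integral_eq_0\<close>. Countably
  many closed boxes cover \<open>U\<close>, so the exceptional sets stay null.\<close>

lemma fundamental_lemma_calculus_of_variations:
  fixes f :: "real^'n \<Rightarrow> real^'n"
  assumes U: "open U" and f: "\<And>K. compact K \<Longrightarrow> K \<subseteq> U \<Longrightarrow> f absolutely_integrable_on K"
    and zero: "\<And>\<phi>. \<phi> \<in> test_functions U \<Longrightarrow> (LINT x|lebesgue_on U. \<phi> x *\<^sub>R f x) = 0"
  shows "AE x in lebesgue_on U. f x = 0"
proof -
  have box: "AE x in lebesgue. x \<in> cbox a b \<longrightarrow> f x = 0" if ab: "cbox a b \<subseteq> U" for a b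
  proof -
    \<comment> \<open>\<open>f\<close> is only locally integrable in \<open>U\<close>; cutting it
      off outside one box gives the integrability on all cubes that the differentiation theorem asks
      for.\<close>
    define F where "F = (\<lambda>x. indicator (cbox a b) x *\<^sub>R f x)"
    have fab: "f absolutely_integrable_on cbox a b" by (rule f[OF compact_cbox ab])
    have "F absolutely_integrable_on UNIV"
      using fab unfolding F_def set_integrable_def by simp
    then have "F absolutely_integrable_on cbox c d" for c d
      by (rule set_integrable_subset) auto
    then have "F integrable_on cbox c d" for c d
      by (rule set_lebesgue_integral_eq_integral(1))
    then obtain N where N: "negligible N"
      "\<And>x e. \<lbrakk>x \<notin> N; 0 < e\<rbrakk> \<Longrightarrow> \<exists>d>0. \<forall>h. 0 < h \<and> h < d \<longrightarrow>
         norm (integral (cbox x (x + h *\<^sub>R One)) F /\<^sub>R h ^ DIM(real^'n) - F x) < e"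
      using integrable_ccontinuous_explicit[of F] by blast
    have "f x = 0" if x: "x \<in> box a b" "x \<notin> N" for x
    proof (rule ccontr)
      assume "f x \<noteq> 0"
      then have "F x \<noteq> 0" using x box_subset_cbox[of a b] by (auto simp: F_def)
      then obtain d where d: "d > 0" "\<And>h. 0 < h \<Longrightarrow> h < d \<Longrightarrow>
          norm (integral (cbox x (x + h *\<^sub>R One)) F /\<^sub>R h ^ DIM(real^'n) - F x) < norm (F x)"
        using N(2)[OF x(2), of "norm (F x)"] by auto
      obtain r where r: "r > 0" "ball x r \<subseteq> box a b"
        using x(1) open_box open_contains_ball by blast
      define C where "C = norm (One :: real^'n)"
      have C: "C \<ge> 0" by (simp add: C_def)
      \<comment> \<open>\<open>h\<close> is below \<open>d\<close>, and h C < r bounds the diagonal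
        of the cube with corner \<open>x\<close> and side \<open>h\<close>, so the cube stays inside
        the box.\<close>
      define h where "h = min (d / 2) (r / (2 * (C + 1)))"
      have h: "0 < h" "h < d" using d(1) r(1) C by (auto simp: h_def)
      have "h * C \<le> r / (2 * (C + 1)) * (C + 1)"
        using h C by (intro mult_mono) (auto simp: h_def)
      also have "\<dots> = r / 2"
      proof -
        have "C + 1 \<noteq> 0" using C by linarith
        then show ?thesis by (simp add: field_simps)
      qed
      also have "\<dots> < r" using r by simp
      finally have hr: "h * C < r" .
      have sub: "cbox x (x + h *\<^sub>R One) \<subseteq> box a b"
      proof
        fix y assume y: "y \<in> cbox x (x + h *\<^sub>R One)"
        have "norm (y - x) \<le> norm (h *\<^sub>R (One :: real^'n))"
        proof (rule norm_le_componentwise)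
          fix i :: "real^'n" assume "i \<in> Basis"
          then show "\<bar>(y - x) \<bullet> i\<bar> \<le> \<bar>(h *\<^sub>R One) \<bullet> i\<bar>"
            using y h(1) by (auto simp: mem_box inner_simps)
        qed
        then have "y \<in> ball x r" using hr h by (simp add: C_def dist_norm norm_minus_commute)
        then show "y \<in> box a b" using r by blast
      qed
      have "integral (cbox x (x + h *\<^sub>R One)) F = integral (cbox x (x + h *\<^sub>R One)) f"
        using sub box_subset_cbox[of a b] by (intro integral_cong) (auto simp: F_def subset_iff)
      also have "\<dots> = 0"
        using sub box_subset_cbox[of a b] ab by (intro box_integral_eq_0[OF U f zero]) auto
      finally show False using d(2)[OF h] by simp
    qed
    moreover have "negligible (N \<union> (cbox a b - box a b))"
      using N(1) negligible_frontier_interval by (intro negligible_Un)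
    ultimately have "{x. \<not> (x \<in> cbox a b \<longrightarrow> f x = 0)} \<subseteq> N \<union> (cbox a b - box a b)"
      "N \<union> (cbox a b - box a b) \<in> null_sets lebesgue"
      by (auto simp: negligible_iff_null_sets)
    then show ?thesis by (intro AE_I'[of "N \<union> (cbox a b - box a b)"]) auto
  qed
  obtain D where D: "countable D" "\<And>X. X \<in> D \<Longrightarrow> X \<subseteq> U" "\<And>X. X \<in> D \<Longrightarrow> \<exists>a b. X = cbox a b" "\<Union>D = U"
    using open_countable_Union_open_cbox[OF U] by (metis Pow_iff subsetD)
  have "AE x in lebesgue. \<forall>X\<in>D. x \<in> X \<longrightarrow> f x = 0"
    unfolding AE_ball_countable[OF D(1)]
  proof
    fix X assume "X \<in> D"
    then obtain a b where "X = cbox a b" "cbox a b \<subseteq> U" using D by metis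
    then show "AE x in lebesgue. x \<in> X \<longrightarrow> f x = 0" using box by simp
  qed
  then have "AE x in lebesgue. x \<in> U \<longrightarrow> f x = 0"
    using D(4) by (auto elim!: eventually_mono)
  then show ?thesis using U by (subst AE_restrict_space_iff) auto
qed

lemma weak_gradient_unique:
  assumes U: "open U" and g: "is_weak_gradient U u g" and h: "is_weak_gradient U u h"
  shows "AE x in lebesgue_on U. g x = h x"
proof -
  have d: "is_weak_gradient U (\<lambda>x. u x - u x) (\<lambda>x. g x - h x)"
    by (rule is_weak_gradient_diff[OF U g h])
  have "AE x in lebesgue_on U. g x - h x = 0"
  proof (rule fundamental_lemma_calculus_of_variations[OF U])
    show "(\<lambda>x. g x - h x) absolutely_integrable_on K" if "compact K" "K \<subseteq> U" for K
      using conjunct1[OF d[unfolded is_weak_gradient_def]] that by simp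
    show "(LINT x|lebesgue_on U. \<phi> x *\<^sub>R (g x - h x)) = 0" if "\<phi> \<in> test_functions U" for \<phi>
      using bspec[OF conjunct2[OF d[unfolded is_weak_gradient_def]] that] by simp
  qed
  then show ?thesis by simp
qed

text \<open>A weak gradient is integrable on each compact subset of \<open>U\<close>; measurability
  is glued from countably many closed boxes that fill \<open>U\<close>.\<close>

lemma weak_gradient_measurable:
  assumes U: "open U" and g: "is_weak_gradient U u g"
  shows "g \<in> borel_measurable (lebesgue_on U)"
proof -
  obtain D where D: "countable D" "\<And>X. X \<in> D \<Longrightarrow> X \<subseteq> U" "\<And>X. X \<in> D \<Longrightarrow> \<exists>a b. X = cbox a b" "\<Union>D = U"
    using open_countable_Union_open_cbox[OF U] by (metis Pow_iff subsetD)
  show ?thesis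
  proof (rule measurable_piecewise_restrict[OF D(1)])
    fix X assume X: "X \<in> D"
    then obtain a b where ab: "X = cbox a b" "X \<subseteq> U" using D by metis
    show "X \<inter> space (lebesgue_on U) \<in> sets (lebesgue_on U)"
      using ab by (auto simp: sets_restrict_space)
    have "g absolutely_integrable_on X"
      using g ab unfolding is_weak_gradient_def by auto
    then have "(\<lambda>x. indicator X x *\<^sub>R g x) \<in> borel_measurable lebesgue"
      unfolding set_integrable_def by (rule borel_measurable_integrable)
    then have "g \<in> borel_measurable (lebesgue_on X)"
      using ab by (subst borel_measurable_restrict_space_iff) auto
    moreover have "restrict_space (lebesgue_on U) X = lebesgue_on X"
      using ab U by (subst restrict_restrict_space) (auto simp: Int_absorb1)
    ultimately show "g \<in> borel_measurable (restrict_space (lebesgue_on U) X)" by simp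
  qed (use D in auto)
qed

lemma is_weak_gradient_weak_gradient: "is_weak_gradient U u g \<Longrightarrow> is_weak_gradient U u (weak_gradient U u)"
  unfolding weak_gradient_def by (rule someI[of "is_weak_gradient U u"])

lemma Lp_cong_AE:
  assumes "AE x in lebesgue_on U. f x = g x" "f \<in> borel_measurable (lebesgue_on U)" "g \<in> borel_measurable (lebesgue_on U)"
  shows "f \<in> Lp p U \<longleftrightarrow> g \<in> Lp p U" "Lp_norm p U f = Lp_norm p U g"
proof -
  have "AE x in lebesgue_on U. norm (f x) powr p = norm (g x) powr p"
    using assms(1) by (auto elim!: eventually_mono)
  then have "integrable (lebesgue_on U) (\<lambda>x. norm (f x) powr p) \<longleftrightarrow> integrable (lebesgue_on U) (\<lambda>x. norm (g x) powr p)"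
    "(LINT x|lebesgue_on U. norm (f x) powr p) = (LINT x|lebesgue_on U. norm (g x) powr p)"
    using assms(2,3) by (intro integrable_cong_AE integral_cong_AE; simp)+
  then show "f \<in> Lp p U \<longleftrightarrow> g \<in> Lp p U" "Lp_norm p U f = Lp_norm p U g"
    using assms(2,3) by (auto simp: Lp_def Lp_norm_def)
qed

text \<open>The arbitrary choice in \<open>weak_gradient\<close> is harmless: any weak gradient at
  hand may be used to compute norms, in particular the classical gradient of a test
  function.\<close>

lemma Lp_norm_weak_gradient:
  assumes U: "open U" and g: "is_weak_gradient U u g"
  shows "Lp_norm p U (weak_gradient U u) = Lp_norm p U g" "weak_gradient U u \<in> Lp p U \<longleftrightarrow> g \<in> Lp p U"
proof -
  have w: "is_weak_gradient U u (weak_gradient U u)" using g by (rule is_weak_gradient_weak_gradient)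
  show "Lp_norm p U (weak_gradient U u) = Lp_norm p U g" "weak_gradient U u \<in> Lp p U \<longleftrightarrow> g \<in> Lp p U"
    using Lp_cong_AE[OF weak_gradient_unique[OF U w g] weak_gradient_measurable[OF U w] weak_gradient_measurable[OF U g]]
    by blast+
qed

lemma p_energy_eq_Lp_norm: "p > 0 \<Longrightarrow> p_energy p U u = Lp_norm p U (weak_gradient U u) powr p"
  by (simp add: Lp_norm_powr p_energy_def)

lemma p_energy_nonneg: "p_energy p U u \<ge> 0"
  by (simp add: p_energy_def)

lemma Lp_norm_le_W1p_norm:
  assumes "p > 0"
  shows "Lp_norm p U u \<le> W1p_norm p U u" "Lp_norm p U (weak_gradient U u) \<le> W1p_norm p U u"
proof -
  have 1: "(Lp_norm p U u powr p) powr (1 / p) \<le> (Lp_norm p U u powr p + p_energy p U u) powr (1 / p)"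
    "p_energy p U u powr (1 / p) \<le> (Lp_norm p U u powr p + p_energy p U u) powr (1 / p)"
    using assms by (auto intro!: powr_mono2 simp: p_energy_nonneg)
  then show "Lp_norm p U u \<le> W1p_norm p U u" "Lp_norm p U (weak_gradient U u) \<le> W1p_norm p U u"
    using assms by (simp_all add: W1p_norm_def powr_powr Lp_norm_nonneg p_energy_eq_Lp_norm)
qed

lemma W1pD:
  assumes "open U" "u \<in> W1p p U"
  shows "u \<in> Lp p U" "is_weak_gradient U u (weak_gradient U u)" "weak_gradient U u \<in> Lp p U"
proof -
  obtain g where g: "g \<in> Lp p U" "is_weak_gradient U u g" and "u \<in> Lp p U" using assms(2) by (auto simp: W1p_def)
  then show "u \<in> Lp p U" by simp
  show "is_weak_gradient U u (weak_gradient U u)" using g by (blast intro: is_weak_gradient_weak_gradient)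
  show "weak_gradient U u \<in> Lp p U" using Lp_norm_weak_gradient(2)[OF assms(1) g(2)] g by simp
qed

lemma W1p_diff_bounds:
  assumes U: "open U" and p: "p \<ge> 1" and u: "u \<in> W1p p U" and v: "v \<in> W1p p U"
  shows "Lp_norm p U v \<le> Lp_norm p U u + W1p_norm p U (\<lambda>x. v x - u x)"
    "Lp_norm p U u \<le> Lp_norm p U v + W1p_norm p U (\<lambda>x. v x - u x)"
    "Lp_norm p U (weak_gradient U v) \<le> Lp_norm p U (weak_gradient U u) + W1p_norm p U (\<lambda>x. v x - u x)"
    "Lp_norm p U (weak_gradient U u) \<le> Lp_norm p U (weak_gradient U v) + W1p_norm p U (\<lambda>x. v x - u x)"
proof -
  let ?W = "W1p_norm p U (\<lambda>x. v x - u x)"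
  note u' = W1pD[OF U u] and v' = W1pD[OF U v]
  have "Lp_norm p U (weak_gradient U (\<lambda>x. v x - u x)) = Lp_norm p U (\<lambda>x. weak_gradient U v x - weak_gradient U u x)"
    by (rule Lp_norm_weak_gradient(1)[OF U is_weak_gradient_diff[OF U v'(2) u'(2)]])
  then have w: "Lp_norm p U (\<lambda>x. v x - u x) \<le> ?W" "Lp_norm p U (\<lambda>x. weak_gradient U v x - weak_gradient U u x) \<le> ?W"
    using Lp_norm_le_W1p_norm[of p U "\<lambda>x. v x - u x"] p by auto
  show "Lp_norm p U v \<le> Lp_norm p U u + ?W" "Lp_norm p U u \<le> Lp_norm p U v + ?W"
    using w(1) Lp_norm_triangle[OF p v'(1) u'(1)] Lp_norm_triangle[OF p u'(1) v'(1)] Lp_norm_commute[of p U v u] by auto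
  show "Lp_norm p U (weak_gradient U v) \<le> Lp_norm p U (weak_gradient U u) + ?W"
    "Lp_norm p U (weak_gradient U u) \<le> Lp_norm p U (weak_gradient U v) + ?W"
    using w(2) Lp_norm_triangle[OF p v'(3) u'(3)] Lp_norm_triangle[OF p u'(3) v'(3)]
      Lp_norm_commute[of p U "weak_gradient U v" "weak_gradient U u"] by auto
qed

lemma test_function_weak_gradient:
  assumes U: "open U" and \<phi>: "\<phi> \<in> test_functions U"
  shows "Lp_norm p U (weak_gradient U \<phi>) = Lp_norm p U (gradient \<phi>)"
  by (rule Lp_norm_weak_gradient(1)[OF U is_weak_gradient_test_function[OF U \<phi>]])

lemma Lp_UNIV_subset:
  fixes f :: "real^'n \<Rightarrow> 'b::euclidean_space"
  assumes U: "U \<in> sets lebesgue" and f: "f \<in> Lp p UNIV" and p: "p > 0"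
  shows "f \<in> Lp p U" "Lp_norm p U f \<le> Lp_norm p UNIV f"
    "(\<And>x. x \<notin> U \<Longrightarrow> f x = 0) \<Longrightarrow> Lp_norm p U f = Lp_norm p UNIV f"
proof -
  have f': "f \<in> borel_measurable lebesgue" "integrable lebesgue (\<lambda>x. norm (f x) powr p)"
    using f by (auto simp: Lp_def lebesgue_on_UNIV_eq)
  have i: "integrable lebesgue (\<lambda>x. indicator U x *\<^sub>R norm (f x) powr p)"
    using f'(2) U by (intro integrable_mult_indicator) auto
  have "integrable (lebesgue_on U) (\<lambda>x. norm (f x) powr p)"
    using i U by (simp add: integrable_restrict_space)
  moreover have "f \<in> borel_measurable (lebesgue_on U)" using f'(1) by (rule measurable_restrict_space1)
  ultimately show "f \<in> Lp p U" by (simp add: Lp_def)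
  have eq: "(LINT x|lebesgue_on U. norm (f x) powr p) = (LINT x|lebesgue. indicator U x *\<^sub>R norm (f x) powr p)"
    using U by (simp add: integral_restrict_space)
  have "(LINT x|lebesgue_on U. norm (f x) powr p) \<le> (LINT x|lebesgue. norm (f x) powr p)"
    unfolding eq by (rule integral_mono[OF i f'(2)]) (auto simp: indicator_def)
  then show "Lp_norm p U f \<le> Lp_norm p UNIV f"
    using p by (auto simp: Lp_norm_def lebesgue_on_UNIV_eq intro!: powr_mono2)
  assume "\<And>x. x \<notin> U \<Longrightarrow> f x = 0"
  then have "indicator U x *\<^sub>R norm (f x) powr p = norm (f x) powr p" for x by (auto simp: indicator_def)
  then show "Lp_norm p U f = Lp_norm p UNIV f" unfolding Lp_norm_def eq lebesgue_on_UNIV_eq by (simp only:)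
qed

lemma test_function_Lp:
  assumes U: "U \<in> sets lebesgue" and \<phi>: "\<phi> \<in> test_functions U" and p: "p > 0"
  shows "\<phi> \<in> Lp p U" "gradient \<phi> \<in> Lp p U" "\<phi> \<in> Lp p UNIV" "gradient \<phi> \<in> Lp p UNIV"
    "Lp_norm p U \<phi> = Lp_norm p UNIV \<phi>" "Lp_norm p U (gradient \<phi>) = Lp_norm p UNIV (gradient \<phi>)"
proof -
  have sm: "smooth \<phi>" by (rule test_functions_smooth[OF \<phi>])
  obtain K where K: "compact K" "K \<subseteq> U" "\<And>x. x \<notin> K \<Longrightarrow> \<phi> x = 0" "\<And>x. x \<notin> K \<Longrightarrow> gradient \<phi> x = 0"
    using test_functionsE[OF \<phi>] by metis
  show 1: "\<phi> \<in> Lp p UNIV" "gradient \<phi> \<in> Lp p UNIV"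
    using Lp_UNIV_compact_support[OF smooth_continuous_on[OF sm] K(1,3) p]
      Lp_UNIV_compact_support[OF smooth_gradient_continuous_on[OF sm] K(1,4) p] by simp_all
  show "\<phi> \<in> Lp p U" "gradient \<phi> \<in> Lp p U"
    using Lp_UNIV_subset(1)[OF U 1(1) p] Lp_UNIV_subset(1)[OF U 1(2) p] by simp_all
  show "Lp_norm p U \<phi> = Lp_norm p UNIV \<phi>" "Lp_norm p U (gradient \<phi>) = Lp_norm p UNIV (gradient \<phi>)"
    using K(2-4) by (intro Lp_UNIV_subset(3)[OF U 1(1) p] Lp_UNIV_subset(3)[OF U 1(2) p]; auto)+
qed

lemma test_function_W01p:
  assumes U: "open U" and \<phi>: "\<phi> \<in> test_functions U" and p: "p > 0"
  shows "\<phi> \<in> W1p p U" "\<phi> \<in> W01p p U"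
proof -
  have UL: "U \<in> sets lebesgue" using U by auto
  show 1: "\<phi> \<in> W1p p U"
    using test_function_Lp[OF UL \<phi> p] is_weak_gradient_test_function[OF U \<phi>] by (auto simp: W1p_def)
  have z: "(\<lambda>x. \<phi> x - \<phi> x) \<in> test_functions U" by (rule test_functions_diff[OF \<phi> \<phi>])
  have "gradient (\<lambda>x. 0) x = 0" for x :: "real^'a"
    by (rule gradient_eqI[OF GDERIV_const])
  then have "Lp_norm p U (weak_gradient U (\<lambda>x. \<phi> x - \<phi> x)) = 0"
    unfolding test_function_weak_gradient[OF U z] by (simp add: Lp_norm_def \<open>p > 0\<close>)
  moreover have "Lp_norm p U (\<lambda>x. \<phi> x - \<phi> x) = 0" by (simp add: Lp_norm_def)
  ultimately have "W1p_norm p U (\<lambda>x. \<phi> x - \<phi> x) = 0"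
    unfolding W1p_norm_def p_energy_eq_Lp_norm[OF p] using p by simp
  then show "\<phi> \<in> W01p p U" using 1 \<phi> unfolding W01p_def mem_Collect_eq
    by (intro conjI allI impI bexI[of _ \<phi>]) simp_all
qed

lemma W1p_norm_test_function_le:
  fixes U :: "(real^'n) set"
  assumes U: "open U" "bounded U" and \<phi>: "\<phi> \<in> test_functions U" and p: "p > 0" and c: "c \<ge> 0"
    and le: "\<And>x. x \<in> U \<Longrightarrow> \<bar>\<phi> x\<bar> \<le> c" "\<And>x. x \<in> U \<Longrightarrow> norm (gradient \<phi> x) \<le> c"
  shows "W1p_norm p U \<phi> \<le> c * (2 * measure lebesgue U) powr (1 / p)"
proof -
  have UL: "U \<in> sets lebesgue" using U by auto
  let ?V = "measure lebesgue U"
  have "Lp_norm p U \<phi> \<le> c * ?V powr (1 / p)" "Lp_norm p U (gradient \<phi>) \<le> c * ?V powr (1 / p)"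
  proof -
    have m: "\<phi> \<in> borel_measurable (lebesgue_on U)" "gradient \<phi> \<in> borel_measurable (lebesgue_on U)"
      using test_function_Lp(1,2)[OF UL \<phi> p] by (simp_all add: Lp_def)
    show "Lp_norm p U \<phi> \<le> c * ?V powr (1 / p)"
      by (rule Lp_bounded(2)[OF U(2) UL m(1) _ c p]) (use le in simp)
    show "Lp_norm p U (gradient \<phi>) \<le> c * ?V powr (1 / p)"
      by (rule Lp_bounded(2)[OF U(2) UL m(2) _ c p]) (use le in simp)
  qed
  then have "Lp_norm p U \<phi> powr p \<le> (c * ?V powr (1 / p)) powr p"
    "Lp_norm p U (gradient \<phi>) powr p \<le> (c * ?V powr (1 / p)) powr p"
    using p by (auto intro!: powr_mono2 simp: Lp_norm_nonneg)
  moreover have "(c * ?V powr (1 / p)) powr p = c powr p * ?V"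
    using p c by (simp add: powr_mult powr_powr)
  ultimately have "Lp_norm p U \<phi> powr p + p_energy p U \<phi> \<le> c powr p * (2 * ?V)"
    unfolding p_energy_eq_Lp_norm[OF p] test_function_weak_gradient[OF U(1) \<phi>] by simp
  then have "W1p_norm p U \<phi> \<le> (c powr p * (2 * ?V)) powr (1 / p)"
    using p by (auto simp: W1p_norm_def p_energy_nonneg intro!: powr_mono2)
  also have "\<dots> = c * (2 * ?V) powr (1 / p)"
    using p c by (simp add: powr_mult powr_powr)
  finally show ?thesis .
qed

section \<open>The topology of the Sobolev space\<close>

lemma W01p_subset_W1p: "u \<in> W01p p U \<Longrightarrow> u \<in> W1p p U"
  by (simp add: W01p_def)

lemma continuous_map_into_W01p:
  assumes "\<And>t. t \<in> topspace T \<Longrightarrow> F t \<in> W01p p U"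
    and "\<And>t \<epsilon>. t \<in> topspace T \<Longrightarrow> \<epsilon> > 0 \<Longrightarrow>
      \<exists>V. openin T V \<and> t \<in> V \<and> (\<forall>s\<in>V. W1p_norm p U (\<lambda>x. F s x - F t x) < \<epsilon>)"
  shows "continuous_map T (W01p_topology p U) F"
  unfolding continuous_map_def
proof (intro conjI allI impI)
  show "F \<in> topspace T \<rightarrow> topspace (W01p_topology p U)" using assms(1) by (simp add: topspace_W01p_topology)
  fix S assume S: "openin (W01p_topology p U) S"
  show "openin T {t \<in> topspace T. F t \<in> S}"
  proof (subst openin_subopen, rule ballI)
    fix t assume t: "t \<in> {t \<in> topspace T. F t \<in> S}"
    then obtain \<epsilon> where \<epsilon>: "\<epsilon> > 0" "\<forall>v\<in>W01p p U. W1p_norm p U (\<lambda>x. v x - F t x) < \<epsilon> \<longrightarrow> v \<in> S"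
      using S unfolding openin_W01p_topology by blast
    obtain V where V: "openin T V" "t \<in> V" "\<forall>s\<in>V. W1p_norm p U (\<lambda>x. F s x - F t x) < \<epsilon>"
      using assms(2)[of t \<epsilon>] t \<epsilon> by blast
    have "V \<subseteq> {t \<in> topspace T. F t \<in> S}"
      using V \<epsilon> assms(1) openin_subset[OF V(1)] by blast
    then show "\<exists>V. openin T V \<and> t \<in> V \<and> V \<subseteq> {t \<in> topspace T. F t \<in> S}" using V by blast
  qed
qed

text \<open>On a bounded set uniform closeness of functions and gradients controls the Sobolev norm.
  All families of test functions below are shown continuous through this criterion.\<close>

lemma continuous_map_test_functions:
  fixes U :: "(real^'n) set"
  assumes U: "open U" "bounded U" and p: "p > 0"
    and test: "\<And>t. t \<in> topspace T \<Longrightarrow> F t \<in> test_functions U"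
    and cont: "\<And>t \<epsilon>. t \<in> topspace T \<Longrightarrow> \<epsilon> > 0 \<Longrightarrow>
      \<exists>V. openin T V \<and> t \<in> V \<and> (\<forall>s\<in>V. \<forall>x\<in>U. \<bar>F s x - F t x\<bar> \<le> \<epsilon> \<and> norm (gradient (F s) x - gradient (F t) x) \<le> \<epsilon>)"
  shows "continuous_map T (W01p_topology p U) F"
proof (rule continuous_map_into_W01p)
  show "F t \<in> W01p p U" if "t \<in> topspace T" for t
    using test_function_W01p[OF U(1) test[OF that] p] by simp
  fix t and \<epsilon> :: real assume t: "t \<in> topspace T" and \<epsilon>: "\<epsilon> > 0"
  define C where "C = (2 * measure lebesgue U) powr (1 / p)"
  have C: "C \<ge> 0" by (simp add: C_def)
  define \<delta> where "\<delta> = \<epsilon> / (C + 1)"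
  have \<delta>: "\<delta> > 0" "\<delta> * C < \<epsilon>" using \<epsilon> C by (auto simp: \<delta>_def field_simps)
  obtain V where V: "openin T V" "t \<in> V"
    "\<And>s x. s \<in> V \<Longrightarrow> x \<in> U \<Longrightarrow> \<bar>F s x - F t x\<bar> \<le> \<delta> \<and> norm (gradient (F s) x - gradient (F t) x) \<le> \<delta>"
    using cont[OF t \<delta>(1)] by blast
  have "W1p_norm p U (\<lambda>x. F s x - F t x) < \<epsilon>" if s: "s \<in> V" for s
  proof -
    have st: "F s \<in> test_functions U" "F t \<in> test_functions U"
      using openin_subset[OF V(1)] s t test by auto
    have grad: "gradient (\<lambda>x. F s x - F t x) x = gradient (F s) x - gradient (F t) x" for x
      by (intro gradient_eqI GDERIV_diff GDERIV_smooth test_functions_smooth[OF st(1)] test_functions_smooth[OF st(2)])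
    have "W1p_norm p U (\<lambda>x. F s x - F t x) \<le> \<delta> * C"
      unfolding C_def using V(3)[OF s] \<delta>(1)
      by (intro W1p_norm_test_function_le[OF U test_functions_diff[OF st] p]) (auto simp: grad)
    then show ?thesis using \<delta>(2) by simp
  qed
  then show "\<exists>V. openin T V \<and> t \<in> V \<and> (\<forall>s\<in>V. W1p_norm p U (\<lambda>x. F s x - F t x) < \<epsilon>)"
    using V by blast
qed

lemma openin_W01p_energy_less:
  assumes U: "open U" and p: "p \<ge> 1"
  shows "openin (W01p_topology p U) {v \<in> W01p p U. Lp_norm p U (weak_gradient U v) < c}"
  unfolding openin_W01p_topology
proof (intro conjI ballI)
  fix u assume u: "u \<in> {v \<in> W01p p U. Lp_norm p U (weak_gradient U v) < c}"
  then show "\<exists>\<epsilon>>0. \<forall>v\<in>W01p p U. W1p_norm p U (\<lambda>x. v x - u x) < \<epsilon> \<longrightarrow>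
      v \<in> {v \<in> W01p p U. Lp_norm p U (weak_gradient U v) < c}"
    using W1p_diff_bounds(3)[OF U p, of u] W01p_subset_W1p
    by (intro exI[of _ "c - Lp_norm p U (weak_gradient U u)"]) fastforce
qed auto

text \<open>The sublevel sets of the gradient norm are open and exhaust the space, so finitely many
  of them cover \<open>A\<close>. Without the bound the \<open>SUP\<close> in the definition of the
  eigenvalues would have no meaning as a least upper bound.\<close>

lemma compactin_W01p_energy_bounded:
  assumes U: "open U" and p: "p \<ge> 1" and A: "compactin (W01p_topology p U) A"
  shows "bdd_above (p_energy p U ` A)"
proof -
  define S where "S n = {v \<in> W01p p U. Lp_norm p U (weak_gradient U v) < real n}" for n :: nat
  have sub: "A \<subseteq> W01p p U" using compactin_subset_topspace[OF A] by (simp add: topspace_W01p_topology)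
  have "A \<subseteq> \<Union>(range S)"
  proof
    fix v assume "v \<in> A"
    moreover obtain n where "Lp_norm p U (weak_gradient U v) < real n" using reals_Archimedean2 by blast
    ultimately show "v \<in> \<Union>(range S)" using sub by (auto simp: S_def)
  qed
  moreover have "openin (W01p_topology p U) X" if "X \<in> range S" for X
  proof -
    obtain n where "X = S n" using \<open>X \<in> range S\<close> by (rule rangeE)
    then show ?thesis unfolding S_def by (simp only: openin_W01p_energy_less[OF U p])
  qed
  ultimately obtain \<F> where \<F>: "finite \<F>" "\<F> \<subseteq> range S" "A \<subseteq> \<Union>\<F>"
    using compactinD[OF A, of "range S"] by auto
  obtain I where I: "finite I" "\<F> = S ` I" using finite_subset_image[OF \<F>(1,2)] by auto
  \<comment> \<open>The sum of the finitely many indices dominates each of them.\<close>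
  have "p_energy p U v \<le> real (\<Sum>I) powr p" if vA: "v \<in> A" for v
  proof -
    obtain n where n: "n \<in> I" "v \<in> S n" using subsetD[OF \<F>(3) vA] I by auto
    have "n \<le> \<Sum>I" using I n by (intro member_le_sum) auto
    then have "real n \<le> real (\<Sum>I)" by (simp only: of_nat_le_iff)
    then have "Lp_norm p U (weak_gradient U v) \<le> real (\<Sum>I)"
      using n(2) unfolding S_def mem_Collect_eq by linarith
    then show ?thesis
      using p by (subst p_energy_eq_Lp_norm) (auto intro!: powr_mono2 simp: Lp_norm_nonneg)
  qed
  then show ?thesis by (rule bdd_aboveI2)
qed

text \<open>With \<open>Q\<close> a grid cell these integrals become the coordinates of the odd map
  in \<open>genus_bounded_by_energy\<close>. Continuity holds because a small Sobolev norm forces a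
  small 1-norm on a bounded set.\<close>

lemma continuous_map_W01p_integral:
  fixes U :: "(real^'n) set"
  assumes U: "open U" "bounded U" and p: "p > 1" and Q: "Q \<in> sets lebesgue"
  shows "continuous_map (W01p_topology p U) euclideanreal (\<lambda>u. LINT x|lebesgue_on U. indicator Q x * u x)"
proof -
  have UL: "U \<in> sets lebesgue" using U by auto
  let ?L = "\<lambda>u. LINT x|lebesgue_on U. indicator Q x * u x :: real"
  have QU: "indicator Q \<in> borel_measurable (lebesgue_on U)" for Q' :: "(real^'n) set"
    using Q by (intro measurable_restrict_space1 borel_measurable_indicator)
  show ?thesis
    unfolding continuous_map_def
  proof (intro conjI allI impI)
    fix S :: "real set" assume "openin euclideanreal S"
    then have S: "open S" by simp
    show "openin (W01p_topology p U) {u \<in> topspace (W01p_topology p U). ?L u \<in> S}"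
      unfolding openin_W01p_topology topspace_W01p_topology
    proof (intro conjI ballI)
      fix u assume "u \<in> {u \<in> W01p p U. ?L u \<in> S}"
      then have u: "u \<in> W1p p U" "?L u \<in> S" by (auto simp: W01p_subset_W1p)
      obtain e where e: "e > 0" "\<And>y. \<bar>y - ?L u\<bar> < e \<Longrightarrow> y \<in> S"
        using S u(2) unfolding open_dist dist_real_def by meson
      obtain \<delta> where \<delta>: "\<delta> > 0" "\<And>f :: real^'n \<Rightarrow> real. f \<in> Lp p U \<Longrightarrow> Lp_norm p U f < \<delta> \<Longrightarrow> (LINT x|lebesgue_on U. norm (f x)) < e"
        using Lp_norm_small_L1_small[OF U(2) UL p e(1)] by blast
      have "v \<in> {u \<in> W01p p U. ?L u \<in> S}" if v: "v \<in> W01p p U" "W1p_norm p U (\<lambda>x. v x - u x) < \<delta>" for v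
      proof -
        have Lpuv: "u \<in> Lp p U" "v \<in> Lp p U" using W1pD(1)[OF U(1) u(1)] W1pD(1)[OF U(1) W01p_subset_W1p[OF v(1)]] by simp_all
        then have d: "(\<lambda>x. v x - u x) \<in> Lp p U" using p by (intro Lp_diff) auto
        have i: "integrable (lebesgue_on U) (\<lambda>x. indicator Q x * f x)" if f: "f \<in> Lp p U" for f :: "real^'n \<Rightarrow> real"
        proof (rule Bochner_Integration.integrable_bound[OF Lp_integrable(1)[OF U(2) UL f p]])
          show "(\<lambda>x. indicator Q x * f x) \<in> borel_measurable (lebesgue_on U)"
            using f by (intro borel_measurable_times QU) (simp add: Lp_def)
        qed (auto simp: indicator_def)
        have "?L v - ?L u = (LINT x|lebesgue_on U. indicator Q x * (v x - u x))"
          using i[OF Lpuv(1)] i[OF Lpuv(2)] by (simp add: right_diff_distrib)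
        then have "\<bar>?L v - ?L u\<bar> \<le> (LINT x|lebesgue_on U. norm (indicator Q x * (v x - u x)))"
          using integral_norm_bound[of "lebesgue_on U" "\<lambda>x. indicator Q x * (v x - u x)"] by simp
        also have "\<dots> \<le> (LINT x|lebesgue_on U. norm (v x - u x))"
          by (intro integral_mono integrable_norm i[OF d] Lp_integrable(1)[OF U(2) UL d p]) (auto simp: indicator_def)
        also have "\<dots> < e"
          using \<delta>(2)[OF d] v(2) Lp_norm_le_W1p_norm(1)[of p U "\<lambda>x. v x - u x"] p by simp
        finally show ?thesis using e(2) v by simp
      qed
      then show "\<exists>\<epsilon>>0. \<forall>v\<in>W01p p U. W1p_norm p U (\<lambda>x. v x - u x) < \<epsilon> \<longrightarrow> v \<in> {u \<in> W01p p U. ?L u \<in> S}"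
        using \<delta>(1) by blast
    qed auto
  qed auto
qed

section \<open>Unboundedness of the variational eigenvalues\<close>

definition cell :: "real \<Rightarrow> ('n::finite \<Rightarrow> int) \<Rightarrow> (real^'n) set" where
  "cell h k = {x. \<forall>i. \<lfloor>x $ i / h\<rfloor> = k i}"

lemma in_cell_iff:
  assumes "h > 0"
  shows "x \<in> cell h k \<longleftrightarrow> (\<forall>i. h * k i \<le> x $ i \<and> x $ i < h * k i + h)"
  using assms by (simp add: cell_def floor_eq_iff field_simps)

lemma borel_measurable_vec_component [measurable]: "(\<lambda>x :: real^'n. x $ i) \<in> borel_measurable borel"
  by (rule borel_measurable_continuous_onI) (rule smooth_continuous_on[OF smooth_component])

lemma cell_borel: "cell h k \<in> sets borel"
proof -
  have "{x \<in> space borel. \<forall>i\<in>UNIV. \<lfloor>x $ i / h\<rfloor> = k i} \<in> sets borel"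
    by (intro sets.sets_Collect_finite_All') measurable
  then show ?thesis by (simp add: cell_def)
qed

lemma cell_box:
  fixes k :: "'n::finite \<Rightarrow> int" and h :: real
  assumes h: "h > 0"
  defines "a \<equiv> \<chi> i. h * k i"
  shows "box a (a + (\<chi> i. h)) \<subseteq> cell h k" "cell h k \<subseteq> cbox a (a + (\<chi> i. h))"
  using h by (auto simp: in_cell_iff mem_box_cart a_def less_imp_le)

lemma emeasure_box_cart:
  fixes a :: "real^'n"
  assumes "h > 0"
  shows "emeasure lborel (box a (a + (\<chi> i. h))) = ennreal (h ^ CARD('n))"
    "emeasure lborel (cbox a (a + (\<chi> i. h))) = ennreal (h ^ CARD('n))"
proof -
  have "(\<Prod>b\<in>Basis. ((a + (\<chi> i. h)) - a) \<bullet> b) = (\<Prod>b\<in>(Basis :: (real^'n) set). h)"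
    by (intro prod.cong) (auto simp: Basis_vec_def inner_axis)
  also have "\<dots> = h ^ CARD('n)" by simp
  finally have *: "(\<Prod>b\<in>Basis. ((a + (\<chi> i. h)) - a) \<bullet> b) = h ^ CARD('n)" .
  have le: "a \<bullet> b \<le> (a + (\<chi> i. h)) \<bullet> b" if "b \<in> Basis" for b
    using that assms by (auto simp: Basis_vec_def inner_axis)
  show "emeasure lborel (box a (a + (\<chi> i. h))) = ennreal (h ^ CARD('n))"
    "emeasure lborel (cbox a (a + (\<chi> i. h))) = ennreal (h ^ CARD('n))"
    using emeasure_lborel_box[OF le] emeasure_lborel_cbox[OF le] unfolding * by blast+
qed

lemma emeasure_cell:
  fixes k :: "'n::finite \<Rightarrow> int"
  assumes h: "h > 0"
  shows "emeasure lborel (cell h k) = ennreal (h ^ CARD('n))"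
proof (rule antisym)
  define a where "a = (\<chi> i. h * k i)"
  show "emeasure lborel (cell h k) \<le> ennreal (h ^ CARD('n))"
    using emeasure_mono[OF cell_box(2)[OF h, of k], of lborel] emeasure_box_cart(2)[OF h, of a] by (simp add: a_def)
  show "ennreal (h ^ CARD('n)) \<le> emeasure lborel (cell h k)"
    using emeasure_mono[OF cell_box(1)[OF h, of k], of lborel] emeasure_box_cart(1)[OF h, of a] cell_borel[of h k]
    by (simp add: a_def)
qed

lemma measure_cell: "h > 0 \<Longrightarrow> measure lebesgue (cell h (k :: 'n::finite \<Rightarrow> int)) = h ^ CARD('n)"
  using emeasure_cell[of h k] cell_borel[of h k] by (simp add: measure_def)

lemma bounded_cell: "h > 0 \<Longrightarrow> bounded (cell h k)"
  by (rule bounded_subset[OF bounded_cbox cell_box(2)])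

text \<open>Jensen's inequality up to the factor 2^p. It comes from the bound in
  \<open>Lp_integrable\<close> with eta equal to half the absolute mean: one half of the left side
  is absorbed.\<close>

lemma mean_power_le:
  fixes f :: "real^'n \<Rightarrow> real"
  assumes Q: "bounded Q" "Q \<in> sets lebesgue" "measure lebesgue Q > 0" and f: "f \<in> Lp p Q" and p: "p > 1"
  shows "\<bar>(LINT y|lebesgue_on Q. f y) / measure lebesgue Q\<bar> powr p
    \<le> 2 powr p / measure lebesgue Q * (LINT y|lebesgue_on Q. \<bar>f y\<bar> powr p)"
proof -
  define V where "V = measure lebesgue Q"
  define a where "a = \<bar>(LINT y|lebesgue_on Q. f y) / V\<bar>"
  define I where "I = (LINT y|lebesgue_on Q. \<bar>f y\<bar> powr p)"
  have V: "V > 0" using Q by (simp add: V_def)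
  have I: "I \<ge> 0" by (simp add: I_def)
  have "a powr p \<le> 2 powr p / V * I"
  proof (cases "a = 0")
    case False
    then have a: "a > 0" by (simp add: a_def)
    have "a * V = \<bar>LINT y|lebesgue_on Q. f y\<bar>" using V by (simp add: a_def)
    also have "\<dots> \<le> (LINT y|lebesgue_on Q. norm (f y))"
      using integral_norm_bound[of "lebesgue_on Q" f] by simp
    also have "\<dots> \<le> a / 2 * V + (a / 2) powr (1 - p) * I"
      using Lp_integrable(2)[OF Q(1,2) f p, of "a / 2"] a p by (simp add: V_def I_def Lp_norm_powr)
    finally have "a / 2 * V \<le> (a / 2) powr (1 - p) * I" by (simp add: field_simps)
    then have "(a / 2) powr (p - 1) * (a / 2 * V) \<le> (a / 2) powr (p - 1) * ((a / 2) powr (1 - p) * I)"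
      by (rule mult_left_mono) simp
    also have "\<dots> = ((a / 2) powr (p - 1) * (a / 2) powr (1 - p)) * I" by simp
    also have "(a / 2) powr (p - 1) * (a / 2) powr (1 - p) = 1" using a by (simp flip: powr_add)
    also have "(a / 2) powr (p - 1) * (a / 2 * V) = ((a / 2) * (a / 2) powr (p - 1)) * V"
      by (simp only: mult_ac)
    also have "(a / 2) * (a / 2) powr (p - 1) = (a / 2) powr p"
      using powr_mult_base[of "a / 2" "p - 1"] a by simp
    also have "(a / 2) powr p = a powr p / 2 powr p" using a by (simp add: powr_divide)
    finally show ?thesis using V by (simp add: field_simps)
  qed (use V I p in auto)
  then show ?thesis by (simp only: a_def V_def I_def)
qed

lemma nn_integral_translation:
  fixes f :: "'a::euclidean_space \<Rightarrow> ennreal"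
  assumes [measurable]: "f \<in> borel_measurable borel"
  shows "(\<integral>\<^sup>+x. f (c + x) \<partial>lborel) = (\<integral>\<^sup>+x. f x \<partial>lborel)"
proof -
  have "(\<integral>\<^sup>+x. f x \<partial>distr lborel borel ((+) c)) = (\<integral>\<^sup>+x. f (c + x) \<partial>lborel)"
    by (subst nn_integral_distr) auto
  then show ?thesis by (simp add: lborel_distr_plus)
qed

lemma nn_integral_shift_difference:
  fixes \<phi> :: "real^'n \<Rightarrow> real"
  assumes \<phi>: "\<phi> \<in> test_functions UNIV" and p: "p > 1"
  shows "(\<integral>\<^sup>+x. ennreal (\<bar>\<phi> x - \<phi> (x + z)\<bar> powr p) \<partial>lborel)
    \<le> ennreal ((norm z * Lp_norm p UNIV (gradient \<phi>)) powr p)"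
proof -
  have cont: "continuous_on UNIV \<phi>" by (intro smooth_continuous_on test_functions_smooth[OF \<phi>])
  obtain K where K: "compact K" "\<And>x. x \<notin> K \<Longrightarrow> \<phi> x = 0"
    using test_functionsE[OF \<phi>] by metis
  let ?D = "\<lambda>x. \<phi> (x + z) - \<phi> x"
  have cD: "continuous_on UNIV ?D"
    by (intro continuous_on_diff cont continuous_on_compose2[OF cont]) (auto intro!: continuous_intros)
  have D: "?D \<in> Lp p UNIV"
  proof (rule Lp_UNIV_compact_support[OF cD])
    show "compact (K \<union> (\<lambda>x. x - z) ` K)"
      using K(1) by (intro compact_Un compact_continuous_image continuous_intros)
    show "?D x = 0" if "x \<notin> K \<union> (\<lambda>x. x - z) ` K" for x
    proof -
      have "x + z \<notin> K" using that by (auto simp: image_iff)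
      then show ?thesis using K(2) that by simp
    qed
  qed (use p in auto)
  have meas: "?D \<in> borel_measurable borel" by (rule borel_measurable_continuous_onI[OF cD])
  have int: "integrable lborel (\<lambda>x. \<bar>?D x\<bar> powr p)"
  proof -
    have "integrable lebesgue (\<lambda>x. norm (?D x) powr p)" using D by (simp add: Lp_def lebesgue_on_UNIV_eq)
    then show ?thesis using meas by (subst (asm) integrable_completion) auto
  qed
  have "(\<integral>\<^sup>+x. ennreal (\<bar>\<phi> x - \<phi> (x + z)\<bar> powr p) \<partial>lborel) = (\<integral>\<^sup>+x. ennreal (\<bar>?D x\<bar> powr p) \<partial>lborel)"
    by (simp add: abs_minus_commute)
  also have "\<dots> = ennreal (LINT x|lborel. \<bar>?D x\<bar> powr p)"
    by (rule nn_integral_eq_integral[OF int]) simp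
  also have "(LINT x|lborel. \<bar>?D x\<bar> powr p) = Lp_norm p UNIV ?D powr p"
    unfolding Lp_norm_UNIV_lborel[OF meas] using p by (simp add: powr_powr)
  also have "ennreal (Lp_norm p UNIV ?D powr p) \<le> ennreal ((norm z * Lp_norm p UNIV (gradient \<phi>)) powr p)"
    using Lp_norm_shift_difference[OF \<phi>, of p z] p
    by (intro ennreal_leI powr_mono2) (auto simp: Lp_norm_nonneg)
  finally show ?thesis .
qed

text \<open>Two points of one cell differ by a vector \<open>z\<close> of the cube \<open>B\<close>
  of side 2 h. Substituting y = x + z and exchanging the integrals leaves, for each
  \<open>z\<close>, the p-th power of a shift difference, with |z| <= N h by comparison with the
  1-norm; the measure of \<open>B\<close> gives the factor (2 h)^N.\<close>

lemma double_integral_cells_le: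
  fixes \<phi> :: "real^'n \<Rightarrow> real" and h :: real
  assumes \<phi>: "\<phi> \<in> test_functions UNIV" and p: "p > 1" and h: "h > 0"
  shows "(\<integral>\<^sup>+x. \<integral>\<^sup>+y. indicator (cell h (\<lambda>i. \<lfloor>x $ i / h\<rfloor>)) y * ennreal (\<bar>\<phi> x - \<phi> y\<bar> powr p) \<partial>lborel \<partial>lborel)
    \<le> ennreal ((2 * h) ^ CARD('n) * (CARD('n) * h * Lp_norm p UNIV (gradient \<phi>)) powr p)"
proof -
  have cont: "continuous_on UNIV \<phi>" by (intro smooth_continuous_on test_functions_smooth[OF \<phi>])
  then have [measurable]: "\<phi> \<in> borel_measurable borel" by (rule borel_measurable_continuous_onI)
  define B where "B = cbox (- (\<chi> i. h)) (- (\<chi> i. h) + (\<chi> i. 2 * h) :: real^'n)"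
  have [measurable]: "B \<in> sets borel" by (simp add: B_def)
  let ?G = "CARD('n) * h * Lp_norm p UNIV (gradient \<phi>)"
  have inB: "z \<in> B \<longleftrightarrow> (\<forall>i. - h \<le> z $ i \<and> z $ i \<le> h)" for z
    by (simp add: B_def mem_box_cart)
  have cell: "indicator (cell h (\<lambda>i. \<lfloor>x $ i / h\<rfloor>)) y \<le> (indicator B (y - x) :: ennreal)" for x y
  proof (cases "y \<in> cell h (\<lambda>i. \<lfloor>x $ i / h\<rfloor>)")
    case True
    moreover have "x \<in> cell h (\<lambda>i. \<lfloor>x $ i / h\<rfloor>)" by (simp add: cell_def)
    ultimately have "y - x \<in> B"
      unfolding inB in_cell_iff[OF h] by (smt (verit, best) vector_minus_component)
    then show ?thesis by (simp add: indicator_def)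
  qed simp
  have "(\<integral>\<^sup>+x. \<integral>\<^sup>+y. indicator (cell h (\<lambda>i. \<lfloor>x $ i / h\<rfloor>)) y * ennreal (\<bar>\<phi> x - \<phi> y\<bar> powr p) \<partial>lborel \<partial>lborel)
    \<le> (\<integral>\<^sup>+x. \<integral>\<^sup>+y. indicator B (y - x) * ennreal (\<bar>\<phi> x - \<phi> y\<bar> powr p) \<partial>lborel \<partial>lborel)"
    by (intro nn_integral_mono mult_right_mono cell) simp
  also have "\<dots> = (\<integral>\<^sup>+x. \<integral>\<^sup>+z. indicator B z * ennreal (\<bar>\<phi> x - \<phi> (x + z)\<bar> powr p) \<partial>lborel \<partial>lborel)"
  proof (rule nn_integral_cong)
    fix x :: "real^'n"
    show "(\<integral>\<^sup>+y. indicator B (y - x) * ennreal (\<bar>\<phi> x - \<phi> y\<bar> powr p) \<partial>lborel)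
      = (\<integral>\<^sup>+z. indicator B z * ennreal (\<bar>\<phi> x - \<phi> (x + z)\<bar> powr p) \<partial>lborel)"
      by (subst nn_integral_translation[of "\<lambda>y. indicator B (y - x) * ennreal (\<bar>\<phi> x - \<phi> y\<bar> powr p)" x, symmetric]) simp_all
  qed
  also have "\<dots> = (\<integral>\<^sup>+z. \<integral>\<^sup>+x. indicator B z * ennreal (\<bar>\<phi> x - \<phi> (x + z)\<bar> powr p) \<partial>lborel \<partial>lborel)"
    by (rule lborel_pair.Fubini') measurable
  also have "\<dots> = (\<integral>\<^sup>+z. indicator B z * (\<integral>\<^sup>+x. ennreal (\<bar>\<phi> x - \<phi> (x + z)\<bar> powr p) \<partial>lborel) \<partial>lborel)"
    by (intro nn_integral_cong nn_integral_cmult) measurable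
  also have "\<dots> \<le> (\<integral>\<^sup>+z. ennreal (?G powr p) * indicator B z \<partial>lborel)"
  proof (rule nn_integral_mono)
    fix z :: "real^'n"
    show "indicator B z * (\<integral>\<^sup>+x. ennreal (\<bar>\<phi> x - \<phi> (x + z)\<bar> powr p) \<partial>lborel) \<le> ennreal (?G powr p) * indicator B z"
    proof (cases "z \<in> B")
      case True
      have "norm z \<le> (\<Sum>i\<in>UNIV. \<bar>z $ i\<bar>)" by (rule norm_le_l1_cart)
      also have "\<dots> \<le> (\<Sum>i\<in>(UNIV :: 'n set). h)"
        using True unfolding inB by (intro sum_mono) (simp add: abs_le_iff minus_le_iff)
      finally have "norm z \<le> CARD('n) * h" by simp
      then have "norm z * Lp_norm p UNIV (gradient \<phi>) \<le> ?G"
        by (intro mult_right_mono) (auto simp: Lp_norm_nonneg)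
      then have "ennreal ((norm z * Lp_norm p UNIV (gradient \<phi>)) powr p) \<le> ennreal (?G powr p)"
        using p by (intro ennreal_leI powr_mono2) (auto simp: Lp_norm_nonneg)
      then have "(\<integral>\<^sup>+x. ennreal (\<bar>\<phi> x - \<phi> (x + z)\<bar> powr p) \<partial>lborel) \<le> ennreal (?G powr p)"
        using nn_integral_shift_difference[OF \<phi> p, of z] by (rule order_trans[rotated])
      then show ?thesis using True by simp
    qed simp
  qed
  also have "\<dots> = ennreal (?G powr p) * emeasure lborel B"
    by (simp add: nn_integral_cmult)
  also have "emeasure lborel B = ennreal ((2 * h) ^ CARD('n))"
    unfolding B_def using emeasure_box_cart(2)[of "2 * h" "- (\<chi> i. h) :: real^'n"] h by simp
  also have "ennreal (?G powr p) * ennreal ((2 * h) ^ CARD('n)) = ennreal ((2 * h) ^ CARD('n) * ?G powr p)"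
    using h by (subst ennreal_mult'[symmetric]) (auto simp: mult.commute)
  finally show ?thesis .
qed

text \<open>Split the value at x into the mean of the differences to the other points of its cell
  and the cell mean. The first part is estimated by \<open>mean_power_le\<close> and integrated with
  \<open>double_integral_cells_le\<close>; the second is at most \<open>M\<close>. Admitting cell
  means up to \<open>M\<close> allows approximants of a function whose own cell means are 0.\<close>

lemma test_function_cell_estimate:
  fixes h M :: real and \<phi> :: "real^'n \<Rightarrow> real" and U :: "(real^'n) set"
  assumes U: "open U" "bounded U" and \<phi>: "\<phi> \<in> test_functions U" and p: "p > 1" and h: "h > 0" and M: "M \<ge> 0"
    and cells: "\<And>k. \<bar>LINT y|lebesgue_on (cell h k). \<phi> y\<bar> \<le> M * h ^ CARD('n)"
  shows "Lp_norm p U \<phi> powr p \<le> 2 powr p * (2 powr p * 2 ^ CARD('n) *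
      (CARD('n) * h * Lp_norm p U (gradient \<phi>)) powr p + M powr p * measure lebesgue U)"
proof -
  have UL: "U \<in> sets lebesgue" using U by auto
  have \<phi>U: "\<phi> \<in> test_functions UNIV" using test_functions_mono[OF _ \<phi>] by simp
  have cont: "continuous_on UNIV \<phi>" by (intro smooth_continuous_on test_functions_smooth[OF \<phi>])
  then have bm [measurable]: "\<phi> \<in> borel_measurable borel" by (rule borel_measurable_continuous_onI)
  have lm: "\<phi> \<in> borel_measurable lebesgue" by (rule borel_measurable_lebesgue_continuous[OF cont])
  obtain B where B: "B \<ge> 0" "\<And>x. \<bar>\<phi> x\<bar> \<le> B" using test_functionsE[OF \<phi>] by metis
  define V where "V = h ^ CARD('n)"
  have V: "V > 0" using h by (simp add: V_def)
  let ?k = "\<lambda>x i. \<lfloor>x $ i / h\<rfloor>"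
  let ?J = "\<lambda>x. \<integral>\<^sup>+y. indicator (cell h (?k x)) y * ennreal (\<bar>\<phi> x - \<phi> y\<bar> powr p) \<partial>lborel"
  have split: "(a + b) powr p \<le> 2 powr p * (a powr p + b powr p)" if "a \<ge> 0" "b \<ge> 0" for a b
  proof -
    have "(a + b) powr p \<le> (2 * max a b) powr p" using that p by (intro powr_mono2) auto
    also have "\<dots> = 2 powr p * max a b powr p" using that by (simp add: powr_mult)
    also have "max a b powr p \<le> a powr p + b powr p" by (auto simp: max_def)
    finally show ?thesis by simp
  qed
  have point: "ennreal (\<bar>\<phi> x\<bar> powr p) \<le> ennreal (2 powr p * (2 powr p / V)) * ?J x + ennreal (2 powr p * M powr p)" for x
  proof -
    let ?Q = "cell h (?k x)"
    have Q: "bounded ?Q" "?Q \<in> sets lebesgue" "measure lebesgue ?Q = V"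
      using bounded_cell[OF h] measure_cell[OF h, of "?k x"] cell_borel[of h "?k x"]
      by (auto simp: V_def intro!: sets_completionI_sets)
    interpret finite_measure "lebesgue_on ?Q" by (rule finite_measure_lebesgue_on_bounded[OF Q(1,2)])
    have mQ: "\<phi> \<in> borel_measurable (lebesgue_on ?Q)" by (rule measurable_restrict_space1[OF lm])
    have iQ: "integrable (lebesgue_on ?Q) \<phi>"
      by (rule integrable_const_bound[of _ B]) (use B mQ in auto)
    have fQ: "(\<lambda>y. \<phi> x - \<phi> y) \<in> Lp p ?Q"
      by (rule Lp_bounded(1)[OF Q(1,2), of _ "2 * B"])
         (use B mQ p in \<open>auto intro: order_trans[OF abs_triangle_ineq4] add_mono[of _ B _ B, simplified mult_2[symmetric]]\<close>)
    have "(LINT y|lebesgue_on ?Q. \<phi> x - \<phi> y) = V * \<phi> x - (LINT y|lebesgue_on ?Q. \<phi> y)"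
      using iQ Q by (simp add: measure_restrict_space)
    then have eq: "\<phi> x = (LINT y|lebesgue_on ?Q. \<phi> x - \<phi> y) / V + (LINT y|lebesgue_on ?Q. \<phi> y) / V"
      using V by (simp add: field_simps)
    have "\<bar>(LINT y|lebesgue_on ?Q. \<phi> y) / V\<bar> \<le> M"
      using cells[of "?k x"] V by (simp add: abs_divide V_def[symmetric] pos_divide_le_eq)
    then have "\<bar>\<phi> x\<bar> \<le> \<bar>(LINT y|lebesgue_on ?Q. \<phi> x - \<phi> y) / V\<bar> + M"
      using eq abs_triangle_ineq[of "(LINT y|lebesgue_on ?Q. \<phi> x - \<phi> y) / V" "(LINT y|lebesgue_on ?Q. \<phi> y) / V"] by linarith
    then have "\<bar>\<phi> x\<bar> powr p \<le> (\<bar>(LINT y|lebesgue_on ?Q. \<phi> x - \<phi> y) / V\<bar> + M) powr p"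
      using p by (intro powr_mono2) auto
    also have "\<dots> \<le> 2 powr p * (\<bar>(LINT y|lebesgue_on ?Q. \<phi> x - \<phi> y) / V\<bar> powr p + M powr p)"
      using M by (intro split) auto
    also have "\<bar>(LINT y|lebesgue_on ?Q. \<phi> x - \<phi> y) / V\<bar> powr p
        \<le> 2 powr p / V * (LINT y|lebesgue_on ?Q. \<bar>\<phi> x - \<phi> y\<bar> powr p)"
      using mean_power_le[OF Q(1,2) _ fQ p] Q(3) V by simp
    finally have le: "\<bar>\<phi> x\<bar> powr p \<le> 2 powr p * (2 powr p / V) * (LINT y|lebesgue_on ?Q. \<bar>\<phi> x - \<phi> y\<bar> powr p) + 2 powr p * M powr p"
      by (simp add: algebra_simps)
    have J: "ennreal (LINT y|lebesgue_on ?Q. \<bar>\<phi> x - \<phi> y\<bar> powr p) = ?J x"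
    proof -
      have "ennreal (LINT y|lebesgue_on ?Q. \<bar>\<phi> x - \<phi> y\<bar> powr p) = (\<integral>\<^sup>+y. ennreal (\<bar>\<phi> x - \<phi> y\<bar> powr p) \<partial>lebesgue_on ?Q)"
        using fQ by (intro nn_integral_eq_integral[symmetric]) (auto simp: Lp_def)
      also have "\<dots> = (\<integral>\<^sup>+y. ennreal (\<bar>\<phi> x - \<phi> y\<bar> powr p) * indicator ?Q y \<partial>lebesgue)"
        using Q(2) by (intro nn_integral_restrict_space) simp
      also have "\<dots> = (\<integral>\<^sup>+y. indicator ?Q y * ennreal (\<bar>\<phi> x - \<phi> y\<bar> powr p) \<partial>lebesgue)"
        by (simp add: mult.commute)
      also have "\<dots> = ?J x"
        by (rule nn_integral_completion)
      finally show ?thesis .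
    qed
    have "ennreal (\<bar>\<phi> x\<bar> powr p) \<le> ennreal (2 powr p * (2 powr p / V) * (LINT y|lebesgue_on ?Q. \<bar>\<phi> x - \<phi> y\<bar> powr p) + 2 powr p * M powr p)"
      by (rule ennreal_leI[OF le])
    also have "\<dots> = ennreal (2 powr p * (2 powr p / V)) * ennreal (LINT y|lebesgue_on ?Q. \<bar>\<phi> x - \<phi> y\<bar> powr p) + ennreal (2 powr p * M powr p)"
    proof -
      have affine: "ennreal (c * I + d) = ennreal c * ennreal I + ennreal d" if "c \<ge> 0" "I \<ge> 0" "d \<ge> 0" for c I d
        using that by (simp add: ennreal_mult)
      show ?thesis using V by (intro affine) auto
    qed
    finally show ?thesis by (simp only: J)
  qed
  \<comment> \<open>Lying in the same cell is a measurable relation on pairs, being a finite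
    intersection of conditions on the floors of the coordinates; so the inner integral is measurable
    in x.\<close>
  have Jm: "?J \<in> borel_measurable lborel"
  proof -
    have "{(x :: real^'n, y). y \<in> cell h (?k x)} = (\<Inter>i\<in>UNIV. {z. \<lfloor>snd z $ i / h\<rfloor> = \<lfloor>fst z $ i / h\<rfloor>})"
      by (auto simp: cell_def)
    also have "\<dots> \<in> sets (borel \<Otimes>\<^sub>M borel)"
    proof (intro sets.countable_INT'')
      fix i
      have "{z \<in> space (borel \<Otimes>\<^sub>M borel). \<lfloor>snd z $ i / h\<rfloor> = \<lfloor>(fst z :: real^'n) $ i / h\<rfloor>} \<in> sets (borel \<Otimes>\<^sub>M borel)"
        by measurable
      then show "{z. \<lfloor>snd z $ i / h\<rfloor> = \<lfloor>(fst z :: real^'n) $ i / h\<rfloor>} \<in> sets (borel \<Otimes>\<^sub>M borel)"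
        by (simp add: space_pair_measure)
    qed (use sets.top[of "borel \<Otimes>\<^sub>M borel :: ((real^'n) \<times> (real^'n)) measure"] in \<open>simp_all add: space_pair_measure\<close>)
    finally have S [measurable]: "{(x :: real^'n, y). y \<in> cell h (?k x)} \<in> sets (borel \<Otimes>\<^sub>M borel)" .
    have "(\<lambda>(x, y). indicator {(x :: real^'n, y). y \<in> cell h (?k x)} (x, y) * ennreal (\<bar>\<phi> x - \<phi> y\<bar> powr p))
      \<in> borel_measurable (borel \<Otimes>\<^sub>M borel)" by measurable
    then have "(\<lambda>(x, y). indicator (cell h (?k x)) y * ennreal (\<bar>\<phi> x - \<phi> y\<bar> powr p)) \<in> borel_measurable (lborel \<Otimes>\<^sub>M lborel)"
      by (simp add: indicator_def cong: measurable_cong_sets)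
    from lborel.borel_measurable_nn_integral_fst[OF this] show ?thesis by simp
  qed
  let ?C = "2 powr p * (2 powr p / V)" and ?G = "CARD('n) * h * Lp_norm p U (gradient \<phi>)"
  have GU: "Lp_norm p U (gradient \<phi>) = Lp_norm p UNIV (gradient \<phi>)"
    using test_function_Lp(6)[OF UL \<phi>] p by simp
  have VU: "emeasure lebesgue U = ennreal (measure lebesgue U)"
    by (rule emeasure_eq_measure2[OF bounded_set_imp_lmeasurable[OF U(2) UL]])
  have JL: "?J \<in> borel_measurable lebesgue" using measurable_completion[of ?J lborel borel] Jm by simp
  have comb: "ennreal a * ennreal b + ennreal c * ennreal d = ennreal (a * b + c * d)"
    if "a \<ge> 0" "b \<ge> 0" "c \<ge> 0" "d \<ge> 0" for a b c d
    using that by (simp add: ennreal_mult)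
  have "ennreal (Lp_norm p U \<phi> powr p) = (\<integral>\<^sup>+x. ennreal (\<bar>\<phi> x\<bar> powr p) \<partial>lebesgue_on U)"
    using test_function_Lp(1)[OF UL \<phi>, of p] p
    by (subst nn_integral_eq_integral) (auto simp: Lp_def Lp_norm_powr)
  also have "\<dots> = (\<integral>\<^sup>+x. ennreal (\<bar>\<phi> x\<bar> powr p) * indicator U x \<partial>lebesgue)"
    using UL by (intro nn_integral_restrict_space) simp
  also have "\<dots> \<le> (\<integral>\<^sup>+x. ennreal ?C * ?J x + ennreal (2 powr p * M powr p) * indicator U x \<partial>lebesgue)"
  proof (rule nn_integral_mono)
    fix x
    show "ennreal (\<bar>\<phi> x\<bar> powr p) * indicator U x \<le> ennreal ?C * ?J x + ennreal (2 powr p * M powr p) * indicator U x"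
      using point[of x] by (cases "x \<in> U") auto
  qed
  also have "\<dots> = ennreal ?C * (\<integral>\<^sup>+x. ?J x \<partial>lebesgue) + ennreal (2 powr p * M powr p) * emeasure lebesgue U"
  proof -
    have "(\<integral>\<^sup>+x. ennreal ?C * ?J x + ennreal (2 powr p * M powr p) * indicator U x \<partial>lebesgue)
      = (\<integral>\<^sup>+x. ennreal ?C * ?J x \<partial>lebesgue) + (\<integral>\<^sup>+x. ennreal (2 powr p * M powr p) * indicator U x \<partial>lebesgue)"
      by (intro nn_integral_add borel_measurable_times_ennreal JL borel_measurable_indicator UL) auto
    also have "(\<integral>\<^sup>+x. ennreal ?C * ?J x \<partial>lebesgue) = ennreal ?C * (\<integral>\<^sup>+x. ?J x \<partial>lebesgue)"
      by (rule nn_integral_cmult[OF JL])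
    also have "(\<integral>\<^sup>+x. ennreal (2 powr p * M powr p) * indicator U x \<partial>lebesgue) = ennreal (2 powr p * M powr p) * emeasure lebesgue U"
      by (rule nn_integral_cmult_indicator[OF UL])
    finally show ?thesis .
  qed
  also have "(\<integral>\<^sup>+x. ?J x \<partial>lebesgue) = (\<integral>\<^sup>+x. ?J x \<partial>lborel)"
    by (rule nn_integral_completion)
  also have "ennreal ?C * (\<integral>\<^sup>+x. ?J x \<partial>lborel) + ennreal (2 powr p * M powr p) * emeasure lebesgue U
     \<le> ennreal ?C * ennreal ((2 * h) ^ CARD('n) * ?G powr p) + ennreal (2 powr p * M powr p) * ennreal (measure lebesgue U)"
    using double_integral_cells_le[OF \<phi>U p h] unfolding VU GU by (intro add_mono mult_left_mono) auto
  also have "\<dots> = ennreal (?C * ((2 * h) ^ CARD('n) * ?G powr p) + 2 powr p * M powr p * measure lebesgue U)"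
    using V h by (intro comb) auto
  finally have "Lp_norm p U \<phi> powr p \<le> ?C * ((2 * h) ^ CARD('n) * ?G powr p) + 2 powr p * M powr p * measure lebesgue U"
    using V h by (subst (asm) ennreal_le_iff) auto
  also have "?C * ((2 * h) ^ CARD('n) * ?G powr p) = 2 powr p * (2 powr p * 2 ^ CARD('n) * ?G powr p)"
    using V by (simp add: V_def power_mult_distrib)
  finally show ?thesis by (simp add: algebra_simps)
qed

text \<open>Test functions approximate \<open>u\<close>. Since the cell integrals of
  \<open>u\<close> vanish, those of the n-th approximant are at most its 1-distance to
  \<open>u\<close>, which is \<open>M n\<close> times the cell volume, and \<open>M n\<close> tends
  to 0; norms and gradient norms pass to the limit.\<close>

lemma cell_poincare:
  fixes u :: "real^'n \<Rightarrow> real" and U :: "(real^'n) set" and h :: real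
  assumes U: "open U" "bounded U" and p: "p > 1" and h: "h > 0" and u: "u \<in> W01p p U"
    and zero: "\<And>k. (LINT x|lebesgue_on U. indicator (cell h k) x * u x) = 0"
  shows "Lp_norm p U u powr p \<le> 2 powr p * (2 powr p * 2 ^ CARD('n) *
      (CARD('n) * h * Lp_norm p U (weak_gradient U u)) powr p)"
proof -
  have UL: "U \<in> sets lebesgue" using U by auto
  have uW: "u \<in> W1p p U" by (rule W01p_subset_W1p[OF u])
  define V where "V = h ^ CARD('n)"
  have V: "V > 0" using h by (simp add: V_def)
  have "\<forall>n. \<exists>\<phi>\<in>test_functions U. W1p_norm p U (\<lambda>x. u x - \<phi> x) < 1 / real (Suc n)"
    using u by (simp add: W01p_def del: of_nat_Suc)
  then obtain \<phi> where \<phi>: "\<And>n. \<phi> n \<in> test_functions U" "\<And>n. W1p_norm p U (\<lambda>x. u x - \<phi> n x) < 1 / real (Suc n)"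
    by metis
  have \<phi>W: "\<phi> n \<in> W1p p U" for n using test_function_W01p(1)[OF U(1) \<phi>(1)] p by simp
  have d: "(\<lambda>x. u x - \<phi> n x) \<in> Lp p U" for n
    using Lp_diff[OF _ W1pD(1)[OF U(1) uW] W1pD(1)[OF U(1) \<phi>W]] p by simp
  have null: "(\<lambda>n. 1 / real (Suc n)) \<longlonglongrightarrow> 0"
    using LIMSEQ_inverse_real_of_nat by (simp add: inverse_eq_divide)
  define M where "M n = (LINT x|lebesgue_on U. norm (u x - \<phi> n x)) / V" for n
  have M0: "M n \<ge> 0" for n using V by (simp add: M_def)
  have "(\<lambda>n. LINT x|lebesgue_on U. norm (u x - \<phi> n x)) \<longlonglongrightarrow> 0"
  proof (rule LIMSEQ_I)
    fix e :: real assume e: "e > 0"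
    obtain \<delta> where \<delta>: "\<delta> > 0" "\<And>f :: real^'n \<Rightarrow> real. f \<in> Lp p U \<Longrightarrow> Lp_norm p U f < \<delta> \<Longrightarrow> (LINT x|lebesgue_on U. norm (f x)) < e"
      using Lp_norm_small_L1_small[OF U(2) UL p e] by blast
    obtain n0 where n0: "\<And>n. n \<ge> n0 \<Longrightarrow> 1 / real (Suc n) < \<delta>"
      using LIMSEQ_D[OF null \<delta>(1)] by fastforce
    have "(LINT x|lebesgue_on U. norm (u x - \<phi> n x)) < e" if "n \<ge> n0" for n
      using \<delta>(2)[OF d[of n]] n0[OF that] \<phi>(2)[of n] Lp_norm_le_W1p_norm(1)[of p U "\<lambda>x. u x - \<phi> n x"] p by linarith
    then show "\<exists>no. \<forall>n\<ge>no. norm ((LINT x|lebesgue_on U. norm (u x - \<phi> n x)) - 0) < e"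
      by (intro exI[of _ n0]) simp
  qed
  then have Mlim: "M \<longlonglongrightarrow> 0" unfolding M_def using V by (intro tendsto_eq_intros) auto
  have cells: "\<bar>LINT y|lebesgue_on (cell h k). \<phi> n y\<bar> \<le> M n * h ^ CARD('n)" for n k
  proof -
    let ?Q = "cell h k"
    have Q: "?Q \<in> sets lebesgue" using cell_borel[of h k] by (auto intro!: sets_completionI_sets)
    have i: "integrable (lebesgue_on U) (\<lambda>x. indicator ?Q x * f x)" if f: "f \<in> Lp p U" for f :: "real^'n \<Rightarrow> real"
    proof (rule Bochner_Integration.integrable_bound[OF Lp_integrable(1)[OF U(2) UL f p]])
      show "(\<lambda>x. indicator ?Q x * f x) \<in> borel_measurable (lebesgue_on U)"
        by (rule borel_measurable_times[OF measurable_restrict_space1[OF borel_measurable_indicator[OF Q]]])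
           (use f in \<open>simp add: Lp_def\<close>)
    qed (auto simp: indicator_def)
    obtain K where K: "K \<subseteq> U" "\<And>x. x \<notin> K \<Longrightarrow> \<phi> n x = 0" using test_functionsE[OF \<phi>(1)[of n]] by metis
    have "(LINT y|lebesgue_on ?Q. \<phi> n y) = (LINT y|lebesgue. indicator ?Q y * \<phi> n y)"
      using Q by (simp add: integral_restrict_space)
    also have "\<dots> = (LINT y|lebesgue_on U. indicator ?Q y * \<phi> n y)"
      using K by (intro integrable_lebesgue_on_support(2)[OF UL, symmetric]) auto
    also have "\<dots> = - (LINT y|lebesgue_on U. indicator ?Q y * (u y - \<phi> n y))"
      using zero[of k] i[OF W1pD(1)[OF U(1) uW]] i[OF W1pD(1)[OF U(1) \<phi>W[of n]]] by (simp add: right_diff_distrib)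
    finally have "\<bar>LINT y|lebesgue_on ?Q. \<phi> n y\<bar> \<le> (LINT y|lebesgue_on U. norm (indicator ?Q y * (u y - \<phi> n y)))"
      using integral_norm_bound[of "lebesgue_on U" "\<lambda>y. indicator ?Q y * (u y - \<phi> n y)"] by simp
    also have "\<dots> \<le> (LINT y|lebesgue_on U. norm (u y - \<phi> n y))"
      by (intro integral_mono integrable_norm i[OF d] Lp_integrable(1)[OF U(2) UL d p]) (auto simp: indicator_def)
    also have "\<dots> = M n * h ^ CARD('n)" using h by (simp add: M_def V_def)
    finally show ?thesis .
  qed
  have lim: "(\<lambda>n. a n) \<longlonglongrightarrow> b" if "\<And>n. a n \<le> b + 1 / real (Suc n)" "\<And>n. b \<le> a n + 1 / real (Suc n)" for a b
  proof (rule tendsto_sandwich)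
    show "(\<lambda>n. b - 1 / real (Suc n)) \<longlonglongrightarrow> b" "(\<lambda>n. b + 1 / real (Suc n)) \<longlonglongrightarrow> b"
      using tendsto_diff[OF tendsto_const[of b] null] tendsto_add[OF tendsto_const[of b] null] by simp_all
    show "\<forall>\<^sub>F n in sequentially. b - 1 / real (Suc n) \<le> a n"
      by (intro always_eventually allI) (use that(2) in \<open>simp add: diff_le_eq\<close>)
    show "\<forall>\<^sub>F n in sequentially. a n \<le> b + 1 / real (Suc n)"
      by (intro always_eventually allI that(1))
  qed
  have bounds: "Lp_norm p U (\<phi> n) \<le> Lp_norm p U u + 1 / real (Suc n)" "Lp_norm p U u \<le> Lp_norm p U (\<phi> n) + 1 / real (Suc n)"
    "Lp_norm p U (gradient (\<phi> n)) \<le> Lp_norm p U (weak_gradient U u) + 1 / real (Suc n)"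
    "Lp_norm p U (weak_gradient U u) \<le> Lp_norm p U (gradient (\<phi> n)) + 1 / real (Suc n)" for n
    using W1p_diff_bounds[OF U(1) less_imp_le[OF p] \<phi>W[of n] uW] \<phi>(2)[of n] test_function_weak_gradient[OF U(1) \<phi>(1)[of n], of p]
    by linarith+
  have L1: "(\<lambda>n. Lp_norm p U (\<phi> n)) \<longlonglongrightarrow> Lp_norm p U u" by (rule lim[OF bounds(1,2)])
  have L2: "(\<lambda>n. Lp_norm p U (gradient (\<phi> n))) \<longlonglongrightarrow> Lp_norm p U (weak_gradient U u)" by (rule lim[OF bounds(3,4)])
  let ?N = "real CARD('n)"
  have "(\<lambda>n. Lp_norm p U (\<phi> n) powr p) \<longlonglongrightarrow> Lp_norm p U u powr p"
    using p L1 by (intro tendsto_powr' tendsto_const) (auto simp: Lp_norm_nonneg)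
  moreover have "(\<lambda>n. 2 powr p * (2 powr p * 2 ^ CARD('n) * (?N * h * Lp_norm p U (gradient (\<phi> n))) powr p + M n powr p * measure lebesgue U))
    \<longlonglongrightarrow> 2 powr p * (2 powr p * 2 ^ CARD('n) * (?N * h * Lp_norm p U (weak_gradient U u)) powr p + 0 powr p * measure lebesgue U)"
    using p h L2 Mlim M0 by (intro tendsto_mult tendsto_add tendsto_powr' tendsto_const) (auto simp: Lp_norm_nonneg)
  moreover have "Lp_norm p U (\<phi> n) powr p \<le> 2 powr p * (2 powr p * 2 ^ CARD('n) *
      (?N * h * Lp_norm p U (gradient (\<phi> n))) powr p + M n powr p * measure lebesgue U)" for n
    by (rule test_function_cell_estimate[OF U \<phi>(1) p h M0 cells])
  ultimately have "Lp_norm p U u powr p \<le> 2 powr p * (2 powr p * 2 ^ CARD('n) * (?N * h * Lp_norm p U (weak_gradient U u)) powr p + 0 powr p * measure lebesgue U)"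
    by (blast intro: LIMSEQ_le)
  then show ?thesis using p by simp
qed

text \<open>On a fine grid a function of norm 1 and energy below \<open>R\<close> cannot have all
  cell integrals 0, by \<open>cell_poincare\<close>. Only finitely many cells meet the bounded set,
  so the normalised vector of cell integrals is an odd continuous map into a sphere whose dimension
  depends on \<open>R\<close> but not on \<open>A\<close>.\<close>

lemma genus_bounded_by_energy:
  fixes U :: "(real^'n) set"
  assumes U: "open U" "bounded U" and p: "p > 1" and R: "R \<ge> 0"
  obtains M where "\<And>A. A \<subseteq> Lp_sphere p U \<Longrightarrow> (\<And>u. u \<in> A \<Longrightarrow> p_energy p U u < R) \<Longrightarrow> genus p U A \<le> enat M"
proof -
  let ?N = "real CARD('n)"
  define C where "C = 2 powr p * (2 powr p * 2 ^ CARD('n))"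
  have C: "C > 0" by (simp add: C_def)
  \<comment> \<open>This gives s C R < 1, and the mesh \<open>h\<close> is then fixed by (N h)^p =
    s; the summand 1 keeps the denominator positive for R = 0.\<close>
  define s where "s = 1 / (2 * (C * R + 1))"
  have CR: "C * R + 1 > 0" using C R by (simp add: add_nonneg_pos)
  have s: "s > 0" using CR by (simp add: s_def)
  have sCR: "s * (C * R) < 1"
  proof -
    have "s * (C * R) \<le> s * (C * R + 1)" using s by (intro mult_left_mono) auto
    also have "\<dots> = 1 / 2" using CR by (simp add: s_def)
    finally show ?thesis by simp
  qed
  define h where "h = s powr (1 / p) / ?N"
  have h: "h > 0" using s by (simp add: h_def)
  have Nh: "(?N * h) powr p = s" using s p by (simp add: h_def powr_powr)
  define L where "L k u = (LINT x|lebesgue_on U. indicator (cell h k) x * u x)" for k :: "'n \<Rightarrow> int" and u :: "real^'n \<Rightarrow> real"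
  define K where "K = {k :: 'n \<Rightarrow> int. cell h k \<inter> U \<noteq> {}}"
  have "finite K"
  proof -
    obtain B where B: "\<And>x. x \<in> U \<Longrightarrow> norm x \<le> B" using U(2) unfolding bounded_iff by blast
    have "k i \<in> {\<lfloor>- B / h\<rfloor>..\<lfloor>B / h\<rfloor>}" if k: "k \<in> K" for k i
    proof -
      obtain x where x: "x \<in> cell h k" "x \<in> U" using k by (auto simp: K_def)
      have "\<bar>x $ i\<bar> \<le> B" using component_le_norm_cart[of x i] B[OF x(2)] by linarith
      then have "- B \<le> x $ i" "x $ i \<le> B" by linarith+
      then have "- B / h \<le> x $ i / h" "x $ i / h \<le> B / h" using h by (intro divide_right_mono; simp)+
      moreover have "k i = \<lfloor>x $ i / h\<rfloor>" using x(1) by (simp add: cell_def)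
      ultimately show ?thesis by (auto intro: floor_mono)
    qed
    then have "K \<subseteq> (UNIV :: 'n set) \<rightarrow>\<^sub>E {\<lfloor>- B / h\<rfloor>..\<lfloor>B / h\<rfloor>}" by (auto simp: PiE_UNIV_domain)
    then show ?thesis by (rule finite_subset) (intro finite_PiE; simp)
  qed
  then obtain e where e: "bij_betw e {0..<card K} K" using ex_bij_betw_nat_finite by blast
  show thesis
  proof (rule that)
    fix A assume A: "A \<subseteq> Lp_sphere p U" and E: "\<And>u. u \<in> A \<Longrightarrow> p_energy p U u < R"
    define S where "S u = sqrt (\<Sum>i<card K. (L (e i) u)\<^sup>2)" for u
    have S: "S u > 0" if u: "u \<in> A" for u
    proof (rule ccontr)
      assume "\<not> S u > 0"
      moreover have "(\<Sum>i<card K. (L (e i) u)\<^sup>2) \<ge> 0" by (intro sum_nonneg) auto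
      ultimately have "(\<Sum>i<card K. (L (e i) u)\<^sup>2) = 0" unfolding S_def by (simp add: not_less)
      then have Le: "L (e i) u = 0" if "i < card K" for i using that by (simp add: sum_nonneg_eq_0_iff)
      have zero: "L k u = 0" for k
      proof (cases "k \<in> K")
        case True
        then obtain i where "i < card K" "e i = k" using e by (force simp: bij_betw_def)
        then show ?thesis using Le by blast
      next
        case False
        then have "L k u = (LINT x|lebesgue_on U. 0)"
          unfolding L_def by (intro Bochner_Integration.integral_cong) (auto simp: K_def indicator_def)
        then show ?thesis by simp
      qed
      have uS: "u \<in> W01p p U" "Lp_norm p U u = 1" using A u by (auto simp: Lp_sphere_def)
      have "1 \<le> 2 powr p * (2 powr p * 2 ^ CARD('n) * (?N * h * Lp_norm p U (weak_gradient U u)) powr p)"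
        using cell_poincare[OF U p h uS(1)] zero uS(2) by (simp add: L_def)
      also have "(?N * h * Lp_norm p U (weak_gradient U u)) powr p = s * p_energy p U u"
        using h p by (simp add: powr_mult Lp_norm_nonneg Nh p_energy_eq_Lp_norm flip: Nh)
      also have "2 powr p * (2 powr p * 2 ^ CARD('n) * (s * p_energy p U u)) = s * (C * p_energy p U u)"
        by (simp add: C_def mult_ac)
      also have "\<dots> \<le> s * (C * R)" using s C E[OF u] by (intro mult_left_mono) auto
      finally show False using sCR by simp
    qed
    \<comment> \<open>The coordinate with index \<open>card K\<close> is always 0. This spare
      dimension keeps the genus index positive even if \<open>K\<close> is empty.\<close>
    define f where "f u i = (if i < card K then L (e i) u / S u else 0)" for u and i :: nat
    let ?T = "subtopology (W01p_topology p U) A"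
    have Lc: "continuous_map ?T euclideanreal (L k)" for k
      unfolding L_def using cell_borel[of h k]
      by (intro continuous_map_from_subtopology continuous_map_W01p_integral[OF U p]) (auto intro!: sets_completionI_sets)
    have "continuous_map ?T euclideanreal (\<lambda>u. \<Sum>i<card K. (L (e i) u)\<^sup>2)"
      by (intro continuous_map_sum continuous_map_real_pow Lc) auto
    then have Sc: "continuous_map ?T euclideanreal S"
      unfolding S_def by (rule continuous_map_sqrt)
    have "continuous_map ?T (nsphere (Suc (card K) - 1)) f"
    proof (rule continuous_map_into_nsphere)
      show "continuous_map ?T euclideanreal (\<lambda>u. f u i)" for i
      proof (cases "i < card K")
        case True
        have "S u \<noteq> 0" if "u \<in> topspace ?T" for u using S[of u] that by auto
        then have "continuous_map ?T euclideanreal (\<lambda>u. L (e i) u / S u)"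
          by (rule continuous_map_real_divide[OF Lc Sc])
        then show ?thesis using True by (simp add: f_def)
      qed (simp add: f_def)
      fix u assume "u \<in> topspace ?T"
      then have Su: "S u > 0" using S by auto
      have "(\<Sum>i\<le>card K. (f u i)\<^sup>2) = (\<Sum>i<card K. (f u i)\<^sup>2)"
        by (simp add: f_def flip: lessThan_Suc_atMost)
      also have "\<dots> = (\<Sum>i<card K. (L (e i) u)\<^sup>2 / (S u)\<^sup>2)"
        by (intro sum.cong) (auto simp: f_def power_divide)
      also have "\<dots> = (\<Sum>i<card K. (L (e i) u)\<^sup>2) / (S u)\<^sup>2" by (simp add: sum_divide_distrib)
      also have "(\<Sum>i<card K. (L (e i) u)\<^sup>2) = (S u)\<^sup>2"
        unfolding S_def by (simp add: sum_nonneg)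
      finally have "(\<Sum>i\<le>card K. (f u i)\<^sup>2) = 1" using Su by simp
      then show "f u \<in> topspace (nsphere (Suc (card K) - 1))"
        by (simp add: topspace_nsphere f_def)
    qed
    moreover have "f (\<lambda>x. - u x) i = - f u i" for u i
      by (simp add: f_def S_def L_def)
    ultimately have "enat (Suc (card K)) \<in> {enat k |k. k \<ge> 1 \<and>
       (\<exists>f. continuous_map (subtopology (W01p_topology p U) A) (nsphere (k - 1)) f \<and>
          (\<forall>u\<in>A. \<forall>i. f (\<lambda>x. - u x) i = - f u i))}"
      by (intro CollectI exI[of _ "Suc (card K)"] conjI exI[of _ f]) simp_all
    then show "genus p U A \<le> enat (Suc (card K))"
      unfolding genus_def by (rule Inf_lower)
  qed
qed

section \<open>Sets of prescribed genus\<close>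

text \<open>\<open>nsphere\<close> lives in an infinite product of lines, so compactness comes from
  Tychonoff's theorem: the sphere is closed and contained in the product of the intervals
  [-1, 1].\<close>

lemma compactin_topspace_nsphere: "compactin (nsphere n) (topspace (nsphere n))"
proof -
  let ?P = "powertop_real UNIV :: (nat \<Rightarrow> real) topology"
  define C where "C = topspace (nsphere n)"
  have C: "C = {x \<in> topspace ?P. (\<Sum>i\<le>n. (x i)\<^sup>2) \<in> {1}} \<inter> (\<Inter>j\<in>{n<..}. {x \<in> topspace ?P. x j \<in> {0}})"
    by (auto simp: C_def topspace_nsphere)
  have proj: "continuous_map ?P euclideanreal (\<lambda>x. x j)" for j
    by (rule continuous_map_product_projection) simp
  have "closedin ?P C"
    unfolding C
  proof (intro closedin_Int closedin_INT)
    show "closedin ?P {x \<in> topspace ?P. (\<Sum>i\<le>n. (x i)\<^sup>2) \<in> {1}}"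
      by (rule closedin_continuous_map_preimage[of ?P euclideanreal])
         (auto intro!: continuous_map_sum continuous_map_real_pow proj)
    show "closedin ?P {x \<in> topspace ?P. x j \<in> {0}}" if "j \<in> {n<..}" for j
      by (rule closedin_continuous_map_preimage[OF proj]) simp
  qed auto
  moreover have "compactin ?P (PiE UNIV (\<lambda>_. {-1..1}))"
    by (simp add: compactin_PiE)
  moreover have "C \<subseteq> PiE UNIV (\<lambda>_. {-1..1})"
  proof
    fix x assume x: "x \<in> C"
    have "x i \<in> {-1..1}" for i
      using topspace_nsphere_1[of x n i] x by (auto simp: C_def abs_square_le_1 abs_le_iff)
    then show "x \<in> PiE UNIV (\<lambda>_. {-1..1})" by (simp add: PiE_UNIV_domain)
  qed
  ultimately have "compactin ?P C" by (metis closed_compactin)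
  moreover have "nsphere n = subtopology ?P C"
    unfolding C_def nsphere by simp
  ultimately show ?thesis
    unfolding C_def[symmetric] by (metis compactin_subtopology order_refl)
qed

text \<open>An odd map from the image into a sphere of dimension below \<open>n\<close>, composed
  with \<open>F\<close>, would contradict the Borsuk-Ulam theorem.\<close>

lemma genus_ge_sphere_image:
  assumes F: "continuous_map (nsphere n) (W01p_topology p U) F"
    and odd: "\<And>x. x \<in> topspace (nsphere n) \<Longrightarrow> F (antipode x) = (\<lambda>y. - F x y)"
  shows "genus p U (F ` topspace (nsphere n)) \<ge> enat (Suc n)"
  unfolding genus_def
proof (rule Inf_greatest, clarify)
  fix j f
  let ?A = "F ` topspace (nsphere n)"
  assume j: "j \<ge> 1" and f: "continuous_map (subtopology (W01p_topology p U) ?A) (nsphere (j - 1)) f"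
    and fodd: "\<forall>u\<in>?A. \<forall>i. f (\<lambda>x. - u x) i = - f u i"
  show "enat (Suc n) \<le> enat j"
  proof (rule ccontr)
    assume "\<not> enat (Suc n) \<le> enat j"
    then have less: "j - 1 < n" using j by simp
    have "continuous_map (nsphere n) (subtopology (W01p_topology p U) ?A) F"
      using F by (simp add: continuous_map_in_subtopology)
    then have "continuous_map (nsphere n) (nsphere (j - 1)) (f \<circ> F)"
      using f by (rule continuous_map_compose)
    then show False
    proof (rule Borsuk_Ulam_nsphere[OF less])
      fix x assume x: "x \<in> topspace (nsphere n)"
      then have "f (\<lambda>y. - F x y) i = - f (F x) i" for i using fodd by blast
      then show "(f \<circ> F) (antipode x) = antipode ((f \<circ> F) x)"
        unfolding o_def odd[OF x] by (simp add: fun_eq_iff)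
    qed
  qed
qed

section \<open>Combinations of functions with disjoint supports\<close>

lemma sum_disjoint_powr:
  fixes a :: "'i \<Rightarrow> 'b::real_normed_vector"
  assumes "finite I" "\<And>i j. i \<in> I \<Longrightarrow> j \<in> I \<Longrightarrow> i \<noteq> j \<Longrightarrow> a i = 0 \<or> a j = 0"
  shows "norm (\<Sum>i\<in>I. a i) powr p = (\<Sum>i\<in>I. norm (a i) powr p)"
proof (cases "\<exists>i\<in>I. a i \<noteq> 0")
  case True
  then obtain i where i: "i \<in> I" "a i \<noteq> 0" by blast
  have 0: "a j = 0" if "j \<in> I - {i}" for j using assms(2)[of i j] i that by auto
  have "(\<Sum>j\<in>I. a j) = a i" using i 0 assms(1) by (subst sum.remove[of I i]) auto
  moreover have "(\<Sum>j\<in>I. norm (a j) powr p) = norm (a i) powr p"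
    using i 0 assms(1) by (subst sum.remove[of I i]) auto
  ultimately show ?thesis by simp
qed simp

lemma gradient_sum_cmult:
  assumes "\<And>i. i \<in> I \<Longrightarrow> smooth (\<psi> i)"
  shows "gradient (\<lambda>x. \<Sum>i\<in>I. c i * \<psi> i x) x = (\<Sum>i\<in>I. c i *\<^sub>R gradient (\<psi> i) x)"
proof -
  have "GDERIV (\<lambda>x. c i * \<psi> i x) x :> c i *\<^sub>R gradient (\<psi> i) x" if "i \<in> I" for i
    using GDERIV_mult[OF GDERIV_const[of "c i" x] GDERIV_smooth[OF assms[OF that]]] by simp
  then show ?thesis by (intro gradient_eqI GDERIV_sum)
qed

lemma Lp_norm_sum_disjoint:
  fixes f :: "'i \<Rightarrow> real^'n \<Rightarrow> 'b::euclidean_space"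
  assumes "finite I" and p: "p > 0" and f: "\<And>i. i \<in> I \<Longrightarrow> f i \<in> Lp p U"
    and dis: "\<And>i j x. i \<in> I \<Longrightarrow> j \<in> I \<Longrightarrow> i \<noteq> j \<Longrightarrow> f i x = 0 \<or> f j x = 0"
  shows "Lp_norm p U (\<lambda>x. \<Sum>i\<in>I. c i *\<^sub>R f i x) powr p = (\<Sum>i\<in>I. \<bar>c i\<bar> powr p * Lp_norm p U (f i) powr p)"
proof -
  have "norm (\<Sum>i\<in>I. c i *\<^sub>R f i x) powr p = (\<Sum>i\<in>I. norm (c i *\<^sub>R f i x) powr p)" for x
    using assms(1) dis by (intro sum_disjoint_powr) auto
  then have "Lp_norm p U (\<lambda>x. \<Sum>i\<in>I. c i *\<^sub>R f i x) powr p = (LINT x|lebesgue_on U. (\<Sum>i\<in>I. \<bar>c i\<bar> powr p * norm (f i x) powr p))"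
    using p by (simp add: Lp_norm_powr powr_mult)
  also have "\<dots> = (\<Sum>i\<in>I. \<bar>c i\<bar> powr p * (LINT x|lebesgue_on U. norm (f i x) powr p))"
    using f by (subst Bochner_Integration.integral_sum) (auto simp: Lp_def intro: integrable_mult_right)
  finally show ?thesis using p by (simp add: Lp_norm_powr)
qed

lemma continuous_map_linear_combination:
  fixes U :: "(real^'n) set"
  assumes U: "open U" "bounded U" and p: "p > 0" and I: "finite I"
    and \<psi>: "\<And>i. i \<in> I \<Longrightarrow> \<psi> i \<in> test_functions U"
    and c: "\<And>i. i \<in> I \<Longrightarrow> continuous_map T euclideanreal (c i)"
  shows "continuous_map T (W01p_topology p U) (\<lambda>t x. \<Sum>i\<in>I. c i t * \<psi> i x)"
proof (rule continuous_map_test_functions[OF U p])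
  fix t assume t: "t \<in> topspace T"
  show "(\<lambda>x. \<Sum>i\<in>I. c i t * \<psi> i x) \<in> test_functions U"
    by (intro test_functions_sum test_functions_cmult \<psi>)
  fix \<epsilon> :: real assume \<epsilon>: "\<epsilon> > 0"
  have "\<exists>B\<ge>0. \<forall>x. \<bar>\<psi> i x\<bar> \<le> B \<and> norm (gradient (\<psi> i) x) \<le> B" if "i \<in> I" for i
    using test_functionsE[OF \<psi>[OF that]] by metis
  then obtain B where B: "\<And>i. i \<in> I \<Longrightarrow> B i \<ge> 0" "\<And>i x. i \<in> I \<Longrightarrow> \<bar>\<psi> i x\<bar> \<le> B i"
    "\<And>i x. i \<in> I \<Longrightarrow> norm (gradient (\<psi> i) x) \<le> B i" by metis
  define g where "g s = (\<Sum>i\<in>I. \<bar>c i s - c i t\<bar> * B i)" for s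
  have "continuous_map T euclideanreal g"
    unfolding g_def using c I by (intro continuous_map_sum continuous_map_real_mult continuous_map_real_abs continuous_map_diff) auto
  then have V: "openin T {s \<in> topspace T. g s \<in> {..<\<epsilon>}}"
    by (rule openin_continuous_map_preimage) simp
  have sm: "smooth (\<psi> i)" if "i \<in> I" for i using \<psi>[OF that] by (rule test_functions_smooth)
  have main: "\<bar>(\<Sum>i\<in>I. c i s * \<psi> i x) - (\<Sum>i\<in>I. c i t * \<psi> i x)\<bar> \<le> \<epsilon> \<and>
    norm (gradient (\<lambda>x. \<Sum>i\<in>I. c i s * \<psi> i x) x - gradient (\<lambda>x. \<Sum>i\<in>I. c i t * \<psi> i x) x) \<le> \<epsilon>" if s: "g s < \<epsilon>" for s x
  proof
    have "\<bar>(\<Sum>i\<in>I. c i s * \<psi> i x) - (\<Sum>i\<in>I. c i t * \<psi> i x)\<bar> = \<bar>\<Sum>i\<in>I. (c i s - c i t) * \<psi> i x\<bar>"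
      by (simp add: left_diff_distrib sum_subtractf)
    also have "\<dots> \<le> (\<Sum>i\<in>I. \<bar>(c i s - c i t) * \<psi> i x\<bar>)" by (rule sum_abs)
    also have "\<dots> \<le> g s"
      unfolding g_def abs_mult by (intro sum_mono mult_left_mono B) auto
    finally show "\<bar>(\<Sum>i\<in>I. c i s * \<psi> i x) - (\<Sum>i\<in>I. c i t * \<psi> i x)\<bar> \<le> \<epsilon>" using s by simp
    have "norm (gradient (\<lambda>x. \<Sum>i\<in>I. c i s * \<psi> i x) x - gradient (\<lambda>x. \<Sum>i\<in>I. c i t * \<psi> i x) x)
      = norm (\<Sum>i\<in>I. (c i s - c i t) *\<^sub>R gradient (\<psi> i) x)"
      using gradient_sum_cmult[of I \<psi> "\<lambda>i. c i s" x] gradient_sum_cmult[of I \<psi> "\<lambda>i. c i t" x] sm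
      by (simp add: scaleR_left_diff_distrib sum_subtractf)
    also have "\<dots> \<le> (\<Sum>i\<in>I. norm ((c i s - c i t) *\<^sub>R gradient (\<psi> i) x))" by (rule norm_sum)
    also have "\<dots> \<le> g s"
      unfolding g_def norm_scaleR by (intro sum_mono mult_left_mono B) auto
    finally show "norm (gradient (\<lambda>x. \<Sum>i\<in>I. c i s * \<psi> i x) x - gradient (\<lambda>x. \<Sum>i\<in>I. c i t * \<psi> i x) x) \<le> \<epsilon>"
      using s by simp
  qed
  show "\<exists>V. openin T V \<and> t \<in> V \<and> (\<forall>s\<in>V. \<forall>x\<in>U. \<bar>(\<Sum>i\<in>I. c i s * \<psi> i x) - (\<Sum>i\<in>I. c i t * \<psi> i x)\<bar> \<le> \<epsilon> \<and>
     norm (gradient (\<lambda>x. \<Sum>i\<in>I. c i s * \<psi> i x) x - gradient (\<lambda>x. \<Sum>i\<in>I. c i t * \<psi> i x) x) \<le> \<epsilon>)"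
    using V t \<epsilon> main by (intro exI[of _ "{s \<in> topspace T. g s \<in> {..<\<epsilon>}}"]) (simp add: g_def)
qed

text \<open>The odd function with \<open>\<bar>signed_powr q t\<bar> = \<bar>t\<bar> powr q\<close>, in a form whose continuity is evident.\<close>

definition signed_powr :: "real \<Rightarrow> real \<Rightarrow> real" where
  "signed_powr q t = max t 0 powr q - max (- t) 0 powr q"

lemma abs_signed_powr: "\<bar>signed_powr q t\<bar> = \<bar>t\<bar> powr q"
  by (cases "t \<ge> 0") (auto simp: signed_powr_def max_def)

lemma signed_powr_minus [simp]: "signed_powr q (- t) = - signed_powr q t"
  by (simp add: signed_powr_def)

lemma continuous_on_signed_powr: "q > 0 \<Longrightarrow> continuous_on S (signed_powr q)"
  unfolding signed_powr_def[abs_def]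
  by (intro continuous_on_diff continuous_on_powr' continuous_on_max continuous_on_minus continuous_on_id continuous_on_const) auto

lemma Lp_norm_test_function_pos:
  fixes U :: "(real^'n) set"
  assumes U: "open U" and \<phi>: "\<phi> \<in> test_functions U" and p: "p > 0" and x: "\<phi> x0 \<noteq> 0"
  shows "Lp_norm p U \<phi> > 0"
proof (rule ccontr)
  assume "\<not> Lp_norm p U \<phi> > 0"
  then have 0: "Lp_norm p U \<phi> = 0" using Lp_norm_nonneg[of p U \<phi>] by linarith
  have UL: "U \<in> sets lebesgue" using U by auto
  have "(LINT x|lebesgue_on U. norm (\<phi> x) powr p) = 0"
    using Lp_norm_powr[OF p, of U \<phi>] 0 by simp
  moreover have "integrable (lebesgue_on U) (\<lambda>x. norm (\<phi> x) powr p)"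
    using test_function_Lp(1)[OF UL \<phi> p] by (simp add: Lp_def)
  ultimately have "AE x in lebesgue_on U. norm (\<phi> x) powr p = 0"
    by (subst integral_nonneg_eq_0_iff_AE[symmetric]) auto
  then have "AE x in lebesgue. x \<in> U \<longrightarrow> \<phi> x = 0"
    using UL by (subst (asm) AE_restrict_space_iff) (auto elim!: eventually_mono)
  moreover have off: "\<phi> x = 0" if "x \<notin> U" for x
    using \<phi> that by (auto simp: test_functions_def)
  ultimately have "AE x in lebesgue. \<phi> x = 0" by (auto elim!: eventually_mono)
  moreover have op: "open {x. \<phi> x \<noteq> 0}"
    using smooth_continuous_on[OF test_functions_smooth[OF \<phi>], of UNIV] by (intro open_Collect_neq continuous_on_const)
  then have S: "{x. \<phi> x \<noteq> 0} \<in> sets lebesgue" by auto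
  ultimately have "emeasure lebesgue {x. \<phi> x \<noteq> 0} = 0"
    by (subst (asm) AE_iff_measurable[OF S]) auto
  then have "negligible {x. \<phi> x \<noteq> 0}" using S by (auto simp: negligible_iff_null_sets null_sets_def)
  then show False using open_not_negligible[OF op] x by auto
qed

text \<open>A box inside \<open>U\<close> is cut into n + 1 slabs by equally spaced hyperplanes
  orthogonal to one coordinate axis, and each open slab carries a normalised bump.\<close>

lemma disjoint_test_functions:
  fixes U :: "(real^'n) set"
  assumes U: "open U" "U \<noteq> {}" and p: "p > 0"
  obtains \<psi> :: "nat \<Rightarrow> real^'n \<Rightarrow> real" where "\<And>i. i \<le> n \<Longrightarrow> \<psi> i \<in> test_functions U"
    "\<And>i. i \<le> n \<Longrightarrow> Lp_norm p U (\<psi> i) = 1" "\<And>i j x. i \<le> n \<Longrightarrow> j \<le> n \<Longrightarrow> i \<noteq> j \<Longrightarrow> \<psi> i x = 0 \<or> \<psi> j x = 0"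
proof -
  obtain x0 where "x0 \<in> U" using U by blast
  then obtain A B where AB: "cbox A B \<subseteq> U" "x0 \<in> box A B"
    by (rule open_contains_cbox[OF U(1)])
  define k :: 'n where "k = undefined"
  have less: "A $ i < B $ i" for i using AB(2) by (auto simp: mem_box_cart intro: less_trans)
  define c where "c i = A $ k + (real i / real (Suc n)) * (B $ k - A $ k)" for i :: nat
  define a where "a i = (\<chi> j. if j = k then c i else A $ j)" for i
  define b where "b i = (\<chi> j. if j = k then c (Suc i) else B $ j)" for i
  have cmono: "c i \<le> c j" if "i \<le> j" for i j
    unfolding c_def using that less[of k] by (intro add_left_mono mult_right_mono divide_right_mono) auto
  have cstrict: "c i < c (Suc i)" for i
    unfolding c_def using less[of k] by (intro add_strict_left_mono mult_strict_right_mono divide_strict_right_mono) auto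
  have c0: "c 0 = A $ k" and cn: "c (Suc n) = B $ k" by (simp_all add: c_def)
  have sub: "cbox (a i) (b i) \<subseteq> U" if "i \<le> n" for i
  proof -
    have "c 0 \<le> c i" "c (Suc i) \<le> c (Suc n)" using that by (intro cmono; simp)+
    have "cbox (a i) (b i) \<subseteq> cbox A B"
    proof
      fix y assume y: "y \<in> cbox (a i) (b i)"
      have "A $ j \<le> y $ j \<and> y $ j \<le> B $ j" for j
        using y \<open>c 0 \<le> c i\<close> \<open>c (Suc i) \<le> c (Suc n)\<close> c0 cn unfolding mem_box_cart a_def b_def
        by (cases "j = k") (auto dest!: spec[of _ j])
      then show "y \<in> cbox A B" by (simp add: mem_box_cart)
    qed
    then show ?thesis using AB by blast
  qed
  define \<phi> where "\<phi> i = box_bump (a i) (b i) 0" for i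
  have \<phi>: "\<phi> i \<in> test_functions U" if "i \<le> n" for i
    unfolding \<phi>_def by (rule box_bump_test_function[OF sub[OF that]])
  have pos: "Lp_norm p U (\<phi> i) > 0" if "i \<le> n" for i
  proof (rule Lp_norm_test_function_pos[OF U(1) \<phi>[OF that] p])
    let ?m = "\<chi> j. (a i $ j + b i $ j) / 2"
    have "?m \<in> box (a i) (b i)"
      using less cstrict[of i] by (auto simp: mem_box_cart a_def b_def)
    then show "\<phi> i ?m \<noteq> 0" using box_bump_pos_iff[of "a i" "b i" 0 ?m] by (simp add: \<phi>_def)
  qed
  define \<psi> where "\<psi> i x = (1 / Lp_norm p U (\<phi> i)) * \<phi> i x" for i x
  show thesis
  proof (rule that[of \<psi>])
    fix i assume i: "i \<le> n"
    show "\<psi> i \<in> test_functions U" unfolding \<psi>_def by (rule test_functions_cmult[OF \<phi>[OF i]])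
    show "Lp_norm p U (\<psi> i) = 1"
      using Lp_cmult(2)[OF test_function_Lp(1)[OF _ \<phi>[OF i] p] p, of "1 / Lp_norm p U (\<phi> i)"] pos[OF i] U(1)
      by (simp add: \<psi>_def[abs_def])
    fix j x assume j: "j \<le> n" "i \<noteq> j"
    have "x \<notin> box (a i) (b i) \<or> x \<notin> box (a j) (b j)"
    proof (rule ccontr)
      assume "\<not> ?thesis"
      then have "x \<in> box (a i) (b i)" "x \<in> box (a j) (b j)" by auto
      then have "c i < x $ k" "x $ k < c (Suc i)" "c j < x $ k" "x $ k < c (Suc j)"
        unfolding mem_box_cart a_def b_def by (auto dest: spec[of _ k])
      moreover have "c (Suc i) \<le> c j \<or> c (Suc j) \<le> c i" using j(2) by (cases "i < j") (auto intro: cmono)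
      ultimately show False by linarith
    qed
    then show "\<psi> i x = 0 \<or> \<psi> j x = 0" by (auto simp: \<psi>_def \<phi>_def box_bump_eq_0)
  qed
qed

text \<open>Combinations of n + 1 disjointly supported unit functions form a copy of the n-sphere in
  the unit sphere of the p-norm. Nonemptiness is what makes the infimum defining the eigenvalue
  meaningful.\<close>

lemma genus_family_nonempty:
  fixes U :: "(real^'n) set"
  assumes U: "open U" "bounded U" "U \<noteq> {}" and p: "p > 1" and k: "k \<ge> 1"
  shows "genus_family p U k \<noteq> {}"
proof -
  obtain n where n: "k = Suc n" using k by (cases k) auto
  have UL: "U \<in> sets lebesgue" using U by auto
  have p0: "p > 0" using p by simp
  obtain \<psi> :: "nat \<Rightarrow> real^'n \<Rightarrow> real" where \<psi>: "\<And>i. i \<le> n \<Longrightarrow> \<psi> i \<in> test_functions U"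
    "\<And>i. i \<le> n \<Longrightarrow> Lp_norm p U (\<psi> i) = 1" "\<And>i j x. i \<le> n \<Longrightarrow> j \<le> n \<Longrightarrow> i \<noteq> j \<Longrightarrow> \<psi> i x = 0 \<or> \<psi> j x = 0"
    using disjoint_test_functions[OF U(1,3) p0] by blast
  \<comment> \<open>The exponent 2 / p turns Euclidean normalisation into p-normalisation: the p-th
    power of the absolute value of a coefficient is the square of the coordinate, and these add up
    to 1.\<close>
  define F where "F t x = (\<Sum>i\<in>{..n}. signed_powr (2 / p) (t i) * \<psi> i x)" for t :: "nat \<Rightarrow> real" and x
  have F: "continuous_map (nsphere n) (W01p_topology p U) F"
    unfolding F_def
  proof (rule continuous_map_linear_combination[OF U(1,2) p0])
    show "continuous_map (nsphere n) euclideanreal (\<lambda>t. signed_powr (2 / p) (t i))" for i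
      using continuous_map_compose[OF continuous_map_nsphere_projection[of n i], of euclideanreal "signed_powr (2 / p)"]
        continuous_on_signed_powr[of "2 / p" UNIV] p by (simp add: o_def)
  qed (use \<psi> in auto)
  have odd: "F (antipode t) = (\<lambda>y. - F t y)" for t
    by (simp add: F_def fun_eq_iff sum_negf)
  have test: "F t \<in> test_functions U" for t
    unfolding F_def by (intro test_functions_sum test_functions_cmult \<psi>) simp
  have norm1: "Lp_norm p U (F t) = 1" if t: "t \<in> topspace (nsphere n)" for t
  proof -
    have "Lp_norm p U (F t) powr p = (\<Sum>i\<in>{..n}. \<bar>signed_powr (2 / p) (t i)\<bar> powr p * Lp_norm p U (\<psi> i) powr p)"
      using Lp_norm_sum_disjoint[OF _ p0, of "{..n}" \<psi> U "\<lambda>i. signed_powr (2 / p) (t i)"]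
        test_function_Lp(1)[OF UL \<psi>(1) p0] \<psi>(3) by (simp add: F_def[abs_def])
    also have "\<dots> = (\<Sum>i\<in>{..n}. (t i)\<^sup>2)"
    proof (rule sum.cong)
      fix i assume "i \<in> {..n}"
      then show "\<bar>signed_powr (2 / p) (t i)\<bar> powr p * Lp_norm p U (\<psi> i) powr p = (t i)\<^sup>2"
        using p by (cases "t i = 0") (simp_all add: \<psi>(2) abs_signed_powr powr_powr)
    qed simp
    also have "\<dots> = 1" using t by (simp add: topspace_nsphere)
    finally have "Lp_norm p U (F t) powr p = 1" .
    then have "(Lp_norm p U (F t) powr p) powr (1 / p) = 1" by simp
    then show ?thesis using p by (simp add: powr_powr Lp_norm_nonneg)
  qed
  have "F ` topspace (nsphere n) \<in> genus_family p U k"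
    unfolding genus_family_def
  proof (intro CollectI conjI)
    show "F ` topspace (nsphere n) \<noteq> {}" by (simp add: topspace_nsphere) (use in_topspace_nsphere[of n] in \<open>auto simp: topspace_nsphere\<close>)
    show "F ` topspace (nsphere n) \<subseteq> Lp_sphere p U"
      using test_function_W01p(2)[OF U(1) test p0] norm1 by (auto simp: Lp_sphere_def)
    show "symmetric (F ` topspace (nsphere n))"
      unfolding symmetric_def
    proof
      fix u assume "u \<in> F ` topspace (nsphere n)"
      then obtain t where t: "t \<in> topspace (nsphere n)" "u = F t" by blast
      then show "(\<lambda>x. - u x) \<in> F ` topspace (nsphere n)"
        using odd[of t] by (intro image_eqI[of _ _ "antipode t"]) simp_all
    qed
    show "compactin (W01p_topology p U) (F ` topspace (nsphere n))"
      by (rule image_compactin[OF compactin_topspace_nsphere F])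
    show "enat k \<le> genus p U (F ` topspace (nsphere n))"
      unfolding n by (rule genus_ge_sphere_image[OF F odd])
  qed
  then show ?thesis by blast
qed

section \<open>The sequence of variational eigenvalues\<close>

lemma genus_family_antimono: "j \<le> k \<Longrightarrow> genus_family p U k \<subseteq> genus_family p U j"
proof
  fix A assume jk: "j \<le> k" and A: "A \<in> genus_family p U k"
  then have "enat j \<le> genus p U A" using order_trans[of "enat j" "enat k" "genus p U A"] by (simp add: genus_family_def)
  then show "A \<in> genus_family p U j" using A by (simp add: genus_family_def)
qed

lemma genus_family_energy:
  assumes "open U" "p > 1" "A \<in> genus_family p U k"
  shows "A \<noteq> {}" "bdd_above (p_energy p U ` A)" "0 \<le> (SUP u\<in>A. p_energy p U u)"
proof -
  show A: "A \<noteq> {}" and b: "bdd_above (p_energy p U ` A)"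
    using assms compactin_W01p_energy_bounded[of U p A] by (auto simp: genus_family_def)
  obtain u where "u \<in> A" using A by blast
  then show "0 \<le> (SUP u\<in>A. p_energy p U u)"
    using cSUP_upper2[OF b _ p_energy_nonneg] by simp
qed

lemma genus_family_bdd_below:
  "open U \<Longrightarrow> p > 1 \<Longrightarrow> bdd_below ((\<lambda>A. SUP u\<in>A. p_energy p U u) ` genus_family p U k)"
  by (rule bdd_belowI2[of _ 0]) (rule genus_family_energy(3))

lemma variational_eigenvalue_mono:
  fixes U :: "(real^'n) set"
  assumes "open U" "bounded U" "U \<noteq> {}" "p > 1" "1 \<le> j" "j \<le> k"
  shows "variational_eigenvalue p U j \<le> variational_eigenvalue p U k"
  unfolding variational_eigenvalue_def
proof (rule cINF_superset_mono)
  show "genus_family p U k \<noteq> {}" using assms by (intro genus_family_nonempty) auto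
  show "bdd_below ((\<lambda>A. SUP u\<in>A. p_energy p U u) ` genus_family p U j)"
    by (rule genus_family_bdd_below[OF assms(1,4)])
  show "genus_family p U k \<subseteq> genus_family p U j" by (rule genus_family_antimono[OF assms(6)])
qed simp

lemma variational_eigenvalue_le:
  assumes "open U" "p > 1" "A \<in> genus_family p U k" "\<And>u. u \<in> A \<Longrightarrow> p_energy p U u \<le> c"
  shows "variational_eigenvalue p U k \<le> c"
proof -
  have "variational_eigenvalue p U k \<le> (SUP u\<in>A. p_energy p U u)"
    unfolding variational_eigenvalue_def by (rule cINF_lower[OF genus_family_bdd_below[OF assms(1,2)] assms(3)])
  also have "\<dots> \<le> c" using genus_family_energy(1)[OF assms(1-3)] assms(4) by (rule cSUP_least)
  finally show ?thesis .
qed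

text \<open>If the genus of every set with energies below \<open>R\<close> is at most
  \<open>M\<close>, then a set of genus at least M + 1 contains a function of energy at least
  \<open>R\<close>.\<close>

lemma variational_eigenvalue_unbounded:
  fixes U :: "(real^'n) set"
  assumes U: "open U" "bounded U" "U \<noteq> {}" and p: "p > 1"
  obtains k where "k \<ge> 1" "R \<le> variational_eigenvalue p U k"
proof -
  obtain M where M: "\<And>A. A \<subseteq> Lp_sphere p U \<Longrightarrow> (\<And>u. u \<in> A \<Longrightarrow> p_energy p U u < max R 0) \<Longrightarrow> genus p U A \<le> enat M"
    using genus_bounded_by_energy[OF U(1,2) p, of "max R 0"] by auto
  have "R \<le> variational_eigenvalue p U (Suc M)"
    unfolding variational_eigenvalue_def
  proof (rule cINF_greatest)
    show "genus_family p U (Suc M) \<noteq> {}" by (rule genus_family_nonempty[OF U p]) simp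
    fix A assume A: "A \<in> genus_family p U (Suc M)"
    have AS: "A \<subseteq> Lp_sphere p U" using A by (simp add: genus_family_def)
    have "enat (Suc M) \<le> genus p U A" using A by (simp add: genus_family_def)
    then have "\<not> genus p U A \<le> enat M" using order_trans[of "enat (Suc M)" "genus p U A" "enat M"] by auto
    then have "\<exists>u\<in>A. max R 0 \<le> p_energy p U u" using M[OF AS] by (meson not_le)
    then obtain u where "u \<in> A" "max R 0 \<le> p_energy p U u" by blast
    then have "R \<le> p_energy p U u" by simp
    then show "R \<le> (SUP u\<in>A. p_energy p U u)"
      by (rule cSUP_upper2[OF genus_family_energy(2)[OF U(1) p A] \<open>u \<in> A\<close>])
  qed
  then show thesis using that[of "Suc M"] by simp
qed

text \<open>\<open>K\<close> is the first index whose value exceeds that at 2, and monotonicity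
  places it beyond N + 1. All values from 2 to K - 1 agree, a run of length K - 2 >= N, extended to
  K - 1 if index 1 also belongs to it.\<close>

lemma has_multiplicity_at_least:
  fixes \<mu> :: "nat \<Rightarrow> real"
  assumes mono: "\<And>j k. 1 \<le> j \<Longrightarrow> j \<le> k \<Longrightarrow> \<mu> j \<le> \<mu> k"
    and N: "N \<ge> 2" "\<mu> (N + 1) \<le> \<mu> 2" and large: "k0 \<ge> 1" "\<mu> 2 < \<mu> k0"
  shows "\<exists>m\<ge>N. has_multiplicity \<mu> 2 m"
proof -
  define K where "K = (LEAST k. k \<ge> 1 \<and> \<mu> 2 < \<mu> k)"
  have K: "K \<ge> 1" "\<mu> 2 < \<mu> K" using LeastI[of "\<lambda>k. k \<ge> 1 \<and> \<mu> 2 < \<mu> k" k0] large by (auto simp: K_def)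
  have below: "\<mu> j \<le> \<mu> 2" if "1 \<le> j" "j < K" for j
    using not_less_Least[of j "\<lambda>k. k \<ge> 1 \<and> \<mu> 2 < \<mu> k"] that by (auto simp: K_def)
  have KN: "K > N + 1"
  proof (rule ccontr)
    assume "\<not> K > N + 1"
    then have "\<mu> K \<le> \<mu> (N + 1)" using K by (intro mono) auto
    then show False using K N by simp
  qed
  have eq: "\<mu> j = \<mu> 2" if "2 \<le> j" "j < K" for j
    by (rule antisym) (use below[of j] mono[of 2 j] that in auto)
  show ?thesis
  proof (cases "\<mu> 1 = \<mu> 2")
    case True
    have eq1: "\<mu> j = \<mu> 2" if "1 \<le> j" "j < K" for j
      by (cases "j = 1") (use that True in \<open>auto intro: eq\<close>)
    have "has_multiplicity \<mu> 2 (K - 1)"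
      unfolding has_multiplicity_def
    proof (intro exI[of _ 1] conjI ballI)
      show "\<mu> j = \<mu> 2" if "j \<in> {1..<1 + (K - 1)}" for j using that by (intro eq1) auto
    qed (use K KN N in auto)
    then show ?thesis using KN by (intro exI[of _ "K - 1"]) auto
  next
    case False
    then have less: "\<mu> 1 < \<mu> 2" using mono[of 1 2] by simp
    have "has_multiplicity \<mu> 2 (K - 2)"
      unfolding has_multiplicity_def
    proof (intro exI[of _ 2] conjI ballI)
      show "\<mu> j = \<mu> 2" if "j \<in> {2..<2 + (K - 2)}" for j using that KN by (intro eq) auto
      show "2 < 2 + (K - 2)" using KN N by simp
      have "2 + (K - 2) = K" using KN N by simp
      then show "\<mu> 2 < \<mu> (2 + (K - 2))" using K(2) by (simp only:)
    qed (use K KN N less in auto)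
    then show ?thesis using KN by (intro exI[of _ "K - 2"]) auto
  qed
qed

section \<open>Cylindrical coordinates\<close>

definition axial_radius :: "'n::finite \<Rightarrow> real^'n \<Rightarrow> real" where
  "axial_radius k x = norm (x - (x $ k) *\<^sub>R axis k 1)"

text \<open>On the axis the direction is 0, by the convention for the inverse of 0, so
  \<open>axial_decomposition\<close> holds there too; off the axis it is a unit vector orthogonal to
  the axis.\<close>

definition axial_direction :: "'n::finite \<Rightarrow> real^'n \<Rightarrow> real^'n" where
  "axial_direction k x = (x - (x $ k) *\<^sub>R axis k 1) /\<^sub>R axial_radius k x"

lemma axial_radius_nonneg: "axial_radius k x \<ge> 0"
  by (simp add: axial_radius_def)

lemma axial_decomposition: "axial_radius k x *\<^sub>R axial_direction k x + (x $ k) *\<^sub>R axis k 1 = x"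
  by (cases "axial_radius k x = 0") (simp_all add: axial_direction_def axial_radius_def)

lemma axial_direction_unit:
  assumes "axial_radius k x \<noteq> 0"
  shows "norm (axial_direction k x) = 1" "axial_direction k x $ k = 0"
  using assms by (simp_all add: axial_direction_def axial_radius_def axis_def)

lemma axial_measurable [measurable]:
  "axial_radius k \<in> borel_measurable borel" "axial_direction k \<in> borel_measurable borel"
proof -
  have [measurable]: "(\<lambda>x :: real^'a. x - (x $ k) *\<^sub>R axis k 1) \<in> borel_measurable borel" by measurable
  show [measurable]: "axial_radius k \<in> borel_measurable borel"
    unfolding axial_radius_def[abs_def] by measurable
  show "axial_direction k \<in> borel_measurable borel"
    unfolding axial_direction_def[abs_def] by measurable
qed

definition axial_scaling :: "'n::finite \<Rightarrow> real \<Rightarrow> real \<Rightarrow> real^'n \<Rightarrow> real^'n" where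
  "axial_scaling k c s x = c *\<^sub>R (x - (x $ k) *\<^sub>R axis k 1) + (s * x $ k) *\<^sub>R axis k 1"

lemma axial_scaling_coordinates:
  assumes "c > 0"
  shows "axial_scaling k c s x $ k = s * x $ k" "axial_radius k (axial_scaling k c s x) = c * axial_radius k x"
    "axial_direction k (axial_scaling k c s x) = axial_direction k x"
proof -
  show k: "axial_scaling k c s x $ k = s * x $ k" by (simp add: axial_scaling_def axis_def)
  have d: "axial_scaling k c s x - (axial_scaling k c s x $ k) *\<^sub>R axis k 1 = c *\<^sub>R (x - (x $ k) *\<^sub>R axis k 1)"
    unfolding k by (simp add: axial_scaling_def)
  show r: "axial_radius k (axial_scaling k c s x) = c * axial_radius k x"
    unfolding axial_radius_def d using assms by simp
  show "axial_direction k (axial_scaling k c s x) = axial_direction k x"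
    unfolding axial_direction_def r d using assms by simp
qed

text \<open>Scaling by constants along coordinate axes multiplies volumes by a constant. Its value
  is left implicit, because only proportions between pieces are compared afterwards.\<close>

lemma emeasure_axial_scaling:
  fixes k :: "'n::finite"
  assumes cs: "c > 0" "s > 0"
  obtains D where "\<And>A. A \<in> sets borel \<Longrightarrow> emeasure lborel A = D * emeasure lborel (axial_scaling k c s -` A)"
proof -
  define cc where "cc j = (if j = axis k 1 then s else c)" for j :: "real^'n"
  have T: "0 + (\<Sum>j\<in>Basis. (cc j * (x \<bullet> j)) *\<^sub>R j) = axial_scaling k c s x" for x :: "real^'n"
  proof (rule euclidean_eqI)
    fix b :: "real^'n" assume b: "b \<in> Basis"
    then obtain i where i: "b = axis i 1" by (auto simp: Basis_vec_def)
    have "(0 + (\<Sum>j\<in>Basis. (cc j * (x \<bullet> j)) *\<^sub>R j)) \<bullet> b = cc b * (x \<bullet> b)"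
      using b by simp
    also have "\<dots> = axial_scaling k c s x \<bullet> b"
    proof -
      have "cc b = (if i = k then s else c)" by (simp add: cc_def i axis_eq_axis)
      then show ?thesis unfolding i inner_axis by (simp add: axial_scaling_def axis_def)
    qed
    finally show "(0 + (\<Sum>j\<in>Basis. (cc j * (x \<bullet> j)) *\<^sub>R j)) \<bullet> b = axial_scaling k c s x \<bullet> b" .
  qed
  define D where "D = ennreal (\<Prod>j\<in>(Basis :: (real^'n) set). \<bar>cc j\<bar>)"
  have "lborel = density (distr lborel borel (\<lambda>x. 0 + (\<Sum>j\<in>Basis. (cc j * (x \<bullet> j)) *\<^sub>R j))) (\<lambda>_. D)"
    unfolding D_def by (rule lborel_affine_euclidean) (use cs in \<open>auto simp: cc_def\<close>)
  then have lb: "(lborel :: (real^'n) measure) = density (distr lborel borel (axial_scaling k c s)) (\<lambda>_. D)"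
    unfolding T .
  have [measurable]: "axial_scaling k c s \<in> borel_measurable borel"
    unfolding axial_scaling_def[abs_def] by measurable
  show thesis
  proof (rule that)
    fix A :: "(real^'n) set" assume A: "A \<in> sets borel"
    have "emeasure lborel A = emeasure (density (distr lborel borel (axial_scaling k c s)) (\<lambda>_. D)) A"
      using arg_cong[OF lb, of "\<lambda>M. emeasure M A"] .
    also have "\<dots> = D * emeasure (distr lborel borel (axial_scaling k c s)) A"
      using A by (simp add: emeasure_density_const)
    also have "emeasure (distr lborel borel (axial_scaling k c s)) A = emeasure lborel (axial_scaling k c s -` A)"
      using A by (subst emeasure_distr) auto
    finally show "emeasure lborel A = D * emeasure lborel (axial_scaling k c s -` A)" .
  qed
qed

definition axial_piece :: "'n::finite \<Rightarrow> (real \<times> real) set \<Rightarrow> (real^'n) set \<Rightarrow> (real^'n) set" where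
  "axial_piece k S B = {x. x $ k > 0 \<and> (axial_radius k x, x $ k) \<in> S \<and> axial_direction k x \<in> B}"

lemma axial_piece_measurable:
  assumes [measurable]: "S \<in> sets borel" "B \<in> sets borel"
  shows "axial_piece k S B \<in> sets borel"
proof -
  have [measurable]: "(\<lambda>x. (axial_radius k x, x $ k)) \<in> borel_measurable borel"
    by (subst borel_prod[symmetric]) measurable
  have "{x \<in> space borel. x $ k > 0 \<and> (axial_radius k x, x $ k) \<in> S \<and> axial_direction k x \<in> B} \<in> sets borel"
    by measurable
  then show ?thesis by (simp add: axial_piece_def)
qed

text \<open>In the componentwise order on pairs this bounds both the radius and the height by 1. The
  piece has positive finite measure and serves as the reference for measuring sets of
  directions.\<close>

abbreviation unit_piece :: "'n::finite \<Rightarrow> (real^'n) set \<Rightarrow> (real^'n) set" where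
  "unit_piece k B \<equiv> axial_piece k {..(1, 1)} B"

lemma norm_le_axial: "norm x \<le> axial_radius k x + \<bar>x $ k\<bar>"
  using norm_triangle_ineq[of "x - (x $ k) *\<^sub>R axis k 1" "(x $ k) *\<^sub>R axis k 1"]
  by (simp add: axial_radius_def norm_axis_1)

lemma emeasure_axial_piece_finite:
  fixes k :: "'n::finite"
  shows "emeasure lborel (axial_piece k {..(c, b)} B) < \<infinity>"
proof -
  have "axial_piece k {..(c, b)} B \<subseteq> cball 0 (c + b)"
  proof
    fix x assume "x \<in> axial_piece k {..(c, b)} B"
    then show "x \<in> cball 0 (c + b)" using norm_le_axial[of x k] by (auto simp: axial_piece_def)
  qed
  then have "emeasure lborel (axial_piece k {..(c, b)} B) \<le> emeasure lborel (cball (0 :: real^'n) (c + b))"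
    by (rule emeasure_mono) simp
  also have "\<dots> < \<infinity>" by (rule emeasure_lborel_cball_finite)
  finally show ?thesis .
qed

lemma emeasure_unit_piece_pos: "emeasure lborel (unit_piece k UNIV) > 0"
proof -
  let ?O = "{x. axial_radius k x < 1} \<inter> {x. 0 < x $ k} \<inter> {x. x $ k < 1}"
  have "continuous_on UNIV (axial_radius k)"
    unfolding axial_radius_def[abs_def]
    by (intro continuous_on_norm continuous_on_diff continuous_on_scaleR continuous_on_id continuous_on_const smooth_continuous_on smooth_component)
  moreover have "continuous_on UNIV (\<lambda>x :: real^'a. x $ k)" by (rule smooth_continuous_on[OF smooth_component])
  ultimately have op: "open ?O"
    by (intro open_Int open_Collect_less continuous_on_const)
  have "(1 / 2) *\<^sub>R axis k 1 \<in> ?O" by (simp add: axial_radius_def axis_def)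
  then have "\<not> negligible ?O" using open_not_negligible[OF op] by blast
  then have "emeasure lborel ?O \<noteq> 0"
    using op by (auto simp: negligible_iff_null_sets null_sets_def)
  then have "0 < emeasure lborel ?O" by (simp add: zero_less_iff_neq_zero)
  also have "\<dots> \<le> emeasure lborel (unit_piece k UNIV)"
    by (rule emeasure_mono) (auto simp: axial_piece_def intro!: axial_piece_measurable)
  finally show ?thesis .
qed

text \<open>In dimension at least 2 another coordinate exists, and the axis lies in the hyperplane
  where it vanishes.\<close>

lemma negligible_axis:
  fixes k :: "'n::finite"
  assumes "CARD('n) \<ge> 2"
  shows "{x. axial_radius k x = 0} \<in> null_sets lborel"
proof -
  obtain j where j: "j \<noteq> k"
  proof -
    have "UNIV \<noteq> {k}"
    proof
      assume "UNIV = {k}"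
      then have "CARD('n) = card {k}" by simp
      then show False using assms by simp
    qed
    then show thesis using that by blast
  qed
  have "x $ j = 0" if "axial_radius k x = 0" for x
  proof -
    have "x = (x $ k) *\<^sub>R axis k 1" using that by (simp add: axial_radius_def)
    then have "x $ j = ((x $ k) *\<^sub>R axis k 1) $ j" by simp
    then show ?thesis using j by (simp add: axis_def)
  qed
  then have "{x. axial_radius k x = 0} \<subseteq> {x. axis j 1 \<bullet> x = 0}" by (auto simp: inner_axis')
  moreover have "negligible {x :: real^'n. axis j 1 \<bullet> x = 0}"
    by (rule negligible_hyperplane) simp
  ultimately have "negligible {x. axial_radius k x = 0}" by (metis negligible_subset)
  moreover have "{x \<in> space borel. axial_radius k x = 0} \<in> sets borel" by measurable
  ultimately show ?thesis by (auto simp: negligible_iff_null_sets null_sets_def)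
qed

text \<open>An axial scaling carries the unit piece to the piece over the rectangle without changing
  directions, so the proportion of directions in \<open>B\<close> is the same in both. The equation
  is the cross-multiplied form; rectangles of radius 0 give null sets and negative ones are
  empty.\<close>

lemma axial_rectangle:
  fixes k :: "'n::finite"
  assumes N: "CARD('n) \<ge> 2" and B: "B \<in> sets borel"
  shows "emeasure lborel (unit_piece k UNIV) * emeasure lborel (axial_piece k {..(c, b)} B)
    = emeasure lborel (unit_piece k B) * emeasure lborel (axial_piece k {..(c, b)} UNIV)"
proof -
  consider "b \<le> 0" | "c < 0" | "b > 0" "c = 0" | "b > 0" "c > 0" by linarith
  then show ?thesis
  proof cases
    case 1
    then have "axial_piece k {..(c, b)} B = {}" for B by (auto simp: axial_piece_def)
    then show ?thesis by simp
  next
    case 2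
    then have "axial_piece k {..(c, b)} B = {}" for B
      using axial_radius_nonneg[of k] by (auto simp: axial_piece_def) (meson dual_order.trans not_le)
    then show ?thesis by simp
  next
    case 3
    have "emeasure lborel (axial_piece k {..(c, b)} B) = 0" if "B \<in> sets borel" for B
    proof -
      have sub: "axial_piece k {..(c, b)} B \<subseteq> {x. axial_radius k x = 0}"
        using 3 axial_radius_nonneg[of k] by (auto simp: axial_piece_def antisym)
      have "axial_piece k {..(c, b)} B \<in> null_sets lborel"
        by (rule null_sets_subset[OF negligible_axis[OF N, of k] _ sub])
           (use axial_piece_measurable[OF _ that, of "{..(c, b)}" k] in auto)
      then show ?thesis by blast
    qed
    then show ?thesis using B by simp
  next
    case 4
    obtain D where D: "\<And>A. A \<in> sets borel \<Longrightarrow> emeasure lborel A = D * emeasure lborel (axial_scaling k c b -` A)"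
      using emeasure_axial_scaling[OF 4(2,1)] by blast
    have pre: "axial_scaling k c b -` axial_piece k {..(c, b)} B = unit_piece k B" for B
      using 4 by (auto simp: axial_piece_def axial_scaling_coordinates zero_less_mult_iff)
    have "emeasure lborel (axial_piece k {..(c, b)} B) = D * emeasure lborel (unit_piece k B)" if "B \<in> sets borel" for B
      unfolding pre[symmetric] using that by (intro D axial_piece_measurable) auto
    then show ?thesis using B by (simp add: mult_ac)
  qed
qed

lemma UN_atMost_real_pair: "(\<Union>n::nat. {..(real n, real n)}) = UNIV"
proof -
  have "x \<in> (\<Union>n::nat. {..(real n, real n)})" for x :: "real \<times> real"
  proof -
    obtain n where "max (fst x) (snd x) \<le> real n" using real_arch_simple by blast
    then have "x \<le> (real n, real n)" by (simp add: less_eq_prod_def)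
    then show ?thesis by blast
  qed
  then show ?thesis by blast
qed

text \<open>For fixed \<open>B\<close> both sides are measures in \<open>S\<close> that agree on
  lower left quadrants, an intersection-stable generator. So the direction is independent of radius
  and height: Lebesgue measure on the half space is a product in cylindrical coordinates, obtained
  without a Jacobian.\<close>

lemma axial_product:
  fixes k :: "'n::finite"
  assumes N: "CARD('n) \<ge> 2" and B: "B \<in> sets borel" and S: "S \<in> sets borel"
  shows "emeasure lborel (unit_piece k UNIV) * emeasure lborel (axial_piece k S B)
    = emeasure lborel (unit_piece k B) * emeasure lborel (axial_piece k S UNIV)"
proof -
  let ?\<Phi> = "\<lambda>x. (axial_radius k x, x $ k)"
  have \<Phi> [measurable]: "?\<Phi> \<in> borel_measurable borel"
    by (subst borel_prod[symmetric]) measurable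
  define \<mu> where "\<mu> C B = density (distr (density lborel (indicator (axial_piece k UNIV B))) borel ?\<Phi>) (\<lambda>_. C)"
    for C :: ennreal and B
  have sets: "sets (\<mu> C B) = sets borel" for C B by (simp add: \<mu>_def)
  have em: "emeasure (\<mu> C B) S = C * emeasure lborel (axial_piece k S B)"
    if [measurable]: "S \<in> sets borel" "B \<in> sets borel" for C B S
  proof -
    have [measurable]: "axial_piece k UNIV B \<in> sets borel" by (intro axial_piece_measurable) auto
    have "emeasure (\<mu> C B) S = C * emeasure (density lborel (indicator (axial_piece k UNIV B))) (?\<Phi> -` S)"
      unfolding \<mu>_def by (subst emeasure_density_const) (simp_all add: emeasure_distr)
    also have "emeasure (density lborel (indicator (axial_piece k UNIV B))) (?\<Phi> -` S)
      = (\<integral>\<^sup>+x. indicator (axial_piece k UNIV B) x * indicator (?\<Phi> -` S) x \<partial>lborel)"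
    proof (rule emeasure_density)
      show "?\<Phi> -` S \<in> sets lborel" using measurable_sets[OF \<Phi> that(1)] by simp
    qed simp
    also have "\<dots> = (\<integral>\<^sup>+x. indicator (axial_piece k S B) x \<partial>lborel)"
      by (intro nn_integral_cong) (auto simp: indicator_def axial_piece_def)
    also have "\<dots> = emeasure lborel (axial_piece k S B)"
      using axial_piece_measurable[OF that, of k] by simp
    finally show ?thesis .
  qed
  have "\<mu> (emeasure lborel (unit_piece k UNIV)) B = \<mu> (emeasure lborel (unit_piece k B)) UNIV"
  proof (rule measure_eqI_generator_eq[where E = "range atMost" and \<Omega> = UNIV and A = "\<lambda>n. {..(real n, real n)}"])
    have "{..x} \<inter> {..y} = {..inf x y}" for x y :: "real \<times> real" by auto
    then show "Int_stable (range atMost :: (real \<times> real) set set)"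
      by (auto simp: Int_stable_def)
    show "sets (\<mu> (emeasure lborel (unit_piece k UNIV)) B) = sigma_sets UNIV (range atMost)"
      "sets (\<mu> (emeasure lborel (unit_piece k B)) UNIV) = sigma_sets UNIV (range atMost)"
      unfolding sets by (simp_all add: borel_eq_atMost)
    fix X :: "(real \<times> real) set" assume "X \<in> range atMost"
    then obtain c b where X: "X = {..(c, b)}" by auto
    show "emeasure (\<mu> (emeasure lborel (unit_piece k UNIV)) B) X = emeasure (\<mu> (emeasure lborel (unit_piece k B)) UNIV) X"
      unfolding X using axial_rectangle[OF N B, of k c b] B by (simp add: em)
  next
    show "(\<Union>n. {..(real n, real n)}) = UNIV" by (rule UN_atMost_real_pair)
    fix n
    show "emeasure (\<mu> (emeasure lborel (unit_piece k UNIV)) B) {..(real n, real n)} \<noteq> \<infinity>"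
      using emeasure_axial_piece_finite[of k 1 1 UNIV] emeasure_axial_piece_finite[of k "real n" "real n" B] B
      by (simp add: em ennreal_mult_eq_top_iff less_top)
  qed auto
  then have "emeasure (\<mu> (emeasure lborel (unit_piece k UNIV)) B) S = emeasure (\<mu> (emeasure lborel (unit_piece k B)) UNIV) S"
    by simp
  then show ?thesis using B S by (simp add: em)
qed

text \<open>Fubini for this product: replacing the direction of x by that of an independent point y
  and averaging over y in the unit piece recovers the integral of \<open>G\<close>.\<close>

lemma axial_integral:
  fixes k :: "'n::finite" and G :: "real^'n \<Rightarrow> ennreal"
  assumes N: "CARD('n) \<ge> 2" and G [measurable]: "G \<in> borel_measurable borel" and G0: "\<And>x. x $ k \<le> 0 \<Longrightarrow> G x = 0"
  shows "(\<integral>\<^sup>+y. indicator (unit_piece k UNIV) y *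
       (\<integral>\<^sup>+x. G (axial_radius k x *\<^sub>R axial_direction k y + (x $ k) *\<^sub>R axis k 1) \<partial>lborel) \<partial>lborel)
    = emeasure lborel (unit_piece k UNIV) * (\<integral>\<^sup>+x. G x \<partial>lborel)"
    "(\<lambda>y. \<integral>\<^sup>+x. G (axial_radius k x *\<^sub>R axial_direction k y + (x $ k) *\<^sub>R axis k 1) \<partial>lborel) \<in> borel_measurable borel"
proof -
  let ?\<Phi> = "\<lambda>x. (axial_radius k x, x $ k)"
  let ?V = "emeasure lborel (unit_piece k UNIV)"
  have \<Phi> [measurable]: "?\<Phi> \<in> borel_measurable borel"
    by (subst borel_prod[symmetric]) measurable
  have [measurable]: "axial_piece k UNIV UNIV \<in> sets borel" "unit_piece k UNIV \<in> sets borel"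
    by (intro axial_piece_measurable; simp)+
  define P where "P = density lborel (indicator (axial_piece k UNIV UNIV))"
  define Q where "Q = density lborel (indicator (unit_piece k UNIV))"
  define M1 where "M1 = distr P borel ?\<Phi>"
  define M2 where "M2 = distr Q borel (axial_direction k)"
  define M where "M = density (distr P (borel \<Otimes>\<^sub>M borel) (\<lambda>x. (?\<Phi> x, axial_direction k x))) (\<lambda>_. ?V)"
  have sPQ [measurable_cong]: "sets P = sets borel" "sets Q = sets borel" by (simp_all add: P_def Q_def)
  have sM [measurable_cong]: "sets M1 = sets borel" "sets M2 = sets borel" by (simp_all add: M1_def M2_def)
  have pm [measurable]: "(\<lambda>x. (?\<Phi> x, axial_direction k x)) \<in> borel \<rightarrow>\<^sub>M borel \<Otimes>\<^sub>M borel" by measurable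
  have eP: "emeasure P A = emeasure lborel (axial_piece k UNIV UNIV \<inter> A)" if "A \<in> sets borel" for A
    unfolding P_def using that by (subst emeasure_density) (auto simp: indicator_inter_arith[symmetric] emeasure_eq_AE)
  have eQ: "emeasure Q A = emeasure lborel (unit_piece k UNIV \<inter> A)" if "A \<in> sets borel" for A
    unfolding Q_def using that by (subst emeasure_density) (auto simp: indicator_inter_arith[symmetric])
  have eM1: "emeasure M1 S = emeasure lborel (axial_piece k S UNIV)" if S: "S \<in> sets borel" for S
  proof -
    have "?\<Phi> -` S \<in> sets borel" using measurable_sets[OF \<Phi> S] by simp
    from eP[OF this] have "emeasure M1 S = emeasure lborel (axial_piece k UNIV UNIV \<inter> ?\<Phi> -` S)"
      using S unfolding M1_def by (subst emeasure_distr) (simp_all add: P_def)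
    also have "axial_piece k UNIV UNIV \<inter> ?\<Phi> -` S = axial_piece k S UNIV" by (auto simp: axial_piece_def)
    finally show ?thesis .
  qed
  have eM2: "emeasure M2 B = emeasure lborel (unit_piece k B)" if B: "B \<in> sets borel" for B
  proof -
    have "axial_direction k -` B \<in> sets borel" using measurable_sets[OF axial_measurable(2) B] by simp
    from eQ[OF this] have "emeasure M2 B = emeasure lborel (unit_piece k UNIV \<inter> axial_direction k -` B)"
      using B unfolding M2_def by (subst emeasure_distr) (simp_all add: Q_def)
    also have "unit_piece k UNIV \<inter> axial_direction k -` B = unit_piece k B" by (auto simp: axial_piece_def)
    finally show ?thesis .
  qed
  have eM: "emeasure M (S \<times> B) = ?V * emeasure lborel (axial_piece k S B)" if SB: "S \<in> sets borel" "B \<in> sets borel" for S B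
  proof -
    let ?X = "(\<lambda>x. (?\<Phi> x, axial_direction k x)) -` (S \<times> B)"
    have SBm: "S \<times> B \<in> sets (borel \<Otimes>\<^sub>M borel)" using SB by auto
    then have X: "?X \<in> sets borel" using measurable_sets[OF pm SBm] by simp
    have "emeasure M (S \<times> B) = ?V * emeasure P ?X"
      unfolding M_def using SBm pm by (subst emeasure_density_const) (simp_all add: emeasure_distr P_def)
    also have "emeasure P ?X = emeasure lborel (axial_piece k UNIV UNIV \<inter> ?X)" by (rule eP[OF X])
    also have "axial_piece k UNIV UNIV \<inter> ?X = axial_piece k S B" by (auto simp: axial_piece_def)
    finally show ?thesis .
  qed
  have fin1: "sigma_finite_measure M1"
  proof
    show "\<exists>A. countable A \<and> A \<subseteq> sets M1 \<and> \<Union>A = space M1 \<and> (\<forall>a\<in>A. emeasure M1 a \<noteq> \<infinity>)"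
    proof (intro exI[of _ "range (\<lambda>n::nat. {..(real n, real n)})"] conjI ballI)
      show "\<Union>(range (\<lambda>n::nat. {..(real n, real n)})) = space M1"
        unfolding UN_atMost_real_pair by (simp add: M1_def)
      show "emeasure M1 a \<noteq> \<infinity>" if "a \<in> range (\<lambda>n::nat. {..(real n, real n)})" for a
        using that emeasure_axial_piece_finite[of k _ _ UNIV] by (auto simp: eM1 less_top)
    qed (auto simp: sM)
  qed
  have fin2: "sigma_finite_measure M2"
  proof -
    have "finite_measure M2"
      by (rule finite_measureI) (use eM2[of UNIV] emeasure_axial_piece_finite[of k 1 1 UNIV] in \<open>auto simp: M2_def less_top\<close>)
    then show ?thesis by (rule finite_measure.axioms(1))
  qed
  interpret M1: sigma_finite_measure M1 by (rule fin1)
  interpret M2: sigma_finite_measure M2 by (rule fin2)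
  interpret pair_sigma_finite M1 M2 ..
  \<comment> \<open>Agreement on rectangles is \<open>axial_product\<close>. \<open>M\<close> is the
    image of Lebesgue measure on the half space under the pair of (radius, height) and direction,
    scaled by the volume of the unit piece.\<close>
  have prod: "M1 \<Otimes>\<^sub>M M2 = M"
  proof (rule pair_measure_eqI[OF fin1 fin2])
    show "sets (M1 \<Otimes>\<^sub>M M2) = sets M"
      unfolding M_def by (simp add: sM cong: sets_pair_measure_cong)
    show "emeasure M1 A * emeasure M2 B = emeasure M (A \<times> B)" if "A \<in> sets M1" "B \<in> sets M2" for A B
      using axial_product[OF N, of B A k] that by (simp add: sM eM1 eM2 eM mult.commute)
  qed
  define H where "H = (\<lambda>(z, w). G (fst z *\<^sub>R w + snd z *\<^sub>R axis k 1) :: ennreal)"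
  have Hm [measurable]: "H \<in> borel_measurable (borel \<Otimes>\<^sub>M borel)"
  proof -
    have "(\<lambda>q :: (real \<times> real) \<times> (real^'n). fst (fst q) *\<^sub>R snd q + snd (fst q) *\<^sub>R axis k 1)
        \<in> borel_measurable (borel \<Otimes>\<^sub>M borel)"
      unfolding borel_prod by (intro borel_measurable_continuous_onI continuous_intros)
    from measurable_compose[OF this G] show ?thesis by (simp add: H_def case_prod_unfold)
  qed
  then have Hm': "H \<in> borel_measurable (M1 \<Otimes>\<^sub>M M2)"
    by (simp add: sM cong: measurable_cong_sets sets_pair_measure_cong)
  have inner: "(\<integral>\<^sup>+z. H (z, w) \<partial>M1) = (\<integral>\<^sup>+x. G (axial_radius k x *\<^sub>R w + (x $ k) *\<^sub>R axis k 1) \<partial>lborel)" if w: "w $ k = 0" for w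
  proof -
    have "(\<integral>\<^sup>+z. H (z, w) \<partial>M1) = (\<integral>\<^sup>+x. H (?\<Phi> x, w) \<partial>P)"
      unfolding M1_def by (rule nn_integral_distr) (simp_all add: P_def)
    also have "\<dots> = (\<integral>\<^sup>+x. indicator (axial_piece k UNIV UNIV) x * H (?\<Phi> x, w) \<partial>lborel)"
      unfolding P_def by (subst nn_integral_density) auto
    also have "\<dots> = (\<integral>\<^sup>+x. G (axial_radius k x *\<^sub>R w + (x $ k) *\<^sub>R axis k 1) \<partial>lborel)"
    proof (rule nn_integral_cong)
      fix x :: "real^'n"
      show "indicator (axial_piece k UNIV UNIV) x * H (?\<Phi> x, w) = G (axial_radius k x *\<^sub>R w + (x $ k) *\<^sub>R axis k 1)"
      proof (cases "x $ k > 0")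
        case False
        then have "G (axial_radius k x *\<^sub>R w + (x $ k) *\<^sub>R axis k 1) = 0"
          using w by (intro G0) (simp add: axis_def)
        then show ?thesis by (simp add: H_def)
      qed (simp add: H_def axial_piece_def)
    qed
    finally show ?thesis .
  qed
  have dir0: "axial_direction k y $ k = 0" for y
    by (simp add: axial_direction_def axis_def)
  have "(\<lambda>w. \<integral>\<^sup>+z. H (z, w) \<partial>M1) \<in> borel_measurable M2"
    using M1.borel_measurable_nn_integral[of "\<lambda>w z. H (z, w)" M2] Hm'
    by (simp add: case_prod_unfold measurable_pair_swap_iff[of _ M1 M2])
  then have im [measurable]: "(\<lambda>w. \<integral>\<^sup>+z. H (z, w) \<partial>M1) \<in> borel_measurable borel"
    by (simp add: sM cong: measurable_cong_sets)
  have "(\<lambda>y. \<integral>\<^sup>+z. H (z, axial_direction k y) \<partial>M1) \<in> borel_measurable borel"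
    using measurable_compose[OF axial_measurable(2) im] by simp
  then show "(\<lambda>y. \<integral>\<^sup>+x. G (axial_radius k x *\<^sub>R axial_direction k y + (x $ k) *\<^sub>R axis k 1) \<partial>lborel) \<in> borel_measurable borel"
    by (simp add: inner[OF dir0])
  have "(\<integral>\<^sup>+y. indicator (unit_piece k UNIV) y *
       (\<integral>\<^sup>+x. G (axial_radius k x *\<^sub>R axial_direction k y + (x $ k) *\<^sub>R axis k 1) \<partial>lborel) \<partial>lborel)
    = (\<integral>\<^sup>+y. indicator (unit_piece k UNIV) y * (\<integral>\<^sup>+z. H (z, axial_direction k y) \<partial>M1) \<partial>lborel)"
    by (simp only: inner[OF dir0])
  also have "\<dots> = (\<integral>\<^sup>+y. (\<integral>\<^sup>+z. H (z, axial_direction k y) \<partial>M1) \<partial>Q)"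
    unfolding Q_def by (subst nn_integral_density) (auto intro!: measurable_compose[OF axial_measurable(2) im])
  also have "\<dots> = (\<integral>\<^sup>+w. \<integral>\<^sup>+z. H (z, w) \<partial>M1 \<partial>M2)"
    unfolding M2_def by (rule nn_integral_distr[symmetric]) (use im in \<open>simp_all add: Q_def\<close>)
  also have "\<dots> = (\<integral>\<^sup>+p. H p \<partial>(M1 \<Otimes>\<^sub>M M2))"
    using nn_integral_snd[of H] Hm' by simp
  also have "\<dots> = (\<integral>\<^sup>+p. H p \<partial>M)" by (simp only: prod)
  also have "\<dots> = ?V * (\<integral>\<^sup>+p. H p \<partial>distr P (borel \<Otimes>\<^sub>M borel) (\<lambda>x. (?\<Phi> x, axial_direction k x)))"
    unfolding M_def using Hm by (subst nn_integral_density) (auto simp: nn_integral_cmult)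
  also have "(\<integral>\<^sup>+p. H p \<partial>distr P (borel \<Otimes>\<^sub>M borel) (\<lambda>x. (?\<Phi> x, axial_direction k x)))
     = (\<integral>\<^sup>+x. H (?\<Phi> x, axial_direction k x) \<partial>P)"
    by (rule nn_integral_distr) (use pm Hm in \<open>simp_all add: P_def\<close>)
  also have "\<dots> = (\<integral>\<^sup>+x. G x \<partial>P)"
    by (simp add: H_def axial_decomposition)
  also have "\<dots> = (\<integral>\<^sup>+x. indicator (axial_piece k UNIV UNIV) x * G x \<partial>lborel)"
    unfolding P_def by (subst nn_integral_density) auto
  also have "\<dots> = (\<integral>\<^sup>+x. G x \<partial>lborel)"
    using G0 by (intro nn_integral_cong) (auto simp: indicator_def axial_piece_def not_less)
  finally show "(\<integral>\<^sup>+y. indicator (unit_piece k UNIV) y *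
       (\<integral>\<^sup>+x. G (axial_radius k x *\<^sub>R axial_direction k y + (x $ k) *\<^sub>R axis k 1) \<partial>lborel) \<partial>lborel)
    = ?V * (\<integral>\<^sup>+x. G x \<partial>lborel)" .
qed

text \<open>Averaging over all directions preserves both integrals, so some direction does at least as well
  as the average.\<close>

lemma exists_good_direction:
  fixes k :: "'n::finite" and f g :: "real^'n \<Rightarrow> ennreal"
  assumes N: "CARD('n) \<ge> 2" and f [measurable]: "f \<in> borel_measurable borel" and g [measurable]: "g \<in> borel_measurable borel"
    and f0: "\<And>x. x $ k \<le> 0 \<Longrightarrow> f x = 0" and g0: "\<And>x. x $ k \<le> 0 \<Longrightarrow> g x = 0"
    and less: "(\<integral>\<^sup>+x. g x \<partial>lborel) < C * (\<integral>\<^sup>+x. f x \<partial>lborel)"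
  shows "\<exists>w. norm w = 1 \<and> w $ k = 0 \<and>
    (\<integral>\<^sup>+x. g (axial_radius k x *\<^sub>R w + (x $ k) *\<^sub>R axis k 1) \<partial>lborel)
      < C * (\<integral>\<^sup>+x. f (axial_radius k x *\<^sub>R w + (x $ k) *\<^sub>R axis k 1) \<partial>lborel)"
proof (rule ccontr)
  let ?I = "\<lambda>h w. \<integral>\<^sup>+x. h (axial_radius k x *\<^sub>R w + (x $ k) *\<^sub>R axis k 1) \<partial>lborel"
  let ?V = "emeasure lborel (unit_piece k UNIV)"
  assume "\<not> ?thesis"
  then have le: "C * ?I f w \<le> ?I g w" if "norm w = 1" "w $ k = 0" for w using that by (auto simp: not_less)
  have [measurable]: "unit_piece k UNIV \<in> sets borel" by (intro axial_piece_measurable; simp)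
  note [measurable] = axial_integral(2)[OF N f f0] axial_integral(2)[OF N g g0]
  have "C * (?V * (\<integral>\<^sup>+x. f x \<partial>lborel)) = C * (\<integral>\<^sup>+y. indicator (unit_piece k UNIV) y * ?I f (axial_direction k y) \<partial>lborel)"
    by (simp only: axial_integral(1)[OF N f f0])
  also have "\<dots> = (\<integral>\<^sup>+y. C * (indicator (unit_piece k UNIV) y * ?I f (axial_direction k y)) \<partial>lborel)"
    by (rule nn_integral_cmult[symmetric]) measurable
  also have "\<dots> \<le> (\<integral>\<^sup>+y. indicator (unit_piece k UNIV) y * ?I g (axial_direction k y) \<partial>lborel)"
  proof (rule nn_integral_mono_AE)
    have "AE y in lborel. y \<notin> {x. axial_radius k x = 0}" by (rule AE_not_in[OF negligible_axis[OF N]])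
    then show "AE y in lborel. C * (indicator (unit_piece k UNIV) y * ?I f (axial_direction k y))
        \<le> indicator (unit_piece k UNIV) y * ?I g (axial_direction k y)"
    proof (rule eventually_mono)
      fix y assume "y \<notin> {x. axial_radius k x = 0}"
      then have "C * ?I f (axial_direction k y) \<le> ?I g (axial_direction k y)"
        by (intro le axial_direction_unit) auto
      then show "C * (indicator (unit_piece k UNIV) y * ?I f (axial_direction k y))
        \<le> indicator (unit_piece k UNIV) y * ?I g (axial_direction k y)"
        by (cases "y \<in> unit_piece k UNIV") simp_all
    qed
  qed
  also have "\<dots> = ?V * (\<integral>\<^sup>+x. g x \<partial>lborel)"
    by (rule axial_integral(1)[OF N g g0])
  finally have "?V * (C * (\<integral>\<^sup>+x. f x \<partial>lborel)) \<le> ?V * (\<integral>\<^sup>+x. g x \<partial>lborel)"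
    by (simp add: mult.left_commute)
  moreover have "?V * (\<integral>\<^sup>+x. g x \<partial>lborel) < ?V * (C * (\<integral>\<^sup>+x. f x \<partial>lborel))"
    using less emeasure_unit_piece_pos[of k] emeasure_axial_piece_finite[of k 1 1 UNIV]
    by (intro ennreal_mult_strict_left_mono) (auto simp: less_top)
  ultimately show False by simp
qed

section \<open>Axially symmetric functions\<close>

lemma nn_integral_lborel_translation:
  fixes h :: "'a::euclidean_space \<Rightarrow> ennreal"
  assumes [measurable]: "h \<in> borel_measurable borel"
  shows "(\<integral>\<^sup>+x. h (c + x) \<partial>lborel) = (\<integral>\<^sup>+x. h x \<partial>lborel)"
proof -
  have "(\<integral>\<^sup>+x. h x \<partial>lborel) = (\<integral>\<^sup>+x. h x \<partial>distr lborel borel ((+) c))"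
    by (simp add: lborel_distr_plus)
  also have "\<dots> = (\<integral>\<^sup>+x. h (c + x) \<partial>lborel)" by (rule nn_integral_distr) simp_all
  finally show ?thesis by simp
qed

lemma emeasure_lborel_ball_translation:
  "emeasure lborel (ball (z :: 'a::euclidean_space) 1) = emeasure lborel (ball (0 :: 'a) 1)"
proof -
  have "emeasure lborel (ball z 1) = (\<integral>\<^sup>+x. indicator (ball z 1) x \<partial>lborel)" by simp
  also have "\<dots> = (\<integral>\<^sup>+x. indicator (ball z 1) (z + x) \<partial>lborel)"
    by (rule nn_integral_lborel_translation[symmetric], rule borel_measurable_indicator) simp
  also have "\<dots> = (\<integral>\<^sup>+x. indicator (ball (0 :: 'a) 1) x \<partial>lborel)"
    by (intro nn_integral_cong) (simp add: indicator_def dist_norm)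
  finally show ?thesis by simp
qed

text \<open>The image of the Lebesgue measure is translation invariant, so by Fubini's theorem it is a
  multiple of the Lebesgue measure; the unit ball shows that the factor is 1.\<close>

lemma nn_integral_orthogonal_transformation:
  fixes R :: "'a::euclidean_space \<Rightarrow> 'a" and h :: "'a \<Rightarrow> ennreal"
  assumes R: "orthogonal_transformation R" and h [measurable]: "h \<in> borel_measurable borel"
  shows "(\<integral>\<^sup>+x. h (R x) \<partial>lborel) = (\<integral>\<^sup>+x. h x \<partial>lborel)"
proof -
  have lin: "linear R" by (rule orthogonal_transformation_linear[OF R])
  have [measurable]: "R \<in> borel_measurable borel"
    by (rule borel_measurable_continuous_onI[OF linear_continuous_on]) (use lin in \<open>simp add: linear_conv_bounded_linear\<close>)
  define b where "b = emeasure lborel (ball (0 :: 'a) 1)"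
  define g :: "'a \<Rightarrow> ennreal" where "g = indicator (ball 0 1)"
  have g [measurable]: "g \<in> borel_measurable borel" unfolding g_def by (rule borel_measurable_indicator) simp
  have gR: "g (R y) = g y" for y by (simp add: g_def indicator_def orthogonal_transformation_norm[OF R])
  have gb: "(\<integral>\<^sup>+x. g (z - x) \<partial>lborel) = b" for z
  proof -
    have "(\<integral>\<^sup>+x. g (z - x) \<partial>lborel) = (\<integral>\<^sup>+x. indicator (ball z 1) x \<partial>lborel)"
      by (intro nn_integral_cong) (simp add: g_def indicator_def dist_norm norm_minus_commute)
    also have "\<dots> = emeasure lborel (ball z 1)" by simp
    finally show ?thesis unfolding b_def emeasure_lborel_ball_translation[of z] .
  qed
  have "b * (\<integral>\<^sup>+x. h x \<partial>lborel) = (\<integral>\<^sup>+y. g (R y) * (\<integral>\<^sup>+x. h x \<partial>lborel) \<partial>lborel)"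
  proof -
    have "(\<integral>\<^sup>+y. g y * (\<integral>\<^sup>+x. h x \<partial>lborel) \<partial>lborel) = (\<integral>\<^sup>+y. g y \<partial>lborel) * (\<integral>\<^sup>+x. h x \<partial>lborel)"
      by (rule nn_integral_multc) measurable
    also have "(\<integral>\<^sup>+y. g y \<partial>lborel) = b" unfolding g_def b_def by (rule nn_integral_indicator) simp
    finally show ?thesis unfolding gR by (rule sym)
  qed
  also have "\<dots> = (\<integral>\<^sup>+y. (\<integral>\<^sup>+x. g (R y) * h (R y + x) \<partial>lborel) \<partial>lborel)"
  proof (rule nn_integral_cong)
    fix y
    have "(\<integral>\<^sup>+x. g (R y) * h (R y + x) \<partial>lborel) = g (R y) * (\<integral>\<^sup>+x. h (R y + x) \<partial>lborel)"
      by (rule nn_integral_cmult) measurable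
    then show "g (R y) * (\<integral>\<^sup>+x. h x \<partial>lborel) = (\<integral>\<^sup>+x. g (R y) * h (R y + x) \<partial>lborel)"
      unfolding nn_integral_lborel_translation[OF h] by simp
  qed
  also have "\<dots> = (\<integral>\<^sup>+x. (\<integral>\<^sup>+y. g (R y) * h (R y + x) \<partial>lborel) \<partial>lborel)"
    by (rule lborel_pair.Fubini') measurable
  also have "\<dots> = (\<integral>\<^sup>+x. (\<integral>\<^sup>+y. g (R y - x) * h (R y) \<partial>lborel) \<partial>lborel)"
  proof (rule nn_integral_cong)
    fix x
    obtain x' where x': "x = R x'" using orthogonal_transformation_surj[OF R] by (metis surjD)
    have "(\<integral>\<^sup>+y. g (R y - x) * h (R y) \<partial>lborel) = (\<integral>\<^sup>+y. g (R (x' + y) - x) * h (R (x' + y)) \<partial>lborel)"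
      by (rule nn_integral_lborel_translation[symmetric]) measurable
    also have "\<dots> = (\<integral>\<^sup>+y. g (R y) * h (R y + x) \<partial>lborel)"
      by (simp add: linear_add[OF lin] x' add.commute)
    finally show "(\<integral>\<^sup>+y. g (R y) * h (R y + x) \<partial>lborel) = (\<integral>\<^sup>+y. g (R y - x) * h (R y) \<partial>lborel)" by simp
  qed
  also have "\<dots> = (\<integral>\<^sup>+y. (\<integral>\<^sup>+x. g (R y - x) * h (R y) \<partial>lborel) \<partial>lborel)"
    by (rule lborel_pair.Fubini') measurable
  also have "\<dots> = (\<integral>\<^sup>+y. b * h (R y) \<partial>lborel)"
  proof (rule nn_integral_cong)
    fix y
    have "(\<integral>\<^sup>+x. g (R y - x) * h (R y) \<partial>lborel) = (\<integral>\<^sup>+x. g (R y - x) \<partial>lborel) * h (R y)"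
      by (rule nn_integral_multc) measurable
    then show "(\<integral>\<^sup>+x. g (R y - x) * h (R y) \<partial>lborel) = b * h (R y)" unfolding gb .
  qed
  also have "\<dots> = b * (\<integral>\<^sup>+y. h (R y) \<partial>lborel)" by (rule nn_integral_cmult) measurable
  finally have "b * (\<integral>\<^sup>+x. h x \<partial>lborel) = b * (\<integral>\<^sup>+y. h (R y) \<partial>lborel)" .
  moreover have "b \<noteq> \<infinity>" using emeasure_lborel_ball_finite[of "0 :: 'a" 1] by (simp add: b_def)
  moreover have "b \<noteq> 0"
    using open_not_negligible[of "ball (0 :: 'a) 1"] by (auto simp: b_def negligible_iff_null_sets null_sets_def)
  ultimately show ?thesis by (simp add: ennreal_mult_cancel_left)
qed

text \<open>The coordinates of \<open>x\<close> with respect to the axis \<open>e\<close> are transferred to the half plane spanned by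
  \<open>w\<close> and the axis \<open>a\<close>; a positive \<open>d\<close> smoothes the distance from the axis.\<close>

definition axial_point :: "'a::real_inner \<Rightarrow> 'a \<Rightarrow> real \<Rightarrow> 'a \<Rightarrow> 'a \<Rightarrow> 'a" where
  "axial_point w a d e x = sqrt (x \<bullet> x - (x \<bullet> e)\<^sup>2 + d\<^sup>2) *\<^sub>R w + (x \<bullet> e) *\<^sub>R a"

lemma inner_unit_le: "norm e = 1 \<Longrightarrow> (x \<bullet> e)\<^sup>2 \<le> x \<bullet> x"
  using Cauchy_Schwarz_ineq[of x e] by (simp add: dot_square_norm)

text \<open>For d = 0 the map preserves the norm, which in a radially symmetric set means staying
  inside or outside it. A positive \<open>d\<close> moves points by at most d and only increases the
  norm, so preimages of bounded sets remain bounded.\<close>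

lemma axial_point_props:
  assumes w: "norm w = 1" "norm a = 1" "w \<bullet> a = 0" and e: "norm e = 1"
  shows "(norm (axial_point w a d e x))\<^sup>2 = (norm x)\<^sup>2 + d\<^sup>2" "axial_point w a d e x \<bullet> a = x \<bullet> e"
    "norm (axial_point w a d e x - axial_point w a 0 e x) \<le> \<bar>d\<bar>"
proof -
  have wa: "w \<bullet> w = 1" "a \<bullet> a = 1" "a \<bullet> w = 0" using w by (simp_all add: dot_square_norm inner_commute)
  have nn: "0 \<le> x \<bullet> x - (x \<bullet> e)\<^sup>2" using inner_unit_le[OF e, of x] by simp
  show "axial_point w a d e x \<bullet> a = x \<bullet> e" using w wa by (simp add: axial_point_def inner_add_left)
  have "axial_point w a d e x \<bullet> axial_point w a d e x = (sqrt (x \<bullet> x - (x \<bullet> e)\<^sup>2 + d\<^sup>2))\<^sup>2 + (x \<bullet> e)\<^sup>2"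
    using wa w by (simp add: axial_point_def inner_add_left inner_add_right power2_eq_square)
  also have "\<dots> = x \<bullet> x + d\<^sup>2" using nn by simp
  finally show "(norm (axial_point w a d e x))\<^sup>2 = (norm x)\<^sup>2 + d\<^sup>2" by (simp add: power2_norm_eq_inner)
  define q where "q = x \<bullet> x - (x \<bullet> e)\<^sup>2"
  have "sqrt (q + d\<^sup>2) \<le> sqrt q + \<bar>d\<bar>" using sqrt_add_le_add_sqrt[of q "d\<^sup>2"] nn by (simp add: q_def)
  moreover have "sqrt q \<le> sqrt (q + d\<^sup>2)" by simp
  moreover have "axial_point w a d e x - axial_point w a 0 e x = (sqrt (q + d\<^sup>2) - sqrt q) *\<^sub>R w"
    by (simp add: axial_point_def q_def scaleR_diff_left)
  ultimately show "norm (axial_point w a d e x - axial_point w a 0 e x) \<le> \<bar>d\<bar>" using w by simp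
qed

text \<open>The point depends on x only through x . x and x . e, which \<open>R\<close> preserves
  when it carries the axis along. With rotation invariance this makes the integrals independent of
  \<open>e\<close>.\<close>

lemma axial_point_orthogonal:
  assumes "orthogonal_transformation R" "R e = a"
  shows "axial_point w a d a (R x) = axial_point w a d e x"
  using assms unfolding axial_point_def orthogonal_transformation_def by metis

lemma continuous_on_axial_point:
  "continuous_on S (\<lambda>z. axial_point w a d (fst z) (snd z))"
  unfolding axial_point_def by (intro continuous_intros)

lemma borel_measurable_axial_point [measurable]:
  fixes w a e :: "'a::euclidean_space"
  shows "axial_point w a d e \<in> borel_measurable borel"
  unfolding axial_point_def by (intro borel_measurable_continuous_onI continuous_intros)

text \<open>A positive \<open>d\<close> keeps the square root away from 0. The explicit gradient
  serves twice: for the norm bound and for joint continuity in axis and point.\<close>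

lemma smooth_axial:
  fixes w a e :: "real^'n"
  assumes v: "smooth v" and e: "norm e = 1" and d: "d > 0"
  shows "smooth (\<lambda>x. v (axial_point w a d e x))"
    "gradient (\<lambda>x. v (axial_point w a d e x)) x =
      (gradient v (axial_point w a d e x) \<bullet> w / sqrt (x \<bullet> x - (x \<bullet> e)\<^sup>2 + d\<^sup>2)) *\<^sub>R (x - (x \<bullet> e) *\<^sub>R e)
        + (gradient v (axial_point w a d e x) \<bullet> a) *\<^sub>R e"
proof -
  define q where "q x = x \<bullet> x - (x \<bullet> e) * (x \<bullet> e) + d\<^sup>2" for x :: "real^'n"
  have q: "q x > 0" for x
    using inner_unit_le[OF e, of x] d unfolding q_def power2_eq_square[symmetric] by (simp add: add_nonneg_pos)
  define g where "g j x = sqrt (q x) * w $ j + (x \<bullet> e) * a $ j" for j x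
  have P: "(\<chi> j. g j x) = axial_point w a d e x" for x
    by (simp add: g_def vec_eq_iff axial_point_def q_def power2_eq_square)
  have "smooth (\<lambda>x. q x)" unfolding q_def
    by (intro smooth_add smooth_diff smooth_mult smooth_norm_sq smooth_inner_const smooth_const)
  then have "smooth (\<lambda>x. q x powr (1 / 2))" by (rule smooth_powr) (rule q)
  then have "smooth (\<lambda>x. sqrt (q x))" using q by (simp add: powr_half_sqrt less_imp_le)
  then have sg: "smooth (g j)" for j unfolding g_def[abs_def]
    by (intro smooth_add smooth_mult smooth_inner_const smooth_const)
  show "smooth (\<lambda>x. v (axial_point w a d e x))"
    unfolding P[symmetric] by (rule smooth_compose[OF v sg])
  define G where "G j = (w $ j / sqrt (q x)) *\<^sub>R (x - (x \<bullet> e) *\<^sub>R e) + (a $ j) *\<^sub>R e" for j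
  have G: "GDERIV (g j) x :> G j" for j
  proof -
    have xx: "GDERIV (\<lambda>x. x \<bullet> x) x :> 2 *\<^sub>R x"
      unfolding gderiv_def by (rule has_derivative_eq_rhs[OF has_derivative_inner[OF has_derivative_ident has_derivative_ident]])
        (simp add: fun_eq_iff inner_commute)
    have xe: "GDERIV (\<lambda>x. x \<bullet> e) x :> e"
      unfolding gderiv_def by (rule has_derivative_inner_left[OF has_derivative_ident])
    have "GDERIV q x :> 2 *\<^sub>R x - ((x \<bullet> e) *\<^sub>R e + (x \<bullet> e) *\<^sub>R e) + 0"
      unfolding q_def[abs_def] by (rule GDERIV_add[OF GDERIV_diff[OF xx GDERIV_mult[OF xe xe]] GDERIV_const])
    then have sq: "GDERIV (\<lambda>x. sqrt (q x)) x :>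
        (inverse (sqrt (q x)) / 2) *\<^sub>R (2 *\<^sub>R x - ((x \<bullet> e) *\<^sub>R e + (x \<bullet> e) *\<^sub>R e) + 0)"
      by (rule GDERIV_DERIV_compose) (rule DERIV_real_sqrt[OF q])
    have D: "GDERIV (\<lambda>x. sqrt (q x) * w $ j + (x \<bullet> e) * a $ j) x :>
        (sqrt (q x) *\<^sub>R 0 + (w $ j) *\<^sub>R ((inverse (sqrt (q x)) / 2) *\<^sub>R (2 *\<^sub>R x - ((x \<bullet> e) *\<^sub>R e + (x \<bullet> e) *\<^sub>R e) + 0)))
        + ((x \<bullet> e) *\<^sub>R 0 + (a $ j) *\<^sub>R e)"
      by (rule GDERIV_add[OF GDERIV_mult[OF sq GDERIV_const] GDERIV_mult[OF xe GDERIV_const]])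
    have E: "2 *\<^sub>R x - ((x \<bullet> e) *\<^sub>R e + (x \<bullet> e) *\<^sub>R e) + 0 = 2 *\<^sub>R (x - (x \<bullet> e) *\<^sub>R e)"
      by (simp only: scaleR_diff_right scaleR_2 add_0_right)
    have "sqrt (q x) *\<^sub>R 0 + (w $ j) *\<^sub>R ((inverse (sqrt (q x)) / 2) *\<^sub>R (2 *\<^sub>R z)) + ((x \<bullet> e) *\<^sub>R 0 + (a $ j) *\<^sub>R e)
        = (w $ j / sqrt (q x)) *\<^sub>R z + (a $ j) *\<^sub>R e" for z :: "real^'n"
      by (simp add: inverse_eq_divide)
    from D[unfolded E this] show ?thesis unfolding g_def[abs_def] G_def .
  qed
  define F where "F = gradient v (axial_point w a d e x)"
  have "GDERIV (\<lambda>x. v (\<chi> j. g j x)) x :> (\<Sum>j\<in>UNIV. F $ j *\<^sub>R G j)"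
    by (rule GDERIV_vec_compose[OF _ G]) (unfold P F_def, rule GDERIV_smooth[OF v])
  then have "gradient (\<lambda>x. v (axial_point w a d e x)) x = (\<Sum>j\<in>UNIV. F $ j *\<^sub>R G j)"
    unfolding P by (rule gradient_eqI)
  also have "\<dots> = (\<Sum>j\<in>UNIV. (F $ j * w $ j / sqrt (q x)) *\<^sub>R (x - (x \<bullet> e) *\<^sub>R e) + (F $ j * a $ j) *\<^sub>R e)"
    by (rule sum.cong) (simp_all add: G_def scaleR_add_right)
  also have "\<dots> = (F \<bullet> w / sqrt (q x)) *\<^sub>R (x - (x \<bullet> e) *\<^sub>R e) + (F \<bullet> a) *\<^sub>R e"
    by (simp only: sum.distrib scaleR_sum_left[symmetric] inner_vec_def sum_divide_distrib inner_real_def)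
  finally show "gradient (\<lambda>x. v (axial_point w a d e x)) x =
      (gradient v (axial_point w a d e x) \<bullet> w / sqrt (x \<bullet> x - (x \<bullet> e)\<^sup>2 + d\<^sup>2)) *\<^sub>R (x - (x \<bullet> e) *\<^sub>R e)
        + (gradient v (axial_point w a d e x) \<bullet> a) *\<^sub>R e"
    by (simp add: F_def q_def power2_eq_square)
qed

lemma Bessel_two:
  fixes w a F :: "'a::real_inner"
  assumes "norm w = 1" "norm a = 1" "w \<bullet> a = 0"
  shows "(F \<bullet> w)\<^sup>2 + (F \<bullet> a)\<^sup>2 \<le> (norm F)\<^sup>2"
proof -
  have wa: "w \<bullet> w = 1" "a \<bullet> a = 1" "a \<bullet> w = 0" using assms by (simp_all add: dot_square_norm inner_commute)
  have "0 \<le> (F - (F \<bullet> w) *\<^sub>R w - (F \<bullet> a) *\<^sub>R a) \<bullet> (F - (F \<bullet> w) *\<^sub>R w - (F \<bullet> a) *\<^sub>R a)" by simp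
  also have "\<dots> = F \<bullet> F - (F \<bullet> w)\<^sup>2 - (F \<bullet> a)\<^sup>2"
    using wa assms(3) by (simp add: inner_diff_left inner_diff_right inner_commute[of w F] inner_commute[of a F] power2_eq_square)
  finally show ?thesis by (simp add: dot_square_norm)
qed

text \<open>Only the components of the gradient of \<open>v\<close> along \<open>w\<close> and
  \<open>a\<close> enter, and Bessel's inequality bounds them. The component along \<open>w\<close>
  is moreover multiplied by the ratio of the true to the smoothed distance from the axis, which is
  at most 1.\<close>

lemma norm_gradient_axial:
  fixes w a e :: "real^'n"
  assumes v: "smooth v" and e: "norm e = 1" and d: "d > 0" and w: "norm w = 1" "norm a = 1" "w \<bullet> a = 0"
  shows "norm (gradient (\<lambda>x. v (axial_point w a d e x)) x) \<le> norm (gradient v (axial_point w a d e x))"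
proof -
  define F where "F = gradient v (axial_point w a d e x)"
  define q where "q = x \<bullet> x - (x \<bullet> e)\<^sup>2 + d\<^sup>2"
  define z where "z = x - (x \<bullet> e) *\<^sub>R e"
  have ee: "e \<bullet> e = 1" using e by (simp add: dot_square_norm)
  have q: "q > 0" using inner_unit_le[OF e, of x] d by (simp add: q_def add_nonneg_pos)
  have z: "z \<bullet> e = 0" "e \<bullet> z = 0" "z \<bullet> z = x \<bullet> x - (x \<bullet> e)\<^sup>2"
    using ee by (simp_all add: z_def inner_diff_left inner_diff_right inner_commute power2_eq_square)
  let ?D = "(F \<bullet> w / sqrt q) *\<^sub>R z + (F \<bullet> a) *\<^sub>R e"
  have "(norm ?D)\<^sup>2 = (F \<bullet> w / sqrt q)\<^sup>2 * (z \<bullet> z) + (F \<bullet> a)\<^sup>2"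
    unfolding power2_norm_eq_inner using z ee
    by (simp add: inner_add_left inner_add_right power2_eq_square)
  also have "(F \<bullet> w / sqrt q)\<^sup>2 * (z \<bullet> z) = (F \<bullet> w)\<^sup>2 * ((z \<bullet> z) / q)"
    using q by (simp add: power_divide)
  also have "\<dots> \<le> (F \<bullet> w)\<^sup>2 * 1"
    using q z(3) by (intro mult_left_mono) (auto simp: q_def)
  finally have "(norm ?D)\<^sup>2 \<le> (F \<bullet> w)\<^sup>2 + (F \<bullet> a)\<^sup>2" by simp
  also have "\<dots> \<le> (norm F)\<^sup>2" by (rule Bessel_two[OF w])
  finally have "norm ?D \<le> norm F" by (rule power2_le_imp_le) simp
  then show ?thesis using smooth_axial(2)[OF v e d, of w a x] by (simp add: F_def q_def z_def)
qed

text \<open>The support is the preimage of that of \<open>v\<close>: bounded since norms do not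
  decrease, in the half space of \<open>e\<close> since heights are preserved, and in
  \<open>U\<close> by radial symmetry. The margin \<open>d0\<close> depends only on the support of
  \<open>v\<close>, hence serves all axes.\<close>

lemma axial_test_function:
  fixes w a :: "real^'n"
  assumes U: "open U" "radially_symmetric U" and v: "v \<in> test_functions {x \<in> U. x \<bullet> a > 0}"
    and w: "norm w = 1" "norm a = 1" "w \<bullet> a = 0"
  obtains d0 where "d0 > 0"
    "\<And>d e. 0 < d \<Longrightarrow> d \<le> d0 \<Longrightarrow> norm e = 1 \<Longrightarrow>
      (\<lambda>x. v (axial_point w a d e x)) \<in> test_functions {x \<in> U. x \<bullet> e > 0}"
proof -
  obtain K where K: "compact K" "K \<subseteq> {x \<in> U. x \<bullet> a > 0}" "\<And>x. x \<notin> K \<Longrightarrow> v x = 0" and vs: "smooth v"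
    using v unfolding test_functions_def by blast
  have "K \<subseteq> U" using K(2) by auto
  then obtain r where r: "r > 0" "(\<Union>x\<in>K. ball x r) \<subseteq> U"
    using compact_subset_open_imp_ball_epsilon_subset[OF K(1) U(1)] by blast
  show thesis
  proof (rule that[of "r / 2"])
    show "r / 2 > 0" using r by simp
    fix d :: real and e :: "real^'n" assume d: "0 < d" "d \<le> r / 2" and e: "norm e = 1"
    let ?P = "axial_point w a d e"
    have cont: "continuous_on UNIV ?P" unfolding axial_point_def by (intro continuous_intros)
    have cl: "closed (?P -` K)" by (rule closed_vimage[OF compact_imp_closed[OF K(1)] cont])
    have bd: "bounded (?P -` K)"
    proof -
      obtain B where B: "\<And>y. y \<in> K \<Longrightarrow> norm y \<le> B" using compact_imp_bounded[OF K(1)] by (auto simp: bounded_iff)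
      have "norm x \<le> B" if "x \<in> ?P -` K" for x
      proof -
        have "(norm x)\<^sup>2 \<le> (norm (?P x))\<^sup>2" using axial_point_props(1)[OF w e, of d x] by simp
        then have "norm x \<le> norm (?P x)" by (rule power2_le_imp_le) simp
        then show ?thesis using B[of "?P x"] that by simp
      qed
      then show ?thesis by (auto simp: bounded_iff)
    qed
    have sub: "?P -` K \<subseteq> {x \<in> U. x \<bullet> e > 0}"
    proof
      fix x assume "x \<in> ?P -` K"
      then have PK: "?P x \<in> K" by simp
      then have "x \<bullet> e > 0" using K(2) axial_point_props(2)[OF w e, of d x] by auto
      \<comment> \<open>The unsmoothed point is within d <= r / 2 of the compact support, hence in
        \<open>U\<close>; having the norm of x, it can be rotated to x.\<close>
      have "dist (?P x) (axial_point w a 0 e x) < r"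
        using axial_point_props(3)[OF w e, of d x] d r by (simp add: dist_norm)
      then have "axial_point w a 0 e x \<in> ball (?P x) r" by simp
      then have P0: "axial_point w a 0 e x \<in> U" using r(2) PK by blast
      have "(norm (axial_point w a 0 e x))\<^sup>2 = (norm x)\<^sup>2" using axial_point_props(1)[OF w e, of 0 x] by simp
      then have "norm (axial_point w a 0 e x) = norm x" by simp
      then obtain f where f: "orthogonal_transformation f" "f (axial_point w a 0 e x) = x"
        by (rule orthogonal_transformation_exists)
      then have "f ` U = U" using U(2) by (simp add: radially_symmetric_def)
      then have "x \<in> U" using P0 f(2) by (metis imageI)
      then show "x \<in> {x \<in> U. x \<bullet> e > 0}" using \<open>x \<bullet> e > 0\<close> by simp
    qed
    have "compact (?P -` K)" using cl bd by (simp add: compact_eq_bounded_closed)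
    then show "(\<lambda>x. v (?P x)) \<in> test_functions {x \<in> U. x \<bullet> e > 0}"
      unfolding test_functions_def using smooth_axial(1)[OF vs e d(1)] sub K(3)
      by (intro CollectI conjI exI[of _ "?P -` K"]) auto
  qed
qed

section \<open>Normalised axially symmetric test functions of small energy\<close>

lemma nn_integral_Lp_norm:
  fixes f :: "real^'n \<Rightarrow> 'b::euclidean_space"
  assumes "f \<in> Lp p UNIV" "f \<in> borel_measurable borel" "p > 0"
  shows "(\<integral>\<^sup>+x. ennreal (norm (f x) powr p) \<partial>lborel) = ennreal (Lp_norm p UNIV f powr p)"
proof -
  have m: "(\<lambda>x. norm (f x) powr p) \<in> borel_measurable lborel" using assms(2) by measurable
  have "integrable (completion lborel) (\<lambda>x. norm (f x) powr p)"
    using assms(1) by (simp add: Lp_def lebesgue_on_UNIV_eq)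
  then have i: "integrable lborel (\<lambda>x. norm (f x) powr p)" by (simp only: integrable_completion[OF m])
  have "(\<integral>\<^sup>+x. ennreal (norm (f x) powr p) \<partial>lborel) = ennreal (LINT x|lborel. norm (f x) powr p)"
    by (rule nn_integral_eq_integral[OF i]) simp
  also have "(LINT x|lborel. norm (f x) powr p) = Lp_norm p UNIV f powr p"
    unfolding Lp_norm_powr[OF assms(3)] lebesgue_on_UNIV_eq by (rule integral_completion[OF m, symmetric])
  finally show ?thesis .
qed

lemma test_function_nn_integral:
  fixes U :: "(real^'n) set"
  assumes U: "open U" and \<phi>: "\<phi> \<in> test_functions U" and p: "p > 0"
  shows "(\<integral>\<^sup>+x. ennreal (\<bar>\<phi> x\<bar> powr p) \<partial>lborel) = ennreal (Lp_norm p U \<phi> powr p)"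
    "(\<integral>\<^sup>+x. ennreal (norm (gradient \<phi> x) powr p) \<partial>lborel) = ennreal (Lp_norm p U (gradient \<phi>) powr p)"
proof -
  have UL: "U \<in> sets lebesgue" using U by auto
  note L = test_function_Lp[OF UL \<phi> p]
  have sm: "smooth \<phi>" by (rule test_functions_smooth[OF \<phi>])
  have m: "\<phi> \<in> borel_measurable borel" "gradient \<phi> \<in> borel_measurable borel"
    by (rule borel_measurable_continuous_onI[OF smooth_continuous_on[OF sm]])
       (rule borel_measurable_continuous_onI[OF smooth_gradient_continuous_on[OF sm]])
  show "(\<integral>\<^sup>+x. ennreal (\<bar>\<phi> x\<bar> powr p) \<partial>lborel) = ennreal (Lp_norm p U \<phi> powr p)"
    using nn_integral_Lp_norm[OF L(3) m(1) p] unfolding L(5) by simp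
  show "(\<integral>\<^sup>+x. ennreal (norm (gradient \<phi> x) powr p) \<partial>lborel) = ennreal (Lp_norm p U (gradient \<phi>) powr p)"
    using nn_integral_Lp_norm[OF L(4) m(2) p] unfolding L(6) .
qed

text \<open>A function of norm 1 with energy below \<open>c\<close> is approximated in the Sobolev
  norm by a test function. The approximant is no longer normalised, so the conclusion is stated for
  the quotient.\<close>

lemma test_function_Rayleigh_quotient:
  fixes U :: "(real^'n) set"
  assumes U: "open U" "U \<noteq> {}" and p: "p > 1" and c: "first_eigenvalue p U < c"
  obtains v where "v \<in> test_functions U" "Lp_norm p U (gradient v) powr p < c * Lp_norm p U v powr p"
proof -
  have p0: "p > 0" "p \<ge> 1" using p by simp_all
  obtain \<psi> :: "nat \<Rightarrow> real^'n \<Rightarrow> real" where \<psi>: "\<And>i. i \<le> 0 \<Longrightarrow> \<psi> i \<in> test_functions U"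
    "\<And>i. i \<le> 0 \<Longrightarrow> Lp_norm p U (\<psi> i) = 1"
    using disjoint_test_functions[OF U p0(1), of 0] by metis
  have "\<psi> 0 \<in> Lp_sphere p U"
    unfolding Lp_sphere_def using test_function_W01p(2)[OF U(1) \<psi>(1)[OF le_refl] p0(1)] \<psi>(2)[OF le_refl] by (intro CollectI conjI)
  then have "Lp_sphere p U \<noteq> {}" by blast
  moreover have "bdd_below (p_energy p U ` Lp_sphere p U)" by (rule bdd_belowI2[of _ 0]) (rule p_energy_nonneg)
  ultimately obtain u where u: "u \<in> Lp_sphere p U" "p_energy p U u < c"
    using c cINF_less_iff[of "Lp_sphere p U" "p_energy p U" c] unfolding first_eigenvalue_def by blast
  define s where "s = Lp_norm p U (weak_gradient U u)"
  have s: "s \<ge> 0" by (simp add: s_def Lp_norm_nonneg)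
  have c0: "c > 0" using u(2) p_energy_nonneg[of p U u] by simp
  define t where "t = c powr (1 / p)"
  have t: "t powr p = c" "t > 0" using c0 p0 by (simp_all add: t_def powr_powr)
  have "s powr p < t powr p" using u(2) unfolding p_energy_eq_Lp_norm[OF p0(1)] s_def t(1) .
  have st: "s < t"
  proof (rule ccontr)
    assume "\<not> s < t"
    then have "t powr p \<le> s powr p" using p0 t(2) by (intro powr_mono2) auto
    then show False using \<open>s powr p < t powr p\<close> by simp
  qed
  \<comment> \<open>Chosen so that s + \<eta> < t (1 - \<eta>): an approximant closer than \<eta>
    has gradient norm below s + \<eta> and norm above 1 - \<eta>, hence quotient of norms below t,
    the p-th root of \<open>c\<close>.\<close>
  define \<eta> where "\<eta> = (t - s) / (2 * (1 + t))"
  have \<eta>: "\<eta> > 0" using st t by (simp add: \<eta>_def)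
  have "\<eta> * (1 + t) = (t - s) / 2" using t by (simp add: \<eta>_def field_simps)
  then have less: "s + \<eta> < t * (1 - \<eta>)" using st by (simp add: algebra_simps)
  have uW: "u \<in> W01p p U" "Lp_norm p U u = 1" using u by (auto simp: Lp_sphere_def)
  then obtain v where v: "v \<in> test_functions U" "W1p_norm p U (\<lambda>x. u x - v x) < \<eta>"
    using \<eta> unfolding W01p_def by blast
  note b = W1p_diff_bounds[OF U(1) p0(2) test_function_W01p(1)[OF U(1) v(1) p0(1)] W01p_subset_W1p[OF uW(1)]]
  have 1: "Lp_norm p U v > 1 - \<eta>" using b(1) v(2) uW(2) by simp
  have 2: "Lp_norm p U (gradient v) < s + \<eta>"
    using b(4) v(2) unfolding s_def test_function_weak_gradient[OF U(1) v(1)] by simp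
  have "t * (1 - \<eta>) \<le> t * Lp_norm p U v" using 1 t by (intro mult_left_mono) auto
  then have "Lp_norm p U (gradient v) < t * Lp_norm p U v" using 2 less by simp
  then have "Lp_norm p U (gradient v) powr p < (t * Lp_norm p U v) powr p"
    using p0 by (intro powr_less_mono2) (simp_all add: Lp_norm_nonneg)
  also have "\<dots> = c * Lp_norm p U v powr p"
    using t by (simp add: powr_mult Lp_norm_nonneg)
  finally show thesis using that v(1) by blast
qed

lemma nn_integral_axial_point_rotate:
  fixes w a e :: "real^'n" and h :: "real^'n \<Rightarrow> ennreal"
  assumes "norm a = 1" "norm e = 1" and h [measurable]: "h \<in> borel_measurable borel"
  shows "(\<integral>\<^sup>+x. h (axial_point w a d e x) \<partial>lborel) = (\<integral>\<^sup>+x. h (axial_point w a d a x) \<partial>lborel)"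
proof -
  have "norm e = norm a" using assms by simp
  then obtain R where R: "orthogonal_transformation R" "R e = a"
    by (rule orthogonal_transformation_exists)
  have "(\<integral>\<^sup>+x. h (axial_point w a d a (R x)) \<partial>lborel) = (\<integral>\<^sup>+x. h (axial_point w a d a x) \<partial>lborel)"
    by (rule nn_integral_orthogonal_transformation[OF R(1)]) measurable
  then show ?thesis unfolding axial_point_orthogonal[OF R] .
qed

text \<open>Lets a strict inequality found for d = 0 survive for small d > 0. Norms do not decrease,
  so all integrands vanish outside one ball, which gives the majorant.\<close>

lemma nn_integral_axial_point_limit:
  fixes w a :: "real^'n" and h :: "real^'n \<Rightarrow> real"
  assumes w: "norm w = 1" "norm a = 1" "w \<bullet> a = 0"
    and h: "continuous_on UNIV h" "\<And>x. h x \<le> M" "M \<ge> 0" and K: "compact K" "\<And>x. x \<notin> K \<Longrightarrow> h x = 0"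
  shows "(\<lambda>n. \<integral>\<^sup>+x. ennreal (h (axial_point w a (1 / real (Suc n)) a x)) \<partial>lborel)
    \<longlonglongrightarrow> (\<integral>\<^sup>+x. ennreal (h (axial_point w a 0 a x)) \<partial>lborel)"
proof -
  obtain B where B: "\<And>y. y \<in> K \<Longrightarrow> norm y \<le> B" using compact_imp_bounded[OF K(1)] by (auto simp: bounded_iff)
  have hm [measurable]: "h \<in> borel_measurable borel" by (rule borel_measurable_continuous_onI[OF h(1)])
  show ?thesis
  proof (rule nn_integral_dominated_convergence[where w = "\<lambda>x. ennreal M * indicator (cball 0 B) x"])
    show "(\<lambda>x. ennreal (h (axial_point w a (1 / real (Suc n)) a x))) \<in> borel_measurable lborel" for n
      by measurable
    show "(\<lambda>x. ennreal (h (axial_point w a 0 a x))) \<in> borel_measurable lborel" by measurable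
    show "(\<lambda>x. ennreal M * indicator (cball 0 B) x) \<in> borel_measurable lborel"
      by (intro borel_measurable_times_ennreal borel_measurable_const borel_measurable_indicator) simp
    show "AE x in lborel. ennreal (h (axial_point w a (1 / real (Suc n)) a x)) \<le> ennreal M * indicator (cball 0 B) x" for n
    proof (rule AE_I2)
      fix x
      let ?P = "axial_point w a (1 / real (Suc n)) a x"
      show "ennreal (h ?P) \<le> ennreal M * indicator (cball 0 B) x"
      proof (cases "?P \<in> K")
        case True
        have "(norm x)\<^sup>2 \<le> (norm ?P)\<^sup>2" using axial_point_props(1)[OF w w(2), of "1 / real (Suc n)" x] by simp
        then have "norm x \<le> norm ?P" by (rule power2_le_imp_le) simp
        then have "x \<in> cball 0 B" using B[OF True] by simp
        then show ?thesis using h(2)[of ?P] by (simp add: ennreal_leI)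
      qed (simp add: K(2))
    qed
    have "(\<integral>\<^sup>+x. ennreal M * indicator (cball (0 :: real^'n) B) x \<partial>lborel) = ennreal M * emeasure lborel (cball (0 :: real^'n) B)"
      by (rule nn_integral_cmult_indicator) simp
    also have "\<dots> < \<infinity>" using emeasure_lborel_cball_finite[of "0 :: real^'n" B] by (simp add: ennreal_mult_less_top)
    finally show "(\<integral>\<^sup>+x. ennreal M * indicator (cball (0 :: real^'n) B) x \<partial>lborel) < \<infinity>" .
    show "AE x in lborel. (\<lambda>n. ennreal (h (axial_point w a (1 / real (Suc n)) a x))) \<longlonglongrightarrow> ennreal (h (axial_point w a 0 a x))"
    proof (rule AE_I2)
      fix x
      have "(\<lambda>n. 1 / real (Suc n)) \<longlonglongrightarrow> 0" using LIMSEQ_inverse_real_of_nat by (simp add: inverse_eq_divide)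
      then have "(\<lambda>n. axial_point w a (1 / real (Suc n)) a x) \<longlonglongrightarrow> axial_point w a 0 a x"
        unfolding axial_point_def by (intro tendsto_add tendsto_scaleR tendsto_real_sqrt tendsto_power tendsto_const)
      then have "(\<lambda>n. h (axial_point w a (1 / real (Suc n)) a x)) \<longlonglongrightarrow> h (axial_point w a 0 a x)"
        by (rule continuous_on_tendsto_compose[OF h(1)]) simp_all
      then show "(\<lambda>n. ennreal (h (axial_point w a (1 / real (Suc n)) a x))) \<longlonglongrightarrow> ennreal (h (axial_point w a 0 a x))"
        by (rule tendsto_ennrealI)
    qed
  qed
qed

lemma axial_point_axis:
  "axial_point w (axis k 1) 0 (axis k 1) x = axial_radius k x *\<^sub>R w + (x $ k) *\<^sub>R axis k 1"
proof -
  have i: "x \<bullet> axis k 1 = x $ k" by (simp add: inner_axis)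
  have "axial_radius k x = sqrt (x \<bullet> x - (x $ k)\<^sup>2)"
    unfolding axial_radius_def norm_eq_sqrt_inner
    by (simp add: inner_diff_left inner_diff_right inner_axis inner_axis' power2_eq_square)
  then show ?thesis by (simp add: axial_point_def i)
qed

text \<open>A strict inequality is carried along: for \<open>v\<close> on the half domain, for the
  half plane given by a good direction \<open>w\<close>, and for a sufficiently small smoothing
  \<open>d\<close>. Continuity is joint in axis and point because the compactness of the resulting
  set of functions is derived from it.\<close>

lemma axial_functions:
  fixes \<Omega> :: "(real^'n) set" and k :: 'n
  assumes N: "CARD('n) \<ge> 2" and \<Omega>: "open \<Omega>" "\<Omega> \<noteq> {}" "radially_symmetric \<Omega>" and p: "p > 1"
    and c: "first_eigenvalue p {x \<in> \<Omega>. x $ k > 0} < c"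
  obtains V :: "real^'n \<Rightarrow> real^'n \<Rightarrow> real" where
    "\<And>e. norm e = 1 \<Longrightarrow> V e \<in> test_functions {x \<in> \<Omega>. x \<bullet> e > 0}"
    "\<And>e. norm e = 1 \<Longrightarrow> Lp_norm p \<Omega> (V e) = 1"
    "\<And>e. norm e = 1 \<Longrightarrow> Lp_norm p \<Omega> (gradient (V e)) powr p \<le> c"
    "continuous_on (sphere 0 1 \<times> UNIV) (\<lambda>z. V (fst z) (snd z))"
    "continuous_on (sphere 0 1 \<times> UNIV) (\<lambda>z. gradient (V (fst z)) (snd z))"
proof -
  define a :: "real^'n" where "a = axis k 1"
  have a: "norm a = 1" by (simp add: a_def norm_axis_1)
  have xa: "x \<bullet> a = x $ k" for x by (simp add: a_def inner_axis)
  define H where "H = {x \<in> \<Omega>. x \<bullet> a > 0}"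
  have p0: "p > 0" using p by simp
  have H: "open H"
  proof -
    have "H = \<Omega> \<inter> {x. x \<bullet> a > 0}" by (auto simp: H_def)
    moreover have "open {x. x \<bullet> a > 0}" by (intro open_Collect_less continuous_intros)
    ultimately show ?thesis using \<Omega>(1) by (simp add: open_Int)
  qed
  have "H \<noteq> {}"
  proof -
    \<comment> \<open>An open set is not a single point, so it contains some x other than 0;
      rotating x onto the positive axis gives a point of the half domain.\<close>
    have "\<Omega> \<noteq> {0}" using \<Omega>(1) not_open_singleton by metis
    then obtain x where x: "x \<in> \<Omega>" "x \<noteq> 0" using \<Omega>(2) by blast
    have "norm x = norm (norm x *\<^sub>R a)" using a by simp
    then obtain f where f: "orthogonal_transformation f" "f x = norm x *\<^sub>R a"
      by (rule orthogonal_transformation_exists)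
    then have "f ` \<Omega> = \<Omega>" using \<Omega>(3) by (simp add: radially_symmetric_def)
    then have "norm x *\<^sub>R a \<in> \<Omega>" using x f(2) by (metis imageI)
    moreover have "a \<bullet> a = 1" using a by (simp add: dot_square_norm)
    ultimately have "norm x *\<^sub>R a \<in> H" using x(2) by (simp add: H_def)
    then show ?thesis by blast
  qed
  moreover have "first_eigenvalue p H < c" using c by (simp add: H_def xa)
  ultimately obtain v where v: "v \<in> test_functions H" and vc: "Lp_norm p H (gradient v) powr p < c * Lp_norm p H v powr p"
    using test_function_Rayleigh_quotient[OF H _ p] by blast
  have vs: "smooth v" by (rule test_functions_smooth[OF v])
  have c0: "c > 0"
  proof (rule ccontr)
    assume "\<not> c > 0"
    then have "c * Lp_norm p H v powr p \<le> 0" by (simp add: mult_nonpos_nonneg)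
    then show False using vc powr_ge_zero[of "Lp_norm p H (gradient v)" p] by linarith
  qed
  obtain K B where K: "compact K" "\<And>x. x \<notin> K \<Longrightarrow> v x = 0" "\<And>x. x \<notin> K \<Longrightarrow> gradient v x = 0" "K \<subseteq> H"
    and B: "B \<ge> 0" "\<And>x. \<bar>v x\<bar> \<le> B" "\<And>x. norm (gradient v x) \<le> B"
    using test_functionsE[OF v] by metis
  define f where "f x = \<bar>v x\<bar> powr p" for x
  define g where "g x = norm (gradient v x) powr p" for x
  have cont: "continuous_on UNIV f" "continuous_on UNIV g"
    unfolding f_def[abs_def] g_def[abs_def] using p0
    by (intro continuous_on_powr' continuous_on_norm continuous_on_rabs smooth_continuous_on smooth_gradient_continuous_on vs continuous_on_const; simp)+
  have [measurable]: "f \<in> borel_measurable borel" "g \<in> borel_measurable borel"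
    by (rule borel_measurable_continuous_onI, rule cont)+
  have bd: "f x \<le> B powr p" "g x \<le> B powr p" for x
    unfolding f_def g_def using B p0 by (auto intro: powr_mono2)
  have off: "f x = 0" "g x = 0" if "x \<notin> K" for x using K(2,3)[OF that] p0 by (simp_all add: f_def g_def)
  have "(\<integral>\<^sup>+x. ennreal (g x) \<partial>lborel) < ennreal c * (\<integral>\<^sup>+x. ennreal (f x) \<partial>lborel)"
    unfolding f_def g_def test_function_nn_integral[OF H v p0]
    using vc c0 by (simp add: ennreal_mult'[symmetric] ennreal_less_iff)
  moreover have "x \<notin> K" if "x $ k \<le> 0" for x using K(4) that by (auto simp: H_def xa)
  ultimately obtain w where w: "norm w = 1" "w $ k = 0" and
    wc: "(\<integral>\<^sup>+x. ennreal (g (axial_radius k x *\<^sub>R w + (x $ k) *\<^sub>R axis k 1)) \<partial>lborel)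
      < ennreal c * (\<integral>\<^sup>+x. ennreal (f (axial_radius k x *\<^sub>R w + (x $ k) *\<^sub>R axis k 1)) \<partial>lborel)"
    using exists_good_direction[OF N, of "\<lambda>x. ennreal (f x)" "\<lambda>x. ennreal (g x)" k "ennreal c"] off by auto
  have wa: "w \<bullet> a = 0" by (simp add: xa w)
  note props = w(1) a wa
  let ?P = "axial_point w a"
  define I where "I d h = (\<integral>\<^sup>+x. ennreal (h (?P d a x)) \<partial>lborel)" for d and h :: "real^'n \<Rightarrow> real"
  have "I 0 g < ennreal c * I 0 f"
    using wc unfolding I_def a_def axial_point_axis .
  \<comment> \<open>A level strictly between the two sides lets both limits be treated
    separately.\<close>
  then obtain m where m: "I 0 g < m" "m < ennreal c * I 0 f" using dense by blast
  have lim: "(\<lambda>n. I (1 / real (Suc n)) f) \<longlonglongrightarrow> I 0 f" "(\<lambda>n. I (1 / real (Suc n)) g) \<longlonglongrightarrow> I 0 g"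
    unfolding I_def
    by (rule nn_integral_axial_point_limit[OF props cont(1) bd(1) powr_ge_zero K(1) off(1)], assumption)
       (rule nn_integral_axial_point_limit[OF props cont(2) bd(2) powr_ge_zero K(1) off(2)], assumption)
  have "(\<lambda>n. ennreal c * I (1 / real (Suc n)) f) \<longlonglongrightarrow> ennreal c * I 0 f"
    by (rule ennreal_tendsto_cmult[OF _ lim(1)]) simp
  then have ev1: "\<forall>\<^sub>F n in sequentially. m < ennreal c * I (1 / real (Suc n)) f"
    using m(2) by (rule order_tendstoD(1))
  have ev2: "\<forall>\<^sub>F n in sequentially. I (1 / real (Suc n)) g < m"
    by (rule order_tendstoD(2)[OF lim(2) m(1)])
  obtain d0 where d0: "d0 > 0" "\<And>d e. 0 < d \<Longrightarrow> d \<le> d0 \<Longrightarrow> norm e = 1 \<Longrightarrow>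
      (\<lambda>x. v (?P d e x)) \<in> test_functions {x \<in> \<Omega>. x \<bullet> e > 0}"
  proof (rule axial_test_function[OF \<Omega>(1,3) v[unfolded H_def] props])
    fix d0 assume *: "d0 > 0" "\<And>d e. 0 < d \<Longrightarrow> d \<le> d0 \<Longrightarrow> norm e = 1 \<Longrightarrow>
      (\<lambda>x. v (?P d e x)) \<in> test_functions {x \<in> \<Omega>. x \<bullet> e > 0}"
    show thesis by (rule that[OF *])
  qed
  have "(\<lambda>n. 1 / real (Suc n)) \<longlonglongrightarrow> 0" using LIMSEQ_inverse_real_of_nat by (simp add: inverse_eq_divide)
  then have "\<forall>\<^sub>F n in sequentially. 1 / real (Suc n) < d0" by (rule order_tendstoD(2)) (rule d0(1))
  then have "\<forall>\<^sub>F n in sequentially. 1 / real (Suc n) < d0 \<and> I (1 / real (Suc n)) g < m \<and> m < ennreal c * I (1 / real (Suc n)) f"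
    using ev1 ev2 by eventually_elim simp
  then obtain n where n: "1 / real (Suc n) < d0" "I (1 / real (Suc n)) g < m" "m < ennreal c * I (1 / real (Suc n)) f"
    using eventually_happens'[OF sequentially_bot] by blast
  define d where "d = 1 / real (Suc n)"
  have d: "0 < d" "d \<le> d0" using n(1) by (simp_all add: d_def)
  have Id: "I d g < ennreal c * I d f" unfolding d_def by (rule less_trans[OF n(2,3)])
  define W where "W e x = v (?P d e x)" for e x
  have W: "W e \<in> test_functions {x \<in> \<Omega>. x \<bullet> e > 0}" if "norm e = 1" for e
    unfolding W_def[abs_def] by (rule d0(2)[OF d that])
  have W\<Omega>: "W e \<in> test_functions \<Omega>" if "norm e = 1" for e
    by (rule test_functions_mono[OF _ W[OF that]]) blast
  have If: "ennreal (Lp_norm p \<Omega> (W e) powr p) = I d f" if e: "norm e = 1" for e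
  proof -
    have "ennreal (Lp_norm p \<Omega> (W e) powr p) = (\<integral>\<^sup>+x. ennreal (f (?P d e x)) \<partial>lborel)"
      unfolding test_function_nn_integral(1)[OF \<Omega>(1) W\<Omega>[OF e] p0, symmetric] by (simp add: W_def f_def)
    also have "\<dots> = I d f" unfolding I_def
      by (rule nn_integral_axial_point_rotate[OF a e, of "\<lambda>x. ennreal (f x)"]) measurable
    finally show ?thesis .
  qed
  have Ig: "ennreal (Lp_norm p \<Omega> (gradient (W e)) powr p) \<le> I d g" if e: "norm e = 1" for e
  proof -
    have "norm (gradient (W e) x) powr p \<le> g (?P d e x)" for x
      unfolding g_def W_def[abs_def] using norm_gradient_axial[OF vs e d(1) props, of x] p0 by (intro powr_mono2) auto
    then have "ennreal (Lp_norm p \<Omega> (gradient (W e)) powr p) \<le> (\<integral>\<^sup>+x. ennreal (g (?P d e x)) \<partial>lborel)"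
      unfolding test_function_nn_integral(2)[OF \<Omega>(1) W\<Omega>[OF e] p0, symmetric] by (intro nn_integral_mono ennreal_leI)
    also have "\<dots> = I d g" unfolding I_def
      by (rule nn_integral_axial_point_rotate[OF a e, of "\<lambda>x. ennreal (g x)"]) measurable
    finally show ?thesis .
  qed
  \<comment> \<open>All \<open>W e\<close> have the same norm, so one constant normalises the whole
    family and continuity in \<open>e\<close> is preserved.\<close>
  define \<alpha> where "\<alpha> = Lp_norm p \<Omega> (W a)"
  have \<alpha>e: "Lp_norm p \<Omega> (W e) = \<alpha>" if e: "norm e = 1" for e
  proof -
    have "ennreal (Lp_norm p \<Omega> (W e) powr p) = ennreal (\<alpha> powr p)" using If[OF e] If[OF a] by (simp add: \<alpha>_def)
    then have "Lp_norm p \<Omega> (W e) powr p = \<alpha> powr p" by simp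
    then have "(Lp_norm p \<Omega> (W e) powr p) powr (1 / p) = (\<alpha> powr p) powr (1 / p)" by simp
    then show ?thesis using p0 by (simp add: powr_powr Lp_norm_nonneg \<alpha>_def)
  qed
  have energy: "Lp_norm p \<Omega> (gradient (W e)) powr p < c * \<alpha> powr p" if e: "norm e = 1" for e
  proof -
    have "ennreal (Lp_norm p \<Omega> (gradient (W e)) powr p) < ennreal c * ennreal (\<alpha> powr p)"
      using Ig[OF e] Id If[OF a] by (simp add: \<alpha>_def)
    then show ?thesis using c0 by (simp add: ennreal_mult'[symmetric] ennreal_less_iff)
  qed
  have \<alpha>: "\<alpha> > 0"
  proof (rule ccontr)
    assume "\<not> \<alpha> > 0"
    then have "\<alpha> = 0" using Lp_norm_nonneg[of p \<Omega> "W a"] by (simp add: \<alpha>_def)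
    then show False using energy[OF a] by simp
  qed
  define V where "V e x = (1 / \<alpha>) * W e x" for e x
  have grad: "gradient (V e) x = (1 / \<alpha>) *\<^sub>R gradient (W e) x" if e: "norm e = 1" for e x
    using GDERIV_mult[OF GDERIV_const[of "1 / \<alpha>" x] GDERIV_smooth[OF test_functions_smooth[OF W[OF e]], of x]]
    unfolding V_def[abs_def] by (intro gradient_eqI) simp
  have UL: "\<Omega> \<in> sets lebesgue" using \<Omega>(1) by auto
  show thesis
  proof (rule that[of V])
    fix e :: "real^'n" assume e: "norm e = 1"
    show "V e \<in> test_functions {x \<in> \<Omega>. x \<bullet> e > 0}" unfolding V_def[abs_def] by (rule test_functions_cmult[OF W[OF e]])
    show "Lp_norm p \<Omega> (V e) = 1"
      using Lp_cmult(2)[OF test_function_Lp(1)[OF UL W\<Omega>[OF e] p0] p0, of "1 / \<alpha>"] \<alpha>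
      by (simp add: V_def[abs_def] \<alpha>e[OF e])
    have "gradient (V e) = (\<lambda>x. (1 / \<alpha>) *\<^sub>R gradient (W e) x)" using grad[OF e] by blast
    then have "Lp_norm p \<Omega> (gradient (V e)) powr p = (1 / \<alpha> * Lp_norm p \<Omega> (gradient (W e))) powr p"
      using Lp_cmult(2)[OF test_function_Lp(2)[OF UL W\<Omega>[OF e] p0] p0, of "1 / \<alpha>"] \<alpha> by simp
    also have "\<dots> = Lp_norm p \<Omega> (gradient (W e)) powr p / \<alpha> powr p"
      using \<alpha> by (simp add: powr_divide Lp_norm_nonneg)
    also have "\<dots> \<le> c" using energy[OF e] \<alpha> by (simp add: pos_divide_le_eq)
    finally show "Lp_norm p \<Omega> (gradient (V e)) powr p \<le> c" .
  next
    have P: "continuous_on S (\<lambda>z. ?P d (fst z) (snd z))" for S by (rule continuous_on_axial_point)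
    have comp: "continuous_on S (\<lambda>z. h (?P d (fst z) (snd z)))" if "continuous_on UNIV h" for h :: "real^'n \<Rightarrow> 'c::topological_space" and S
      by (rule continuous_on_compose2[OF that P]) simp
    show "continuous_on (sphere 0 1 \<times> UNIV) (\<lambda>z. V (fst z) (snd z))"
      unfolding V_def W_def by (intro continuous_on_mult continuous_on_const comp smooth_continuous_on vs)
    \<comment> \<open>Written out, the gradient is visibly continuous in axis and point together;
      the denominator does not vanish since d > 0.\<close>
    let ?G = "\<lambda>z. (1 / \<alpha>) *\<^sub>R ((gradient v (?P d (fst z) (snd z)) \<bullet> w / sqrt (snd z \<bullet> snd z - (snd z \<bullet> fst z)\<^sup>2 + d\<^sup>2)) *\<^sub>R (snd z - (snd z \<bullet> fst z) *\<^sub>R fst z)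
        + (gradient v (?P d (fst z) (snd z)) \<bullet> a) *\<^sub>R fst z)"
    have nz: "sqrt (x \<bullet> x - (x \<bullet> e)\<^sup>2 + d\<^sup>2) \<noteq> 0" if "norm e = 1" for x e :: "real^'n"
    proof -
      have "0 < x \<bullet> x - (x \<bullet> e)\<^sup>2 + d\<^sup>2" using inner_unit_le[OF that, of x] d(1) by (simp add: add_nonneg_pos)
      then show ?thesis by simp
    qed
    have cG: "continuous_on (sphere 0 1 \<times> UNIV) ?G"
      by (intro continuous_on_scaleR continuous_on_const continuous_on_add continuous_on_diff continuous_on_divide continuous_on_inner
          continuous_on_real_sqrt continuous_on_power continuous_on_fst continuous_on_snd continuous_on_id comp smooth_gradient_continuous_on vs)
         (use nz in auto)
    show "continuous_on (sphere 0 1 \<times> UNIV) (\<lambda>z. gradient (V (fst z)) (snd z))"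
    proof (rule continuous_on_eq[OF cG])
      fix z :: "(real^'n) \<times> (real^'n)" assume "z \<in> sphere 0 1 \<times> UNIV"
      then have e: "norm (fst z) = 1" by auto
      have "gradient (W (fst z)) (snd z) =
          (gradient v (?P d (fst z) (snd z)) \<bullet> w / sqrt (snd z \<bullet> snd z - (snd z \<bullet> fst z)\<^sup>2 + d\<^sup>2)) *\<^sub>R (snd z - (snd z \<bullet> fst z) *\<^sub>R fst z)
            + (gradient v (?P d (fst z) (snd z)) \<bullet> a) *\<^sub>R fst z"
        unfolding W_def[abs_def] by (rule smooth_axial(2)[OF vs e d(1)])
      then show "?G z = gradient (V (fst z)) (snd z)" unfolding grad[OF e, of "snd z"] by (simp only:)
    qed
  qed
qed

section \<open>Multiplicity of the second eigenvalue\<close>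

text \<open>The set where h(s, x) is close to h(t, x) is open and contains the slice over t, so by
  the tube lemma it contains a strip around it.\<close>

lemma continuous_on_compact_uniform_neighbourhood:
  fixes h :: "'a::topological_space \<times> 'b::topological_space \<Rightarrow> 'c::metric_space"
  assumes h: "continuous_on (S \<times> K) h" and K: "compact K" and t: "t \<in> S" and \<epsilon>: "\<epsilon> > 0"
  shows "\<exists>V. openin (top_of_set S) V \<and> t \<in> V \<and> (\<forall>s\<in>V. \<forall>x\<in>K. dist (h (s, x)) (h (t, x)) < \<epsilon>)"
proof -
  define g where "g z = dist (h z) (h (t, snd z))" for z
  have "continuous_on (S \<times> K) (\<lambda>z. h (t, snd z))"
    by (rule continuous_on_compose2[OF h]) (use t in \<open>auto intro!: continuous_intros\<close>)
  then have "continuous_on (S \<times> K) g" unfolding g_def by (intro continuous_on_dist h)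
  then have op: "openin (top_of_set (S \<times> K)) (S \<times> K \<inter> g -` {..<\<epsilon>})"
    by (rule continuous_openin_preimage_gen) simp
  have "\<exists>U V. openin (top_of_set S) U \<and> openin (top_of_set K) V \<and> t \<in> U \<and> K \<subseteq> V \<and> U \<times> V \<subseteq> S \<times> K \<inter> g -` {..<\<epsilon>}"
  proof (rule tube_lemma_right)
    show "openin (prod_topology (top_of_set S) (top_of_set K)) (S \<times> K \<inter> g -` {..<\<epsilon>})" using op by simp
    show "compactin (top_of_set K) K" using K by (simp add: compactin_subtopology)
    show "{t} \<times> K \<subseteq> S \<times> K \<inter> g -` {..<\<epsilon>}" using t \<epsilon> by (auto simp: g_def)
  qed (use t in simp)
  then obtain U V where UV: "openin (top_of_set S) U" "t \<in> U" "K \<subseteq> V" "U \<times> V \<subseteq> S \<times> K \<inter> g -` {..<\<epsilon>}" by blast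
  have "dist (h (s, x)) (h (t, x)) < \<epsilon>" if "s \<in> U" "x \<in> K" for s x
  proof -
    have "(s, x) \<in> S \<times> K \<inter> g -` {..<\<epsilon>}" using UV(3,4) that by blast
    then show ?thesis by (simp add: g_def)
  qed
  then show ?thesis using UV(1,2) by blast
qed

lemma continuous_map_test_function_family:
  fixes U :: "(real^'n) set" and F :: "'a::topological_space \<Rightarrow> real^'n \<Rightarrow> real"
  assumes U: "open U" "bounded U" and p: "p > 0" and test: "\<And>t. t \<in> S \<Longrightarrow> F t \<in> test_functions U"
    and cont: "continuous_on (S \<times> UNIV) (\<lambda>z. F (fst z) (snd z))"
      "continuous_on (S \<times> UNIV) (\<lambda>z. gradient (F (fst z)) (snd z))"
  shows "continuous_map (top_of_set S) (W01p_topology p U) F"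
proof (rule continuous_map_test_functions[OF U p])
  show "F t \<in> test_functions U" if "t \<in> topspace (top_of_set S)" for t using that test by simp
  fix t and \<epsilon> :: real assume "t \<in> topspace (top_of_set S)" and \<epsilon>: "\<epsilon> > 0"
  then have t: "t \<in> S" by simp
  have K: "compact (closure U)" using U(2) by simp
  have c: "continuous_on (S \<times> closure U) (\<lambda>z. F (fst z) (snd z))"
    "continuous_on (S \<times> closure U) (\<lambda>z. gradient (F (fst z)) (snd z))"
    by (rule continuous_on_subset[OF cont(1)], blast) (rule continuous_on_subset[OF cont(2)], blast)
  obtain V1 where V1: "openin (top_of_set S) V1" "t \<in> V1"
    "\<forall>s\<in>V1. \<forall>x\<in>closure U. dist (F s x) (F t x) < \<epsilon>"
    using continuous_on_compact_uniform_neighbourhood[OF c(1) K t \<epsilon>] unfolding fst_conv snd_conv by blast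
  obtain V2 where V2: "openin (top_of_set S) V2" "t \<in> V2"
    "\<forall>s\<in>V2. \<forall>x\<in>closure U. dist (gradient (F s) x) (gradient (F t) x) < \<epsilon>"
    using continuous_on_compact_uniform_neighbourhood[OF c(2) K t \<epsilon>] unfolding fst_conv snd_conv by blast
  have "\<bar>F s x - F t x\<bar> \<le> \<epsilon> \<and> norm (gradient (F s) x - gradient (F t) x) \<le> \<epsilon>" if "s \<in> V1 \<inter> V2" "x \<in> U" for s x
  proof -
    have "x \<in> closure U" using that(2) closure_subset by blast
    then have "dist (F s x) (F t x) < \<epsilon>" "dist (gradient (F s) x) (gradient (F t) x) < \<epsilon>"
      using V1(3) V2(3) that(1) by blast+
    then show ?thesis by (simp add: dist_norm)
  qed
  then show "\<exists>V. openin (top_of_set S) V \<and> t \<in> V \<and> (\<forall>s\<in>V. \<forall>x\<in>U. \<bar>F s x - F t x\<bar> \<le> \<epsilon> \<and> norm (gradient (F s) x - gradient (F t) x) \<le> \<epsilon>)"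
    using V1(1,2) V2(1,2) by (intro exI[of _ "V1 \<inter> V2"]) (simp add: openin_Int)
qed

lemma nsphere_parametrization:
  obtains E :: "(nat \<Rightarrow> real) \<Rightarrow> real^'n" where "continuous_on UNIV E" "\<And>t. E (antipode t) = - E t"
    "\<And>t. t \<in> topspace (nsphere (CARD('n) - 1)) \<Longrightarrow> norm (E t) = 1"
proof -
  have "card (UNIV :: 'n set) = card {..CARD('n) - 1}" by simp
  then obtain b :: "'n \<Rightarrow> nat" where b: "bij_betw b UNIV {..CARD('n) - 1}"
    using finite_same_card_bij[of "UNIV :: 'n set" "{..CARD('n) - 1}"] by auto
  show thesis
  proof (rule that[of "\<lambda>t. \<chi> i. t (b i)"])
    show "continuous_on UNIV (\<lambda>t :: nat \<Rightarrow> real. \<chi> i. t (b i))"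
      by (intro continuous_on_vec_lambda continuous_on_product_coordinates)
    show "(\<chi> i. antipode t (b i)) = - (\<chi> i. t (b i))" for t by (simp add: vec_eq_iff)
    fix t assume t: "t \<in> topspace (nsphere (CARD('n) - 1))"
    have "(norm (\<chi> i. t (b i)))\<^sup>2 = (\<Sum>i\<in>UNIV. (t (b i))\<^sup>2)"
      unfolding power2_norm_eq_inner inner_vec_def by (simp add: power2_eq_square)
    also have "\<dots> = (\<Sum>j\<le>CARD('n) - 1. (t j)\<^sup>2)" by (rule sum.reindex_bij_betw[OF b])
    also have "\<dots> = 1" using t by (simp add: topspace_nsphere)
    finally have "(norm (\<chi> i. t (b i)))\<^sup>2 = 1" .
    then have "norm (\<chi> i. t (b i)) = 1 \<or> norm (\<chi> i. t (b i)) = - 1" by (simp add: power2_eq_1_iff)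
    then show "norm (\<chi> i. t (b i)) = 1" using norm_ge_zero[of "\<chi> i. t (b i)"] by linarith
  qed
qed

lemma nsphere_eq_top_of_set: "nsphere n = top_of_set (topspace (nsphere n))"
  unfolding nsphere by (simp add: euclidean_product_topology)

text \<open>The parameter space is the product of the sphere of axes and a circle of coefficients.
  Negating the coefficients negates the function, which gives symmetry; exchanging the axis with its
  opposite exchanges the two coefficients, which drives the genus bound.\<close>

lemma axial_genus_family:
  fixes \<Omega> :: "(real^'n) set" and V :: "real^'n \<Rightarrow> real^'n \<Rightarrow> real"
  assumes \<Omega>: "open \<Omega>" "bounded \<Omega>" and p: "p > 1"
    and V: "\<And>e. norm e = 1 \<Longrightarrow> V e \<in> test_functions {x \<in> \<Omega>. x \<bullet> e > 0}"
      "\<And>e. norm e = 1 \<Longrightarrow> Lp_norm p \<Omega> (V e) = 1"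
      "\<And>e. norm e = 1 \<Longrightarrow> Lp_norm p \<Omega> (gradient (V e)) powr p \<le> c"
      "continuous_on (sphere 0 1 \<times> UNIV) (\<lambda>z. V (fst z) (snd z))"
      "continuous_on (sphere 0 1 \<times> UNIV) (\<lambda>z. gradient (V (fst z)) (snd z))"
  obtains A where "A \<in> genus_family p \<Omega> (CARD('n) + 1)" "\<And>u. u \<in> A \<Longrightarrow> p_energy p \<Omega> u \<le> c"
proof -
  have p0: "p > 0" using p by simp
  have UL: "\<Omega> \<in> sets lebesgue" using \<Omega>(1) by auto
  let ?sp = "signed_powr (2 / p)"
  \<comment> \<open>The circle is mapped to admissible weights by the signed power 2 / p, so that
    the p-th powers of their absolute values add up to 1.\<close>
  define T where "T = sphere (0 :: real^'n) 1 \<times> sphere (0 :: real \<times> real) 1"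
  define F where "F q x = ?sp (fst (snd q)) * V (fst q) x + ?sp (snd (snd q)) * V (- fst q) x"
    for q :: "(real^'n) \<times> real \<times> real" and x
  have unit: "norm (fst q) = 1" "norm (- fst q) = 1" "(fst (snd q))\<^sup>2 + (snd (snd q))\<^sup>2 = 1" if "q \<in> T" for q
    using that by (auto simp: T_def norm_prod_def real_sqrt_eq_1_iff mem_Times_iff)
  have V\<Omega>: "V e \<in> test_functions \<Omega>" if "norm e = 1" for e
    by (rule test_functions_mono[OF _ V(1)[OF that]]) blast
  have F: "F q \<in> test_functions \<Omega>" if "q \<in> T" for q
    unfolding F_def by (intro test_functions_add test_functions_cmult V\<Omega> unit[OF that])
  have grad: "gradient (F q) x = ?sp (fst (snd q)) *\<^sub>R gradient (V (fst q)) x + ?sp (snd (snd q)) *\<^sub>R gradient (V (- fst q)) x"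
    if q: "q \<in> T" for q x
  proof -
    have *: "GDERIV (\<lambda>x. c * V e x) x :> c *\<^sub>R gradient (V e) x" if "norm e = 1" for c e
      using GDERIV_mult[OF GDERIV_const[of c x] GDERIV_smooth[OF test_functions_smooth[OF V\<Omega>[OF that]]]] by simp
    show ?thesis unfolding F_def by (rule gradient_eqI[OF GDERIV_add[OF * *]]) (rule unit[OF q])+
  qed
  have csp: "continuous_on S (\<lambda>z. ?sp (h z))" if "continuous_on S h" for S and h :: "'z::topological_space \<Rightarrow> real"
    by (rule continuous_on_compose2[OF continuous_on_signed_powr[of "2 / p" UNIV] that]) (use p in auto)
  have cV: "continuous_on (T \<times> UNIV) (\<lambda>z. V (g (fst z)) (snd z))"
      "continuous_on (T \<times> UNIV) (\<lambda>z. gradient (V (g (fst z))) (snd z))"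
    if g: "continuous_on T g" "\<And>q. q \<in> T \<Longrightarrow> norm (g q) = 1" for g
  proof -
    have "continuous_on (T \<times> UNIV) (\<lambda>z :: ((real^'n) \<times> real \<times> real) \<times> (real^'n). g (fst z))"
      by (rule continuous_on_compose2[OF g(1)]) (auto intro!: continuous_intros)
    then have G: "continuous_on (T \<times> UNIV) (\<lambda>z :: ((real^'n) \<times> real \<times> real) \<times> (real^'n). (g (fst z), snd z))"
      by (intro continuous_on_Pair continuous_on_snd continuous_on_id)
    have im: "(\<lambda>z :: ((real^'n) \<times> real \<times> real) \<times> (real^'n). (g (fst z), snd z)) ` (T \<times> UNIV) \<subseteq> sphere 0 1 \<times> UNIV"
      using g(2) by auto
    show "continuous_on (T \<times> UNIV) (\<lambda>z. V (g (fst z)) (snd z))"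
      using continuous_on_compose2[OF V(4) G im] by simp
    show "continuous_on (T \<times> UNIV) (\<lambda>z. gradient (V (g (fst z))) (snd z))"
      using continuous_on_compose2[OF V(5) G im] by simp
  qed
  have cfst: "continuous_on T fst" "continuous_on T (\<lambda>q. - fst q)" by (intro continuous_intros)+
  have c1: "continuous_on (T \<times> UNIV) (\<lambda>z. F (fst z) (snd z))"
    unfolding F_def
    by (intro continuous_on_add continuous_on_mult csp cV cfst unit) (auto intro!: continuous_intros)
  have "continuous_on (T \<times> UNIV) (\<lambda>z. ?sp (fst (snd (fst z))) *\<^sub>R gradient (V (fst (fst z))) (snd z)
      + ?sp (snd (snd (fst z))) *\<^sub>R gradient (V (- fst (fst z))) (snd z))"
    by (intro continuous_on_add continuous_on_scaleR csp cV cfst unit) (auto intro!: continuous_intros)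
  then have c2: "continuous_on (T \<times> UNIV) (\<lambda>z. gradient (F (fst z)) (snd z))"
    by (rule continuous_on_eq) (use grad in auto)
  have contF: "continuous_map (top_of_set T) (W01p_topology p \<Omega>) F"
    by (rule continuous_map_test_function_family[OF \<Omega> p0 F c1 c2])
  \<comment> \<open>The two summands are indexed by 0 and 1 to fit
    \<open>Lp_norm_sum_disjoint\<close>; their supports lie in opposite open half spaces.\<close>
  define I :: "nat set" where "I = {..1}"
  define s where "s q i = (if i = 0 then ?sp (fst (snd q)) else ?sp (snd (snd q)))" for q :: "(real^'n) \<times> real \<times> real" and i :: nat
  define e where "e q i = (if i = 0 then fst q else - fst q)" for q :: "(real^'n) \<times> real \<times> real" and i :: nat
  have sumI: "(\<Sum>i\<in>I. h i) = h 0 + h 1" for h :: "nat \<Rightarrow> 'z::comm_monoid_add" by (simp add: I_def atMost_Suc add.commute)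
  have eI: "norm (e q i) = 1" if "q \<in> T" for q i using unit[OF that] by (simp add: e_def)
  have dis: "V (e q i) x = 0 \<or> V (e q j) x = 0" "gradient (V (e q i)) x = 0 \<or> gradient (V (e q j)) x = 0"
    if q: "q \<in> T" and ij: "i \<in> I" "j \<in> I" "i \<noteq> j" for q i j x
  proof -
    have off: "V (e q i) x = 0 \<and> gradient (V (e q i)) x = 0" if "\<not> x \<bullet> e q i > 0" for i
    proof -
      obtain K where "K \<subseteq> {x \<in> \<Omega>. x \<bullet> e q i > 0}" "x \<notin> K \<Longrightarrow> V (e q i) x = 0" "x \<notin> K \<Longrightarrow> gradient (V (e q i)) x = 0"
        by (rule test_functionsE[OF V(1)[OF eI[OF q, of i]]]) blast
      then show ?thesis using that by blast
    qed
    have "e q i = - e q j" using ij by (auto simp: e_def I_def)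
    then have "\<not> x \<bullet> e q i > 0 \<or> \<not> x \<bullet> e q j > 0" by auto
    then show "V (e q i) x = 0 \<or> V (e q j) x = 0" "gradient (V (e q i)) x = 0 \<or> gradient (V (e q j)) x = 0"
      using off by blast+
  qed
  have weights: "(\<Sum>i\<in>I. \<bar>s q i\<bar> powr p) = 1" if q: "q \<in> T" for q
  proof -
    have *: "\<bar>?sp t\<bar> powr p = t\<^sup>2" for t
      using p0 by (cases "t = 0") (simp_all add: abs_signed_powr powr_powr)
    show ?thesis using unit(3)[OF q] by (simp add: sumI s_def *)
  qed
  have Fsum: "F q = (\<lambda>x. \<Sum>i\<in>I. s q i *\<^sub>R V (e q i) x)" for q
    by (simp add: F_def sumI s_def e_def fun_eq_iff)
  have Gsum: "gradient (F q) = (\<lambda>x. \<Sum>i\<in>I. s q i *\<^sub>R gradient (V (e q i)) x)" if "q \<in> T" for q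
    using grad[OF that] by (simp add: sumI s_def e_def fun_eq_iff)
  have fin: "finite I" by (simp add: I_def)
  have norm1: "Lp_norm p \<Omega> (F q) = 1" if q: "q \<in> T" for q
  proof -
    have "Lp_norm p \<Omega> (F q) powr p = (\<Sum>i\<in>I. \<bar>s q i\<bar> powr p * Lp_norm p \<Omega> (V (e q i)) powr p)"
      unfolding Fsum by (rule Lp_norm_sum_disjoint[OF fin p0])
        (use test_function_Lp(1)[OF UL V\<Omega>[OF eI[OF q]] p0] dis(1)[OF q] in blast)+
    also have "\<dots> = 1" using weights[OF q] by (simp add: V(2)[OF eI[OF q]])
    finally have "(Lp_norm p \<Omega> (F q) powr p) powr (1 / p) = 1" by simp
    then show ?thesis using p0 by (simp add: powr_powr Lp_norm_nonneg)
  qed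
  have energy: "p_energy p \<Omega> (F q) \<le> c" if q: "q \<in> T" for q
  proof -
    have "p_energy p \<Omega> (F q) = Lp_norm p \<Omega> (gradient (F q)) powr p"
      unfolding p_energy_eq_Lp_norm[OF p0] test_function_weak_gradient[OF \<Omega>(1) F[OF q]] ..
    also have "\<dots> = (\<Sum>i\<in>I. \<bar>s q i\<bar> powr p * Lp_norm p \<Omega> (gradient (V (e q i))) powr p)"
      unfolding Gsum[OF q] by (rule Lp_norm_sum_disjoint[OF fin p0])
        (use test_function_Lp(2)[OF UL V\<Omega>[OF eI[OF q]] p0] dis(2)[OF q] in blast)+
    also have "\<dots> \<le> (\<Sum>i\<in>I. \<bar>s q i\<bar> powr p * c)"
      by (intro sum_mono mult_left_mono V(3) eI q) simp
    also have "\<dots> = c" using weights[OF q] by (simp add: sum_distrib_right[symmetric])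
    finally show ?thesis .
  qed
  have minus: "F (e, - z) = (\<lambda>x. - F (e, z) x)" for e z by (simp add: F_def fun_eq_iff)
  have T: "compact T" "T \<noteq> {}"
  proof -
    show "compact T" by (simp add: T_def compact_Times)
    have "(axis undefined 1, (1, 0)) \<in> T" by (simp add: T_def norm_axis_1 norm_Pair)
    then show "T \<noteq> {}" by blast
  qed
  have genus: "genus p \<Omega> (F ` T) \<ge> enat (CARD('n) + 1)"
    unfolding genus_def
  proof (rule Inf_greatest, clarify)
    fix j f
    assume j: "j \<ge> 1" and f: "continuous_map (subtopology (W01p_topology p \<Omega>) (F ` T)) (nsphere (j - 1)) f"
      and fodd: "\<forall>u\<in>F ` T. \<forall>i. f (\<lambda>x. - u x) i = - f u i"
    show "enat (CARD('n) + 1) \<le> enat j"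
    proof (rule ccontr)
      assume "\<not> enat (CARD('n) + 1) \<le> enat j"
      \<comment> \<open>The target sphere therefore includes into the sphere of dimension N - 1, and
        the composition along a path of coefficients becomes a homotopy of self-maps of the sphere
        of axes.\<close>
      then have jn: "j - 1 \<le> CARD('n) - 1" by simp
      let ?n = "CARD('n) - 1"
      let ?S = "topspace (nsphere ?n)"
      obtain E :: "(nat \<Rightarrow> real) \<Rightarrow> real^'n" where E: "continuous_on UNIV E" "\<And>t. E (antipode t) = - E t"
        "\<And>t. t \<in> ?S \<Longrightarrow> norm (E t) = 1"
        using nsphere_parametrization by blast
      \<comment> \<open>The angle runs from pi/4 to 3 pi/4. At the start the coefficients are equal,
        so exchanging \<open>e\<close> and -e changes nothing; at the end they are opposite, so it
        changes the sign.\<close>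
      define \<theta> where "\<theta> r = pi / 4 + r * (pi / 2)" for r :: real
      define q where "q y = (E (snd y), (cos (\<theta> (fst y)), sin (\<theta> (fst y))))" for y
      have qT: "q y \<in> T" if "snd y \<in> ?S" for y
        using E(3)[OF that] by (simp add: q_def T_def norm_Pair)
      have qcont: "continuous_on ({0..1} \<times> ?S) q"
        unfolding q_def \<theta>_def by (intro continuous_intros continuous_on_compose2[OF E(1)]) auto
      have X: "prod_topology (top_of_set {0..1}) (nsphere ?n) = top_of_set ({0..1::real} \<times> ?S)"
        by (subst nsphere_eq_top_of_set) (rule prod_topology_subtopology_eu)
      have "continuous_map (top_of_set ({0..1} \<times> ?S)) (top_of_set T) q"
        using qcont qT by (auto simp: continuous_map_in_subtopology)
      moreover have "continuous_map (top_of_set T) (subtopology (W01p_topology p \<Omega>) (F ` T)) F"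
        using contF by (simp add: continuous_map_in_subtopology)
      ultimately have "continuous_map (top_of_set ({0..1} \<times> ?S)) (nsphere (j - 1)) (f \<circ> (F \<circ> q))"
        using f by (intro continuous_map_compose)
      then have H: "continuous_map (prod_topology (top_of_set {0..1}) (nsphere ?n)) (nsphere ?n) (f \<circ> (F \<circ> q))"
        unfolding X using continuous_map_compose[OF _ continuous_map_nsphere_inclusion[OF jn]] by (simp add: o_def)
      show False
      proof (rule even_map_not_homotopic_odd_map)
        show "homotopic_with (\<lambda>x. True) (nsphere ?n) (nsphere ?n) (\<lambda>t. f (F (q (0, t)))) (\<lambda>t. f (F (q (1, t))))"
          unfolding homotopic_with_def using H by (intro exI[of _ "f \<circ> (F \<circ> q)"]) simp
        fix t assume t: "t \<in> topspace (nsphere ?n)"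
        have q0: "q (0, t) = (E t, (sqrt 2 / 2, sqrt 2 / 2))" for t
          by (simp add: q_def \<theta>_def cos_45 sin_45)
        have "F (- e, (z, z)) = F (e, (z, z))" for e z by (simp add: F_def fun_eq_iff)
        then have "F (q (0, antipode t)) = F (q (0, t))" unfolding q0 E(2) by blast
        then show "f (F (q (0, antipode t))) = f (F (q (0, t)))" by simp
        have "cos (pi / 4 + 1 * (pi / 2)) = - (sqrt 2 / 2)" "sin (pi / 4 + 1 * (pi / 2)) = sqrt 2 / 2"
          unfolding mult_1 cos_add sin_add by (simp_all add: cos_45 sin_45)
        then have q1: "q (1, t) = (E t, (- (sqrt 2 / 2), sqrt 2 / 2))" for t
          by (simp only: q_def \<theta>_def fst_conv snd_conv)
        have "F (- e, (- z, z)) = (\<lambda>x. - F (e, (- z, z)) x)" for e z by (simp add: F_def fun_eq_iff)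
        then have eq: "F (q (1, antipode t)) = (\<lambda>x. - F (q (1, t)) x)" unfolding q1 E(2) by blast
        have "F (q (1, t)) \<in> F ` T" using qT[of "(1, t)"] t by simp
        then have "f (\<lambda>x. - F (q (1, t)) x) i = - f (F (q (1, t))) i" for i using fodd by blast
        then show "f (F (q (1, antipode t))) = antipode (f (F (q (1, t))))"
          unfolding eq by (simp add: fun_eq_iff)
      qed
    qed
  qed
  show thesis
  proof (rule that[of "F ` T"])
    show "F ` T \<in> genus_family p \<Omega> (CARD('n) + 1)"
      unfolding genus_family_def
    proof (intro CollectI conjI)
      show "F ` T \<noteq> {}" using T(2) by simp
      show "F ` T \<subseteq> Lp_sphere p \<Omega>"
        using test_function_W01p(2)[OF \<Omega>(1) F p0] norm1 by (auto simp: Lp_sphere_def)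
      show "symmetric (F ` T)"
        unfolding symmetric_def
      proof
        fix u assume "u \<in> F ` T"
        then obtain e z where q: "(e, z) \<in> T" "u = F (e, z)" by auto
        have "(e, - z) \<in> T" using q(1) by (simp add: T_def)
        then show "(\<lambda>x. - u x) \<in> F ` T" using minus[of e z] q(2) by (metis imageI)
      qed
      show "compactin (W01p_topology p \<Omega>) (F ` T)"
        by (rule image_compactin[OF _ contF]) (use T(1) in \<open>simp add: compactin_subtopology\<close>)
      show "enat (CARD('n) + 1) \<le> genus p \<Omega> (F ` T)" by (rule genus)
    qed
    show "p_energy p \<Omega> u \<le> c" if "u \<in> F ` T" for u using that energy by blast
  qed
qed

theorem corollary3p6:
  fixes \<Omega> :: "(real^'n) set" and \<iota> :: "nat \<Rightarrow> 'n" and p :: real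
  assumes "CARD('n) \<ge> 2"
    and "bij_betw \<iota> {1..CARD('n)} UNIV"
    and "open \<Omega>" and "connected \<Omega>" and "\<Omega> \<noteq> {}"
    and "bounded \<Omega>" and "radially_symmetric \<Omega>"
    and "p > 1"
    and "variational_eigenvalue p \<Omega> 2 = tau1 \<iota> p \<Omega>"
  shows "\<exists>m\<ge>CARD('n). has_multiplicity (variational_eigenvalue p \<Omega>) 2 m"
proof -
  have N: "CARD('n) \<ge> 2" by fact
  note \<Omega> = \<open>open \<Omega>\<close> \<open>bounded \<Omega>\<close> \<open>\<Omega> \<noteq> {}\<close>
  note p = \<open>p > 1\<close>
  \<comment> \<open>Every level \<open>c\<close> above tau_1 is reached by test functions, so the
    bound is obtained for all of them and then passed to the limit.\<close>
  have "variational_eigenvalue p \<Omega> (CARD('n) + 1) \<le> tau1 \<iota> p \<Omega>"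
  proof (rule dense_ge)
    fix c assume "tau1 \<iota> p \<Omega> < c"
    then have c: "first_eigenvalue p {x \<in> \<Omega>. x $ \<iota> CARD('n) > 0} < c"
      by (simp add: tau1_def half_domain_eq[OF N])
    show "variational_eigenvalue p \<Omega> (CARD('n) + 1) \<le> c"
    proof (rule axial_functions[OF N \<Omega>(1,3) \<open>radially_symmetric \<Omega>\<close> p c])
      fix V :: "real^'n \<Rightarrow> real^'n \<Rightarrow> real"
      assume V: "\<And>e. norm e = 1 \<Longrightarrow> V e \<in> test_functions {x \<in> \<Omega>. x \<bullet> e > 0}"
        "\<And>e. norm e = 1 \<Longrightarrow> Lp_norm p \<Omega> (V e) = 1"
        "\<And>e. norm e = 1 \<Longrightarrow> Lp_norm p \<Omega> (gradient (V e)) powr p \<le> c"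
        "continuous_on (sphere 0 1 \<times> UNIV) (\<lambda>z. V (fst z) (snd z))"
        "continuous_on (sphere 0 1 \<times> UNIV) (\<lambda>z. gradient (V (fst z)) (snd z))"
      show ?thesis
      proof (rule axial_genus_family[OF \<Omega>(1,2) p V])
        fix A assume "A \<in> genus_family p \<Omega> (CARD('n) + 1)" "\<And>u. u \<in> A \<Longrightarrow> p_energy p \<Omega> u \<le> c"
        then show ?thesis by (rule variational_eigenvalue_le[OF \<Omega>(1) p])
      qed
    qed
  qed
  then have le: "variational_eigenvalue p \<Omega> (CARD('n) + 1) \<le> variational_eigenvalue p \<Omega> 2"
    using assms(9) by simp
  obtain k where k: "k \<ge> 1" "variational_eigenvalue p \<Omega> 2 + 1 \<le> variational_eigenvalue p \<Omega> k"
    by (rule variational_eigenvalue_unbounded[OF \<Omega> p])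
  show ?thesis
  proof (rule has_multiplicity_at_least[OF _ N le k(1)])
    show "variational_eigenvalue p \<Omega> i \<le> variational_eigenvalue p \<Omega> j" if "1 \<le> i" "i \<le> j" for i j
      by (rule variational_eigenvalue_mono[OF \<Omega> p that])
    show "variational_eigenvalue p \<Omega> 2 < variational_eigenvalue p \<Omega> k" using k(2) by simp
  qed
qed

end
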